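(* Let $\nu\in[0,1)$ and let $A_{\nu,\infty}$ be the minimal operator generated by $\tau_\nu=-\frac{d^2}{dx^2}+\frac{\nu^2-1/4}{x^2}$ in $L^2(\mathbb R_+)$. Then: (i) A boundary triplet $\{\mathcal H,\Gamma_0^{\nu,\infty},\Gamma_1^{\nu,\infty}\}$ for $A_{\nu,\infty}^*$ can be chosen in the form $$\mathcal H=\mathbb C,\qquad \Gamma_0^{\nu,\infty}f=[f,x^{1/2+\nu}]_0,\qquad \Gamma_1^{\nu,\infty}f=\begin{cases}-(2\nu)^{-1}[f,x^{1/2-\nu}]_0, & \nu\in(0,1),\\ [f,x^{1/2}\log(x)]_0, & \nu=0.\end{cases}$$ (ii) The corresponding Weyl function is $$M_{\nu;\infty}(z)=\begin{cases}e^{i(1-\nu)\pi}\dfrac{\Gamma(1-\nu)}{2\nu4^\nu\Gamma(1+\nu)}\,z^\nu, & \nu\in(0,1),\\[2mm] -\log\left(\dfrac{\sqrt z}{2}\right)+\dfrac{i\pi}{2}-\gamma, & \nu=0,\end{cases}\qquad z\in\mathbb C\setminus\mathbb R_+,$$ where $\gamma$ is Euler's constant. (iii) The spectral function $\Sigma_\nu(t)$ of the operator $(A_{\nu,\infty})_0=A_{\nu,\infty}^*\upharpoonright\ker\Gamma_0^{\nu,\infty}$ is $$\Sigma_\nu(t)=\frac{t^{\nu+1}}{2^{2\nu+1}\,\Gamma^2(1+\nu)}\,\chi_{[0,\infty)}(t).$$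
   Context: $\mathbb R_+$ denotes the positive half-line with endpoints $0$ and $\infty$ (for the domain of the Weyl function, $0$ is included in the cut). The maximal operator generated by $\tau_\nu$ in $L^2(\mathbb R_+)$ acts as $\tau_\nu$ on all $f\in L^2(\mathbb R_+)$ with $f,f'$ locally absolutely continuous on $(0,\infty)$ and $\tau_\nu f\in L^2(\mathbb R_+)$; the minimal operator $A_{\nu,\infty}$ is the closure of its restriction to functions with compact support in $(0,\infty)$, and $A_{\nu,\infty}^*$ is the maximal operator. $[f,g]_x=f(x)\overline{g'(x)}-f'(x)\overline{g(x)}$ and $[f,g]_0=\lim_{x\to0^+}[f,g]_x$. $\Gamma(\cdot)$ (with a numerical argument) is the Gamma function, and $\chi_{[0,\infty)}$ is the indicator function of $[0,\infty)$. The branch of $z^\nu$ (and of $\sqrt z$) is taken in $\mathbb C$ cut along the positive half-line with $z^\nu=x^\nu$ for $z=x>0$ (on the upper side of the cut), i.e. $\arg z\in[0,2\pi)$; $\log$ in $\log(\sqrt z/2)$ is the principal branch. Boundary triplet: for a densely defined closed symmetric operator $A$ with equal deficiency indices, $\{\mathcal H,\Gamma_0,\Gamma_1\}$ is a boundary triplet for $A^*$ if $\mathcal H$ is a Hilbert space, $\Gamma_0,\Gamma_1:\operatorname{dom}(A^* )\to\mathcal H$ are linear, $(A^*f,g)-(f,A^*g)=(\Gamma_1f,\Gamma_0g)_{\mathcal H}-(\Gamma_0f,\Gamma_1g)_{\mathcal H}$ for all $f,g\in\operatorname{dom}(A^* )$, and $f\mapsto(\Gamma_0f,\Gamma_1f)$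 is surjective onto $\mathcal H\oplus\mathcal H$. Put $A_0=A^*\upharpoonright\ker\Gamma_0$. The corresponding Weyl function is $M(z)=\Gamma_1(\Gamma_0\upharpoonright\ker(A^*-z))^{-1}$, $z\in\rho(A_0)$. The Weyl function has a representation $M(z)=C_0+\int_{\mathbb R}\left(\frac1{t-z}-\frac t{1+t^2}\right)d\Sigma(t)$ with $C_0$ self-adjoint and a unique Borel measure $\Sigma$ on $\mathbb R$ with $\int(1+t^2)^{-1}d\Sigma(t)<\infty$; the spectral function of $A_0$ (associated with the boundary triplet) is the distribution function of this measure, normalized to vanish at $t=0$.
   Formalization: In (iii) the spectral function is proved with an extra factor 1/(ν+1), i.e. t^{ν+1}/((ν+1)2^{2ν+1}Γ²(1+ν)) on [0,∞); the printed formula contradicts (ii) for 0<ν<1 (at ν=1/2 the true value is 2t^{3/2}/(3π), not t^{3/2}/π). *)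

theory Defs
  imports "HOL-Analysis.Analysis" "HOL-Library.Equipollence"
begin

section \<open>Complex Hilbert spaces and unbounded operators\<close>

text \<open>The inner product is linear in its first argument, as in $(f,g) = \int f\,\overline g$.\<close>

class complex_inner = real_inner +
  fixes scaleC :: "complex \<Rightarrow> 'a \<Rightarrow> 'a"  (infixr "*\<^sub>C" 75)
    and cinner :: "'a \<Rightarrow> 'a \<Rightarrow> complex"
  assumes scaleC_add_right: "a *\<^sub>C (x + y) = a *\<^sub>C x + a *\<^sub>C y"
    and scaleC_add_left: "(a + b) *\<^sub>C x = a *\<^sub>C x + b *\<^sub>C x"
    and scaleC_scaleC: "a *\<^sub>C b *\<^sub>C x = (a * b) *\<^sub>C x"
    and scaleC_of_real: "complex_of_real r *\<^sub>C x = r *\<^sub>R x"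
    and cinner_add_left: "cinner (x + y) z = cinner x z + cinner y z"
    and cinner_scaleC_left: "cinner (a *\<^sub>C x) y = a * cinner x y"
    and cinner_commute: "cinner x y = cnj (cinner y x)"
    and Re_cinner: "Re (cinner x y) = inner x y"

class complex_hilbert = complex_inner + complete_space

instantiation complex :: complex_hilbert
begin
definition "a *\<^sub>C (x::complex) = a * x"
definition "cinner (x::complex) y = x * cnj y"
instance
  by standard
    (auto simp: scaleC_complex_def cinner_complex_def algebra_simps scaleR_conv_of_real inner_complex_def)
end

text \<open>An unbounded operator is identified with its graph; adjoints and closures of graphs are
  then again sets of pairs, and \<^const>\<open>closure\<close> and \<^const>\<open>closed\<close> refer to the
  product topology.\<close>

definition linear_operator :: "('a::complex_inner \<times> 'a) set \<Rightarrow> bool" where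
  "linear_operator T \<longleftrightarrow> (0, 0) \<in> T \<and>
     (\<forall>(f, f')\<in>T. \<forall>(g, g')\<in>T. (f + g, f' + g') \<in> T) \<and>
     (\<forall>c. \<forall>(f, f')\<in>T. (c *\<^sub>C f, c *\<^sub>C f') \<in> T) \<and>
     single_valued T"

definition densely_defined :: "('a::complex_inner \<times> 'a) set \<Rightarrow> bool" where
  "densely_defined T \<longleftrightarrow> closure (Domain T) = UNIV"

definition symmetric_operator :: "('a::complex_inner \<times> 'a) set \<Rightarrow> bool" where
  "symmetric_operator T \<longleftrightarrow> (\<forall>(f, f')\<in>T. \<forall>(g, g')\<in>T. cinner f' g = cinner f g')"

definition adjoint_operator :: "('a::complex_inner \<times> 'a) set \<Rightarrow> ('a \<times> 'a) set" where
  "adjoint_operator T = {(g, g'). \<forall>(f, f')\<in>T. cinner f' g = cinner f g'}"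

text \<open>\<open>eigenspace_of T z\<close> is $\ker(T - z)$.\<close>

definition eigenspace_of :: "('a::complex_inner \<times> 'a) set \<Rightarrow> complex \<Rightarrow> 'a set" where
  "eigenspace_of T z = {f. (f, z *\<^sub>C f) \<in> T}"

text \<open>\<open>R\<close> is the everywhere defined bounded inverse of $T - z$.\<close>

definition resolvent_set_of :: "('a::complex_inner \<times> 'a) set \<Rightarrow> complex set" where
  "resolvent_set_of T =
     {z. \<exists>R. bounded_linear R \<and> (\<forall>h f. R h = f \<longleftrightarrow> (f, h + z *\<^sub>C f) \<in> T)}"

definition orthonormal_basis_of :: "'a::complex_inner set \<Rightarrow> 'a set \<Rightarrow> bool" where
  "orthonormal_basis_of V B \<longleftrightarrow> B \<subseteq> V \<and>
     (\<forall>x\<in>B. \<forall>y\<in>B. cinner x y = (if x = y then 1 else 0)) \<and>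
     (\<forall>x\<in>V. (\<forall>y\<in>B. cinner x y = 0) \<longrightarrow> x = 0)"

text \<open>Equality of the (possibly infinite) Hilbert space dimensions of $\ker(T^* \mp i)$.\<close>

definition equal_deficiency_indices :: "('a::complex_inner \<times> 'a) set \<Rightarrow> bool" where
  "equal_deficiency_indices T \<longleftrightarrow>
     (\<exists>B C. orthonormal_basis_of (eigenspace_of (adjoint_operator T) \<i>) B \<and>
            orthonormal_basis_of (eigenspace_of (adjoint_operator T) (- \<i>)) C \<and> B \<approx> C)"


section \<open>Boundary triplets, Weyl functions and spectral functions\<close>

text \<open>The boundary space is the type \<open>'h\<close>. The boundary maps are total functions of which only
  the values on the domain of the adjoint matter.\<close>

definition boundary_triplet ::
  "('a::complex_hilbert \<times> 'a) set \<Rightarrow> ('a \<Rightarrow> 'h::complex_hilbert) \<Rightarrow> ('a \<Rightarrow> 'h) \<Rightarrow> bool" where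
  "boundary_triplet A \<Gamma>\<^sub>0 \<Gamma>\<^sub>1 \<longleftrightarrow>
     linear_operator A \<and> densely_defined A \<and> closed A \<and> symmetric_operator A \<and>
     equal_deficiency_indices A \<and>
     (\<forall>\<Gamma>\<in>{\<Gamma>\<^sub>0, \<Gamma>\<^sub>1}. \<forall>f\<in>Domain (adjoint_operator A). \<forall>g\<in>Domain (adjoint_operator A).
        \<forall>c. \<Gamma> (f + g) = \<Gamma> f + \<Gamma> g \<and> \<Gamma> (c *\<^sub>C f) = c *\<^sub>C \<Gamma> f) \<and>
     (\<forall>(f, f')\<in>adjoint_operator A. \<forall>(g, g')\<in>adjoint_operator A.
        cinner f' g - cinner f g' = cinner (\<Gamma>\<^sub>1 f) (\<Gamma>\<^sub>0 g) - cinner (\<Gamma>\<^sub>0 f) (\<Gamma>\<^sub>1 g)) \<and>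
     (\<lambda>f. (\<Gamma>\<^sub>0 f, \<Gamma>\<^sub>1 f)) ` Domain (adjoint_operator A) = UNIV"

text \<open>The extension $A_0 = A^* \upharpoonright \ker\Gamma_0$.\<close>

definition extension_0 ::
  "('a::complex_hilbert \<times> 'a) set \<Rightarrow> ('a \<Rightarrow> 'h::complex_hilbert) \<Rightarrow> ('a \<times> 'a) set" where
  "extension_0 A \<Gamma>\<^sub>0 = {(f, f') \<in> adjoint_operator A. \<Gamma>\<^sub>0 f = 0}"

text \<open>Meaningful for \<open>z \<in> resolvent_set_of (extension_0 A \<Gamma>\<^sub>0)\<close>.\<close>

definition weyl_function ::
  "('a::complex_hilbert \<times> 'a) set \<Rightarrow> ('a \<Rightarrow> 'h::complex_hilbert) \<Rightarrow> ('a \<Rightarrow> 'h)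
     \<Rightarrow> complex \<Rightarrow> 'h \<Rightarrow> 'h" where
  "weyl_function A \<Gamma>\<^sub>0 \<Gamma>\<^sub>1 z h =
     \<Gamma>\<^sub>1 (the_inv_into (eigenspace_of (adjoint_operator A) z) \<Gamma>\<^sub>0 h)"

text \<open>The measure in the integral representation of a scalar Nevanlinna function \<open>m\<close>; the
  representation is required off the real axis, where the integrand is always integrable.
  The self-adjoint constant is a real number.\<close>

definition nevanlinna_measure :: "(complex \<Rightarrow> complex) \<Rightarrow> real measure \<Rightarrow> bool" where
  "nevanlinna_measure m \<mu> \<longleftrightarrow> sets \<mu> = sets borel \<and>
     (\<integral>\<^sup>+t. ennreal (1 / (1 + t\<^sup>2)) \<partial>\<mu>) < \<infinity> \<and>
     (\<exists>C\<^sub>0::real. \<forall>z. Im z \<noteq> 0 \<longrightarrow>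
        m z = of_real C\<^sub>0 +
          (LINT t|\<mu>. 1 / (complex_of_real t - z) - complex_of_real (t / (1 + t\<^sup>2))))"

text \<open>For the boundary space \<^typ>\<open>complex\<close>, the operator $M(z)$ is multiplication by the scalar
  $M(z)1$.\<close>

definition spectral_measure ::
  "('a::complex_hilbert \<times> 'a) set \<Rightarrow> ('a \<Rightarrow> complex) \<Rightarrow> ('a \<Rightarrow> complex) \<Rightarrow> real measure" where
  "spectral_measure A \<Gamma>\<^sub>0 \<Gamma>\<^sub>1 =
     (THE \<mu>. nevanlinna_measure (\<lambda>z. weyl_function A \<Gamma>\<^sub>0 \<Gamma>\<^sub>1 z 1) \<mu>)"

text \<open>The right-continuous distribution function vanishing at \<open>0\<close>.\<close>

definition distribution_function :: "real measure \<Rightarrow> real \<Rightarrow> real" where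
  "distribution_function \<mu> t =
     (if 0 \<le> t then measure \<mu> {0<..t} else - measure \<mu> {t<..0})"

definition spectral_function ::
  "('a::complex_hilbert \<times> 'a) set \<Rightarrow> ('a \<Rightarrow> complex) \<Rightarrow> ('a \<Rightarrow> complex) \<Rightarrow> real \<Rightarrow> real" where
  "spectral_function A \<Gamma>\<^sub>0 \<Gamma>\<^sub>1 = distribution_function (spectral_measure A \<Gamma>\<^sub>0 \<Gamma>\<^sub>1)"


section \<open>The Hilbert space of square integrable functions on the half-line\<close>

abbreviation half_line :: "real measure" where
  "half_line \<equiv> lebesgue_on {0<..}"

definition square_integrable :: "(real \<Rightarrow> complex) \<Rightarrow> bool" where
  "square_integrable f \<longleftrightarrow> f \<in> borel_measurable half_line \<and>
     integrable half_line (\<lambda>x. (cmod (f x))\<^sup>2)"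

definition L2_equiv :: "(real \<Rightarrow> complex) \<Rightarrow> (real \<Rightarrow> complex) \<Rightarrow> bool" where
  "L2_equiv f g \<longleftrightarrow> square_integrable f \<and> square_integrable g \<and> (AE x in half_line. f x = g x)"

lemma square_integrable_0 [simp]: "square_integrable (\<lambda>x. 0)"
  by (simp add: square_integrable_def)

lemma square_integrable_scale:
  assumes "square_integrable f" shows "square_integrable (\<lambda>x. c * f x)"
  using assms by (auto simp: square_integrable_def norm_mult power_mult_distrib)

lemma square_integrable_mult_cnj:
  assumes "square_integrable f" "square_integrable g"
  shows "integrable half_line (\<lambda>x. f x * cnj (g x))"
proof (rule Bochner_Integration.integrable_bound)
  show "integrable half_line (\<lambda>x. (cmod (f x))\<^sup>2 + (cmod (g x))\<^sup>2)"
    using assms by (auto simp: square_integrable_def)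
  have [measurable]: "f \<in> borel_measurable half_line" "g \<in> borel_measurable half_line"
    using assms by (auto simp: square_integrable_def)
  have "(\<lambda>x. cnj (g x)) \<in> borel_measurable half_line"
    by (rule borel_measurable_continuous_on[of cnj]) (auto intro!: continuous_intros)
  then show "(\<lambda>x. f x * cnj (g x)) \<in> borel_measurable half_line" by measurable
  have "a * b \<le> a\<^sup>2 + b\<^sup>2" for a b :: real
    using sum_squares_bound[of a b, unfolded mult.assoc] zero_le_power2[of a] zero_le_power2[of b]
    by linarith
  then show "AE x in half_line. norm (f x * cnj (g x)) \<le> norm ((cmod (f x))\<^sup>2 + (cmod (g x))\<^sup>2)"
    by (simp add: norm_mult)
qed

lemma square_integrable_add:
  assumes "square_integrable f" "square_integrable g"
  shows "square_integrable (\<lambda>x. f x + g x)"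
proof -
  have [measurable]: "f \<in> borel_measurable half_line" "g \<in> borel_measurable half_line"
    using assms by (auto simp: square_integrable_def)
  have "integrable half_line (\<lambda>x. (cmod (f x + g x))\<^sup>2)"
  proof (rule Bochner_Integration.integrable_bound)
    show "integrable half_line (\<lambda>x. 2 * (cmod (f x))\<^sup>2 + 2 * (cmod (g x))\<^sup>2)"
      using assms by (auto simp: square_integrable_def)
    have "(cmod (a + b))\<^sup>2 \<le> 2 * (cmod a)\<^sup>2 + 2 * (cmod b)\<^sup>2" for a b
    proof -
      have "(cmod (a + b))\<^sup>2 \<le> (cmod a + cmod b)\<^sup>2"
        by (intro power_mono norm_triangle_ineq) auto
      also have "\<dots> \<le> 2 * (cmod a)\<^sup>2 + 2 * (cmod b)\<^sup>2"
        using sum_squares_bound[of "cmod a" "cmod b"] by (simp add: power2_sum)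
      finally show ?thesis .
    qed
    then show "AE x in half_line. norm ((cmod (f x + g x))\<^sup>2)
        \<le> norm (2 * (cmod (f x))\<^sup>2 + 2 * (cmod (g x))\<^sup>2)"
      by simp
  qed measurable
  then show ?thesis
    by (auto simp: square_integrable_def)
qed

lemma L2_equivD:
  assumes "L2_equiv f g"
  shows "square_integrable f" "square_integrable g" "AE x in half_line. f x = g x"
  using assms by (auto simp: L2_equiv_def)

quotient_type L2_half_line = "real \<Rightarrow> complex" / partial: L2_equiv
proof (rule part_equivpI)
  show "\<exists>x. L2_equiv x x"
    by (rule exI[of _ "\<lambda>x. 0"]) (simp add: L2_equiv_def)
  show "symp L2_equiv"
    by (auto simp: symp_def L2_equiv_def)
  show "transp L2_equiv"
    by (auto simp: transp_def L2_equiv_def elim: AE_mp)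
qed

instantiation L2_half_line :: complex_inner
begin

lift_definition zero_L2_half_line :: L2_half_line is "\<lambda>x. 0"
  by (simp add: L2_equiv_def)

lift_definition plus_L2_half_line :: "L2_half_line \<Rightarrow> L2_half_line \<Rightarrow> L2_half_line"
  is "\<lambda>f g x. f x + g x"
  by (auto simp: L2_equiv_def square_integrable_add)

lift_definition scaleC_L2_half_line :: "complex \<Rightarrow> L2_half_line \<Rightarrow> L2_half_line"
  is "\<lambda>c f x. c * f x"
  by (auto simp: L2_equiv_def square_integrable_scale)

lift_definition cinner_L2_half_line :: "L2_half_line \<Rightarrow> L2_half_line \<Rightarrow> complex"
  is "\<lambda>f g. LINT x|half_line. f x * cnj (g x)"
proof -
  fix f1 f2 g1 g2 assume *: "L2_equiv f1 f2" "L2_equiv g1 g2"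
  have "AE x in half_line. f1 x * cnj (g1 x) = f2 x * cnj (g2 x)"
    using L2_equivD(3)[OF *(1)] L2_equivD(3)[OF *(2)] by eventually_elim auto
  then show "(LINT x|half_line. f1 x * cnj (g1 x)) = (LINT x|half_line. f2 x * cnj (g2 x))"
    using square_integrable_mult_cnj L2_equivD[OF *(1)] L2_equivD[OF *(2)]
    by (intro integral_cong_AE) (auto dest: borel_measurable_integrable)
qed

definition scaleR_L2_half_line :: "real \<Rightarrow> L2_half_line \<Rightarrow> L2_half_line" where
  "scaleR_L2_half_line r f = complex_of_real r *\<^sub>C f"
definition uminus_L2_half_line :: "L2_half_line \<Rightarrow> L2_half_line" where
  "uminus_L2_half_line f = (- 1) *\<^sub>C f"
definition minus_L2_half_line :: "L2_half_line \<Rightarrow> L2_half_line \<Rightarrow> L2_half_line" where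
  "minus_L2_half_line f g = f + (- g)"
definition inner_L2_half_line :: "L2_half_line \<Rightarrow> L2_half_line \<Rightarrow> real" where
  "inner_L2_half_line f g = Re (cinner f g)"
definition norm_L2_half_line :: "L2_half_line \<Rightarrow> real" where
  "norm_L2_half_line f = sqrt (inner f f)"
definition sgn_L2_half_line :: "L2_half_line \<Rightarrow> L2_half_line" where
  "sgn_L2_half_line f = inverse (norm f) *\<^sub>R f"
definition dist_L2_half_line :: "L2_half_line \<Rightarrow> L2_half_line \<Rightarrow> real" where
  "dist_L2_half_line f g = norm (f - g)"
definition uniformity_L2_half_line :: "(L2_half_line \<times> L2_half_line) filter" where
  "uniformity_L2_half_line = (INF e\<in>{0<..}. principal {(f, g). dist f g < e})"
definition open_L2_half_line :: "L2_half_line set \<Rightarrow> bool" where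
  "open_L2_half_line U \<longleftrightarrow> (\<forall>f\<in>U. \<forall>\<^sub>F (f', g) in uniformity. f' = f \<longrightarrow> g \<in> U)"

instance
proof
  fix f g h :: L2_half_line and a b :: complex and r s :: real and U :: "L2_half_line set"
  have CC: "a *\<^sub>C b *\<^sub>C f = (a * b) *\<^sub>C f" for a b and f :: L2_half_line
    by transfer (auto simp: L2_equiv_def square_integrable_scale mult.assoc)
  have CL: "(a + b) *\<^sub>C f = a *\<^sub>C f + b *\<^sub>C f" for a b and f :: L2_half_line
    by transfer (auto simp: L2_equiv_def square_integrable_scale square_integrable_add algebra_simps
        intro!: square_integrable_add)
  have CR: "a *\<^sub>C (f + g) = a *\<^sub>C f + a *\<^sub>C g" for a and f g :: L2_half_line
    by transfer (auto simp: L2_equiv_def algebra_simps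
        intro!: square_integrable_add square_integrable_scale)
  have C1: "1 *\<^sub>C f = f" for f :: L2_half_line
    by transfer auto
  have C0: "0 *\<^sub>C f = 0" for f :: L2_half_line
    by transfer (auto simp: L2_equiv_def)
  have IA: "cinner (f + g) h = cinner f h + cinner g h" for f g h :: L2_half_line
    by transfer (auto simp: ring_distribs L2_equiv_def square_integrable_mult_cnj)
  have IS: "cinner (a *\<^sub>C f) g = a * cinner f g" for a and f g :: L2_half_line
    by transfer (auto simp: mult.assoc L2_equiv_def square_integrable_mult_cnj)
  have IC: "cinner f g = cnj (cinner g f)" for f g :: L2_half_line
  proof (transfer, goal_cases)
    case (1 f g)
    have "integrable half_line (\<lambda>x. g x * cnj (f x))"
      using 1 by (intro square_integrable_mult_cnj) (auto dest: L2_equivD)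
    from integral_bounded_linear[OF bounded_linear_cnj this] show ?case
      by (simp add: mult.commute)
  qed
  have II: "inner f f \<ge> 0 \<and> (inner f f = 0 \<longleftrightarrow> f = 0)" for f :: L2_half_line
    unfolding inner_L2_half_line_def
  proof (transfer, goal_cases)
    case (1 f)
    then have sq: "square_integrable f" by (rule L2_equivD)
    have "(LINT x|half_line. f x * cnj (f x))
        = (LINT x|half_line. complex_of_real ((cmod (f x))\<^sup>2))"
      by (simp add: complex_norm_square del: of_real_power)
    then have *: "Re (LINT x|half_line. f x * cnj (f x)) = (LINT x|half_line. (cmod (f x))\<^sup>2)"
      by (simp del: of_real_power)
    have "(LINT x|half_line. (cmod (f x))\<^sup>2) = 0 \<longleftrightarrow> (AE x in half_line. (cmod (f x))\<^sup>2 = 0)"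
      using sq by (intro integral_nonneg_eq_0_iff_AE) (auto simp: square_integrable_def)
    then show ?case
      using sq unfolding * by (auto simp: L2_equiv_def)
  qed
  show "f + g + h = f + (g + h)"
    by transfer (auto simp: L2_equiv_def add.assoc intro!: square_integrable_add)
  show "f + g = g + f"
    by transfer (auto simp: L2_equiv_def add.commute intro!: square_integrable_add)
  show "0 + f = f"
    by transfer auto
  have "(- 1) *\<^sub>C f + 1 *\<^sub>C f = 0"
    by (simp add: CL[symmetric] C0)
  then show "- f + f = 0"
    by (simp add: uminus_L2_half_line_def C1)
  show "f - g = f + - g"
    by (simp add: minus_L2_half_line_def)
  show "r *\<^sub>R (f + g) = r *\<^sub>R f + r *\<^sub>R g" "(r + s) *\<^sub>R f = r *\<^sub>R f + s *\<^sub>R f"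
    "r *\<^sub>R s *\<^sub>R f = (r * s) *\<^sub>R f" "1 *\<^sub>R f = f"
    by (simp_all add: scaleR_L2_half_line_def CC CL CR C1)
  show "dist f g = norm (f - g)" "sgn f = inverse (norm f) *\<^sub>R f" "norm f = sqrt (inner f f)"
    by (simp_all add: dist_L2_half_line_def sgn_L2_half_line_def norm_L2_half_line_def)
  show "(uniformity :: (L2_half_line \<times> L2_half_line) filter)
      = (INF e\<in>{0<..}. principal {(f, g). dist f g < e})"
    by (rule uniformity_L2_half_line_def)
  show "open U \<longleftrightarrow> (\<forall>f\<in>U. \<forall>\<^sub>F (f', g) in uniformity. f' = f \<longrightarrow> g \<in> U)"
    by (rule open_L2_half_line_def)
  have "Re (cinner f g) = Re (cinner g f)"
    by (subst IC) simp
  then show "inner f g = inner g f"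
    by (simp add: inner_L2_half_line_def)
  show "inner (f + g) h = inner f h + inner g h" "inner (r *\<^sub>R f) g = r * inner f g"
    by (simp_all add: inner_L2_half_line_def IA IS scaleR_L2_half_line_def)
  show "0 \<le> inner f f" "inner f f = 0 \<longleftrightarrow> f = 0"
    using II by auto
  show "a *\<^sub>C (f + g) = a *\<^sub>C f + a *\<^sub>C g" "(a + b) *\<^sub>C f = a *\<^sub>C f + b *\<^sub>C f"
    "a *\<^sub>C b *\<^sub>C f = (a * b) *\<^sub>C f" "cinner (f + g) h = cinner f h + cinner g h"
    "cinner (a *\<^sub>C f) g = a * cinner f g" "cinner f g = cnj (cinner g f)"
    by (fact CR CL CC IA IS IC)+
  show "complex_of_real r *\<^sub>C f = r *\<^sub>R f" "Re (cinner f g) = inner f g"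
    by (simp_all add: scaleR_L2_half_line_def inner_L2_half_line_def)
qed

end

lemma dist_L2_half_line_power2:
  assumes "square_integrable f" "square_integrable g"
  shows "(\<integral>\<^sup>+x. ennreal ((cmod (f x - g x))\<^sup>2) \<partial>half_line)
      = ennreal ((dist (abs_L2_half_line f) (abs_L2_half_line g))\<^sup>2)"
proof -
  have sq: "square_integrable (\<lambda>x. f x - g x)"
    using square_integrable_add[OF assms(1) square_integrable_scale[OF assms(2), of "- 1"]] by simp
  have "abs_L2_half_line f - abs_L2_half_line g = abs_L2_half_line (\<lambda>x. f x - g x)"
    using assms square_integrable_scale[OF assms(2), of "- 1"]
    by (simp add: minus_L2_half_line_def uminus_L2_half_line_def plus_L2_half_line.abs_eq
        scaleC_L2_half_line.abs_eq L2_equiv_def)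
  then have "(dist (abs_L2_half_line f) (abs_L2_half_line g))\<^sup>2
      = Re (LINT x|half_line. (f x - g x) * cnj (f x - g x))"
    using sq
    by (simp add: dist_norm power2_norm_eq_inner inner_L2_half_line_def
        cinner_L2_half_line.abs_eq L2_equiv_def del: complex_cnj_diff)
  also have "(LINT x|half_line. (f x - g x) * cnj (f x - g x))
      = (LINT x|half_line. complex_of_real ((cmod (f x - g x))\<^sup>2))"
    by (simp add: complex_norm_square del: of_real_power complex_cnj_diff)
  finally have "(dist (abs_L2_half_line f) (abs_L2_half_line g))\<^sup>2
      = (LINT x|half_line. (cmod (f x - g x))\<^sup>2)"
    by (simp del: of_real_power)
  then show ?thesis
    using sq by (subst nn_integral_eq_integral) (auto simp: square_integrable_def)
qed

instance L2_half_line :: complex_hilbert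
proof
  fix X :: "nat \<Rightarrow> L2_half_line" assume cauchy: "Cauchy X"
  have "\<exists>r. \<forall>k. (\<forall>m\<ge>r k. \<forall>n\<ge>r k. dist (X m) (X n) < (1 / 2) ^ k) \<and> r k < r (Suc k)"
  proof (rule dependent_nat_choice)
    show "\<exists>x. \<forall>m\<ge>x. \<forall>n\<ge>x. dist (X m) (X n) < (1 / 2) ^ 0"
      using cauchy by (auto dest: metric_CauchyD[of _ 1])
    fix x k
    obtain N where N: "\<forall>m\<ge>N. \<forall>n\<ge>N. dist (X m) (X n) < (1 / 2) ^ Suc k"
      using metric_CauchyD[OF cauchy, of "(1 / 2) ^ Suc k"] by auto
    show "\<exists>y. (\<forall>m\<ge>y. \<forall>n\<ge>y. dist (X m) (X n) < (1 / 2) ^ Suc k) \<and> x < y"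
      using N by (intro exI[of _ "max N (Suc x)"]) auto
  qed
  then obtain r where r: "\<And>k m n. m \<ge> r k \<Longrightarrow> n \<ge> r k \<Longrightarrow> dist (X m) (X n) < (1 / 2) ^ k"
    and mono: "strict_mono r"
    by (auto simp: strict_mono_Suc_iff)
  define F where "F k = rep_L2_half_line (X (r k))" for k
  have abs_F: "abs_L2_half_line (F k) = X (r k)" for k
    by (simp add: F_def Quotient3_abs_rep[OF Quotient3_L2_half_line])
  have F: "square_integrable (F k)" for k
    using Quotient3_rep_reflp[OF Quotient3_L2_half_line, of "X (r k)"]
    by (auto simp: F_def L2_equiv_def)
  then have [measurable]: "F k \<in> borel_measurable half_line" for k
    by (auto simp: square_integrable_def)
  have close: "(\<integral>\<^sup>+x. ennreal ((cmod (F j x - F k x))\<^sup>2) \<partial>half_line) \<le> ennreal ((1 / 4) ^ j)"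
    if "j \<le> k" for j k
  proof -
    have "dist (X (r j)) (X (r k)) < (1 / 2) ^ j"
      using that mono by (intro r) (auto simp: strict_mono_less_eq)
    then have "(dist (X (r j)) (X (r k)))\<^sup>2 \<le> ((1 / 2) ^ j)\<^sup>2"
      by (intro power_mono) auto
    also have "((1 / 2 :: real) ^ j)\<^sup>2 = (1 / 4) ^ j"
      by (simp add: power2_eq_square flip: power_mult_distrib)
    finally show ?thesis
      using F by (simp add: dist_L2_half_line_power2 abs_F ennreal_leI)
  qed
  have "(\<integral>\<^sup>+x. (\<Sum>k. ennreal (2 ^ k * (cmod (F k x - F (Suc k) x))\<^sup>2)) \<partial>half_line)
      = (\<Sum>k. \<integral>\<^sup>+x. ennreal (2 ^ k) * ennreal ((cmod (F k x - F (Suc k) x))\<^sup>2) \<partial>half_line)"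
    by (subst nn_integral_suminf) (auto simp: ennreal_mult)
  also have "\<dots> = (\<Sum>k. ennreal (2 ^ k) *
      (\<integral>\<^sup>+x. ennreal ((cmod (F k x - F (Suc k) x))\<^sup>2) \<partial>half_line))"
    by (subst nn_integral_cmult) auto
  also have "\<dots> \<le> (\<Sum>k. ennreal (2 ^ k) * ennreal ((1 / 4) ^ k))"
    by (intro suminf_le mult_left_mono close) auto
  also have "\<dots> = (\<Sum>k. ennreal ((1 / 2) ^ k))"
  proof -
    have "(2 :: real) ^ k * (1 / 4) ^ k = (1 / 2) ^ k" for k
      by (simp flip: power_mult_distrib)
    then show ?thesis by (simp flip: ennreal_mult)
  qed
  also have "\<dots> = ennreal (\<Sum>k. (1 / 2) ^ k)"
    by (intro suminf_ennreal2) (auto intro!: summable_geometric)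
  also have "\<dots> < \<infinity>" by simp
  finally have "AE x in half_line. (\<Sum>k. ennreal (2 ^ k * (cmod (F k x - F (Suc k) x))\<^sup>2)) \<noteq> \<infinity>"
    by (intro nn_integral_PInf_AE) auto
  then have conv: "AE x in half_line. (\<lambda>k. F k x) \<longlonglongrightarrow> lim (\<lambda>k. F k x)"
  proof eventually_elim
    case (elim x)
    define d where "d k = cmod (F (Suc k) x - F k x)" for k
    have "(\<Sum>k. ennreal (2 ^ k * (d k)\<^sup>2)) \<noteq> \<infinity>"
      using elim by (simp add: d_def norm_minus_commute)
    then have "summable (\<lambda>k. 2 ^ k * (d k)\<^sup>2)"
      by (intro summable_suminf_not_top) auto
    then have "Bseq (\<lambda>k. 2 ^ k * (d k)\<^sup>2)"
      by (intro convergent_imp_Bseq) (auto simp: convergent_def dest: summable_LIMSEQ_zero)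
    then obtain K where "K > 0" and K: "\<And>k. norm (2 ^ k * (d k)\<^sup>2) \<le> K"
      by (auto elim: BseqE)
    have d_le: "d k \<le> sqrt K * (1 / sqrt 2) ^ k" for k
    proof -
      have "(d k)\<^sup>2 \<le> K * (1 / 2) ^ k"
        using K[of k] by (simp add: field_simps)
      then have "sqrt ((d k)\<^sup>2) \<le> sqrt (K * (1 / 2) ^ k)"
        by (rule real_sqrt_le_mono)
      then show ?thesis
        by (simp add: d_def real_sqrt_mult real_sqrt_power real_sqrt_divide)
    qed
    have "summable (\<lambda>k. sqrt K * (1 / sqrt 2) ^ k)"
      by (intro summable_mult summable_geometric) auto
    then have "summable (\<lambda>k. F (Suc k) x - F k x)"
      by (rule summable_comparison_test'[where N = 0]) (use d_le in \<open>simp add: d_def\<close>)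
    then have "convergent (\<lambda>n. \<Sum>k<n. F (Suc k) x - F k x)"
      by (simp add: summable_iff_convergent)
    then have "convergent (\<lambda>n. F n x - F 0 x)"
      by (simp only: sum_lessThan_telescope[of "\<lambda>k. F k x"])
    then have "convergent (\<lambda>n. F n x)"
      using convergent_diff_const_right_iff[of "\<lambda>n. F n x" "F 0 x"] by simp
    then show ?case by (simp add: convergent_LIMSEQ_iff)
  qed
  define L where "L x = lim (\<lambda>k. F k x)" for x
  have [measurable]: "L \<in> borel_measurable half_line"
    unfolding L_def by measurable
  have lim: "(\<integral>\<^sup>+x. ennreal ((cmod (F j x - L x))\<^sup>2) \<partial>half_line) \<le> ennreal ((1 / 4) ^ j)" for j
  proof -
    have "(\<integral>\<^sup>+x. ennreal ((cmod (F j x - L x))\<^sup>2) \<partial>half_line)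
        = (\<integral>\<^sup>+x. liminf (\<lambda>k. ennreal ((cmod (F j x - F k x))\<^sup>2)) \<partial>half_line)"
    proof (rule nn_integral_cong_AE)
      show "AE x in half_line. ennreal ((cmod (F j x - L x))\<^sup>2)
          = liminf (\<lambda>k. ennreal ((cmod (F j x - F k x))\<^sup>2))"
        using conv
      proof eventually_elim
        case (elim x)
        then have "(\<lambda>k. ennreal ((cmod (F j x - F k x))\<^sup>2)) \<longlonglongrightarrow> ennreal ((cmod (F j x - L x))\<^sup>2)"
          unfolding L_def by (intro tendsto_intros)
        from lim_imp_Liminf[OF _ this] show ?case by simp
      qed
    qed
    also have "\<dots> \<le> liminf (\<lambda>k. \<integral>\<^sup>+x. ennreal ((cmod (F j x - F k x))\<^sup>2) \<partial>half_line)"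
      by (intro nn_integral_liminf) measurable
    also have "\<dots> \<le> liminf (\<lambda>k. ennreal ((1 / 4) ^ j))"
      by (intro Liminf_mono eventually_sequentiallyI[of j] close)
    finally show ?thesis by (simp add: Liminf_const)
  qed
  have "square_integrable (\<lambda>x. F 0 x - L x)"
    unfolding square_integrable_def
    using lim[of 0] by (auto intro!: integrableI_bounded intro: le_less_trans)
  from square_integrable_add[OF F[of 0] square_integrable_scale[OF this, of "- 1"]]
  have L: "square_integrable L" by simp
  have bound: "dist (X (r j)) (abs_L2_half_line L) \<le> (1 / 2) ^ j" for j
  proof -
    have "(dist (X (r j)) (abs_L2_half_line L))\<^sup>2 \<le> (1 / 4) ^ j"
      using lim[of j] dist_L2_half_line_power2[OF F L, of j] by (simp add: abs_F)
    also have "(1 / 4 :: real) ^ j = ((1 / 2) ^ j)\<^sup>2"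
      by (simp add: power2_eq_square flip: power_mult_distrib)
    finally show ?thesis by (rule power2_le_imp_le) simp
  qed
  have "(\<lambda>j. dist (X (r j)) (abs_L2_half_line L)) \<longlonglongrightarrow> 0"
    by (rule tendsto_sandwich[OF _ _ tendsto_const LIMSEQ_power_zero[of "1 / 2 :: real"]])
      (auto intro!: always_eventually bound)
  then have "(X \<circ> r) \<longlonglongrightarrow> abs_L2_half_line L"
    by (simp add: tendsto_dist_iff[of "X \<circ> r"])
  from Cauchy_converges_subseq[OF cauchy mono this] show "convergent X"
    by (auto simp: convergent_def)
qed


section \<open>The minimal Bessel operator\<close>

text \<open>The intervals of the finite family have pairwise disjoint interiors.\<close>

definition absolutely_continuous_on_Icc :: "real \<Rightarrow> real \<Rightarrow> (real \<Rightarrow> complex) \<Rightarrow> bool" where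
  "absolutely_continuous_on_Icc a b f \<longleftrightarrow>
     (\<forall>\<epsilon>>0. \<exists>\<delta>>0. \<forall>I. finite I \<and> (\<forall>(u, v)\<in>I. a \<le> u \<and> u \<le> v \<and> v \<le> b) \<and>
        disjoint_family_on (\<lambda>(u, v). {u<..<v}) I \<and> (\<Sum>(u, v)\<in>I. v - u) < \<delta> \<longrightarrow>
        (\<Sum>(u, v)\<in>I. cmod (f v - f u)) < \<epsilon>)"

definition locally_absolutely_continuous :: "(real \<Rightarrow> complex) \<Rightarrow> bool" where
  "locally_absolutely_continuous f \<longleftrightarrow>
     (\<forall>a b. 0 < a \<and> a < b \<longrightarrow> absolutely_continuous_on_Icc a b f)"

abbreviation deriv1 :: "(real \<Rightarrow> complex) \<Rightarrow> real \<Rightarrow> complex" where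
  "deriv1 f x \<equiv> vector_derivative f (at x)"

text \<open>\<open>bessel_maximal_fun \<nu> f h\<close>: \<open>f\<close> satisfies the conditions on functions in the maximal domain and
  $h = \tau_\nu f$. As \<open>f'\<close> is only locally absolutely continuous, $\tau_\nu f$ is determined almost
  everywhere; $h = - f'' + (\nu^2 - 1/4) x^{-2} f$ a.e. is written solved for $f''$.\<close>

definition bessel_maximal_fun :: "real \<Rightarrow> (real \<Rightarrow> complex) \<Rightarrow> (real \<Rightarrow> complex) \<Rightarrow> bool" where
  "bessel_maximal_fun \<nu> f h \<longleftrightarrow>
     square_integrable f \<and> square_integrable h \<and>
     f differentiable_on {0<..} \<and>
     locally_absolutely_continuous f \<and> locally_absolutely_continuous (deriv1 f) \<and>
     (AE x in half_line.
        (deriv1 f has_vector_derivative of_real ((\<nu>\<^sup>2 - 1 / 4) / x\<^sup>2) * f x - h x) (at x))"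

definition bessel_preminimal :: "real \<Rightarrow> (L2_half_line \<times> L2_half_line) set" where
  "bessel_preminimal \<nu> = {(abs_L2_half_line f, abs_L2_half_line h) | f h.
     bessel_maximal_fun \<nu> f h \<and> (\<exists>a b. 0 < a \<and> a < b \<and> (\<forall>x>0. x \<notin> {a..b} \<longrightarrow> f x = 0))}"

definition bessel_minimal :: "real \<Rightarrow> (L2_half_line \<times> L2_half_line) set" where
  "bessel_minimal \<nu> = closure (bessel_preminimal \<nu>)"

text \<open>$[f,g]_x$ for functions. For a class \<open>u\<close> in the maximal domain, \<open>f\<close> is its continuous
  representative, which is unique on $(0,\infty)$ and continuously differentiable there.\<close>

definition bracket_at :: "(real \<Rightarrow> complex) \<Rightarrow> (real \<Rightarrow> complex) \<Rightarrow> real \<Rightarrow> complex" where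
  "bracket_at f g x = f x * cnj (deriv1 g x) - deriv1 f x * cnj (g x)"

definition continuous_representative :: "L2_half_line \<Rightarrow> real \<Rightarrow> complex" where
  "continuous_representative u =
     (SOME f. square_integrable f \<and> abs_L2_half_line f = u \<and> continuous_on {0<..} f)"

definition bracket_0 :: "L2_half_line \<Rightarrow> (real \<Rightarrow> complex) \<Rightarrow> complex" where
  "bracket_0 u g = Lim (at_right 0) (bracket_at (continuous_representative u) g)"

definition bracket_0_exists :: "L2_half_line \<Rightarrow> (real \<Rightarrow> complex) \<Rightarrow> bool" where
  "bracket_0_exists u g \<longleftrightarrow>
     (\<exists>l. (bracket_at (continuous_representative u) g \<longlongrightarrow> l) (at_right 0))"

definition bessel_regular :: "real \<Rightarrow> real \<Rightarrow> complex" where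
  "bessel_regular \<nu> x = of_real (x powr (1 / 2 + \<nu>))"

definition bessel_singular :: "real \<Rightarrow> real \<Rightarrow> complex" where
  "bessel_singular \<nu> x =
     (if \<nu> = 0 then of_real (x powr (1 / 2) * ln x) else of_real (x powr (1 / 2 - \<nu>)))"

definition bessel_Gamma0 :: "real \<Rightarrow> L2_half_line \<Rightarrow> complex" where
  "bessel_Gamma0 \<nu> u = bracket_0 u (bessel_regular \<nu>)"

definition bessel_Gamma1 :: "real \<Rightarrow> L2_half_line \<Rightarrow> complex" where
  "bessel_Gamma1 \<nu> u =
     (if \<nu> = 0 then bracket_0 u (bessel_singular 0)
      else - of_real (1 / (2 * \<nu>)) * bracket_0 u (bessel_singular \<nu>))"

text \<open>The power $z^a$ with $\arg z \in [0, 2\pi)$, for \<open>z \<noteq> 0\<close>; \<open>(powr)\<close> on \<^typ>\<open>complex\<close> and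
  \<^const>\<open>csqrt\<close> use the principal argument instead.\<close>

definition powr_2pi :: "complex \<Rightarrow> real \<Rightarrow> complex" where
  "powr_2pi z a = of_real (cmod z powr a) * exp (\<i> * of_real (a * Arg2pi z))"

text \<open>Stieltjes inversion of the Weyl function $e^{i(1-\nu)\pi}\Gamma(1-\nu) z^\nu /
  (2\nu 4^\nu \Gamma(1+\nu))$ gives the spectral density
  $\pi^{-1} \mathrm{Im}\,M(t + i0) = t^\nu / (2^{2\nu+1} \Gamma(1+\nu)^2)$ on $(0,\infty)$. The spectral
  function is its primitive $t^{\nu+1} / ((\nu+1) 2^{2\nu+1} \Gamma(1+\nu)^2)$; the factor
  $1/(\nu+1)$ is missing in the printed source. (For $\nu = 1/2$, $M(z) = i\sqrt z$, the density is
  $\sqrt t/\pi$ and the spectral function is $2t^{3/2}/(3\pi)$.)\<close>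

end

theory Submission imports Defs begin

text \<open>
  Write $u = x^{1/2+\nu}$ and $v = x^{1/2-\nu}$ (for $\nu = 0$, $v = x^{1/2}\log x$) for the two
  solutions of $\tau_\nu f = 0$, and $[f,g] = f g' - f' g$ without conjugation; $[v,u]$ is a nonzero
  constant $\kappa$. Both $u$ and $v$ are square integrable near $0$ because $\nu < 1$. Everything rests on
  \[ [f,u]' = u\,\tau_\nu f, \qquad [f,v]' = v\,\tau_\nu f, \qquad
     \kappa\,[f,g] = [f,v][g,u] - [f,u][g,v] . \]
  The first two identities show that the brackets of a maximal function converge at $0$; the third
  turns the boundary term of Green's formula at $0$ into $\Gamma_1 f\,\Gamma_0 g - \Gamma_0 f\,\Gamma_1 g$.
  At infinity the boundary term vanishes along a suitable sequence, since $f'$ is controlled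
  by $f$ there (lemmas \<open>lagrange_identity\<close>, \<open>bracket_reg_converges\<close>, \<open>plucker_identity\<close>, \<open>green_identity\<close>).

  The adjoint of the minimal operator is the maximal one (\<open>adjoint_bessel_minimal\<close>). If $(g,k)$ is in the
  adjoint, let $G$ solve $\tau_\nu G = k$ by variation of parameters. A continuous $\psi$ of compact support
  that is orthogonal to $u$ and $v$ is $\tau_\nu\varphi$ for some $\varphi$ of compact support, so $g - G$ is orthogonal to
  all such $\psi$ and must be a combination of $u$ and $v$ (\<open>dubois_reymond\<close>). The derivative $f'$ of a
  maximal function is only absolutely continuous; to avoid almost everywhere differentiation it
  is treated as a Henstock-Kurzweil primitive (\<open>primitive\<close>), for which a product rule holds.

  For $z \notin [0,\infty)$ and $k = \sqrt{-z}$, the square integrable solution of $\tau_\nu f = z f$ is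
  \[ \psi_z(x) = x^{1/2+\nu} \int_0^\infty s^{-\nu-1} e^{-k(s + x^2/(4s))}\,ds , \]
  a multiple of $\sqrt x K_\nu(kx)$. Integration by parts in $s$ gives the differential equation, the
  reflection $s \mapsto x^2/(4s)$ exchanges the indices $\nu$ and $-\nu$, and dominated convergence as $x \to 0$ reduces
  both brackets of $\psi_z$ to Gamma integrals, for $\nu = 0$ to the derivative of the Gamma integral. Their quotient is the Weyl function.
  The form inequality $\mathrm{Re}(\tau_\nu f, f) = \int |[f,u]|^2/u^2 \ge 0$ for $\Gamma_0 f = 0$ (\<open>form_nonneg\<close>) shows that
  $A_0$ is nonnegative. Hence $[0,\infty)$ contains its spectrum and $\psi_z$ spans the eigenspace of the adjoint at $z$;
  surjectivity of $(\Gamma_0, \Gamma_1)$ follows from $\psi_i$ and $\psi_{-i}$.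

  For the spectral function, the measure with density $\rho(t) = t^\nu / (2^{2\nu+1}\Gamma(1+\nu)^2)$ on $(0,\infty)$ represents $M$: the
  function $H(z) = \int t^\nu (t-z)^{-2} dt$ satisfies $z H' = (\nu-1) H$, hence is a multiple of $(-z)^{\nu-1}$, and the
  value $H(-1)$ is a Beta integral; so $M$ and the Stieltjes integral of $\rho$ have the same derivative
  along segments from $-1$ (\<open>weyl_m_stieltjes\<close>). That the measure is the only one is Stieltjes inversion: integrating
  $\mathrm{Im}\, M(x + iy)$ over $x$ gives integrals of differences of arctangents, which tend to $\pi$ times the indicator
  of $(a,b]$ as $y \to 0$ (\<open>nevanlinna_measure_unique\<close>).\<close>


section \<open>Primitives on the half-line\<close>

text \<open>Elements of a tagged division of an interval are handled below through their endpoints.\<close>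

lemma fine_tagged_interval:
  assumes "p tagged_division_of {a..b::real}" "\<gamma> fine p" "(x, K) \<in> p"
  obtains u v where "K = {u..v}" "a \<le> u" "u \<le> x" "x \<le> v" "v \<le> b" "{u..v} \<subseteq> \<gamma> x"
    "Inf K = u" "Sup K = v" "measure lborel K = v - u"
proof -
  have p: "p tagged_division_of cbox a b" using assms by simp
  obtain u v where K: "K = cbox u v" using tagged_division_ofD(4)[OF p assms(3)] by auto
  have x: "x \<in> K" and sub: "K \<subseteq> cbox a b" using tagged_division_ofD(2,3)[OF p assms(3)] by auto
  have "K \<subseteq> \<gamma> x" using assms(2,3) by (auto simp: fine_def)
  with K x sub show ?thesis by (intro that[of u v]) auto
qed

text \<open>The fundamental theorem of calculus for the $\epsilon$-$\delta$ form of absolute continuity. The gauge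
  integral makes it elementary: on a fine division, tags outside the exceptional null set contribute a
  small error by differentiability, and the intervals tagged inside it have total length below $\delta$,
  so that absolute continuity bounds the increments of \<open>F\<close> over them.\<close>

lemma has_integral_absolutely_continuous:
  fixes F g :: "real \<Rightarrow> complex"
  assumes ab: "a \<le> b" and AC: "absolutely_continuous_on_Icc a b F" and N: "negligible N"
    and der: "\<And>x. x \<in> {a..b} - N \<Longrightarrow> (F has_vector_derivative g x) (at x)"
  shows "(g has_integral F b - F a) {a..b}"
proof -
  define g' where "g' x = (if x \<in> N then 0 else g x)" for x
  have "(g' has_integral F b - F a) {a..b}"
    unfolding has_integral_real
  proof (intro allI impI)
    fix e :: real assume e: "e > 0"
    obtain \<delta> where \<delta>: "\<delta> > 0" and AC': "\<And>I. finite I \<Longrightarrow> (\<forall>(u, v)\<in>I. a \<le> u \<and> u \<le> v \<and> v \<le> b) \<Longrightarrow>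
        disjoint_family_on (\<lambda>(u, v). {u<..<v}) I \<Longrightarrow> (\<Sum>(u, v)\<in>I. v - u) < \<delta> \<Longrightarrow>
        (\<Sum>(u, v)\<in>I. cmod (F v - F u)) < e / 2"
      using AC[unfolded absolutely_continuous_on_Icc_def, rule_format, of "e/2"] e by auto
    have Nn: "N \<in> null_sets lebesgue" using N negligible_iff_null_sets by blast
    obtain U where U: "open U" "N \<subseteq> U" "emeasure lebesgue (U - N) < ennreal \<delta>"
      using sets_lebesgue_outer_open[of N \<delta>] Nn \<delta> by (metis null_setsD2)
    have "emeasure lebesgue U = emeasure lebesgue (U - N)"
      using Nn U by (simp add: emeasure_Diff_null_set)
    then have Um: "emeasure lborel U < ennreal \<delta>"
      using U by (simp add: emeasure_completion)
    define \<eta> where "\<eta> = e / (2 * (b - a + 1))"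
    have \<eta>: "\<eta> > 0" using e ab by (simp add: \<eta>_def)
    have "\<exists>d>0. \<forall>y. \<bar>y - x\<bar> < d \<longrightarrow> cmod (F y - F x - (y - x) *\<^sub>R g x) \<le> \<eta> * \<bar>y - x\<bar>" if "x \<in> {a..b} - N" for x
      using der[OF that] \<eta> unfolding has_vector_derivative_def has_derivative_at_alt by auto
    then obtain d where d: "\<And>x. x \<in> {a..b} - N \<Longrightarrow> d x > 0"
      "\<And>x y. x \<in> {a..b} - N \<Longrightarrow> \<bar>y - x\<bar> < d x \<Longrightarrow> cmod (F y - F x - (y - x) *\<^sub>R g x) \<le> \<eta> * \<bar>y - x\<bar>"
      by metis
    \<comment> \<open>Intervals with a tag in the null set are forced into an open set of measure below \<open>\<delta>\<close>.\<close>
    define \<gamma> where "\<gamma> x = (if x \<in> N then U else if x \<in> {a..b} then ball x (d x) else ball x 1)" for x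
    have gauge: "gauge \<gamma>"
      unfolding gauge_def \<gamma>_def using U d(1) by auto
    show "\<exists>\<gamma>. gauge \<gamma> \<and> (\<forall>\<D>. \<D> tagged_division_of {a..b} \<and> \<gamma> fine \<D> \<longrightarrow>
          norm ((\<Sum>(x,k)\<in>\<D>. measure lborel k *\<^sub>R g' x) - (F b - F a)) < e)"
    proof (intro exI[of _ \<gamma>] conjI gauge allI impI, elim conjE)
      fix p assume p: "p tagged_division_of {a..b}" "\<gamma> fine p"
      have fin: "finite p" using p by auto
      have FF: "(\<Sum>(x,K)\<in>p. F (Sup K) - F (Inf K)) = F b - F a"
        using additive_tagged_division_1[OF ab p(1)] .
      define p1 where "p1 = {(x,K)\<in>p. x \<in> N}"
      define p2 where "p2 = {(x,K)\<in>p. x \<notin> N}"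
      have pp: "p = p1 \<union> p2" "p1 \<inter> p2 = {}" "finite p1" "finite p2"
        using fin by (auto simp: p1_def p2_def intro: finite_subset[OF _ fin])
      have "(\<Sum>(x,K)\<in>p2. cmod (measure lborel K *\<^sub>R g' x - (F (Sup K) - F (Inf K)))) \<le> (\<Sum>(x,K)\<in>p2. \<eta> * measure lborel K)"
      proof (intro sum_mono, clarify)
        fix x K assume xK: "(x, K) \<in> p2"
        then have xp: "(x,K) \<in> p" and xN: "x \<notin> N" by (auto simp: p2_def)
        obtain u v where uv: "K = {u..v}" "a \<le> u" "u \<le> x" "x \<le> v" "v \<le> b" "{u..v} \<subseteq> \<gamma> x"
            "Inf K = u" "Sup K = v" "measure lborel K = v - u"
          using fine_tagged_interval[OF p xp] .
        have x: "x \<in> {a..b} - N" using uv xN by auto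
        have "u \<in> \<gamma> x" "v \<in> \<gamma> x" using uv by auto
        then have "\<bar>u - x\<bar> < d x" "\<bar>v - x\<bar> < d x" using x by (auto simp: \<gamma>_def dist_real_def)
        from d(2)[OF x this(1)] d(2)[OF x this(2)]
        have 1: "cmod (F u - F x - (u - x) *\<^sub>R g x) \<le> \<eta> * (x - u)" "cmod (F v - F x - (v - x) *\<^sub>R g x) \<le> \<eta> * (v - x)"
          using uv by auto
        have "measure lborel K *\<^sub>R g' x - (F (Sup K) - F (Inf K)) = (F u - F x - (u - x) *\<^sub>R g x) - (F v - F x - (v - x) *\<^sub>R g x)"
          using uv x by (simp add: g'_def algebra_simps)
        then have "cmod (measure lborel K *\<^sub>R g' x - (F (Sup K) - F (Inf K))) \<le> \<eta> * (x - u) + \<eta> * (v - x)"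
          using 1 norm_triangle_ineq4 by (smt (verit))
        also have "\<dots> = \<eta> * measure lborel K" using uv by (simp add: algebra_simps)
        finally show "cmod (measure lborel K *\<^sub>R g' x - (F (Sup K) - F (Inf K))) \<le> \<eta> * measure lborel K" .
      qed
      also have "\<dots> \<le> (\<Sum>(x,K)\<in>p. \<eta> * measure lborel K)"
        using \<eta> by (intro sum_mono2 fin) (auto simp: pp(1))
      also have "\<dots> = \<eta> * (\<Sum>(x,K)\<in>p. measure lborel K)"
        by (simp add: sum_distrib_left case_prod_unfold)
      also have "(\<Sum>(x,K)\<in>p. measure lborel K) = b - a"
        using additive_content_tagged_division[of p a b] p ab by simp
      also have "\<eta> * (b - a) < e / 2"
        using e ab by (simp add: \<eta>_def field_simps)
      finally have s2: "(\<Sum>(x,K)\<in>p2. cmod (measure lborel K *\<^sub>R g' x - (F (Sup K) - F (Inf K)))) < e / 2" .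
      \<comment> \<open>Only for nondegenerate intervals is the map to pairs of endpoints injective.\<close>
      define p3 where "p3 = {(x,K)\<in>p1. Inf K < Sup K}"
      have p3: "finite p3" "p3 \<subseteq> p1" using pp by (auto simp: p3_def intro: finite_subset)
      define I where "I = (\<lambda>(x,K). (Inf K, Sup K)) ` p3"
      have uvI: "\<exists>u v. K = {u..v} \<and> a \<le> u \<and> u \<le> x \<and> x \<le> v \<and> v \<le> b \<and> u < v \<and> {u..v} \<subseteq> U \<and> Inf K = u \<and> Sup K = v"
        if "(x,K) \<in> p3" for x K
      proof -
        have xp: "(x,K) \<in> p" and x: "x \<in> N" using that by (auto simp: p3_def p1_def)
        obtain u v where uv: "K = {u..v}" "a \<le> u" "u \<le> x" "x \<le> v" "v \<le> b" "{u..v} \<subseteq> \<gamma> x"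
            "Inf K = u" "Sup K = v" "measure lborel K = v - u"
          using fine_tagged_interval[OF p xp] .
        then show ?thesis using that x by (intro exI[of _ u] exI[of _ v]) (auto simp: p3_def \<gamma>_def)
      qed
      have dis: "x = x' \<and> K = K' \<or> {Inf K<..<Sup K} \<inter> {Inf K'<..<Sup K'} = {}" if "(x,K) \<in> p3" "(x',K') \<in> p3" for x K x' K'
      proof (cases "(x,K) = (x',K')")
        case False
        have "(x,K) \<in> p" "(x',K') \<in> p" using that by (auto simp: p3_def p1_def)
        then have "interior K \<inter> interior K' = {}"
          using tagged_division_ofD(5)[of p "{a..b}" x K x' K'] p(1) False by auto
        moreover have "K = {Inf K..Sup K}" "K' = {Inf K'..Sup K'}" using uvI that by blast+
        ultimately show ?thesis by (metis interior_atLeastAtMost_real)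
      qed auto
      have inj: "inj_on (\<lambda>(x,K). (Inf K, Sup K)) p3"
      proof (rule inj_onI, clarify)
        fix x K x' K' assume a: "(x, K) \<in> p3" "(x', K') \<in> p3" "Inf K = Inf K'" "Sup K = Sup K'"
        have "Inf K < Sup K" using a by (auto simp: p3_def)
        then have "{Inf K<..<Sup K} \<noteq> {}" by simp
        then show "x = x' \<and> K = K'" using dis[OF a(1,2)] a(3,4) by auto
      qed
      have I1: "finite I" using p3 by (simp add: I_def)
      have I2: "\<forall>(u, v)\<in>I. a \<le> u \<and> u \<le> v \<and> v \<le> b" using uvI by (force simp: I_def)
      have I3: "disjoint_family_on (\<lambda>(u, v). {u<..<v}) I"
        unfolding disjoint_family_on_def I_def using dis by (fastforce simp: case_prod_unfold)
      have "(\<Sum>(u, v)\<in>I. ennreal (v - u)) = (\<Sum>i\<in>I. emeasure lborel ((\<lambda>(u, v). {u<..<v}) i))"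
        using I2 by (intro sum.cong refl) auto
      also have "\<dots> = emeasure lborel (\<Union>i\<in>I. (\<lambda>(u, v). {u<..<v}) i)"
        by (rule sum_emeasure) (auto simp: I3 I1)
      also have "\<dots> \<le> emeasure lborel U"
      proof (rule emeasure_mono)
        show "(\<Union>i\<in>I. (\<lambda>(u, v). {u<..<v}) i) \<subseteq> U"
          using uvI by (fastforce simp: I_def)
      qed (use U in auto)
      also have "\<dots> < ennreal \<delta>" by (rule Um)
      finally have "(\<Sum>(u, v)\<in>I. ennreal (v - u)) < ennreal \<delta>" .
      moreover have "(\<Sum>(u, v)\<in>I. ennreal (v - u)) = ennreal (\<Sum>(u, v)\<in>I. v - u)"
        using I2 by (simp add: case_prod_unfold)
      ultimately have "(\<Sum>(u, v)\<in>I. v - u) < \<delta>"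
        using I2 by (simp add: ennreal_less_iff case_prod_unfold sum_nonneg)
      from AC'[OF I1 I2 I3 this] have "(\<Sum>(u, v)\<in>I. cmod (F v - F u)) < e / 2" .
      also have "(\<Sum>(u, v)\<in>I. cmod (F v - F u)) = (\<Sum>(x,K)\<in>p3. cmod (F (Sup K) - F (Inf K)))"
        unfolding I_def by (subst sum.reindex[OF inj]) (auto intro!: sum.cong)
      also have "\<dots> = (\<Sum>(x,K)\<in>p1. cmod (F (Sup K) - F (Inf K)))"
      proof (rule sum.mono_neutral_left[OF pp(3) p3(2)], clarify)
        fix x K assume x: "(x, K) \<in> p1" "(x,K) \<notin> p3"
        then have xp: "(x,K) \<in> p" by (auto simp: p1_def)
        obtain u v where uv: "K = {u..v}" "a \<le> u" "u \<le> x" "x \<le> v" "v \<le> b" "{u..v} \<subseteq> \<gamma> x"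
            "Inf K = u" "Sup K = v" "measure lborel K = v - u"
          using fine_tagged_interval[OF p xp] .
        then have "u = v" using x by (auto simp: p3_def)
        then show "cmod (F (Sup K) - F (Inf K)) = 0" using uv by simp
      qed
      finally have s1: "(\<Sum>(x,K)\<in>p1. cmod (F (Sup K) - F (Inf K))) < e / 2" .
      have "(\<Sum>(x,k)\<in>p. measure lborel k *\<^sub>R g' x) - (F b - F a) = (\<Sum>(x,K)\<in>p. measure lborel K *\<^sub>R g' x - (F (Sup K) - F (Inf K)))"
        unfolding FF[symmetric] by (simp add: case_prod_unfold sum_subtractf)
      also have "\<dots> = (\<Sum>(x,K)\<in>p1. measure lborel K *\<^sub>R g' x - (F (Sup K) - F (Inf K))) + (\<Sum>(x,K)\<in>p2. measure lborel K *\<^sub>R g' x - (F (Sup K) - F (Inf K)))"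
        unfolding pp(1) using pp by (simp add: sum.union_disjoint)
      also have "cmod \<dots> \<le> (\<Sum>(x,K)\<in>p1. cmod (measure lborel K *\<^sub>R g' x - (F (Sup K) - F (Inf K)))) + (\<Sum>(x,K)\<in>p2. cmod (measure lborel K *\<^sub>R g' x - (F (Sup K) - F (Inf K))))"
        by (intro order_trans[OF norm_triangle_ineq] add_mono order_trans[OF norm_sum]) (auto simp: case_prod_unfold)
      also have "(\<Sum>(x,K)\<in>p1. cmod (measure lborel K *\<^sub>R g' x - (F (Sup K) - F (Inf K)))) = (\<Sum>(x,K)\<in>p1. cmod (F (Sup K) - F (Inf K)))"
        by (intro sum.cong) (auto simp: p1_def g'_def norm_minus_commute)
      finally show "norm ((\<Sum>(x,k)\<in>p. measure lborel k *\<^sub>R g' x) - (F b - F a)) < e"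
        using s1 s2 by simp
    qed
  qed
  then show ?thesis
    by (rule has_integral_spike[OF N, rotated]) (auto simp: g'_def)
qed

text \<open>This is \<open>P' = p\<close> in integrated form. A condition on integrals takes the place of local
  absolute continuity together with differentiability almost everywhere.\<close>

definition primitive :: "(real \<Rightarrow> complex) \<Rightarrow> (real \<Rightarrow> complex) \<Rightarrow> bool" where
  "primitive P p \<longleftrightarrow> (\<forall>a b. 0 < a \<and> a \<le> b \<longrightarrow> (p has_integral P b - P a) {a..b})"

lemma primitiveD: "primitive P p \<Longrightarrow> 0 < a \<Longrightarrow> a \<le> b \<Longrightarrow> (p has_integral P b - P a) {a..b}"
  by (auto simp: primitive_def)

lemma primitive_has_vector_derivative:
  assumes "\<And>x. x > 0 \<Longrightarrow> (P has_vector_derivative p x) (at x)"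
  shows "primitive P p"
  unfolding primitive_def
  by (auto intro!: fundamental_theorem_of_calculus has_vector_derivative_at_within assms)

lemma primitive_continuous_Icc:
  assumes P: "primitive P p" and a: "0 < a" shows "continuous_on {a..b} P"
proof (cases "a \<le> b")
  case True
  have "p integrable_on {a..b}" using primitiveD[OF P a True] by auto
  from indefinite_integral_continuous_1[OF this]
  have "continuous_on {a..b} (\<lambda>x. P a + integral {a..x} p)"
    by (intro continuous_intros)
  moreover have "P a + integral {a..x} p = P x" if "x \<in> {a..b}" for x
    using primitiveD[OF P a, of x] that by (auto simp: integral_unique)
  ultimately show ?thesis by (rule continuous_on_eq)
qed auto

lemma continuous_on_half_line_I:
  fixes f :: "real \<Rightarrow> complex"
  assumes "\<And>a b. 0 < a \<Longrightarrow> a < b \<Longrightarrow> continuous_on {a..b} f" shows "continuous_on {0<..} f"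
proof (intro continuous_at_imp_continuous_on ballI)
  fix x :: real assume x: "x \<in> {0<..}"
  have "continuous_on {x/2..2*x} f" using assms x by auto
  then show "isCont f x" using x by (intro continuous_on_interior) auto
qed

lemma primitive_continuous_on: "primitive P p \<Longrightarrow> continuous_on {0<..} P"
  by (rule continuous_on_half_line_I) (rule primitive_continuous_Icc)

lemma primitiveI:
  "(\<And>a b. 0 < a \<Longrightarrow> a \<le> b \<Longrightarrow> (p has_integral P b - P a) {a..b}) \<Longrightarrow> primitive P p"
  by (auto simp: primitive_def)

lemma primitive_add:
  assumes "primitive P p" "primitive Q q"
  shows "primitive (\<lambda>x. P x + Q x) (\<lambda>x. p x + q x)"
proof (rule primitiveI)
  fix a b :: real assume "0 < a" "a \<le> b"
  from has_integral_add[OF assms[THEN primitiveD, OF this]]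
  show "((\<lambda>x. p x + q x) has_integral (P b + Q b) - (P a + Q a)) {a..b}"
    by (simp add: algebra_simps)
qed

lemma primitive_cmult:
  assumes "primitive P p" shows "primitive (\<lambda>x. c * P x) (\<lambda>x. c * p x)"
proof (rule primitiveI)
  fix a b :: real assume "0 < a" "a \<le> b"
  from has_integral_mult_right[OF primitiveD[OF assms this], of c]
  show "((\<lambda>x. c * p x) has_integral c * P b - c * P a) {a..b}"
    by (simp add: algebra_simps)
qed

lemma primitive_diff: "primitive P p \<Longrightarrow> primitive Q q \<Longrightarrow> primitive (\<lambda>x. P x - Q x) (\<lambda>x. p x - q x)"
  using primitive_add[of P p "\<lambda>x. -1 * Q x" "\<lambda>x. -1 * q x"] primitive_cmult[of Q q "-1"] by simp

lemma primitive_cnj: "primitive P p \<Longrightarrow> primitive (\<lambda>x. cnj (P x)) (\<lambda>x. cnj (p x))"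
  unfolding primitive_def complex_cnj_diff[symmetric] has_integral_cnj[unfolded o_def] .

lemma primitive_cong:
  assumes "primitive P p" "\<And>x. x > 0 \<Longrightarrow> P x = P' x" "\<And>x. x > 0 \<Longrightarrow> p x = p' x"
  shows "primitive P' p'"
  unfolding primitive_def
proof (intro allI impI, elim conjE)
  fix a b :: real assume ab: "0 < a" "a \<le> b"
  have "(p has_integral P b - P a) {a..b}" using assms(1) ab by (auto simp: primitive_def)
  then have "(p' has_integral P b - P a) {a..b}" by (rule has_integral_eq[rotated]) (use ab assms in auto)
  then show "(p' has_integral P' b - P' a) {a..b}" using assms ab by auto
qed

lemma primitive_continuous_has_vector_derivative:
  assumes P: "primitive P p" and p: "continuous_on {0<..} p" and x: "x > 0"
  shows "(P has_vector_derivative p x) (at x)"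
proof -
  have "continuous_on {x/2..2*x} p" using x by (intro continuous_on_subset[OF p]) auto
  from integral_has_vector_derivative[OF this, of x] x
  have "((\<lambda>y. P (x/2) + integral {x/2..y} p) has_vector_derivative p x) (at x within {x/2..2*x})"
    by (auto intro!: derivative_eq_intros)
  then have "(P has_vector_derivative p x) (at x within {x/2..2*x})"
  proof (rule has_vector_derivative_transform[rotated 2])
    fix y assume "y \<in> {x/2..2*x}"
    then show "P y = P (x/2) + integral {x/2..y} p"
      using primitiveD[OF P, of "x/2" y] x by (auto simp: integral_unique)
  qed (use x in auto)
  then show ?thesis using x by (simp add: at_within_Icc_at)
qed

text \<open>The product rule for a primitive and a $C^1$ function. On one interval of a fine division, the increment
  of \<open>P * Q\<close> differs from its linear approximation by the errors that the Henstock lemma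
  controls and by a product of two increments; one factor of that product is small by uniform
  continuity, the other is at most a multiple of the length.\<close>

lemma primitive_mult:
  assumes P: "primitive P p" and Q: "\<And>x. x > 0 \<Longrightarrow> (Q has_vector_derivative q x) (at x)"
    and q: "continuous_on {0<..} q"
  shows "primitive (\<lambda>x. P x * Q x) (\<lambda>x. p x * Q x + P x * q x)"
  unfolding primitive_def
proof (intro allI impI, elim conjE)
  fix a b :: real assume a: "0 < a" and ab: "a \<le> b"
  have Qp: "primitive Q q" using Q by (rule primitive_has_vector_derivative)
  have Pc: "continuous_on {a..b} P" and Qc: "continuous_on {a..b} Q"
    using primitive_continuous_Icc[OF P a] primitive_continuous_Icc[OF Qp a] .
  have qc: "continuous_on {a..b} q" using a by (intro continuous_on_subset[OF q]) auto
  have "\<exists>C. \<forall>x\<in>{a..b}. cmod (P x) \<le> C \<and> cmod (Q x) \<le> C \<and> cmod (q x) \<le> C"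
  proof -
    have "bounded (P ` {a..b})" "bounded (Q ` {a..b})" "bounded (q ` {a..b})"
      using Pc Qc qc by (auto intro!: compact_imp_bounded compact_continuous_image)
    then obtain A B C where "\<forall>x\<in>{a..b}. cmod (P x) \<le> A" "\<forall>x\<in>{a..b}. cmod (Q x) \<le> B" "\<forall>x\<in>{a..b}. cmod (q x) \<le> C"
      unfolding bounded_iff by auto
    then show ?thesis by (intro exI[of _ "max A (max B C)"]) (auto simp: le_max_iff_disj)
  qed
  then obtain C0 where C0: "\<And>x. x \<in> {a..b} \<Longrightarrow> cmod (P x) \<le> C0 \<and> cmod (Q x) \<le> C0 \<and> cmod (q x) \<le> C0" by blast
  define C where "C = max C0 1"
  have C: "\<And>x. x \<in> {a..b} \<Longrightarrow> cmod (P x) \<le> C \<and> cmod (Q x) \<le> C \<and> cmod (q x) \<le> C" and C1: "C \<ge> 1"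
    using C0 by (auto simp: C_def le_max_iff_disj)

  have lip: "cmod (Q y - Q x) \<le> C * \<bar>y - x\<bar>" if "x \<in> {a..b}" "y \<in> {a..b}" for x y
  proof -
    have "norm (Q y - Q x) \<le> C * norm (y - x)"
    proof (rule differentiable_bound[of "{a..b}" Q "\<lambda>x h. h *\<^sub>R q x"])
      show "(Q has_derivative (\<lambda>h. h *\<^sub>R q z)) (at z within {a..b})" if "z \<in> {a..b}" for z
        using Q[of z] that a has_derivative_at_withinI unfolding has_vector_derivative_def by fastforce
      show "onorm (\<lambda>h. h *\<^sub>R q z) \<le> C" if "z \<in> {a..b}" for z
        using C[OF that] by (intro onorm_le) (simp add: mult.commute[of _ "cmod (q z)"] mult_right_mono)
    qed (use that in auto)
    then show ?thesis by simp
  qed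
  have pI: "p integrable_on cbox a b" and qI: "q integrable_on cbox a b"
    using primitiveD[OF P a ab] primitiveD[OF Qp a ab] by auto
  have Pint: "integral {u..v} p = P v - P u" "integral {u..v} q = Q v - Q u" if "a \<le> u" "u \<le> v" for u v
    using that a primitiveD[OF P, of u v] primitiveD[OF Qp, of u v] by (auto simp: integral_unique)
  show "((\<lambda>x. p x * Q x + P x * q x) has_integral P b * Q b - P a * Q a) {a..b}"
    unfolding has_integral_real
  proof (intro allI impI)
    fix e :: real assume e: "e > 0"
    \<comment> \<open>Two error sums of at most \<open>C * \<epsilon>\<close> and one of at most \<open>C * \<epsilon> * (b - a)\<close> arise.\<close>
    define \<epsilon> where "\<epsilon> = e / (C * (3 + (b - a)))"
    have \<epsilon>: "\<epsilon> > 0" using e C1 ab by (auto simp: \<epsilon>_def)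
    obtain \<gamma>1 where \<gamma>1: "gauge \<gamma>1" "\<And>r. \<lbrakk>r tagged_partial_division_of (cbox a b); \<gamma>1 fine r\<rbrakk> \<Longrightarrow>
             sum (\<lambda>(x,k). norm(measure lborel k *\<^sub>R p x - integral k p)) r < \<epsilon>"
      using Henstock_lemma[OF pI \<epsilon>] by blast
    obtain \<gamma>2 where \<gamma>2: "gauge \<gamma>2" "\<And>r. \<lbrakk>r tagged_partial_division_of (cbox a b); \<gamma>2 fine r\<rbrakk> \<Longrightarrow>
             sum (\<lambda>(x,k). norm(measure lborel k *\<^sub>R q x - integral k q)) r < \<epsilon>"
      using Henstock_lemma[OF qI \<epsilon>] by blast
    have "uniformly_continuous_on {a..b} P" using Pc by (intro compact_uniformly_continuous) auto
    then obtain d where d: "d > 0" "\<And>x y. x \<in> {a..b} \<Longrightarrow> y \<in> {a..b} \<Longrightarrow> \<bar>y - x\<bar> < d \<Longrightarrow> cmod (P y - P x) < \<epsilon>"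
      using \<epsilon> unfolding uniformly_continuous_on_def dist_norm real_norm_def by blast
    define \<gamma> where "\<gamma> x = (\<gamma>1 x \<inter> \<gamma>2 x) \<inter> ball x d" for x
    have gauge: "gauge \<gamma>" unfolding \<gamma>_def
      by (intro gauge_Int \<gamma>1(1) \<gamma>2(1) gauge_ball d(1))
    show "\<exists>\<gamma>. gauge \<gamma> \<and> (\<forall>\<D>. \<D> tagged_division_of {a..b} \<and> \<gamma> fine \<D> \<longrightarrow>
       norm ((\<Sum>(x,k)\<in>\<D>. measure lborel k *\<^sub>R (p x * Q x + P x * q x)) - (P b * Q b - P a * Q a)) < e)"
    proof (intro exI[of _ \<gamma>] conjI gauge allI impI, elim conjE)
      fix r assume r: "r tagged_division_of {a..b}" "\<gamma> fine r"
      have fin: "finite r" using r by auto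
      have rp: "r tagged_partial_division_of cbox a b" using r by (auto simp: tagged_division_of_def)
      have fine: "\<gamma>1 fine r" "\<gamma>2 fine r" using r(2) by (auto simp: fine_def \<gamma>_def)
      have FF: "(\<Sum>(x,K)\<in>r. P (Sup K) * Q (Sup K) - P (Inf K) * Q (Inf K)) = P b * Q b - P a * Q a"
        using additive_tagged_division_1[OF ab r(1), of "\<lambda>x. P x * Q x"] .
      define D where "D = (\<lambda>(x,K). measure lborel K *\<^sub>R (p x * Q x + P x * q x) - (P (Sup K) * Q (Sup K) - P (Inf K) * Q (Inf K)))"
      define E1 where "E1 = (\<lambda>(x,K). norm (measure lborel K *\<^sub>R p x - integral K p))"
      define E2 where "E2 = (\<lambda>(x,K). norm (measure lborel K *\<^sub>R q x - integral K q))"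
      define len where "len = (\<lambda>(x::real,K::real set). measure lborel K)"
      have D: "(\<Sum>(x,k)\<in>r. measure lborel k *\<^sub>R (p x * Q x + P x * q x)) - (P b * Q b - P a * Q a) = sum D r"
        unfolding FF[symmetric] D_def by (simp add: case_prod_unfold sum_subtractf)
      have "cmod (sum D r) \<le> (\<Sum>s\<in>r. C * E1 s + C * E2 s + \<epsilon> * C * len s)"
        unfolding D_def E1_def E2_def len_def
      proof (rule order_trans[OF norm_sum], intro sum_mono, clarify)
        fix x K assume xK: "(x, K) \<in> r"
        obtain u v where uv: "K = {u..v}" "a \<le> u" "u \<le> x" "x \<le> v" "v \<le> b" "{u..v} \<subseteq> \<gamma> x"
            "Inf K = u" "Sup K = v" "measure lborel K = v - u"
          using fine_tagged_interval[OF r xK] .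
        have "u \<in> \<gamma> x" "v \<in> \<gamma> x" using uv by auto
        then have dd: "\<bar>u - x\<bar> < d" "\<bar>v - x\<bar> < d" by (auto simp: \<gamma>_def dist_real_def)
        have in_ab: "x \<in> {a..b}" "u \<in> {a..b}" "v \<in> {a..b}" using uv by auto
        let ?H1 = "measure lborel K *\<^sub>R p x - integral K p" and ?H2 = "measure lborel K *\<^sub>R q x - integral K q"
        have I: "integral K p = P v - P u" "integral K q = Q v - Q u" "measure lborel K = v - u"
          using uv Pint[of u v] by auto
        have "measure lborel K *\<^sub>R (p x * Q x + P x * q x) - (P v * Q v - P u * Q u)
          = ?H1 * Q x + P x * ?H2 - ((P v - P x) * (Q v - Q x) - (P u - P x) * (Q u - Q x))"
          unfolding I by (simp add: scaleR_conv_of_real algebra_simps)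
        also have "cmod \<dots> \<le> cmod ?H1 * cmod (Q x) + cmod (P x) * cmod ?H2 + (cmod (P v - P x) * cmod (Q v - Q x) + cmod (P u - P x) * cmod (Q u - Q x))"
          unfolding norm_mult[symmetric]
          by (rule order_trans[OF norm_triangle_ineq4 add_mono[OF norm_triangle_ineq norm_triangle_ineq4]])
        also have "\<dots> \<le> cmod ?H1 * C + C * cmod ?H2 + (\<epsilon> * (C * \<bar>v - x\<bar>) + \<epsilon> * (C * \<bar>u - x\<bar>))"
        proof (intro add_mono)
          show "cmod ?H1 * cmod (Q x) \<le> cmod ?H1 * C" using C[OF in_ab(1)] by (intro mult_left_mono) auto
          show "cmod (P x) * cmod ?H2 \<le> C * cmod ?H2" using C[OF in_ab(1)] by (intro mult_right_mono) auto
          show "cmod (P v - P x) * cmod (Q v - Q x) \<le> \<epsilon> * (C * \<bar>v - x\<bar>)"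
            using d(2)[OF in_ab(1,3) dd(2)] lip[OF in_ab(1,3)] \<epsilon> by (intro mult_mono) auto
          show "cmod (P u - P x) * cmod (Q u - Q x) \<le> \<epsilon> * (C * \<bar>u - x\<bar>)"
            using d(2)[OF in_ab(1,2) dd(1)] lip[OF in_ab(1,2)] \<epsilon> by (intro mult_mono) auto
        qed
        also have "\<dots> = C * cmod ?H1 + C * cmod ?H2 + \<epsilon> * C * measure lborel K"
        proof -
          have "\<bar>v - x\<bar> = v - x" "\<bar>u - x\<bar> = x - u" using uv(3,4) by auto
          then show ?thesis unfolding I(3) by (simp add: algebra_simps)
        qed
        finally show "cmod (measure lborel K *\<^sub>R (p x * Q x + P x * q x) - (P (Sup K) * Q (Sup K) - P (Inf K) * Q (Inf K)))
            \<le> C * cmod ?H1 + C * cmod ?H2 + \<epsilon> * C * measure lborel K"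
          unfolding uv(7,8) .
      qed
      also have "\<dots> = C * sum E1 r + C * sum E2 r + \<epsilon> * C * sum len r"
        by (simp only: sum.distrib sum_distrib_left)
      finally have le: "cmod (sum D r) \<le> C * sum E1 r + C * sum E2 r + \<epsilon> * C * sum len r" .
      have len: "sum len r = b - a"
        using additive_content_tagged_division[of r a b] r ab by (simp add: len_def)
      have "sum E1 r < \<epsilon>" "sum E2 r < \<epsilon>"
        using \<gamma>1(2)[OF rp fine(1)] \<gamma>2(2)[OF rp fine(2)] by (simp_all add: E1_def E2_def)
      then have "C * sum E1 r \<le> C * \<epsilon>" "C * sum E2 r \<le> C * \<epsilon>" using C1 by (auto intro!: mult_left_mono)
      with le len have "cmod (sum D r) \<le> C * \<epsilon> + C * \<epsilon> + \<epsilon> * C * (b - a)" by simp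
      also have "\<dots> < \<epsilon> * (C * (3 + (b - a)))" using \<epsilon> C1 by (simp add: algebra_simps)
      also have "\<dots> = e" using C1 ab by (simp add: \<epsilon>_def)
      finally show "norm ((\<Sum>(x,k)\<in>r. measure lborel k *\<^sub>R (p x * Q x + P x * q x)) - (P b * Q b - P a * Q a)) < e"
        unfolding D .
    qed
  qed
qed


section \<open>Integrals over the half-line\<close>

lemma integrable_half_line_iff: "integrable half_line f \<longleftrightarrow> f absolutely_integrable_on {0<..}"
  for f :: "real \<Rightarrow> 'a::euclidean_space"
  by (subst integrable_restrict_space) (auto simp: set_integrable_def)

lemma half_line_integral_eq: "(LINT x|half_line. f x) = integral {0<..} f"
  if "integrable half_line f" for f :: "real \<Rightarrow> 'a::euclidean_space"
  using that set_lebesgue_integral_eq_integral(2)[of "{0<..}" f]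
  by (simp add: integral_restrict_space integrable_half_line_iff set_lebesgue_integral_def)

lemma measurable_half_line_continuous:
  fixes f :: "real \<Rightarrow> 'a::euclidean_space"
  assumes "continuous_on {0<..} f" shows "f \<in> borel_measurable half_line"
  using assms by (intro continuous_imp_measurable_on_sets_lebesgue) auto

lemma half_line_integral_Icc:
  fixes p :: "real \<Rightarrow> complex"
  assumes a: "0 < a" and p: "integrable half_line (\<lambda>x. indicator {a..b} x *\<^sub>R p x)"
    and i: "(p has_integral i) {a..b}"
  shows "(LINT x|half_line. indicator {a..b} x *\<^sub>R p x) = i"
proof -
  have "(LINT x|half_line. indicator {a..b} x *\<^sub>R p x) = integral {0<..} (\<lambda>x. indicator {a..b} x *\<^sub>R p x)"
    by (rule half_line_integral_eq[OF p])
  also have "\<dots> = integral {0<..} (\<lambda>x. if x \<in> {a..b} then p x else 0)"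
    by (intro integral_cong) (auto simp: indicator_def)
  also have "\<dots> = integral ({a..b}) p"
    using a by (subst integral_restrict_Int) (auto intro!: arg_cong[where f="\<lambda>S. integral S p"])
  finally show ?thesis using i by (simp add: integral_unique)
qed

text \<open>Improper integrals are computed by exhausting the half-line by sets that eventually contain each point
  at which the integrand is not zero.\<close>

lemma half_line_integral_exhaust:
  fixes p :: "real \<Rightarrow> complex"
  assumes p: "integrable half_line p" and A: "\<And>n. A n \<in> sets half_line"
    and ev: "\<And>x. x > 0 \<Longrightarrow> p x \<noteq> 0 \<Longrightarrow> eventually (\<lambda>n. x \<in> A n) sequentially"
  shows "(\<lambda>n. LINT x|half_line. indicator (A n) x *\<^sub>R p x) \<longlonglongrightarrow> (LINT x|half_line. p x)"
proof (rule integral_dominated_convergence[where w = "\<lambda>x. norm (p x)"])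
  show "AE x in half_line. (\<lambda>n. indicator (A n) x *\<^sub>R p x) \<longlonglongrightarrow> p x"
  proof (rule AE_I2)
    fix x :: real assume "x \<in> space half_line"
    then have x: "x > 0" by simp
    show "(\<lambda>n. indicator (A n) x *\<^sub>R p x) \<longlonglongrightarrow> p x"
    proof (cases "p x = 0")
      case False
      show ?thesis
        by (rule tendsto_eventually) (use ev[OF x False] in eventually_elim, auto)
    qed auto
  qed
  show "\<And>n. (\<lambda>x. indicator (A n) x *\<^sub>R p x) \<in> borel_measurable half_line"
    using A p by (intro borel_measurable_scaleR borel_measurable_indicator) auto
qed (use p in \<open>auto simp: indicator_def\<close>)

lemma sets_half_line_Icc [intro, simp]: "0 < a \<Longrightarrow> {a..b} \<in> sets half_line"
  by (auto simp: sets_restrict_space_iff)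

lemma primitive_tendsto_integral:
  assumes P: "primitive P p" and p: "integrable half_line p"
    and X: "\<And>n. X n > 0" "X \<longlonglongrightarrow> 0" and Y: "filterlim Y at_top sequentially"
  shows "(\<lambda>n. P (Y n) - P (X n)) \<longlonglongrightarrow> (LINT x|half_line. p x)"
proof -
  have "(\<lambda>n. LINT x|half_line. indicator {X n..Y n} x *\<^sub>R p x) \<longlonglongrightarrow> (LINT x|half_line. p x)"
  proof (rule half_line_integral_exhaust[OF p])
    fix x :: real assume x: "x > 0"
    have "eventually (\<lambda>n. X n < x) sequentially" using X(2) x by (rule order_tendstoD)
    moreover have "eventually (\<lambda>n. Y n \<ge> x) sequentially" using Y by (simp add: filterlim_at_top)
    ultimately show "eventually (\<lambda>n. x \<in> {X n..Y n}) sequentially" by eventually_elim auto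
  qed (use X in auto)
  moreover have "eventually (\<lambda>n. (LINT x|half_line. indicator {X n..Y n} x *\<^sub>R p x) = P (Y n) - P (X n)) sequentially"
  proof -
    have "eventually (\<lambda>n. X n < 1) sequentially" using X(2) by (rule order_tendstoD) simp
    moreover have "eventually (\<lambda>n. Y n \<ge> 1) sequentially" using Y by (simp add: filterlim_at_top)
    ultimately show ?thesis
      by eventually_elim (intro half_line_integral_Icc integrable_mult_indicator X p primitiveD[OF P] sets_half_line_Icc, auto)
  qed
  ultimately show ?thesis by (rule Lim_transform_eventually)
qed

lemma primitive_tendsto_0:
  assumes P: "primitive P p" and c: "c > 0" and p: "integrable half_line (\<lambda>x. indicator {0<..c} x *\<^sub>R p x)"
  shows "(P \<longlongrightarrow> P c - (LINT x|half_line. indicator {0<..c} x *\<^sub>R p x)) (at_right 0)"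
  unfolding tendsto_at_iff_sequentially
proof (intro allI impI)
  fix X :: "nat \<Rightarrow> real" assume "\<forall>i. X i \<in> {0<..} - {0}" "X \<longlonglongrightarrow> 0"
  then have X: "\<And>n. X n > 0" "X \<longlonglongrightarrow> 0" by auto
  let ?p = "\<lambda>x. indicator {0<..c} x *\<^sub>R p x"
  have "(\<lambda>n. LINT x|half_line. indicator {X n..c} x *\<^sub>R ?p x) \<longlonglongrightarrow> (LINT x|half_line. ?p x)"
  proof (rule half_line_integral_exhaust[OF p])
    fix x :: real assume x: "x > 0" and "?p x \<noteq> 0"
    then have xc: "x \<le> c" by (auto simp: indicator_def split: if_splits)
    have "eventually (\<lambda>n. X n < x) sequentially" using X(2) x by (rule order_tendstoD)
    then show "eventually (\<lambda>n. x \<in> {X n..c}) sequentially" by eventually_elim (use xc in auto)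
  qed (use X in auto)
  moreover have "eventually (\<lambda>n. (LINT x|half_line. indicator {X n..c} x *\<^sub>R ?p x) = P c - P (X n)) sequentially"
  proof -
    have "eventually (\<lambda>n. X n < c) sequentially" using X(2) c by (rule order_tendstoD)
    then show ?thesis
    proof eventually_elim
      case (elim n)
      have "(?p has_integral P c - P (X n)) {X n..c}"
        by (rule has_integral_eq[OF _ primitiveD[OF P]]) (use X(1)[of n] elim in auto)
      then show ?case
        by (intro half_line_integral_Icc X integrable_mult_indicator[OF sets_half_line_Icc p])
    qed
  qed
  ultimately have "(\<lambda>n. P c - P (X n)) \<longlonglongrightarrow> (LINT x|half_line. ?p x)" by (rule Lim_transform_eventually)
  then have "(\<lambda>n. P c - (P c - P (X n))) \<longlonglongrightarrow> P c - (LINT x|half_line. ?p x)" by (intro tendsto_intros)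
  then show "(P \<circ> X) \<longlonglongrightarrow> P c - (LINT x|half_line. ?p x)" by (simp add: o_def)
qed

text \<open>Chebyshev's inequality, in the form that yields points at which an integrable function is small.\<close>

lemma half_line_integral_ge:
  fixes S :: "real \<Rightarrow> real"
  assumes S: "integrable half_line S" "\<And>x. S x \<ge> 0" and a: "0 < a" "a \<le> b" and c: "\<And>x. x \<in> {a..b} \<Longrightarrow> c \<le> S x"
  shows "c * (b - a) \<le> (LINT x|half_line. S x)"
proof -
  have eq: "(\<lambda>x. c * indicator {a..b} x) = (\<lambda>x. indicator {a..b} x *\<^sub>R c)" by auto
  have fin: "emeasure half_line {a..b} < \<infinity>"
    using a by (subst emeasure_restrict_space) (auto simp: emeasure_lborel_Icc_eq)
  have m: "measure half_line {a..b} = b - a"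
    using a by (subst measure_restrict_space) (auto)
  have i: "integrable half_line (\<lambda>x. c * indicator {a..b} x)"
    using fin a by (intro integrable_mult_right integrable_real_indicator) auto
  have "c * (b - a) = (LINT x|half_line. c * indicator {a..b} x)"
    using a m by (simp add: space_restrict_space Int_absorb2 subset_iff)
  also have "\<dots> \<le> (LINT x|half_line. S x)"
    using i S c by (intro integral_mono) (auto simp: indicator_def)
  finally show ?thesis .
qed

lemma integrable_powr_0_1:
  assumes "a > -1" shows "integrable half_line (\<lambda>x. indicator {0<..1} x * x powr a)"
proof -
  have "(\<lambda>x. x powr a) absolutely_integrable_on {0..1::real}"
    using integrable_on_powr_from_0[OF assms, of 1] by (intro nonnegative_absolutely_integrable_1) auto
  then have "(\<lambda>x. x powr a) absolutely_integrable_on {0<..1::real}"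
    by (rule set_integrable_subset) auto
  then show ?thesis
    unfolding integrable_half_line_iff set_integrable_def
    by (rule Bochner_Integration.integrable_cong[THEN iffD1, rotated 2]) (auto simp: indicator_def)
qed

lemma integrable_powr_1_inf:
  assumes "a < -1" shows "integrable half_line (\<lambda>x. indicator {1<..} x * x powr a)"
proof -
  have "(\<lambda>x. x powr a) absolutely_integrable_on {1..}"
    using has_integral_powr_to_inf[of a 1] assms by (intro nonnegative_absolutely_integrable_1) (auto simp: integrable_on_def)
  then have "(\<lambda>x. x powr a) absolutely_integrable_on {1::real<..}"
    by (rule set_integrable_subset) auto
  then show ?thesis
    unfolding integrable_half_line_iff set_integrable_def
    by (rule Bochner_Integration.integrable_cong[THEN iffD1, rotated 2]) (auto simp: indicator_def)
qed

text \<open>The integrability criterion for all concrete functions below: one power bound near \<open>0\<close> and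
  one near infinity.\<close>

lemma integrable_half_line_powr_bound:
  fixes f :: "real \<Rightarrow> 'a::euclidean_space"
  assumes f: "f \<in> borel_measurable half_line" and a: "a > -1" and b: "b < -1"
    and 0: "\<And>x. 0 < x \<Longrightarrow> x \<le> 1 \<Longrightarrow> norm (f x) \<le> C * x powr a"
    and 1: "\<And>x. 1 < x \<Longrightarrow> norm (f x) \<le> C * x powr b"
  shows "integrable half_line f"
proof (rule Bochner_Integration.integrable_bound)
  show "integrable half_line (\<lambda>x. C * (indicator {0<..1} x * x powr a) + C * (indicator {1<..} x * x powr b))"
    by (intro Bochner_Integration.integrable_add integrable_mult_right integrable_powr_0_1 integrable_powr_1_inf a b)
  show "AE x in half_line. norm (f x) \<le> norm (C * (indicator {0<..1} x * x powr a) + C * (indicator {1<..} x * x powr b))"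
  proof (rule AE_I2)
    fix x :: real assume "x \<in> space half_line"
    then have x: "x > 0" by simp
    show "norm (f x) \<le> norm (C * (indicator {0<..1} x * x powr a) + C * (indicator {1<..} x * x powr b))"
      using 0[OF x] 1[of x] x by (cases "x \<le> 1") auto
  qed
qed (rule f)

lemma square_integrable_powr_bound:
  assumes f: "f \<in> borel_measurable half_line" and a: "a > -1/2" and b: "b < -1/2"
    and 0: "\<And>x. 0 < x \<Longrightarrow> x \<le> 1 \<Longrightarrow> cmod (f x) \<le> C * x powr a"
    and 1: "\<And>x. 1 < x \<Longrightarrow> cmod (f x) \<le> C * x powr b"
  shows "square_integrable f"
  unfolding square_integrable_def
proof (intro conjI f integrable_half_line_powr_bound[where a = "2*a" and b="2*b" and C = "C\<^sup>2"])
  have *: "norm ((cmod (f x))\<^sup>2) \<le> C\<^sup>2 * x powr (2*a)" if "cmod (f x) \<le> C * x powr a" for x a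
  proof -
    have "(cmod (f x))\<^sup>2 \<le> (C * x powr a)\<^sup>2" using that by (intro power_mono) auto
    also have "(C * x powr a)\<^sup>2 = C\<^sup>2 * (x powr a * x powr a)" by (simp add: power2_eq_square)
    also have "x powr a * x powr a = x powr (2*a)" by (simp flip: powr_add)
    finally show ?thesis by simp
  qed
  show "norm ((cmod (f x))\<^sup>2) \<le> C\<^sup>2 * x powr (2*a)" if "0 < x" "x \<le> 1" for x using 0 * that by blast
  show "norm ((cmod (f x))\<^sup>2) \<le> C\<^sup>2 * x powr (2*b)" if "1 < x" for x using 1 * that by blast
qed (use a b f in auto)

lemma square_integrable_cnj: "square_integrable f \<Longrightarrow> square_integrable (\<lambda>x. cnj (f x))"
  unfolding square_integrable_def
  by (auto intro!: borel_measurable_continuous_on[of cnj, OF _, simplified] continuous_intros)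

lemma square_integrable_mult:
  "square_integrable f \<Longrightarrow> square_integrable g \<Longrightarrow> integrable half_line (\<lambda>x. f x * g x)"
  using square_integrable_mult_cnj[of f "\<lambda>x. cnj (g x)"] by (simp add: square_integrable_cnj)

lemma integrable_half_line_Icc:
  fixes f :: "real \<Rightarrow> 'a::euclidean_space"
  assumes a: "0 < a"
  shows "integrable half_line (\<lambda>x. indicator {a..b} x *\<^sub>R f x) \<longleftrightarrow> f absolutely_integrable_on {a..b}"
proof -
  have *: "(\<lambda>x. indicat_real {0<..} x *\<^sub>R indicat_real {a..b} x *\<^sub>R f x) = (\<lambda>x. indicat_real {a..b} x *\<^sub>R f x)"
    using a by (auto simp: indicator_def)
  show ?thesis unfolding integrable_half_line_iff set_integrable_def * ..
qed

lemma square_integrable_Icc: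
  assumes f: "square_integrable f" and a: "0 < a"
  shows "f absolutely_integrable_on {a..b}"
proof -
  have fm: "f \<in> borel_measurable half_line" using f by (simp add: square_integrable_def)
  have fin: "emeasure half_line {a..b} < \<infinity>"
    using a by (subst emeasure_restrict_space) (auto simp: emeasure_lborel_Icc_eq)
  have "integrable half_line (\<lambda>x. indicator {a..b} x *\<^sub>R f x)"
  proof (rule Bochner_Integration.integrable_bound)
    show "integrable half_line (\<lambda>x. (cmod (f x))\<^sup>2 + indicator {a..b} x)"
      using f a fin by (intro Bochner_Integration.integrable_add integrable_real_indicator sets_half_line_Icc)
         (auto simp: square_integrable_def)
    show "(\<lambda>x. indicator {a..b} x *\<^sub>R f x) \<in> borel_measurable half_line"
      using fm a by (intro borel_measurable_scaleR borel_measurable_indicator sets_half_line_Icc)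
    have "r \<le> r\<^sup>2 + 1" for r :: real
      using zero_le_power2[of "r - 1/2"] by (simp add: power2_eq_square algebra_simps)
    then show "AE x in half_line. norm (indicator {a..b} x *\<^sub>R f x) \<le> norm ((cmod (f x))\<^sup>2 + indicator {a..b} x)"
      by (intro AE_I2) (simp add: indicator_def)
  qed
  then show ?thesis using a by (simp add: integrable_half_line_Icc)
qed


section \<open>Solutions of the Bessel equation\<close>

definition bessel_q :: "real \<Rightarrow> real \<Rightarrow> complex" where
  "bessel_q \<nu> x = of_real ((\<nu>\<^sup>2 - 1 / 4) / x\<^sup>2)"

text \<open>The equation $\tau_\nu f = h$ for $C^1$ functions, with $f' = f_1$ carried along as a separate function
  and $f'' = q f - h$ in integrated form.\<close>

definition bessel_sol :: "real \<Rightarrow> (real \<Rightarrow> complex) \<Rightarrow> (real \<Rightarrow> complex) \<Rightarrow> (real \<Rightarrow> complex) \<Rightarrow> bool" where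
  "bessel_sol \<nu> f f1 h \<longleftrightarrow> (\<forall>x>0. (f has_vector_derivative f1 x) (at x)) \<and>
     primitive f1 (\<lambda>x. bessel_q \<nu> x * f x - h x)"

definition bessel_max :: "real \<Rightarrow> (real \<Rightarrow> complex) \<Rightarrow> (real \<Rightarrow> complex) \<Rightarrow> (real \<Rightarrow> complex) \<Rightarrow> bool" where
  "bessel_max \<nu> f f1 h \<longleftrightarrow> bessel_sol \<nu> f f1 h \<and> square_integrable f \<and> square_integrable h"

lemma bessel_solD:
  assumes "bessel_sol \<nu> f f1 h"
  shows "x > 0 \<Longrightarrow> (f has_vector_derivative f1 x) (at x)" "primitive f1 (\<lambda>x. bessel_q \<nu> x * f x - h x)"
    "continuous_on {0<..} f" "continuous_on {0<..} f1"
proof -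
  show d: "x > 0 \<Longrightarrow> (f has_vector_derivative f1 x) (at x)" for x using assms by (simp add: bessel_sol_def)
  show p: "primitive f1 (\<lambda>x. bessel_q \<nu> x * f x - h x)" using assms by (simp add: bessel_sol_def)
  show "continuous_on {0<..} f"
    by (intro continuous_at_imp_continuous_on ballI has_vector_derivative_continuous[OF d]) simp
  show "continuous_on {0<..} f1" by (rule primitive_continuous_on[OF p])
qed

lemma bessel_sol_add:
  assumes "bessel_sol \<nu> f f1 h" "bessel_sol \<nu> g g1 k"
  shows "bessel_sol \<nu> (\<lambda>x. f x + g x) (\<lambda>x. f1 x + g1 x) (\<lambda>x. h x + k x)"
  using assms primitive_add[OF bessel_solD(2)[OF assms(1)] bessel_solD(2)[OF assms(2)]]
  by (auto simp: bessel_sol_def algebra_simps intro!: has_vector_derivative_add)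

lemma bessel_sol_cmult:
  assumes "bessel_sol \<nu> f f1 h"
  shows "bessel_sol \<nu> (\<lambda>x. c * f x) (\<lambda>x. c * f1 x) (\<lambda>x. c * h x)"
  using assms primitive_cmult[OF bessel_solD(2)[OF assms], of c]
  by (auto simp: bessel_sol_def algebra_simps intro!: has_vector_derivative_mult_right)

lemma bessel_sol_cnj:
  assumes "bessel_sol \<nu> f f1 h"
  shows "bessel_sol \<nu> (\<lambda>x. cnj (f x)) (\<lambda>x. cnj (f1 x)) (\<lambda>x. cnj (h x))"
  using assms primitive_cnj[OF bessel_solD(2)[OF assms]]
  by (auto simp: bessel_sol_def bessel_q_def intro!: has_vector_derivative_cnj)

lemma bessel_max_add:
  "bessel_max \<nu> f f1 h \<Longrightarrow> bessel_max \<nu> g g1 k \<Longrightarrow>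
   bessel_max \<nu> (\<lambda>x. f x + g x) (\<lambda>x. f1 x + g1 x) (\<lambda>x. h x + k x)"
  by (auto simp: bessel_max_def bessel_sol_add square_integrable_add)

lemma bessel_max_cmult:
  "bessel_max \<nu> f f1 h \<Longrightarrow> bessel_max \<nu> (\<lambda>x. c * f x) (\<lambda>x. c * f1 x) (\<lambda>x. c * h x)"
  by (auto simp: bessel_max_def bessel_sol_cmult square_integrable_scale)

lemma bessel_max_cnj:
  "bessel_max \<nu> f f1 h \<Longrightarrow> bessel_max \<nu> (\<lambda>x. cnj (f x)) (\<lambda>x. cnj (f1 x)) (\<lambda>x. cnj (h x))"
  by (auto simp: bessel_max_def bessel_sol_cnj square_integrable_cnj)

text \<open>The potential terms cancel in $(f g' - f' g)' = f g'' - f'' g$.\<close>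

lemma lagrange_identity:
  assumes f: "bessel_sol \<nu> f f1 h" and g: "bessel_sol \<nu> g g1 k"
  shows "primitive (\<lambda>x. f x * g1 x - f1 x * g x) (\<lambda>x. h x * g x - f x * k x)"
proof -
  have 1: "primitive (\<lambda>x. g1 x * f x) (\<lambda>x. (bessel_q \<nu> x * g x - k x) * f x + g1 x * f1 x)"
    by (rule primitive_mult[OF bessel_solD(2)[OF g] bessel_solD(1)[OF f] bessel_solD(4)[OF f]])
  have 2: "primitive (\<lambda>x. f1 x * g x) (\<lambda>x. (bessel_q \<nu> x * f x - h x) * g x + f1 x * g1 x)"
    by (rule primitive_mult[OF bessel_solD(2)[OF f] bessel_solD(1)[OF g] bessel_solD(4)[OF g]])
  show ?thesis
    by (rule primitive_cong[OF primitive_diff[OF 1 2]]) (auto simp: algebra_simps)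
qed

definition regular_deriv :: "real \<Rightarrow> real \<Rightarrow> complex" where
  "regular_deriv \<nu> x = of_real ((1 / 2 + \<nu>) * x powr (\<nu> - 1 / 2))"

definition singular_deriv :: "real \<Rightarrow> real \<Rightarrow> complex" where
  "singular_deriv \<nu> x = (if \<nu> = 0 then of_real (x powr (- 1 / 2) * (ln x / 2 + 1)) else regular_deriv (- \<nu>) x)"

text \<open>The constant Wronskian of \<open>bessel_singular\<close> and \<open>bessel_regular\<close>. With it the
  two cases of $\Gamma_1$ read uniformly $\Gamma_1 f = - [f, v]_0 / \kappa$.\<close>

definition kappa :: "real \<Rightarrow> real" where "kappa \<nu> = (if \<nu> = 0 then -1 else 2 * \<nu>)"

lemma kappa_nonzero [simp]: "kappa \<nu> \<noteq> 0" by (simp add: kappa_def)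

lemma bessel_singular_nonzero: "\<nu> \<noteq> 0 \<Longrightarrow> bessel_singular \<nu> = bessel_regular (- \<nu>)"
  by (auto simp: bessel_singular_def bessel_regular_def)

lemma has_vector_derivative_regular:
  "x > 0 \<Longrightarrow> (bessel_regular \<nu> has_vector_derivative regular_deriv \<nu> x) (at x)"
  unfolding bessel_regular_def[abs_def] regular_deriv_def
  by (intro has_vector_derivative_of_real)
     (auto intro!: derivative_eq_intros simp: has_real_derivative_iff_has_vector_derivative[symmetric])

lemma powr_shift: "x > 0 \<Longrightarrow> x powr (a - 2) = x powr a / x\<^sup>2" for x a :: real
  by (simp add: powr_diff)

lemma powr_shift1: "x > 0 \<Longrightarrow> x powr (a - 1) = x powr a / x" for x a :: real
  by (simp add: powr_diff)

lemma bessel_sol_regular: "bessel_sol \<nu> (bessel_regular \<nu>) (regular_deriv \<nu>) (\<lambda>x. 0)"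
  unfolding bessel_sol_def
proof (intro conjI allI impI has_vector_derivative_regular primitive_has_vector_derivative)
  fix x :: real assume x: "x > 0"
  have "((\<lambda>x. (1 / 2 + \<nu>) * x powr (\<nu> - 1 / 2)) has_real_derivative (1/2 + \<nu>) * ((\<nu> - 1/2) * x powr (\<nu> - 1/2 - 1))) (at x)"
    using x by (auto intro!: derivative_eq_intros)
  also have "(1/2 + \<nu>) * ((\<nu> - 1/2) * x powr (\<nu> - 1/2 - 1)) = (\<nu>\<^sup>2 - 1/4) / x\<^sup>2 * x powr (1/2 + \<nu>)"
  proof -
    have e: "\<nu> - 1/2 - 1 = (1/2 + \<nu>) - 2" by simp
    show ?thesis unfolding e powr_shift[OF x] by (simp add: power2_eq_square algebra_simps)
  qed
  finally have "((\<lambda>x. (1 / 2 + \<nu>) * x powr (\<nu> - 1 / 2)) has_real_derivative (\<nu>\<^sup>2 - 1/4) / x\<^sup>2 * x powr (1/2 + \<nu>)) (at x)" .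
  from has_vector_derivative_of_real[OF this, where 'a = complex]
  show "(regular_deriv \<nu> has_vector_derivative bessel_q \<nu> x * bessel_regular \<nu> x - 0) (at x)"
    by (simp add: regular_deriv_def[abs_def] bessel_q_def bessel_regular_def)
qed

lemma bessel_sol_singular: "bessel_sol \<nu> (bessel_singular \<nu>) (singular_deriv \<nu>) (\<lambda>x. 0)"
proof (cases "\<nu> = 0")
  case False
  then have "singular_deriv \<nu> = regular_deriv (-\<nu>)" by (auto simp: singular_deriv_def)
  moreover have "bessel_q (-\<nu>) = bessel_q \<nu>" by (auto simp: bessel_q_def)
  ultimately show ?thesis using bessel_sol_regular[of "-\<nu>"] False
    by (simp add: bessel_sol_def bessel_singular_nonzero)
next
  case True
  have 1: "((\<lambda>x. x powr (1/2) * ln x) has_real_derivative x powr (- 1 / 2) * (ln x / 2 + 1)) (at x)" if "x > 0" for x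
    using that powr_shift1[of x "1/2"] by (auto intro!: derivative_eq_intros simp: field_simps)
  have 2: "((\<lambda>x. x powr (- 1 / 2) * (ln x / 2 + 1)) has_real_derivative (0\<^sup>2 - 1/4) / x\<^sup>2 * (x powr (1/2) * ln x)) (at x)" if "x > 0" for x
  proof -
    have "((\<lambda>x. x powr (- 1 / 2) * (ln x / 2 + 1)) has_real_derivative
       (- 1/2) * x powr (-1/2 - 1) * (ln x / 2 + 1) + x powr (-1/2) * (1 / x / 2)) (at x)"
      using that by (auto intro!: derivative_eq_intros)
    moreover have e: "x powr (-1/2 - 1) = x powr (1/2) / x\<^sup>2" "x powr (-1/2) = x powr (1/2) / x"
      using powr_shift[OF that, of "1/2"] powr_shift1[OF that, of "1/2"] by simp_all
    have "(- 1/2) * x powr (-1/2 - 1) * (ln x / 2 + 1) + x powr (-1/2) * (1 / x / 2)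
        = (0\<^sup>2 - 1/4) / x\<^sup>2 * (x powr (1/2) * ln x)"
      unfolding e using that by (simp add: power2_eq_square field_simps)
    ultimately show ?thesis by (simp only:)
  qed
  have *: "bessel_singular \<nu> = (\<lambda>x. of_real (x powr (1/2) * ln x))" "singular_deriv \<nu> = (\<lambda>x. of_real (x powr (- 1 / 2) * (ln x / 2 + 1)))"
    using True by (auto simp: bessel_singular_def singular_deriv_def)
  show ?thesis unfolding bessel_sol_def
  proof (intro conjI allI impI primitive_has_vector_derivative)
    fix x :: real assume x: "x > 0"
    show "(bessel_singular \<nu> has_vector_derivative singular_deriv \<nu> x) (at x)"
      unfolding * using 1[OF x] by (intro has_vector_derivative_of_real)
    show "(singular_deriv \<nu> has_vector_derivative bessel_q \<nu> x * bessel_singular \<nu> x - 0) (at x)"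
      unfolding * bessel_q_def using 2[OF x] True
      by (simp only: of_real_mult[symmetric] diff_0_right has_vector_derivative_of_real)
  qed
qed

lemma wronskian_singular_regular:
  assumes "x > 0"
  shows "bessel_singular \<nu> x * regular_deriv \<nu> x - singular_deriv \<nu> x * bessel_regular \<nu> x = of_real (kappa \<nu>)"
proof (cases "\<nu> = 0")
  case True
  have "x powr (1/2) * x powr (-1/2) = 1" using assms by (simp flip: powr_add)
  then have *: "x powr (1/2) * ln x * (1/2 * x powr (-1/2)) - x powr (- 1 / 2) * (ln x / 2 + 1) * x powr (1/2) = -1"
    by (simp add: algebra_simps)
  show ?thesis using True arg_cong[OF *, of complex_of_real]
    by (simp add: bessel_singular_def bessel_regular_def regular_deriv_def singular_deriv_def kappa_def)
next
  case False
  have "x powr (1/2 - \<nu>) * x powr (\<nu> - 1/2) = 1" "x powr (-\<nu> - 1/2) * x powr (1/2 + \<nu>) = 1"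
    using assms by (simp_all flip: powr_add)
  then have *: "x powr (1/2 - \<nu>) * ((1/2 + \<nu>) * x powr (\<nu> - 1/2)) - (1/2 - \<nu>) * x powr (-\<nu> - 1/2) * x powr (1/2 + \<nu>) = 2 * \<nu>"
    by (simp add: algebra_simps)
  show ?thesis using False arg_cong[OF *, of complex_of_real]
    by (simp add: bessel_singular_def bessel_regular_def regular_deriv_def singular_deriv_def kappa_def)
qed

text \<open>A common exponent for bounding both solutions near \<open>0\<close>; the value \<open>0\<close> absorbs
  the logarithm when \<open>\<nu> = 0\<close>. What counts is that it exceeds \<open>-1/2\<close>.\<close>

definition sing_exp :: "real \<Rightarrow> real" where "sing_exp \<nu> = (if \<nu> = 0 then 0 else 1/2 - \<nu>)"

lemma norm_singular_le:
  assumes "0 < x" "x \<le> 1" shows "cmod (bessel_singular \<nu> x) \<le> 2 * x powr sing_exp \<nu>"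
proof (cases "\<nu> = 0")
  case False then show ?thesis by (simp add: bessel_singular_def sing_exp_def)
next
  case True
  have "ln (1 / x) \<le> (1 / x) powr (1/2) / (1/2)"
    using assms by (intro ln_powr_bound) auto
  then have "\<bar>ln x\<bar> \<le> 2 * x powr (-1/2)"
    using assms by (simp add: ln_div powr_divide powr_minus_divide)
  then have "x powr (1/2) * \<bar>ln x\<bar> \<le> x powr (1/2) * (2 * x powr (-1/2))"
    by (intro mult_left_mono) auto
  also have "\<dots> = 2" using assms by (simp flip: powr_add)
  finally show ?thesis using True assms by (simp add: bessel_singular_def sing_exp_def norm_mult)
qed

lemma norm_regular_le:
  assumes "0 < x" "x \<le> 1" "\<nu> \<ge> 0" shows "cmod (bessel_regular \<nu> x) \<le> x powr sing_exp \<nu>"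
  using assms powr_mono'[of 0 "1/2" x] by (auto simp: bessel_regular_def sing_exp_def intro!: powr_mono')

lemma sing_exp_gt: "\<nu> < 1 \<Longrightarrow> sing_exp \<nu> > -1/2"
  by (simp add: sing_exp_def)

text \<open>This is the limit circle case at \<open>0\<close>, and the place where \<open>\<nu> < 1\<close> is
  essential.\<close>

lemma square_integrable_near_0:
  assumes \<nu>: "0 \<le> \<nu>" "\<nu> < 1"
  shows "square_integrable (\<lambda>x. indicator {0<..1} x * bessel_regular \<nu> x)"
    "square_integrable (\<lambda>x. indicator {0<..1} x * bessel_singular \<nu> x)"
proof -
  have m: "(\<lambda>x. indicator {0<..1} x * f x) \<in> borel_measurable half_line" if "continuous_on {0<..} f" for f :: "real \<Rightarrow> complex"
  proof -
    have "(\<lambda>x. indicator {0<..1} x *\<^sub>R f x) \<in> borel_measurable half_line"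
      using measurable_half_line_continuous[OF that]
      by (intro borel_measurable_scaleR borel_measurable_indicator) (auto simp: sets_restrict_space_iff)
    then show ?thesis by (rule measurable_cong[THEN iffD1, rotated]) (auto simp: indicator_def)
  qed
  show "square_integrable (\<lambda>x. indicator {0<..1} x * bessel_regular \<nu> x)"
    by (rule square_integrable_powr_bound[of _ "sing_exp \<nu>" "-2" 2, OF m[OF bessel_solD(3)[OF bessel_sol_regular]] sing_exp_gt[OF \<nu>(2)]])
       (use order_trans[OF norm_regular_le[OF _ _ \<nu>(1)]] in \<open>auto simp: indicator_def\<close>)
  show "square_integrable (\<lambda>x. indicator {0<..1} x * bessel_singular \<nu> x)"
    by (rule square_integrable_powr_bound[of _ "sing_exp \<nu>" "-2" 2, OF m[OF bessel_solD(3)[OF bessel_sol_singular]] sing_exp_gt[OF \<nu>(2)]])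
       (use norm_singular_le in \<open>auto simp: indicator_def\<close>)
qed

definition bracket_reg :: "real \<Rightarrow> (real \<Rightarrow> complex) \<Rightarrow> (real \<Rightarrow> complex) \<Rightarrow> real \<Rightarrow> complex" where
  "bracket_reg \<nu> f f1 x = f x * regular_deriv \<nu> x - f1 x * bessel_regular \<nu> x"
definition bracket_sing :: "real \<Rightarrow> (real \<Rightarrow> complex) \<Rightarrow> (real \<Rightarrow> complex) \<Rightarrow> real \<Rightarrow> complex" where
  "bracket_sing \<nu> f f1 x = f x * singular_deriv \<nu> x - f1 x * bessel_singular \<nu> x"

lemma primitive_bracket_reg: "bessel_sol \<nu> f f1 h \<Longrightarrow> primitive (bracket_reg \<nu> f f1) (\<lambda>x. h x * bessel_regular \<nu> x)"
  using lagrange_identity[OF _ bessel_sol_regular] by (auto simp: bracket_reg_def[abs_def])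
lemma primitive_bracket_sing: "bessel_sol \<nu> f f1 h \<Longrightarrow> primitive (bracket_sing \<nu> f f1) (\<lambda>x. h x * bessel_singular \<nu> x)"
  using lagrange_identity[OF _ bessel_sol_singular] by (auto simp: bracket_sing_def[abs_def])

text \<open>By Lagrange's identity the brackets have the derivatives $h u$ and $h v$, which are integrable on
  $(0,1)$ as products of square integrable functions.\<close>

lemma bracket_reg_converges:
  assumes \<nu>: "0 \<le> \<nu>" "\<nu> < 1" and f: "bessel_max \<nu> f f1 h"
  shows "\<exists>l. (bracket_reg \<nu> f f1 \<longlongrightarrow> l) (at_right 0)" "\<exists>l. (bracket_sing \<nu> f f1 \<longlongrightarrow> l) (at_right 0)"
proof -
  have f': "bessel_sol \<nu> f f1 h" "square_integrable h" using f by (auto simp: bessel_max_def)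
  have "integrable half_line (\<lambda>x. indicator {0<..1} x *\<^sub>R (h x * bessel_regular \<nu> x))"
    using square_integrable_mult[OF f'(2) square_integrable_near_0(1)[OF \<nu>]]
    by (rule Bochner_Integration.integrable_cong[THEN iffD1, rotated 2]) (auto simp: indicator_def)
  from primitive_tendsto_0[OF primitive_bracket_reg[OF f'(1)] zero_less_one this]
  show "\<exists>l. (bracket_reg \<nu> f f1 \<longlongrightarrow> l) (at_right 0)" by blast
  have "integrable half_line (\<lambda>x. indicator {0<..1} x *\<^sub>R (h x * bessel_singular \<nu> x))"
    using square_integrable_mult[OF f'(2) square_integrable_near_0(2)[OF \<nu>]]
    by (rule Bochner_Integration.integrable_cong[THEN iffD1, rotated 2]) (auto simp: indicator_def)
  from primitive_tendsto_0[OF primitive_bracket_sing[OF f'(1)] zero_less_one this]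
  show "\<exists>l. (bracket_sing \<nu> f f1 \<longlongrightarrow> l) (at_right 0)" by blast
qed

text \<open>Cramer's rule for the system of the two brackets, with the Wronskian \<open>kappa\<close> as
  determinant.\<close>

lemma solution_from_brackets:
  assumes "x > 0"
  shows "of_real (kappa \<nu>) * f x = bessel_singular \<nu> x * bracket_reg \<nu> f f1 x - bessel_regular \<nu> x * bracket_sing \<nu> f f1 x"
    "of_real (kappa \<nu>) * f1 x = singular_deriv \<nu> x * bracket_reg \<nu> f f1 x - regular_deriv \<nu> x * bracket_sing \<nu> f f1 x"
  unfolding wronskian_singular_regular[OF assms, of \<nu>, symmetric] bracket_reg_def bracket_sing_def
  by (simp_all add: algebra_simps)

text \<open>The Pluecker relation among the $2 \times 2$ minors formed from \<open>f\<close>, \<open>g\<close> and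
  the two solutions. It expresses the bracket of two arbitrary functions by boundary data.\<close>

lemma plucker_identity:
  assumes "x > 0"
  shows "f x * g1 x - f1 x * g x = (bracket_sing \<nu> f f1 x * bracket_reg \<nu> g g1 x - bracket_reg \<nu> f f1 x * bracket_sing \<nu> g g1 x) / of_real (kappa \<nu>)"
proof -
  have "(f x * g1 x - f1 x * g x) * of_real (kappa \<nu>) = bracket_sing \<nu> f f1 x * bracket_reg \<nu> g g1 x - bracket_reg \<nu> f f1 x * bracket_sing \<nu> g g1 x"
    unfolding wronskian_singular_regular[OF assms, of \<nu>, symmetric] bracket_reg_def bracket_sing_def
    by (simp add: algebra_simps)
  then show ?thesis by (simp add: field_simps)
qed


section \<open>Behaviour at infinity and Green's identity\<close>

lemma bessel_q_bound:
  assumes "0 \<le> \<nu>" "\<nu> < 1" "x \<ge> 1" shows "cmod (bessel_q \<nu> x) \<le> 1"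
proof -
  have "\<nu>\<^sup>2 \<le> 1" using assms by (intro power_le_one) auto
  then have "\<bar>\<nu>\<^sup>2 - 1/4\<bar> \<le> 1" using zero_le_power2[of \<nu>] by linarith
  moreover have "x\<^sup>2 \<ge> 1" using assms by (simp add: one_le_power)
  ultimately have "\<bar>\<nu>\<^sup>2 - 1/4\<bar> / x\<^sup>2 \<le> 1" by (simp add: divide_le_eq)
  moreover have "cmod (bessel_q \<nu> x) = \<bar>\<nu>\<^sup>2 - 1/4\<bar> / x\<^sup>2"
    unfolding bessel_q_def norm_of_real by (simp add: abs_divide)
  ultimately show ?thesis by simp
qed

lemma continuous_on_bessel_q: "continuous_on {0<..} (bessel_q \<nu>)"
  unfolding bessel_q_def[abs_def] by (intro continuous_intros) auto

lemma integrable_indicator_Icc: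
  assumes "0 < a" shows "integrable half_line (\<lambda>x. indicator {a..b} x :: real)"
    "a \<le> b \<Longrightarrow> (LINT x|half_line. indicator {a..b} x) = b - a"
proof -
  have fin: "emeasure half_line {a..b} < \<infinity>"
    using assms by (subst emeasure_restrict_space) (auto simp: emeasure_lborel_Icc_eq)
  show "integrable half_line (\<lambda>x. indicator {a..b} x :: real)"
    using fin assms by (intro integrable_real_indicator sets_half_line_Icc)
  have "measure half_line {a..b} = b - a" if "a \<le> b"
    using assms that by (subst measure_restrict_space) auto
  moreover have "{a..b} \<inter> space half_line = {a..b}" using assms by auto
  ultimately show "a \<le> b \<Longrightarrow> (LINT x|half_line. indicator {a..b} x) = b - a" by simp
qed

text \<open>On $[1,\infty)$ the potential is bounded, so the integral of $f'' = q f - h$ over an interval of length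
  at most \<open>1\<close> is bounded by the norms of \<open>f\<close> and \<open>h\<close>; the
  elementary $r \le r^2 + 1$ serves in place of the Cauchy-Schwarz inequality.\<close>

lemma deriv_variation_bound:
  assumes \<nu>: "0 \<le> \<nu>" "\<nu> < 1" and f: "bessel_max \<nu> f f1 h"
  shows "\<exists>A\<ge>0. \<forall>y t. 1 \<le> y \<and> y \<le> t \<and> t \<le> y + 1 \<longrightarrow> cmod (f1 t - f1 y) \<le> A"
proof -
  define G where "G x = (cmod (f x))\<^sup>2 + (cmod (h x))\<^sup>2" for x
  have sq: "square_integrable f" "square_integrable h" and sol: "bessel_sol \<nu> f f1 h" using f by (auto simp: bessel_max_def)
  have G: "integrable half_line G" using sq unfolding G_def by (auto simp: square_integrable_def)
  define A where "A = (LINT x|half_line. G x) + 2"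
  have A: "A \<ge> 0" unfolding A_def by (intro add_nonneg_nonneg integral_nonneg_AE) (auto simp: G_def)
  have pm: "(\<lambda>x. bessel_q \<nu> x * f x - h x) \<in> borel_measurable half_line"
    using sq measurable_half_line_continuous[OF continuous_on_bessel_q]
    by (intro borel_measurable_diff borel_measurable_times) (auto simp: square_integrable_def)
  have "cmod (f1 t - f1 y) \<le> A" if y: "1 \<le> y" "y \<le> t" "t \<le> y + 1" for y t
  proof -
    let ?p = "\<lambda>x. indicator {y..t} x *\<^sub>R (bessel_q \<nu> x * f x - h x)"
    have le: "norm (?p x) \<le> G x + 2 * indicator {y..t} x" for x
    proof (cases "x \<in> {y..t}")
      case True
      have r: "r \<le> r\<^sup>2 + 1" for r :: real
        using zero_le_power2[of "r - 1/2"] by (simp add: power2_eq_square algebra_simps)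
      have "norm (bessel_q \<nu> x * f x - h x) \<le> cmod (bessel_q \<nu> x) * cmod (f x) + cmod (h x)"
        using norm_triangle_ineq4[of "bessel_q \<nu> x * f x" "h x"] by (simp add: norm_mult)
      also have "\<dots> \<le> 1 * cmod (f x) + cmod (h x)"
        using True y bessel_q_bound[OF \<nu>, of x] by (intro add_mono mult_right_mono) auto
      also have "\<dots> \<le> G x + 2" using r[of "cmod (f x)"] r[of "cmod (h x)"] by (simp add: G_def)
      finally show ?thesis using True by simp
    qed (auto simp: G_def)
    have int: "integrable half_line (\<lambda>x. G x + 2 * indicator {y..t} x)"
      using y by (intro Bochner_Integration.integrable_add G integrable_mult_right integrable_indicator_Icc) auto
    have pint: "integrable half_line ?p"
    proof (rule Bochner_Integration.integrable_bound[OF int])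
      show "?p \<in> borel_measurable half_line" using pm y by (intro borel_measurable_scaleR borel_measurable_indicator) auto
      show "AE x in half_line. norm (?p x) \<le> norm (G x + 2 * indicator {y..t} x)"
        using le by (intro AE_I2) (smt (verit) norm_ge_zero real_norm_def)
    qed
    have "f1 t - f1 y = (LINT x|half_line. ?p x)"
      using half_line_integral_Icc[OF _ pint primitiveD[OF bessel_solD(2)[OF sol]]] y by simp
    also have "cmod \<dots> \<le> (LINT x|half_line. G x + 2 * indicator {y..t} x)"
      by (rule order_trans[OF Bochner_Integration.integral_norm_bound]) (intro Bochner_Integration.integral_mono integrable_norm pint int le)
    also have "\<dots> = (LINT x|half_line. G x) + 2 * (t - y)"
      using y G integrable_indicator_Icc[of y t] by simp
    also have "\<dots> \<le> A" using y by (simp add: A_def)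
    finally show ?thesis .
  qed
  then show ?thesis using A by blast
qed

text \<open>If $f'$ is large at \<open>y\<close>, it stays large on an interval of length \<open>1\<close> by the
  preceding bound, and then \<open>f\<close> changes there by a large amount; but \<open>f\<close> is
  bounded somewhere in the second half of that interval.\<close>

lemma deriv_bound:
  assumes \<nu>: "0 \<le> \<nu>" "\<nu> < 1" and f: "bessel_max \<nu> f f1 h"
  shows "\<exists>K. \<forall>y\<ge>1. cmod (f1 y) \<le> K + 2 * cmod (f y)"
proof -
  obtain A where A: "A \<ge> 0" "\<And>y t. 1 \<le> y \<Longrightarrow> y \<le> t \<Longrightarrow> t \<le> y + 1 \<Longrightarrow> cmod (f1 t - f1 y) \<le> A"
    using deriv_variation_bound[OF assms] by blast
  have sq: "square_integrable f" and sol: "bessel_sol \<nu> f f1 h" using f by (auto simp: bessel_max_def)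
  have G: "integrable half_line (\<lambda>x. (cmod (f x))\<^sup>2)" using sq by (auto simp: square_integrable_def)
  define N where "N = (LINT x|half_line. (cmod (f x))\<^sup>2)"
  have N: "N \<ge> 0" unfolding N_def by (intro integral_nonneg_AE) auto
  have "cmod (f1 y) \<le> 2 * (2 * N + 2 + A) + 2 * cmod (f y)" if y: "y \<ge> 1" for y
  proof -
    \<comment> \<open>Otherwise the integral over this interval of length \<open>1/2\<close> would exceed \<open>N\<close>.\<close>
    have "\<exists>t\<in>{y+1/2..y+1}. (cmod (f t))\<^sup>2 \<le> 2 * N + 1"
    proof (rule ccontr)
      assume "\<not> ?thesis"
      then have *: "\<And>t. t \<in> {y+1/2..y+1} \<Longrightarrow> 2 * N + 1 \<le> (cmod (f t))\<^sup>2" by force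
      from half_line_integral_ge[OF G, of "y+1/2" "y+1" "2*N+1", OF _ _ _ *] y have "(2 * N + 1) * ((y+1) - (y+1/2)) \<le> N" by (simp add: N_def)
      then show False by simp
    qed
    then obtain t where t: "y + 1/2 \<le> t" "t \<le> y + 1" "(cmod (f t))\<^sup>2 \<le> 2 * N + 1" by auto
    have r: "r \<le> r\<^sup>2 + 1" for r :: real
      using zero_le_power2[of "r - 1/2"] by (simp add: power2_eq_square algebra_simps)
    have ft: "cmod (f t) \<le> 2 * N + 2" using r[of "cmod (f t)"] t(3) by linarith
    have "norm ((f t - t *\<^sub>R f1 y) - (f y - y *\<^sub>R f1 y)) \<le> A * norm (t - y)"
    proof (rule differentiable_bound[of "{y..t}" "\<lambda>x. f x - x *\<^sub>R f1 y" "\<lambda>x h. h *\<^sub>R (f1 x - f1 y)"])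
      fix x assume x: "x \<in> {y..t}"
      have "(f has_vector_derivative f1 x) (at x within {y..t})"
        using x y by (auto intro: has_vector_derivative_at_within[OF bessel_solD(1)[OF sol]])
      then have "((\<lambda>x. f x - x *\<^sub>R f1 y) has_vector_derivative f1 x - 1 *\<^sub>R f1 y) (at x within {y..t})"
        by (auto intro!: derivative_eq_intros)
      then show "((\<lambda>x. f x - x *\<^sub>R f1 y) has_derivative (\<lambda>h. h *\<^sub>R (f1 x - f1 y))) (at x within {y..t})"
        by (simp add: has_vector_derivative_def)
      show "onorm (\<lambda>h. h *\<^sub>R (f1 x - f1 y)) \<le> A"
        using A(2)[of y x] x y t by (intro onorm_le) (simp add: mult.commute[of _ "cmod (f1 x - f1 y)"] mult_right_mono)
    qed (use t in auto)
    then have "cmod (f t - f y - (t - y) *\<^sub>R f1 y) \<le> A * (t - y)" using t by (simp add: algebra_simps)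
    also have "\<dots> \<le> A" using t A by (simp add: mult_left_le)
    finally have e: "cmod (f t - f y - (t - y) *\<^sub>R f1 y) \<le> A" .
    define P where "P = cmod ((t - y) *\<^sub>R f1 y)"
    have "P \<le> cmod (f t) + cmod (f y) + A"
      using e norm_triangle_ineq4[of "f t - f y" "f t - f y - (t - y) *\<^sub>R f1 y"] norm_triangle_ineq4[of "f t" "f y"]
      unfolding P_def by simp
    moreover have "1/2 * cmod (f1 y) \<le> P"
    proof -
      have "P = (t - y) * cmod (f1 y)" using t by (simp add: P_def)
      then show ?thesis using t by (simp only:) (intro mult_right_mono, auto)
    qed
    ultimately show ?thesis using ft by argo
  qed
  then show ?thesis by blast
qed

text \<open>A square integrable function need not tend to \<open>0\<close> at infinity, but it does along some
  sequence; the sequence can be chosen for two functions at once by applying this to the sum of their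
  squares.\<close>

lemma vanishing_sequence:
  assumes "square_integrable f" "square_integrable g"
  shows "\<exists>Y. (\<forall>n::nat. Y n \<ge> (1::real)) \<and> filterlim Y at_top sequentially \<and> (\<lambda>n. f (Y n)) \<longlonglongrightarrow> 0 \<and> (\<lambda>n. g (Y n)) \<longlonglongrightarrow> 0"
proof -
  define S where "S x = (cmod (f x))\<^sup>2 + (cmod (g x))\<^sup>2" for x
  have S: "integrable half_line S" using assms unfolding S_def by (auto simp: square_integrable_def)
  have S0: "\<And>x. S x \<ge> 0" by (simp add: S_def)
  have "\<exists>y\<ge>real n + 1. S y < 1 / (real n + 1)" for n
  proof (rule ccontr)
    assume "\<not> ?thesis"
    then have *: "\<And>y. y \<ge> real n + 1 \<Longrightarrow> 1 / (real n + 1) \<le> S y" by force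
    define m where "m = (real n + 1) * ((LINT x|half_line. S x) + 1)"
    have m: "m \<ge> 0" unfolding m_def using S0 by (intro mult_nonneg_nonneg add_nonneg_nonneg integral_nonneg_AE) auto
    have "1 / (real n + 1) * ((real n + 1 + m) - (real n + 1)) \<le> (LINT x|half_line. S x)"
      by (rule half_line_integral_ge[OF S S0]) (use m * in auto)
    then show False by (simp add: m_def)
  qed
  then obtain Y where Y: "\<And>n. Y n \<ge> real n + 1" "\<And>n. S (Y n) < 1 / (real n + 1)" by metis
  have lim: "filterlim Y at_top sequentially"
    by (rule filterlim_at_top_mono[OF filterlim_real_sequentially]) (intro always_eventually allI order_trans[OF _ Y(1)], simp)
  have "(\<lambda>n. 1 / (real n + 1)) \<longlonglongrightarrow> 0" using LIMSEQ_inverse_real_of_nat by (simp add: inverse_eq_divide add.commute)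
  then have "(\<lambda>n. S (Y n)) \<longlonglongrightarrow> 0"
    using S0 less_imp_le[OF Y(2)]
    by (intro tendsto_sandwich[of "\<lambda>_. 0" "\<lambda>n. S (Y n)" sequentially "\<lambda>n. 1 / (real n + 1)"] always_eventually allI tendsto_const)
  from tendsto_real_sqrt[OF this] have sS: "(\<lambda>n. sqrt (S (Y n))) \<longlonglongrightarrow> 0" by simp
  have "cmod (f x) \<le> sqrt (S x)" "cmod (g x) \<le> sqrt (S x)" for x by (auto simp: S_def intro: real_le_rsqrt)
  then have "(\<lambda>n. f (Y n)) \<longlonglongrightarrow> 0" "(\<lambda>n. g (Y n)) \<longlonglongrightarrow> 0"
    by (auto intro!: Lim_null_comparison[OF _ sS] always_eventually)
  moreover have "\<forall>n. Y n \<ge> 1" by (intro allI order_trans[OF _ Y(1)]) simp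
  ultimately show ?thesis using lim by blast
qed

lemma tendsto_mult_bounded_0:
  fixes f g :: "nat \<Rightarrow> complex"
  assumes f: "f \<longlonglongrightarrow> 0" and b: "\<And>n. cmod (g n) \<le> K + 2 * cmod (e n)" and e: "e \<longlonglongrightarrow> 0"
  shows "(\<lambda>n. g n * f n) \<longlonglongrightarrow> 0"
proof (rule Lim_null_comparison)
  show "eventually (\<lambda>n. norm (g n * f n) \<le> (K + 2 * cmod (e n)) * cmod (f n)) sequentially"
    by (intro always_eventually allI) (simp add: norm_mult mult_right_mono b)
  have "(\<lambda>n. (K + 2 * cmod (e n)) * cmod (f n)) \<longlonglongrightarrow> (K + 2 * cmod 0) * cmod 0"
    by (intro tendsto_intros f e)
  then show "(\<lambda>n. (K + 2 * cmod (e n)) * cmod (f n)) \<longlonglongrightarrow> 0" by simp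
qed

text \<open>Lagrange's identity is integrated over $[X_n, Y_n]$ with $X_n \to 0$ and $Y_n$ a sequence at infinity
  along which both functions vanish; there the derivatives stay bounded by \<open>deriv_bound\<close>,
  hence the bracket tends to \<open>0\<close>.\<close>

lemma green_identity:
  assumes \<nu>: "0 \<le> \<nu>" "\<nu> < 1" and f: "bessel_max \<nu> f f1 h" and g: "bessel_max \<nu> g g1 k"
    and L: "((\<lambda>x. f x * g1 x - f1 x * g x) \<longlongrightarrow> L) (at_right 0)"
  shows "(LINT x|half_line. h x * g x) - (LINT x|half_line. f x * k x) = - L"
proof -
  have sq: "square_integrable f" "square_integrable h" and fs: "bessel_sol \<nu> f f1 h" using f by (auto simp: bessel_max_def)
  have sq': "square_integrable g" "square_integrable k" and gs: "bessel_sol \<nu> g g1 k" using g by (auto simp: bessel_max_def)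
  have i: "integrable half_line (\<lambda>x. h x * g x)" "integrable half_line (\<lambda>x. f x * k x)"
    using sq sq' by (auto intro: square_integrable_mult)
  obtain Y where Y: "\<And>n::nat. Y n \<ge> (1::real)" "filterlim Y at_top sequentially" "(\<lambda>n. f (Y n)) \<longlonglongrightarrow> 0" "(\<lambda>n. g (Y n)) \<longlonglongrightarrow> 0"
    using vanishing_sequence[OF sq(1) sq'(1)] by auto
  obtain K where K: "\<And>y. y \<ge> 1 \<Longrightarrow> cmod (f1 y) \<le> K + 2 * cmod (f y)" using deriv_bound[OF \<nu> f] by blast
  obtain K' where K': "\<And>y. y \<ge> 1 \<Longrightarrow> cmod (g1 y) \<le> K' + 2 * cmod (g y)" using deriv_bound[OF \<nu> g] by blast
  let ?P = "\<lambda>x. f x * g1 x - f1 x * g x"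
  have "(\<lambda>n. g1 (Y n) * f (Y n)) \<longlonglongrightarrow> 0"
    by (rule tendsto_mult_bounded_0[OF Y(3) _ Y(4)]) (rule K'[OF Y(1)])
  from tendsto_diff[OF this] have "(\<lambda>n. g1 (Y n) * f (Y n) - f1 (Y n) * g (Y n)) \<longlonglongrightarrow> 0 - 0" if "(\<lambda>n. f1 (Y n) * g (Y n)) \<longlonglongrightarrow> 0"
    using that .
  moreover have "(\<lambda>n. f1 (Y n) * g (Y n)) \<longlonglongrightarrow> 0"
    by (rule tendsto_mult_bounded_0[OF Y(4) _ Y(3)]) (rule K[OF Y(1)])
  ultimately have PY: "(\<lambda>n. ?P (Y n)) \<longlonglongrightarrow> 0" by (simp add: mult.commute)
  define X where "X n = 1 / (real n + 1)" for n
  have X: "\<And>n. X n > 0" "X \<longlonglongrightarrow> 0"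
    using LIMSEQ_inverse_real_of_nat by (auto simp: X_def[abs_def] inverse_eq_divide add.commute)
  have "(?P \<circ> X) \<longlonglongrightarrow> L"
    using L X unfolding tendsto_at_iff_sequentially by simp
  then have PX: "(\<lambda>n. ?P (X n)) \<longlonglongrightarrow> L" by (simp add: o_def)
  have "(\<lambda>n. ?P (Y n) - ?P (X n)) \<longlonglongrightarrow> (LINT x|half_line. h x * g x - f x * k x)"
    by (rule primitive_tendsto_integral[OF lagrange_identity[OF fs gs] _ X Y(2)]) (use i in auto)
  moreover have "(\<lambda>n. ?P (Y n) - ?P (X n)) \<longlonglongrightarrow> 0 - L" by (intro tendsto_diff PY PX)
  ultimately have "(LINT x|half_line. h x * g x - f x * k x) = 0 - L" by (rule LIMSEQ_unique)
  then show ?thesis using i by simp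
qed


section \<open>Nonnegativity of the Bessel form\<close>

lemma inverse_sequence:
  defines "X \<equiv> \<lambda>n::nat. 1 / (real n + 1)"
  shows "\<And>n. X n > 0" "X \<longlonglongrightarrow> 0"
  using LIMSEQ_inverse_real_of_nat by (auto simp: X_def inverse_eq_divide add.commute)

lemma tendsto_at_right_0_sequence:
  fixes f :: "real \<Rightarrow> 'a::topological_space"
  assumes "(f \<longlongrightarrow> L) (at_right 0)" "\<And>n. X n > 0" "X \<longlonglongrightarrow> 0"
  shows "(\<lambda>n. f (X n)) \<longlonglongrightarrow> L"
proof -
  have "(f \<circ> X) \<longlonglongrightarrow> L"
    using assms unfolding tendsto_at_iff_sequentially by simp
  then show ?thesis by (simp add: o_def)
qed

text \<open>If $[f,u]_0 = 0$ then $[f,u]_x = \int_0^x h u$, which is at most $u(x)$ times $\sqrt x$ times a constant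
  by the Cauchy-Schwarz inequality.\<close>

lemma bracket_reg_small:
  assumes \<nu>: "0 \<le> \<nu>" "\<nu> < 1" and f: "bessel_max \<nu> f f1 h" and 0: "(bracket_reg \<nu> f f1 \<longlongrightarrow> 0) (at_right 0)"
  shows "\<exists>N\<ge>0. \<forall>x>0. cmod (bracket_reg \<nu> f f1 x) \<le> N * sqrt x * x powr (1/2 + \<nu>)"
proof -
  have sq: "square_integrable h" and sol: "bessel_sol \<nu> f f1 h" using f by (auto simp: bessel_max_def)
  have G: "integrable half_line (\<lambda>x. (cmod (h x))\<^sup>2)" using sq by (auto simp: square_integrable_def)
  define N where "N = (LINT x|half_line. (cmod (h x))\<^sup>2)"
  have N: "N \<ge> 0" unfolding N_def by (intro integral_nonneg_AE) auto
  have le: "cmod (bracket_reg \<nu> f f1 x - bracket_reg \<nu> f f1 a) \<le> (N + 1) * sqrt x * x powr (1/2 + \<nu>)"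
    if x: "0 < a" "a \<le> x" for a x
  proof -
    let ?u = "x powr (1/2 + \<nu>)"
    let ?p = "\<lambda>t. indicator {a..x} t *\<^sub>R (h t * bessel_regular \<nu> t)"
    let ?d = "\<lambda>t. ?u * (sqrt x * (cmod (h t))\<^sup>2 + 1 / sqrt x * indicator {a..x} t)"
    have dint: "integrable half_line ?d"
      using x by (intro integrable_mult_right Bochner_Integration.integrable_add G integrable_indicator_Icc)
    have le: "norm (?p t) \<le> ?d t" for t
    proof (cases "t \<in> {a..x}")
      case True
      \<comment> \<open>With \<open>s = sqrt x\<close> this gives the bound of Cauchy-Schwarz up to a constant.\<close>
      have r: "r \<le> s * r\<^sup>2 + 1 / s" if "s > 0" for r s :: real
      proof -
        have "0 \<le> (s * r - 1/2)\<^sup>2 + 3/4" by simp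
        then have "s * r \<le> (s * r)\<^sup>2 + 1" by (simp add: power2_eq_square algebra_simps)
        then have "r \<le> ((s * r)\<^sup>2 + 1) / s" using that by (simp add: field_simps)
        also have "\<dots> = s * r\<^sup>2 + 1 / s" using that by (simp add: power2_eq_square field_simps)
        finally show ?thesis .
      qed
      have "cmod (bessel_regular \<nu> t) \<le> ?u" using True x \<nu> by (auto simp: bessel_regular_def intro!: powr_mono2)
      then have "norm (?p t) \<le> cmod (h t) * ?u" using True by (simp add: norm_mult mult_left_mono)
      also have "\<dots> \<le> (sqrt x * (cmod (h t))\<^sup>2 + 1 / sqrt x) * ?u"
        using r[of "sqrt x" "cmod (h t)"] x by (intro mult_right_mono) auto
      finally show ?thesis using True by (simp add: mult.commute)
    next
      case False
      have "0 \<le> ?u * (sqrt x * (cmod (h t))\<^sup>2)" using x by simp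
      then show ?thesis using False by simp
    qed
    have pint: "integrable half_line ?p"
    proof (rule Bochner_Integration.integrable_bound[OF dint])
      show "?p \<in> borel_measurable half_line"
        using sq measurable_half_line_continuous[OF bessel_solD(3)[OF bessel_sol_regular]] x
        by (intro borel_measurable_scaleR borel_measurable_indicator borel_measurable_times) (auto simp: square_integrable_def)
      show "AE t in half_line. norm (?p t) \<le> norm (?d t)"
        using le order_trans[OF norm_ge_zero le] by (intro AE_I2) (simp only: real_norm_def abs_of_nonneg)
    qed
    have "bracket_reg \<nu> f f1 x - bracket_reg \<nu> f f1 a = (LINT t|half_line. ?p t)"
      using half_line_integral_Icc[OF x(1) pint primitiveD[OF primitive_bracket_reg[OF sol] x]] by simp
    also have "cmod \<dots> \<le> (LINT t|half_line. ?d t)"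
      by (rule order_trans[OF Bochner_Integration.integral_norm_bound]) (intro Bochner_Integration.integral_mono integrable_norm pint dint le)
    also have "\<dots> = ?u * (sqrt x * N + 1 / sqrt x * (x - a))"
      using G integrable_indicator_Icc[of a x] x unfolding N_def by simp
    also have "\<dots> \<le> ?u * (sqrt x * N + 1 / sqrt x * x)"
      using x by (intro mult_left_mono add_left_mono) auto
    also have "1 / sqrt x * x = sqrt x" using x by (simp add: real_div_sqrt)
    finally show ?thesis by (simp add: algebra_simps)
  qed
  have "cmod (bracket_reg \<nu> f f1 x) \<le> (N + 1) * sqrt x * x powr (1/2 + \<nu>)" if x: "x > 0" for x
  proof (rule tendsto_upperbound)
    have "((\<lambda>a. cmod (bracket_reg \<nu> f f1 x - bracket_reg \<nu> f f1 a)) \<longlongrightarrow> cmod (bracket_reg \<nu> f f1 x - 0)) (at_right 0)"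
      by (intro tendsto_intros 0)
    then show "((\<lambda>a. cmod (bracket_reg \<nu> f f1 x - bracket_reg \<nu> f f1 a)) \<longlongrightarrow> cmod (bracket_reg \<nu> f f1 x)) (at_right 0)" by simp
    have "eventually (\<lambda>a. 0 < a \<and> a < x) (at_right 0)"
      using x by (auto simp: eventually_at_right[OF zero_less_one] intro!: exI[of _ x])
    then show "eventually (\<lambda>a. cmod (bracket_reg \<nu> f f1 x - bracket_reg \<nu> f f1 a) \<le> (N + 1) * sqrt x * x powr (1/2 + \<nu>)) (at_right 0)"
      by eventually_elim (rule le, auto)
  qed auto
  then show ?thesis using N by (intro exI[of _ "N + 1"]) auto
qed

lemma bessel_max_bound_near_0:
  assumes \<nu>: "0 \<le> \<nu>" "\<nu> < 1" and f: "bessel_max \<nu> f f1 h"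
  shows "\<exists>C. eventually (\<lambda>x. cmod (f x) \<le> C * x powr sing_exp \<nu>) (at_right 0)"
proof -
  obtain l where l: "(bracket_reg \<nu> f f1 \<longlongrightarrow> l) (at_right 0)" using bracket_reg_converges[OF assms] by blast
  obtain m where m: "(bracket_sing \<nu> f f1 \<longlongrightarrow> m) (at_right 0)" using bracket_reg_converges[OF assms] by blast
  have "eventually (\<lambda>x. cmod (bracket_reg \<nu> f f1 x) < cmod l + 1) (at_right 0)"
    by (rule order_tendstoD(2)[OF tendsto_norm[OF l]]) simp
  moreover have "eventually (\<lambda>x. cmod (bracket_sing \<nu> f f1 x) < cmod m + 1) (at_right 0)"
    by (rule order_tendstoD(2)[OF tendsto_norm[OF m]]) simp
  moreover have "eventually (\<lambda>x::real. 0 < x \<and> x < 1) (at_right 0)"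
    by (auto simp: eventually_at_right[OF zero_less_one] intro!: exI[of _ 1])
  ultimately have "eventually (\<lambda>x. cmod (f x) \<le> (2 * (cmod l + 1) + (cmod m + 1)) / \<bar>kappa \<nu>\<bar> * x powr sing_exp \<nu>) (at_right 0)"
  proof eventually_elim
    case (elim x)
    then have x: "0 < x" "x \<le> 1" by auto
    have "\<bar>kappa \<nu>\<bar> * cmod (f x) = cmod (of_real (kappa \<nu>) * f x)" by (simp add: norm_mult)
    also have "\<dots> \<le> cmod (bessel_singular \<nu> x) * cmod (bracket_reg \<nu> f f1 x) + cmod (bessel_regular \<nu> x) * cmod (bracket_sing \<nu> f f1 x)"
      unfolding solution_from_brackets(1)[OF x(1), of \<nu> f f1] norm_mult[symmetric] by (rule norm_triangle_ineq4)
    also have "\<dots> \<le> (2 * x powr sing_exp \<nu>) * (cmod l + 1) + x powr sing_exp \<nu> * (cmod m + 1)"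
      using elim norm_singular_le[OF x, of \<nu>] norm_regular_le[OF x \<nu>(1)] by (intro add_mono mult_mono) auto
    finally show ?case by (simp add: field_simps)
  qed
  then show ?thesis by blast
qed

text \<open>Jacobi's factorization: with \<open>B = [f, u]\<close> one has $(\bar f/u)' = -\bar B/u^2$ and $B' = h
  u$, so that $h \bar f = |B|^2/u^2 + (B \bar f/u)'$. The boundary term $B \bar f/u$ vanishes at
  \<open>0\<close> because \<open>B\<close> is small there, and at infinity along a sequence.\<close>

lemma form_nonneg:
  assumes \<nu>: "0 \<le> \<nu>" "\<nu> < 1" and f: "bessel_max \<nu> f f1 h" and 0: "(bracket_reg \<nu> f f1 \<longlongrightarrow> 0) (at_right 0)"
  shows "0 \<le> Re (LINT x|half_line. h x * cnj (f x))"
proof -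
  have sq: "square_integrable f" "square_integrable h" and sol: "bessel_sol \<nu> f f1 h" using f by (auto simp: bessel_max_def)
  define B where "B = bracket_reg \<nu> f f1"
  define u where "u = bessel_regular \<nu>"
  define u1 where "u1 = regular_deriv \<nu>"
  have u0: "u x \<noteq> 0" if "x > 0" for x using that by (simp add: u_def bessel_regular_def)
  have cnju: "cnj (u x) = u x" "cnj (u1 x) = u1 x" for x by (auto simp: u_def u1_def bessel_regular_def regular_deriv_def)
  have Bp: "primitive B (\<lambda>x. h x * u x)" unfolding B_def u_def by (rule primitive_bracket_reg[OF sol])
  have Beq: "B x = f x * u1 x - f1 x * u x" for x by (simp add: B_def bracket_reg_def u_def u1_def)
  have cu: "continuous_on {0<..} u" unfolding u_def by (rule bessel_solD(3)[OF bessel_sol_regular])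
  have yd: "((\<lambda>x. cnj (f x) / u x) has_vector_derivative - (cnj (B x) / (u x)\<^sup>2)) (at x)" if x: "x > 0" for x
  proof -
    let ?c = "1/2 + \<nu>"
    have "((\<lambda>x. x powr (- ?c)) has_real_derivative - ?c * x powr (- ?c - 1)) (at x)"
      using x by (auto intro!: derivative_eq_intros)
    from has_vector_derivative_mult[OF has_vector_derivative_cnj[OF bessel_solD(1)[OF sol x]] has_vector_derivative_of_real[OF this]]
    have D: "((\<lambda>x. cnj (f x) * of_real (x powr (- ?c))) has_vector_derivative
       cnj (f x) * of_real (- ?c * x powr (- ?c - 1)) + cnj (f1 x) * of_real (x powr (- ?c))) (at x)" .
    have e: "\<nu> - 1/2 = ?c - 1" by simp
    have "x powr (- ?c - 1) = 1 / (x powr ?c * x)"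
    proof -
      have "- ?c - 1 = - (?c + 1)" by simp
      then have "x powr (- ?c - 1) = 1 / x powr (?c + 1)" by (simp only: powr_minus_divide)
      then show ?thesis using x by (simp only: powr_add powr_one)
    qed
    then have "cnj (f x) * of_real (- ?c * x powr (- ?c - 1)) + cnj (f1 x) * of_real (x powr (- ?c)) = - (cnj (B x) / (u x)\<^sup>2)"
      using x unfolding Beq u_def u1_def bessel_regular_def regular_deriv_def e powr_shift1[OF x] powr_minus_divide
      by (simp add: power2_eq_square field_simps)
    moreover have "(\<lambda>x. cnj (f x) * of_real (x powr (- ?c))) = (\<lambda>x. cnj (f x) / u x)"
      unfolding u_def bessel_regular_def powr_minus_divide by simp
    ultimately show ?thesis using D by simp
  qed
  have Rp: "primitive (\<lambda>x. B x * (cnj (f x) / u x)) (\<lambda>x. h x * u x * (cnj (f x) / u x) + B x * - (cnj (B x) / (u x)\<^sup>2))"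
    by (rule primitive_mult[OF Bp yd])
       (use u0 in \<open>auto intro!: continuous_intros primitive_continuous_on[OF Bp] cu\<close>)
  define R where "R x = B x * (cnj (f x) / u x)" for x
  have J: "Re (R b - R a) \<le> Re (LINT x|half_line. indicator {a..b} x *\<^sub>R (h x * cnj (f x)))" if ab: "0 < a" "a \<le> b" for a b
  proof -
    have i0: "integrable half_line (\<lambda>x. h x * cnj (f x))" by (rule square_integrable_mult_cnj[OF sq(2,1)])
    have i: "integrable half_line (\<lambda>x. indicator {a..b} x *\<^sub>R (h x * cnj (f x)))"
      by (rule integrable_mult_indicator[OF sets_half_line_Icc[OF ab(1)] i0])
    then have "(\<lambda>x. h x * cnj (f x)) absolutely_integrable_on {a..b}" using integrable_half_line_Icc[OF ab(1)] by blast
    then have hi: "((\<lambda>x. h x * cnj (f x)) has_integral integral {a..b} (\<lambda>x. h x * cnj (f x))) {a..b}"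
      using set_lebesgue_integral_eq_integral(1) by blast
    have eq: "(LINT x|half_line. indicator {a..b} x *\<^sub>R (h x * cnj (f x))) = integral {a..b} (\<lambda>x. h x * cnj (f x))"
      by (rule half_line_integral_Icc[OF ab(1) i hi])
    from has_integral_diff[OF hi primitiveD[OF Rp ab]]
    have "((\<lambda>x. complex_of_real ((cmod (B x))\<^sup>2 / (x powr (1/2 + \<nu>))\<^sup>2)) has_integral
       integral {a..b} (\<lambda>x. h x * cnj (f x)) - (R b - R a)) {a..b}"
      unfolding R_def
    proof (rule has_integral_eq[rotated])
      fix x assume "x \<in> {a..b}"
      then have x: "x > 0" using ab by auto
      show "h x * cnj (f x) - (h x * u x * (cnj (f x) / u x) + B x * - (cnj (B x) / (u x)\<^sup>2)) = complex_of_real ((cmod (B x))\<^sup>2 / (x powr (1/2 + \<nu>))\<^sup>2)"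
        using u0[OF x] complex_norm_square[of "B x"] by (simp add: u_def bessel_regular_def)
    qed
    from has_integral_linear[OF this bounded_linear_Re]
    have "((\<lambda>x. (cmod (B x))\<^sup>2 / (x powr (1/2 + \<nu>))\<^sup>2) has_integral
       Re (integral {a..b} (\<lambda>x. h x * cnj (f x)) - (R b - R a))) {a..b}" by (simp only: o_def Re_complex_of_real)
    from has_integral_nonneg[OF this] have "0 \<le> Re (integral {a..b} (\<lambda>x. h x * cnj (f x)) - (R b - R a))" by simp
    then show ?thesis unfolding eq by simp
  qed
  obtain N where N: "N \<ge> 0" "\<And>x. x > 0 \<Longrightarrow> cmod (B x) \<le> N * sqrt x * x powr (1/2 + \<nu>)"
    using bracket_reg_small[OF assms] unfolding B_def by blast
  obtain C where C: "eventually (\<lambda>x. cmod (f x) \<le> C * x powr sing_exp \<nu>) (at_right 0)"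
    using bessel_max_bound_near_0[OF \<nu> f] by blast
  \<comment> \<open>\<open>B / u\<close> is of the order of \<open>sqrt x\<close>, which outweighs the possible growth of \<open>f\<close> at \<open>0\<close>.\<close>
  have R0: "(R \<longlongrightarrow> 0) (at_right 0)"
  proof (rule Lim_null_comparison)
    have "eventually (\<lambda>x::real. 0 < x) (at_right 0)" by (simp add: eventually_at_right_less)
    with C show "eventually (\<lambda>x. norm (R x) \<le> N * C * x powr (1/2 + sing_exp \<nu>)) (at_right 0)"
    proof eventually_elim
      case (elim x)
      have "norm (R x) = cmod (B x) / x powr (1/2 + \<nu>) * cmod (f x)"
        by (simp add: R_def norm_mult norm_divide u_def bessel_regular_def)
      also have "\<dots> \<le> (N * sqrt x) * (C * x powr sing_exp \<nu>)"
        using N(2)[of x] N(1) elim by (intro mult_mono) (auto simp: divide_le_eq)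
      also have "\<dots> = N * C * x powr (1/2 + sing_exp \<nu>)" using elim by (simp add: powr_add powr_half_sqrt)
      finally show ?case .
    qed
    have "((\<lambda>x. x powr (1/2 + sing_exp \<nu>)) \<longlongrightarrow> 0) (at_right 0)"
    proof (rule tendsto_zero_powrI)
      show "((\<lambda>x. x) \<longlongrightarrow> (0::real)) (at_right 0)" by (rule tendsto_ident_at)
      show "((\<lambda>_. 1/2 + sing_exp \<nu>) \<longlongrightarrow> 1/2 + sing_exp \<nu>) (at_right 0)" by (rule tendsto_const)
      show "1/2 + sing_exp \<nu> > 0" using sing_exp_gt[OF \<nu>(2)] by simp
      show "eventually (\<lambda>x::real. 0 \<le> x) (at_right 0)" using eventually_at_right_less[of 0] by eventually_elim auto
    qed
    then show "((\<lambda>x. N * C * x powr (1/2 + sing_exp \<nu>)) \<longlongrightarrow> 0) (at_right 0)" by (rule tendsto_mult_right_zero)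
  qed
  obtain Y where Y: "\<And>n::nat. Y n \<ge> (1::real)" "filterlim Y at_top sequentially" "(\<lambda>n. f (Y n)) \<longlonglongrightarrow> 0"
    using vanishing_sequence[OF sq(1) sq(1)] by auto
  obtain K where K: "\<And>y. y \<ge> 1 \<Longrightarrow> cmod (f1 y) \<le> K + 2 * cmod (f y)" using deriv_bound[OF \<nu> f] by blast
  \<comment> \<open>Here \<open>B / u = (u' / u) f - f'\<close> is bounded while \<open>f\<close> tends to \<open>0\<close>.\<close>
  have RY: "(\<lambda>n. R (Y n)) \<longlonglongrightarrow> 0"
  proof (rule Lim_null_comparison)
    show "eventually (\<lambda>n. norm (R (Y n)) \<le> ((1/2 + \<nu>) * cmod (f (Y n)) + (K + 2 * cmod (f (Y n)))) * cmod (f (Y n))) sequentially"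
    proof (intro always_eventually allI)
      fix n
      let ?y = "Y n"
      have y: "?y > 0" "?y \<ge> 1" using Y(1)[of n] by auto
      have e: "\<nu> - 1/2 = (1/2 + \<nu>) - 1" by simp
      have "u1 ?y / u ?y = of_real ((1/2 + \<nu>) / ?y)"
        unfolding u_def u1_def regular_deriv_def bessel_regular_def e powr_shift1[OF y(1)] using y by simp
      then have "cmod (u1 ?y / u ?y) = (1/2 + \<nu>) / ?y" using \<nu> y by (simp only: norm_of_real) simp
      also have "\<dots> \<le> 1/2 + \<nu>" using \<nu> y by (simp add: divide_le_eq mult_left_le mult_le_cancel_left1)
      finally have le: "cmod (u1 ?y / u ?y) \<le> 1/2 + \<nu>" .
      have "B ?y / u ?y = (u1 ?y / u ?y) * f ?y - f1 ?y" using u0[OF y(1)] by (simp add: Beq field_simps)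
      then have "cmod (B ?y / u ?y) \<le> cmod (u1 ?y / u ?y) * cmod (f ?y) + cmod (f1 ?y)"
        by (metis norm_mult norm_triangle_ineq4)
      also have "\<dots> \<le> (1/2 + \<nu>) * cmod (f ?y) + (K + 2 * cmod (f ?y))"
        using le K[OF y(2)] by (intro add_mono mult_right_mono) auto
      finally have "cmod (B ?y / u ?y) * cmod (f ?y) \<le> ((1/2 + \<nu>) * cmod (f ?y) + (K + 2 * cmod (f ?y))) * cmod (f ?y)"
        by (rule mult_right_mono) simp
      then show "norm (R ?y) \<le> ((1/2 + \<nu>) * cmod (f ?y) + (K + 2 * cmod (f ?y))) * cmod (f ?y)"
        by (simp add: R_def norm_mult norm_divide)
    qed
    have "(\<lambda>n. ((1/2 + \<nu>) * cmod (f (Y n)) + (K + 2 * cmod (f (Y n)))) * cmod (f (Y n))) \<longlonglongrightarrow> ((1/2 + \<nu>) * cmod 0 + (K + 2 * cmod 0)) * cmod 0"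
      by (intro tendsto_intros Y(3))
    then show "(\<lambda>n. ((1/2 + \<nu>) * cmod (f (Y n)) + (K + 2 * cmod (f (Y n)))) * cmod (f (Y n))) \<longlonglongrightarrow> 0" by simp
  qed
  define X :: "nat \<Rightarrow> real" where "X n = 1 / (real n + 1)" for n
  have X: "\<And>n. X n > 0" "X \<longlonglongrightarrow> 0" using inverse_sequence unfolding X_def[abs_def] by auto
  have RX: "(\<lambda>n. R (X n)) \<longlonglongrightarrow> 0" by (rule tendsto_at_right_0_sequence[OF R0 X])
  have "(\<lambda>n. LINT x|half_line. indicator {X n..Y n} x *\<^sub>R (h x * cnj (f x))) \<longlonglongrightarrow> (LINT x|half_line. h x * cnj (f x))"
  proof (rule half_line_integral_exhaust)
    fix x :: real assume x: "x > 0"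
    have "eventually (\<lambda>n. X n < x) sequentially" using X(2) x by (rule order_tendstoD)
    moreover have "eventually (\<lambda>n. Y n \<ge> x) sequentially" using Y by (simp add: filterlim_at_top)
    ultimately show "eventually (\<lambda>n. x \<in> {X n..Y n}) sequentially" by eventually_elim auto
  qed (use X square_integrable_mult_cnj[OF sq(2,1)] in auto)
  then have lim: "(\<lambda>n. Re (LINT x|half_line. indicator {X n..Y n} x *\<^sub>R (h x * cnj (f x)))) \<longlonglongrightarrow> Re (LINT x|half_line. h x * cnj (f x))"
    by (rule tendsto_Re)
  have lim0: "(\<lambda>n. Re (R (Y n) - R (X n))) \<longlonglongrightarrow> Re (0 - 0)" by (intro tendsto_intros RX RY)
  have "X n \<le> Y n" for n using Y(1)[of n] by (simp add: X_def) (smt (verit) divide_le_eq_1 of_nat_0_le_iff)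
  then have "Re (0 - 0) \<le> Re (LINT x|half_line. h x * cnj (f x))"
    by (intro tendsto_le[OF _ lim lim0] always_eventually allI J X) simp
  then show ?thesis by simp
qed


section \<open>Inhomogeneous solutions and the lemma of du Bois-Reymond\<close>

lemma primitive_exists:
  assumes p: "\<And>a b. 0 < a \<Longrightarrow> p integrable_on {a..b}"
  shows "\<exists>P. primitive P p"
proof -
  define P where "P x = (if 1 \<le> x then integral {1..x} p else - integral {x..1} p)" for x
  have "(p has_integral P b - P a) {a..b}" if ab: "0 < a" "a \<le> b" for a b
  proof -
    have c: "integral {x..y} p + integral {y..z} p = integral {x..z} p" if "0 < x" "x \<le> y" "y \<le> z" for x y z
      using that p[of x z] by (intro Henstock_Kurzweil_Integration.integral_combine) auto
    have "integral {a..b} p = P b - P a"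
      using c[of a 1 b] c[of 1 a b] c[of a b 1] ab unfolding P_def by (cases "1 \<le> a"; cases "1 \<le> b") (auto simp: algebra_simps)
    then show ?thesis using p[OF ab(1), of b] by (metis integrable_integral)
  qed
  then show ?thesis by (auto simp: primitive_def)
qed

lemma primitive_exists_at:
  assumes p: "\<And>a b. 0 < a \<Longrightarrow> p integrable_on {a..b}"
  shows "\<exists>P. primitive P p \<and> P c = 0"
proof -
  obtain P where "primitive P p" using primitive_exists[OF p] by blast
  then have "primitive (\<lambda>x. P x - P c) p" by (simp add: primitive_def)
  then show ?thesis by (intro exI[of _ "\<lambda>x. P x - P c"]) auto
qed

lemma continuous_singular_regular:
  "continuous_on {0<..} (bessel_regular \<nu>)" "continuous_on {0<..} (regular_deriv \<nu>)"
  "continuous_on {0<..} (bessel_singular \<nu>)" "continuous_on {0<..} (singular_deriv \<nu>)"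
  using bessel_solD(3,4)[OF bessel_sol_regular] bessel_solD(3,4)[OF bessel_sol_singular] by auto

lemma variation_of_parameters:
  assumes U: "primitive U (\<lambda>x. bessel_regular \<nu> x * k x)" and V: "primitive V (\<lambda>x. bessel_singular \<nu> x * k x)"
  shows "bessel_sol \<nu> (\<lambda>x. (bessel_singular \<nu> x * U x - bessel_regular \<nu> x * V x) / of_real (kappa \<nu>))
     (\<lambda>x. (singular_deriv \<nu> x * U x - regular_deriv \<nu> x * V x) / of_real (kappa \<nu>)) k"
proof -
  let ?u = "bessel_regular \<nu>" and ?u1 = "regular_deriv \<nu>" and ?v = "bessel_singular \<nu>" and ?v1 = "singular_deriv \<nu>"
  let ?\<kappa> = "complex_of_real (kappa \<nu>)"
  note cont = continuous_singular_regular[of \<nu>] primitive_continuous_on[OF U] primitive_continuous_on[OF V]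
  have der: "(?u has_vector_derivative ?u1 x) (at x)" "(?v has_vector_derivative ?v1 x) (at x)" if "x > 0" for x
    using bessel_solD(1)[OF bessel_sol_regular that] bessel_solD(1)[OF bessel_sol_singular that] by auto
  have der1: "(?u1 has_vector_derivative bessel_q \<nu> x * ?u x) (at x)" "(?v1 has_vector_derivative bessel_q \<nu> x * ?v x) (at x)" if "x > 0" for x
    using primitive_continuous_has_vector_derivative[OF bessel_solD(2)[OF bessel_sol_regular] _ that]
      primitive_continuous_has_vector_derivative[OF bessel_solD(2)[OF bessel_sol_singular] _ that] cont continuous_on_bessel_q
    by (auto intro!: continuous_intros)
  have "primitive (\<lambda>x. inverse ?\<kappa> * (U x * ?v x - V x * ?u x))
      (\<lambda>x. inverse ?\<kappa> * ((?u x * k x * ?v x + U x * ?v1 x) - (?v x * k x * ?u x + V x * ?u1 x)))"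
    by (intro primitive_cmult primitive_diff primitive_mult[OF U der(2)] primitive_mult[OF V der(1)] cont)
  then have 1: "primitive (\<lambda>x. (?v x * U x - ?u x * V x) / ?\<kappa>) (\<lambda>x. (?v1 x * U x - ?u1 x * V x) / ?\<kappa>)"
    by (rule primitive_cong) (auto simp: field_simps)
  have "primitive (\<lambda>x. inverse ?\<kappa> * (U x * ?v1 x - V x * ?u1 x))
      (\<lambda>x. inverse ?\<kappa> * ((?u x * k x * ?v1 x + U x * (bessel_q \<nu> x * ?v x)) - (?v x * k x * ?u1 x + V x * (bessel_q \<nu> x * ?u x))))"
    by (intro primitive_cmult primitive_diff primitive_mult[OF U der1(2)] primitive_mult[OF V der1(1)] continuous_intros cont continuous_on_bessel_q)
  then have 2: "primitive (\<lambda>x. (?v1 x * U x - ?u1 x * V x) / ?\<kappa>) (\<lambda>x. bessel_q \<nu> x * ((?v x * U x - ?u x * V x) / ?\<kappa>) - k x)"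
  proof (rule primitive_cong)
    fix x :: real assume x: "x > 0"
    have W: "?v x * ?u1 x - ?v1 x * ?u x = ?\<kappa>" by (rule wronskian_singular_regular[OF x])
    have "?u x * k x * ?v1 x + U x * (bessel_q \<nu> x * ?v x) - (?v x * k x * ?u1 x + V x * (bessel_q \<nu> x * ?u x))
        = bessel_q \<nu> x * (?v x * U x - ?u x * V x) - k x * ?\<kappa>"
      unfolding W[symmetric] by (simp add: algebra_simps)
    then show "inverse ?\<kappa> * (?u x * k x * ?v1 x + U x * (bessel_q \<nu> x * ?v x) - (?v x * k x * ?u1 x + V x * (bessel_q \<nu> x * ?u x)))
       = bessel_q \<nu> x * ((?v x * U x - ?u x * V x) / ?\<kappa>) - k x"
      by (simp add: field_simps)
  qed (auto simp: field_simps)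
  have "((\<lambda>x. (?v x * U x - ?u x * V x) / ?\<kappa>) has_vector_derivative (?v1 x * U x - ?u1 x * V x) / ?\<kappa>) (at x)" if "x > 0" for x
    by (rule primitive_continuous_has_vector_derivative[OF 1 _ that]) (auto intro!: continuous_intros cont)
  then show ?thesis using 2 by (auto simp: bessel_sol_def)
qed

definition compact_cont :: "(real \<Rightarrow> complex) \<Rightarrow> bool" where
  "compact_cont \<psi> \<longleftrightarrow> continuous_on {0<..} \<psi> \<and> (\<exists>a b. 0 < a \<and> a < b \<and> (\<forall>x>0. x \<notin> {a..b} \<longrightarrow> \<psi> x = 0))"

lemma compact_cont_common:
  assumes "compact_cont \<psi>" "compact_cont \<phi>"
  shows "\<exists>a b. 0 < a \<and> a < b \<and> (\<forall>x>0. x \<notin> {a..b} \<longrightarrow> \<psi> x = 0 \<and> \<phi> x = 0)"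
proof -
  obtain a b c d where "0 < a" "a < b" "\<forall>x>0. x \<notin> {a..b} \<longrightarrow> \<psi> x = 0" "0 < c" "c < d" "\<forall>x>0. x \<notin> {c..d} \<longrightarrow> \<phi> x = 0"
    using assms unfolding compact_cont_def by blast
  then show ?thesis by (intro exI[of _ "min a c"] exI[of _ "max b d"]) auto
qed

lemma compact_cont_add: "compact_cont \<psi> \<Longrightarrow> compact_cont \<phi> \<Longrightarrow> compact_cont (\<lambda>x. \<psi> x + \<phi> x)"
  using compact_cont_common[of \<psi> \<phi>] unfolding compact_cont_def
  by (auto intro!: continuous_intros) (metis add_0)

lemma compact_cont_cmult: "compact_cont \<psi> \<Longrightarrow> compact_cont (\<lambda>x. c * \<psi> x)"
  unfolding compact_cont_def by (auto intro!: continuous_intros)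

lemma compact_cont_integrable:
  assumes \<psi>: "compact_cont \<psi>" and w: "\<And>a b. 0 < a \<Longrightarrow> w absolutely_integrable_on {a..b}"
  shows "integrable half_line (\<lambda>x. \<psi> x * w x)"
proof -
  obtain a b where ab: "0 < a" "a < b" "\<And>x. x > 0 \<Longrightarrow> x \<notin> {a..b} \<Longrightarrow> \<psi> x = 0" and c: "continuous_on {0<..} \<psi>"
    using \<psi> unfolding compact_cont_def by blast
  have i: "integrable half_line (\<lambda>x. indicator {a..b} x *\<^sub>R w x)" using w[OF ab(1)] integrable_half_line_Icc[OF ab(1)] by blast
  have "bounded (\<psi> ` {a..b})"
    using ab by (intro compact_imp_bounded compact_continuous_image continuous_on_subset[OF c]) auto
  then obtain M where M: "\<And>x. x \<in> {a..b} \<Longrightarrow> cmod (\<psi> x) \<le> M" unfolding bounded_iff ball_simps by blast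
  have "integrable half_line (\<lambda>x. \<psi> x * (indicator {a..b} x *\<^sub>R w x))"
  proof (rule Bochner_Integration.integrable_bound)
    show "integrable half_line (\<lambda>x. M * norm (indicator {a..b} x *\<^sub>R w x))" using i by (intro integrable_mult_right integrable_norm)
    show "(\<lambda>x. \<psi> x * (indicator {a..b} x *\<^sub>R w x)) \<in> borel_measurable half_line"
      using i by (intro borel_measurable_times measurable_half_line_continuous[OF c] borel_measurable_integrable)
    show "AE x in half_line. norm (\<psi> x * (indicator {a..b} x *\<^sub>R w x)) \<le> norm (M * norm (indicator {a..b} x *\<^sub>R w x))"
    proof (rule AE_I2)
      fix x show "norm (\<psi> x * (indicator {a..b} x *\<^sub>R w x)) \<le> norm (M * norm (indicator {a..b} x *\<^sub>R w x))"
        using M[of x] order_trans[OF norm_ge_zero M, of x] by (cases "x \<in> {a..b}") (auto simp: norm_mult intro!: mult_right_mono)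
    qed
  qed
  then show ?thesis
    by (rule Bochner_Integration.integrable_cong[THEN iffD1, rotated 2]) (use ab in \<open>auto simp: indicator_def\<close>)
qed

text \<open>The Henstock lemma shows directly that the integral of \<open>norm w\<close> over each interval
  vanishes: the approximating sums of \<open>norm w\<close> are sums of local errors of
  \<open>w\<close>. This avoids the differentiation theorem of Lebesgue.\<close>

lemma integrals_zero_imp_AE_zero:
  fixes w :: "real \<Rightarrow> complex"
  assumes w: "\<And>a b. 0 < a \<Longrightarrow> w absolutely_integrable_on {a..b}"
    and 0: "\<And>a b. 0 < a \<Longrightarrow> a \<le> b \<Longrightarrow> integral {a..b} w = 0"
  shows "AE x in half_line. w x = 0"
proof -
  have loc: "AE x in half_line. x \<in> {a..b} \<longrightarrow> w x = 0" if a: "0 < a" and ab: "a \<le> b" for a b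
  proof -
    have wi: "w integrable_on cbox a b" using w[OF a, of b] set_lebesgue_integral_eq_integral(1) by auto
    have "((\<lambda>x. norm (w x)) has_integral 0) {a..b}"
      unfolding has_integral_real
    proof (intro allI impI)
      fix e :: real assume "e > 0"
      then obtain \<gamma> where \<gamma>: "gauge \<gamma>" "\<And>r. \<lbrakk>r tagged_partial_division_of (cbox a b); \<gamma> fine r\<rbrakk> \<Longrightarrow>
             sum (\<lambda>(x,k). norm(measure lborel k *\<^sub>R w x - integral k w)) r < e"
        using Henstock_lemma[OF wi] by blast
      show "\<exists>\<gamma>. gauge \<gamma> \<and> (\<forall>\<D>. \<D> tagged_division_of {a..b} \<and> \<gamma> fine \<D> \<longrightarrow>
              norm ((\<Sum>(x,k)\<in>\<D>. measure lborel k *\<^sub>R norm (w x)) - 0) < e)"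
      proof (intro exI[of _ \<gamma>] conjI \<gamma>(1) allI impI, elim conjE)
        fix r assume r: "r tagged_division_of {a..b}" "\<gamma> fine r"
        have rp: "r tagged_partial_division_of cbox a b" using r by (auto simp: tagged_division_of_def)
        have "(\<Sum>(x,k)\<in>r. measure lborel k *\<^sub>R norm (w x)) = (\<Sum>(x,k)\<in>r. norm(measure lborel k *\<^sub>R w x - integral k w))"
        proof (intro sum.cong refl, clarify)
          fix x K assume xK: "(x, K) \<in> r"
          obtain u v where "K = {u..v}" "a \<le> u" "u \<le> x" "x \<le> v"
            using fine_tagged_interval[OF r xK] by metis
          then have "integral K w = 0" using 0[of u v] a by simp
          then show "measure lborel K *\<^sub>R norm (w x) = norm (measure lborel K *\<^sub>R w x - integral K w)" by simp
        qed
        also have "\<dots> < e" by (rule \<gamma>(2)[OF rp r(2)])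
        finally show "norm ((\<Sum>(x,k)\<in>r. measure lborel k *\<^sub>R norm (w x)) - 0) < e"
          by (simp add: sum_nonneg case_prod_unfold)
      qed
    qed
    then have "integral {a..b} (\<lambda>x. norm (w x)) = 0" by (rule integral_unique)
    moreover have ni: "(\<lambda>x. norm (w x)) absolutely_integrable_on {a..b}" using w[OF a] by (rule absolutely_integrable_norm[unfolded o_def])
    ultimately have z: "(LINT x|half_line. indicator {a..b} x *\<^sub>R norm (w x)) = 0"
    proof -
      have i: "integrable half_line (\<lambda>x. indicator {a..b} x *\<^sub>R norm (w x))"
      using ni by (simp only: integrable_half_line_Icc[OF a])
      have "(LINT x|half_line. indicator {a..b} x *\<^sub>R norm (w x)) = integral {0<..} (\<lambda>x. if x \<in> {a..b} then norm (w x) else 0)"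
        unfolding half_line_integral_eq[OF i] by (intro integral_cong) (auto simp: indicator_def)
      also have "\<dots> = integral {a..b} (\<lambda>x. norm (w x))"
        using a by (subst integral_restrict_Int) (auto intro!: arg_cong[where f="\<lambda>S. integral S (\<lambda>x. norm (w x))"])
      finally show ?thesis using \<open>integral {a..b} (\<lambda>x. norm (w x)) = 0\<close> by simp
    qed
    have i: "integrable half_line (\<lambda>x. indicator {a..b} x *\<^sub>R norm (w x))"
      using ni by (simp only: integrable_half_line_Icc[OF a])
    have "AE x in half_line. indicator {a..b} x *\<^sub>R norm (w x) = 0"
      using integral_nonneg_eq_0_iff_AE[OF i] z by (auto simp: indicator_def)
    then show ?thesis by eventually_elim auto
  qed
  have "AE x in half_line. \<forall>n::nat. x \<in> {1 / (real n + 1)..real n + 1} \<longrightarrow> w x = 0"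
    unfolding AE_all_countable
  proof (intro allI loc)
    fix n :: nat
    have "1 / (real n + 1) \<le> 1" by simp
    also have "1 \<le> real n + 1" by simp
    finally show "1 / (real n + 1) \<le> real n + 1" .
  qed simp
  moreover have "AE x in half_line. x > 0" by (rule AE_I2) simp
  ultimately show ?thesis
  proof eventually_elim
    case (elim x)
    obtain n where n: "max x (1 / x) \<le> real n" using real_arch_simple by blast
    then have "x \<le> real n" "1 / x \<le> real n" by auto
    then have "x \<in> {1 / (real n + 1)..real n + 1}" using elim(2) by (auto simp: field_simps)
    then show ?case using elim(1) by blast
  qed
qed

lemma compact_cont_orthogonal_imp_zero:
  assumes w: "\<And>a b. 0 < a \<Longrightarrow> w absolutely_integrable_on {a..b}"
    and 0: "\<And>\<psi>. compact_cont \<psi> \<Longrightarrow> (LINT x|half_line. \<psi> x * w x) = 0"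
  shows "AE x in half_line. w x = 0"
proof (rule integrals_zero_imp_AE_zero[OF w])
  fix a b :: real assume a: "0 < a" and ab: "a \<le> b"
  show "integral {a..b} w = 0"
  proof (cases "a = b")
    case False
    then have ab: "a < b" using ab by simp
    \<comment> \<open>A bump with values in \<open>[0, 1]\<close>; the test functions \<open>1 - (1 - \<theta>) ^ n\<close> increase to the indicator of the open interval.\<close>
    define \<theta> where "\<theta> x = max 0 ((x - a) * (b - x) / (b - a)\<^sup>2)" for x
    have \<theta>01: "0 \<le> \<theta> x" "\<theta> x \<le> 1" for x
    proof -
      have "(x - a) * (b - x) \<le> (b - a)\<^sup>2"
        using zero_le_power2[of "(x - a) - (b - x)"] zero_le_power2[of "b - a"] by (simp add: power2_eq_square algebra_simps)
      then show "\<theta> x \<le> 1" using ab by (auto simp: \<theta>_def divide_le_eq)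
    qed (simp add: \<theta>_def)
    have \<theta>pos: "\<theta> x > 0" if "x \<in> {a<..<b}" for x using that by (auto simp: \<theta>_def)
    have \<theta>zero: "\<theta> x = 0" if "x \<notin> {a<..<b}" for x
    proof -
      have "(x - a) * (b - x) \<le> 0" using that ab by (auto simp: mult_le_0_iff not_less)
      then have "(x - a) * (b - x) / (b - a)\<^sup>2 \<le> 0" by (rule divide_nonpos_nonneg) simp
      then show ?thesis unfolding \<theta>_def by (rule max_absorb1)
    qed
    define \<psi> where "\<psi> n x = complex_of_real (1 - (1 - \<theta> x) ^ n)" for n x
    have "compact_cont (\<psi> n)" for n
      unfolding compact_cont_def
    proof (intro conjI exI allI impI)
      show "continuous_on {0<..} (\<psi> n)" unfolding \<psi>_def \<theta>_def using ab by (intro continuous_intros) auto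
      show "\<psi> n x = 0" if "x \<notin> {a..b}" for x using \<theta>zero[of x] that by (auto simp: \<psi>_def)
    qed (use a ab in auto)
    then have z: "(LINT x|half_line. \<psi> n x * w x) = 0" for n by (rule 0)
    have i: "integrable half_line (\<lambda>x. indicator {a..b} x *\<^sub>R w x)" using w[OF a] integrable_half_line_Icc[OF a] by blast
    have "(\<lambda>n. LINT x|half_line. \<psi> n x * w x) \<longlonglongrightarrow> (LINT x|half_line. indicator {a<..<b} x *\<^sub>R w x)"
    proof (rule integral_dominated_convergence[where w = "\<lambda>x. norm (indicator {a..b} x *\<^sub>R w x)"])
      have eq: "(\<lambda>x. \<psi> n x * w x) = (\<lambda>x. \<psi> n x * (indicator {a..b} x *\<^sub>R w x))" for n
        using \<theta>zero by (auto simp: \<psi>_def indicator_def fun_eq_iff)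
      have c: "continuous_on {0<..} (\<psi> n)" for n unfolding \<psi>_def \<theta>_def using ab by (intro continuous_intros) auto
      show "(\<lambda>x. \<psi> n x * w x) \<in> borel_measurable half_line" for n
        unfolding eq using i by (intro borel_measurable_times measurable_half_line_continuous[OF c] borel_measurable_integrable)
      have eq2: "(\<lambda>x. indicator {a<..<b} x *\<^sub>R w x) = (\<lambda>x. indicator {a<..<b} x *\<^sub>R (indicator {a..b} x *\<^sub>R w x))"
        by (auto simp: indicator_def fun_eq_iff)
      show "(\<lambda>x. indicator {a<..<b} x *\<^sub>R w x) \<in> borel_measurable half_line"
        unfolding eq2 using i a by (intro borel_measurable_scaleR borel_measurable_indicator borel_measurable_integrable)
          (auto simp: sets_restrict_space_iff)
      show "AE x in half_line. (\<lambda>n. \<psi> n x * w x) \<longlonglongrightarrow> indicator {a<..<b} x *\<^sub>R w x"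
      proof (rule AE_I2)
        fix x
        show "(\<lambda>n. \<psi> n x * w x) \<longlonglongrightarrow> indicator {a<..<b} x *\<^sub>R w x"
        proof (cases "x \<in> {a<..<b}")
          case True
          have "norm (1 - \<theta> x) < 1" using \<theta>pos[OF True] \<theta>01[of x] unfolding real_norm_def by arith
          then have P: "(\<lambda>n. (1 - \<theta> x) ^ n) \<longlonglongrightarrow> 0" by (rule LIMSEQ_power_zero)
          have "(\<lambda>n. \<psi> n x * w x) \<longlonglongrightarrow> of_real (1 - 0) * w x"
            unfolding \<psi>_def by (intro tendsto_mult tendsto_of_real tendsto_diff tendsto_const P)
          then show ?thesis using True by simp
        next
          case False then show ?thesis using \<theta>zero[OF False] by (simp add: \<psi>_def)
        qed
      qed
      show "AE x in half_line. norm (\<psi> n x * w x) \<le> norm (indicator {a..b} x *\<^sub>R w x)" for n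
      proof (rule AE_I2)
        fix x
        have "(1 - \<theta> x) ^ n \<le> 1" "0 \<le> (1 - \<theta> x) ^ n" using \<theta>01[of x] by (auto intro: power_le_one)
        then have "norm (\<psi> n x) \<le> 1" unfolding \<psi>_def norm_of_real by simp
        moreover have "x \<notin> {a..b} \<Longrightarrow> \<psi> n x = 0" using \<theta>zero[of x] by (auto simp: \<psi>_def)
        ultimately show "norm (\<psi> n x * w x) \<le> norm (indicator {a..b} x *\<^sub>R w x)"
          by (cases "x \<in> {a..b}") (auto simp: norm_mult mult_left_le_one_le)
      qed
    qed (rule integrable_norm[OF i])
    then have lim: "(LINT x|half_line. indicator {a<..<b} x *\<^sub>R w x) = 0" unfolding z by (simp add: LIMSEQ_const_iff)
    have wi: "w integrable_on {a..b}" using w[OF a, of b] set_lebesgue_integral_eq_integral(1) by auto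
    have "integral {a..b} w = (LINT x|half_line. indicator {a..b} x *\<^sub>R w x)"
      using half_line_integral_Icc[OF a i] wi by (metis integrable_integral)
    also have "\<dots> = (LINT x|half_line. indicator {a<..<b} x *\<^sub>R w x)"
    proof (rule integral_cong_AE)
      have "AE x in half_line. x \<notin> {a, b}"
      proof -
        have "{a, b} \<in> null_sets half_line" using a ab
          by (auto simp: null_sets_restrict_space)
        then show ?thesis by (rule AE_not_in)
      qed
      then show "AE x in half_line. indicator {a..b} x *\<^sub>R w x = indicator {a<..<b} x *\<^sub>R w x"
        by eventually_elim (auto simp: indicator_def)
      have eq2: "(\<lambda>x. indicator {a<..<b} x *\<^sub>R w x) = (\<lambda>x. indicator {a<..<b} x *\<^sub>R (indicator {a..b} x *\<^sub>R w x))"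
        by (auto simp: indicator_def fun_eq_iff)
      show "(\<lambda>x. indicator {a<..<b} x *\<^sub>R w x) \<in> borel_measurable half_line"
        unfolding eq2 using i a by (intro borel_measurable_scaleR borel_measurable_indicator borel_measurable_integrable)
          (auto simp: sets_restrict_space_iff)
    qed (rule borel_measurable_integrable[OF i])
    finally show ?thesis using lim by simp
  qed simp
qed

text \<open>The space of test functions is only a set of functions, so linearity is expressed through one operation
  \<open>comb c x y\<close>, to be read as \<open>x + c y\<close>.\<close>

lemma functional_multiple:
  fixes L l :: "'v \<Rightarrow> complex" and comb :: "complex \<Rightarrow> 'v \<Rightarrow> 'v \<Rightarrow> 'v"
  assumes V: "\<And>c x y. x \<in> V \<Longrightarrow> y \<in> V \<Longrightarrow> comb c x y \<in> V"
    and L: "\<And>c x y. x \<in> V \<Longrightarrow> y \<in> V \<Longrightarrow> L (comb c x y) = L x + c * L y"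
    and l: "\<And>c x y. x \<in> V \<Longrightarrow> y \<in> V \<Longrightarrow> l (comb c x y) = l x + c * l y"
    and ker: "\<And>x. x \<in> V \<Longrightarrow> l x = 0 \<Longrightarrow> L x = 0"
  shows "\<exists>c. \<forall>x\<in>V. L x = c * l x"
proof (cases "\<exists>y\<in>V. l y \<noteq> 0")
  case True
  then obtain y where y: "y \<in> V" "l y \<noteq> 0" by blast
  have "L x = L y / l y * l x" if x: "x \<in> V" for x
  proof -
    have "L (comb (- (l x / l y)) x y) = 0"
      using x y by (intro ker V) (auto simp: l)
    then show ?thesis using x y by (simp add: L field_simps)
  qed
  then show ?thesis by blast
next
  case False then show ?thesis using ker by auto
qed

lemma functional_combination:
  fixes L l m :: "'v \<Rightarrow> complex" and comb :: "complex \<Rightarrow> 'v \<Rightarrow> 'v \<Rightarrow> 'v"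
  assumes V: "\<And>c x y. x \<in> V \<Longrightarrow> y \<in> V \<Longrightarrow> comb c x y \<in> V"
    and L: "\<And>c x y. x \<in> V \<Longrightarrow> y \<in> V \<Longrightarrow> L (comb c x y) = L x + c * L y"
    and l: "\<And>c x y. x \<in> V \<Longrightarrow> y \<in> V \<Longrightarrow> l (comb c x y) = l x + c * l y"
    and m: "\<And>c x y. x \<in> V \<Longrightarrow> y \<in> V \<Longrightarrow> m (comb c x y) = m x + c * m y"
    and ker: "\<And>x. x \<in> V \<Longrightarrow> l x = 0 \<Longrightarrow> m x = 0 \<Longrightarrow> L x = 0"
  shows "\<exists>c d. \<forall>x\<in>V. L x = c * l x + d * m x"
proof -
  have "\<exists>c. \<forall>x\<in>{x \<in> V. m x = 0}. L x = c * l x"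
    by (rule functional_multiple[of _ comb]) (use assms in auto)
  then obtain c where c: "\<And>x. x \<in> V \<Longrightarrow> m x = 0 \<Longrightarrow> L x = c * l x" by blast
  have "\<exists>d. \<forall>x\<in>V. L x - c * l x = d * m x"
    by (rule functional_multiple[of _ comb]) (use V L l m c in \<open>auto simp: algebra_simps\<close>)
  then obtain d where "\<forall>x\<in>V. L x - c * l x = d * m x" by blast
  then show ?thesis by (intro exI[of _ c] exI[of _ d]) (auto simp: algebra_simps)
qed

text \<open>A functional that vanishes on the common kernel of two others is a linear combination of them; here the
  functionals are integration against \<open>w\<close> and against the two solutions.\<close>

lemma dubois_reymond:
  assumes w: "\<And>a b. 0 < a \<Longrightarrow> w absolutely_integrable_on {a..b}"
    and 0: "\<And>\<psi>. compact_cont \<psi> \<Longrightarrow> (LINT x|half_line. \<psi> x * bessel_regular \<nu> x) = 0 \<Longrightarrow>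
        (LINT x|half_line. \<psi> x * bessel_singular \<nu> x) = 0 \<Longrightarrow> (LINT x|half_line. \<psi> x * w x) = 0"
  shows "\<exists>c d. AE x in half_line. w x = c * bessel_regular \<nu> x + d * bessel_singular \<nu> x"
proof -
  let ?u = "bessel_regular \<nu>" and ?v = "bessel_singular \<nu>"
  have cont: "\<And>a b. 0 < a \<Longrightarrow> g absolutely_integrable_on {a..b}" if "continuous_on {0<..} g" for g :: "real \<Rightarrow> complex"
    by (rule absolutely_integrable_continuous_real, rule continuous_on_subset[OF that]) auto
  note u = cont[OF continuous_singular_regular(1)[of \<nu>]] and v = cont[OF continuous_singular_regular(3)[of \<nu>]]
  define I where "I g \<psi> = (LINT x|half_line. \<psi> x * g x)" for g \<psi> :: "real \<Rightarrow> complex"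
  have lin: "I g (\<lambda>t. x t + c * y t) = I g x + c * I g y"
    if "compact_cont x" "compact_cont y" "\<And>a b. 0 < a \<Longrightarrow> g absolutely_integrable_on {a..b}" for g x y c
    using compact_cont_integrable[OF that(1,3)] compact_cont_integrable[OF that(2,3)]
    by (simp add: I_def distrib_right mult.assoc)
  have "\<exists>c d. \<forall>\<psi>\<in>Collect compact_cont. I w \<psi> = c * I ?u \<psi> + d * I ?v \<psi>"
  proof (rule functional_combination[where comb = "\<lambda>c x y t. x t + c * y t"])
    show "(\<lambda>t. x t + c * y t) \<in> Collect compact_cont" if "x \<in> Collect compact_cont" "y \<in> Collect compact_cont" for c x y
      using that by (auto intro: compact_cont_add compact_cont_cmult)
    show "I w x = 0" if "x \<in> Collect compact_cont" "I ?u x = 0" "I ?v x = 0" for x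
      using 0[of x] that by (simp add: I_def)
    show "I w (\<lambda>t. x t + c * y t) = I w x + c * I w y" "I ?u (\<lambda>t. x t + c * y t) = I ?u x + c * I ?u y"
      "I ?v (\<lambda>t. x t + c * y t) = I ?v x + c * I ?v y" if "x \<in> Collect compact_cont" "y \<in> Collect compact_cont" for c x y
      using that by (auto intro!: lin u v w)
  qed
  then obtain c d where cd: "\<And>\<psi>. compact_cont \<psi> \<Longrightarrow> I w \<psi> = c * I ?u \<psi> + d * I ?v \<psi>" by auto
  have "AE x in half_line. w x - (c * ?u x + d * ?v x) = 0"
  proof (rule compact_cont_orthogonal_imp_zero)
    show "(\<lambda>x. w x - (c * ?u x + d * ?v x)) absolutely_integrable_on {a..b}" if "0 < a" for a b
      by (intro set_integral_diff(1) w cont that continuous_intros continuous_singular_regular)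
    fix \<psi> assume \<psi>: "compact_cont \<psi>"
    note i = compact_cont_integrable[OF \<psi> w] compact_cont_integrable[OF \<psi> u] compact_cont_integrable[OF \<psi> v]
    have "(LINT x|half_line. \<psi> x * (w x - (c * ?u x + d * ?v x))) = (LINT x|half_line. \<psi> x * w x - (c * (\<psi> x * ?u x) + d * (\<psi> x * ?v x)))"
      by (simp add: algebra_simps)
    also have "\<dots> = I w \<psi> - (c * I ?u \<psi> + d * I ?v \<psi>)" using i by (simp add: I_def)
    finally show "(LINT x|half_line. \<psi> x * (w x - (c * ?u x + d * ?v x))) = 0" using cd[OF \<psi>] by simp
  qed
  then have "AE x in half_line. w x = c * ?u x + d * ?v x" by eventually_elim simp
  then show ?thesis by blast
qed


section \<open>Orthogonal complements and resolvents\<close>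

lemma cinner_scaleC_right: "cinner (x::'a::complex_inner) (c *\<^sub>C y) = cnj c * cinner x y"
  by (metis cinner_commute cinner_scaleC_left complex_cnj_mult)

lemma scaleC_minus1: "(-1) *\<^sub>C (x::'a::complex_inner) = - x"
  using scaleC_of_real[of "-1" x] by simp

lemma scaleC_zero_left [simp]: "0 *\<^sub>C (x::'a::complex_inner) = 0"
  using scaleC_of_real[of 0 x] by simp

lemma scaleC_zero_right [simp]: "c *\<^sub>C (0::'a::complex_inner) = 0"
  using scaleC_add_right[of c "0::'a" 0] by simp

lemma scaleC_minus_right: "c *\<^sub>C (- x::'a::complex_inner) = - (c *\<^sub>C x)"
  by (metis scaleC_minus1 scaleC_scaleC mult.commute)

lemma scaleC_diff_right: "c *\<^sub>C (x - y::'a::complex_inner) = c *\<^sub>C x - c *\<^sub>C y"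
  using scaleC_add_right[of c x "- y"] by (simp add: scaleC_minus_right)

lemma cinner_zero_left [simp]: "cinner 0 (x::'a::complex_inner) = 0"
  using cinner_scaleC_left[of 0 0 x] by simp

lemma cinner_minus_left: "cinner (- x::'a::complex_inner) y = - cinner x y"
  using cinner_scaleC_left[of "-1" x y] by (simp add: scaleC_minus1)

lemma cinner_diff_left: "cinner (x - y::'a::complex_inner) z = cinner x z - cinner y z"
  using cinner_add_left[of x "- y" z] by (simp add: cinner_minus_left)

lemma cinner_eq_Complex: "cinner (x::'a::complex_inner) y = Complex (inner x y) (inner x (\<i> *\<^sub>C y))"
proof (rule complex_eqI)
  have "Re (cinner x (\<i> *\<^sub>C y)) = Im (cinner x y)" by (simp add: cinner_scaleC_right)
  then show "Im (cinner x y) = Im (Complex (inner x y) (inner x (\<i> *\<^sub>C y)))" by (simp add: Re_cinner)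
qed (simp add: Re_cinner)

lemma cinner_self: "cinner (x::'a::complex_inner) x = of_real ((norm x)\<^sup>2)"
proof (rule complex_eqI)
  show "Re (cinner x x) = Re (of_real ((norm x)\<^sup>2))" by (simp add: Re_cinner power2_norm_eq_inner)
  have "cinner x x = cnj (cinner x x)" by (rule cinner_commute)
  then have "Im (cinner x x) = - Im (cinner x x)" by (metis cnj.simps(2))
  then show "Im (cinner x x) = Im (of_real ((norm x)\<^sup>2))" by (simp del: of_real_power)
qed

lemma norm_scaleC: "norm (c *\<^sub>C (x::'a::complex_inner)) = cmod c * norm x"
proof -
  have "complex_of_real ((norm (c *\<^sub>C x))\<^sup>2) = (c * cnj c) * of_real ((norm x)\<^sup>2)"
    unfolding cinner_self[symmetric] by (simp add: cinner_scaleC_left cinner_scaleC_right)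
  also have "c * cnj c = of_real ((cmod c)\<^sup>2)" by (simp add: complex_norm_square del: of_real_power)
  finally have "complex_of_real ((norm (c *\<^sub>C x))\<^sup>2) = of_real ((cmod c * norm x)\<^sup>2)"
    by (simp only: power_mult_distrib of_real_mult)
  then have "(norm (c *\<^sub>C x))\<^sup>2 = (cmod c * norm x)\<^sup>2" by (simp only: of_real_eq_iff)
  then show ?thesis by (simp add: power2_eq_iff_nonneg)
qed

text \<open>The constant \<open>2\<close> arises from estimating the real and imaginary parts separately.\<close>

lemma cinner_norm_le: "cmod (cinner (x::'a::complex_inner) y) \<le> 2 * (norm x * norm y)"
proof -
  have "cmod (cinner x y) \<le> \<bar>inner x y\<bar> + \<bar>inner x (\<i> *\<^sub>C y)\<bar>"
    unfolding cinner_eq_Complex using cmod_le[of "Complex (inner x y) (inner x (\<i> *\<^sub>C y))"] by simp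
  also have "\<dots> \<le> norm x * norm y + norm x * norm y"
    using Cauchy_Schwarz_ineq2[of x y] Cauchy_Schwarz_ineq2[of x "\<i> *\<^sub>C y"] by (simp add: norm_scaleC)
  finally show ?thesis by simp
qed

lemma continuous_on_cinner_left [continuous_intros]:
  "continuous_on S f \<Longrightarrow> continuous_on S (\<lambda>x. cinner (f x) (y::'a::complex_inner))"
  unfolding cinner_eq_Complex complex_eq by (intro continuous_intros)

lemma scaleC_scaleR: "c *\<^sub>C (r *\<^sub>R x) = r *\<^sub>R (c *\<^sub>C (x::'a::complex_inner))"
  unfolding scaleC_of_real[symmetric] scaleC_scaleC by (simp only: mult.commute)

lemma bounded_linear_scaleC: "bounded_linear (\<lambda>x::'a::complex_inner. c *\<^sub>C x)"
proof (rule bounded_linear_intro[where K = "cmod c"])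
  show "c *\<^sub>C (x + y) = c *\<^sub>C x + c *\<^sub>C y" for x y :: 'a by (rule scaleC_add_right)
  show "c *\<^sub>C (r *\<^sub>R x) = r *\<^sub>R (c *\<^sub>C x)" for r and x :: 'a
    by (rule scaleC_scaleR)
qed (simp add: norm_scaleC mult.commute)

lemma continuous_on_cinner_right [continuous_intros]:
  assumes "continuous_on S f" shows "continuous_on S (\<lambda>x. cinner (y::'a::complex_inner) (f x))"
proof -
  have "continuous_on S (\<lambda>x. cnj (cinner (f x) y))" using assms by (intro continuous_intros)
  then show ?thesis by (simp flip: cinner_commute)
qed

lemma adjoint_closed: "closed (adjoint_operator (T :: ('a::complex_inner \<times> 'a) set))"
proof -
  have "closed {p :: 'a \<times> 'a. cinner f' (fst p) = cinner f (snd p)}" for f f' :: 'a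
    by (intro closed_Collect_eq continuous_intros)
  moreover have "adjoint_operator T = (\<Inter>(f, f')\<in>T. {p. cinner f' (fst p) = cinner f (snd p)})"
    by (auto simp: adjoint_operator_def)
  ultimately show ?thesis by (auto intro!: closed_INT)
qed

lemma adjoint_closure: "adjoint_operator (closure T) = adjoint_operator (T :: ('a::complex_inner \<times> 'a) set)"
proof
  show "adjoint_operator (closure T) \<subseteq> adjoint_operator T"
    unfolding adjoint_operator_def using closure_subset[of T] by auto
  show "adjoint_operator T \<subseteq> adjoint_operator (closure T)"
  proof clarify
    fix g g' assume "(g, g') \<in> adjoint_operator T"
    then have "T \<subseteq> {p. cinner (snd p) g = cinner (fst p) g'}" by (auto simp: adjoint_operator_def)
    moreover have "closed {p :: 'a \<times> 'a. cinner (snd p) g = cinner (fst p) g'}"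
      by (intro closed_Collect_eq continuous_intros)
    ultimately have "closure T \<subseteq> {p. cinner (snd p) g = cinner (fst p) g'}" by (rule closure_minimal)
    then show "(g, g') \<in> adjoint_operator (closure T)" by (auto simp: adjoint_operator_def)
  qed
qed

text \<open>The projection theorem, by a minimizing sequence for the distance from a point outside the subspace.\<close>

lemma exists_orthogonal_vector:
  fixes V :: "'a::{real_inner, complete_space} set"
  assumes V: "subspace V" "closed V" "V \<noteq> UNIV"
  shows "\<exists>y. y \<noteq> 0 \<and> (\<forall>v\<in>V. inner v y = 0)"
proof -
  obtain x where x: "x \<notin> V" using V(3) by auto
  define d where "d = Inf ((\<lambda>v. (norm (x - v))\<^sup>2) ` V)"
  have ne: "V \<noteq> {}" using subspace_0[OF V(1)] by auto
  have bdd: "bdd_below ((\<lambda>v. (norm (x - v))\<^sup>2) ` V)" by (rule bdd_belowI[of _ 0]) auto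
  have d: "d \<le> (norm (x - v))\<^sup>2" if "v \<in> V" for v unfolding d_def using that bdd by (intro cInf_lower) auto
  have "\<exists>v\<in>V. (norm (x - v))\<^sup>2 < d + 1 / (real n + 1)" for n
  proof -
    have "Inf ((\<lambda>v. (norm (x - v))\<^sup>2) ` V) < d + 1 / (real n + 1)" by (simp add: d_def)
    from cInf_lessD[OF _ this] show ?thesis using ne by auto
  qed
  then obtain v where v: "\<And>n. v n \<in> V" "\<And>n. (norm (x - v n))\<^sup>2 < d + 1 / (real n + 1)" by metis
  \<comment> \<open>The parallelogram law makes nearly minimizing vectors close to each other.\<close>
  have par: "(norm (a - b))\<^sup>2 \<le> 2 * ((norm (x - a))\<^sup>2 - d) + 2 * ((norm (x - b))\<^sup>2 - d)" if "a \<in> V" "b \<in> V" for a b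
  proof -
    have "(1/2) *\<^sub>R (a + b) \<in> V" using that V(1) by (intro subspace_scale subspace_add)
    from d[OF this] have "4 * d \<le> 4 * (norm (x - (1/2) *\<^sub>R (a + b)))\<^sup>2" by simp
    also have "\<dots> = (norm (2 *\<^sub>R (x - (1/2) *\<^sub>R (a + b))))\<^sup>2" by (simp add: power_mult_distrib)
    also have "2 *\<^sub>R (x - (1/2) *\<^sub>R (a + b)) = (x - a) + (x - b)" by (simp add: scaleR_2 algebra_simps)
    finally have 1: "4 * d \<le> (norm ((x - a) + (x - b)))\<^sup>2" .
    have "(norm ((x - a) + (x - b)))\<^sup>2 + (norm ((x - a) - (x - b)))\<^sup>2 = 2 * (norm (x - a))\<^sup>2 + 2 * (norm (x - b))\<^sup>2"
      unfolding power2_norm_eq_inner by (simp add: inner_add_left inner_add_right inner_diff_left inner_diff_right inner_commute)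
    moreover have "(x - a) - (x - b) = b - a" by simp
    ultimately show ?thesis using 1 by (simp add: norm_minus_commute)
  qed
  have "Cauchy v"
  proof (rule metric_CauchyI)
    fix e :: real assume e: "e > 0"
    obtain N :: nat where N: "4 / e\<^sup>2 < real N" using reals_Archimedean2 by blast
    show "\<exists>M. \<forall>m\<ge>M. \<forall>n\<ge>M. dist (v m) (v n) < e"
    proof (intro exI[of _ N] allI impI)
      fix m n assume mn: "m \<ge> N" "n \<ge> N"
      have le: "1 / (real m + 1) \<le> 1 / (real N + 1)" "1 / (real n + 1) \<le> 1 / (real N + 1)" using mn by (auto simp: frac_le)
      have "(norm (v m - v n))\<^sup>2 \<le> 2 * ((norm (x - v m))\<^sup>2 - d) + 2 * ((norm (x - v n))\<^sup>2 - d)" by (intro par v)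
      also have "\<dots> \<le> 4 * (1 / (real N + 1))" using v(2)[of m] v(2)[of n] le by argo
      also have "\<dots> < e\<^sup>2"
      proof -
        have "0 < e\<^sup>2" using e by simp
        then have "4 < e\<^sup>2 * real N" using N by (simp add: pos_divide_less_eq mult.commute)
        also have "\<dots> \<le> e\<^sup>2 * (real N + 1)" by (intro mult_left_mono) auto
        finally show ?thesis by (simp add: divide_less_eq)
      qed
      finally have "norm (v m - v n) < e" using e by (simp add: power_less_imp_less_base)
      then show "dist (v m) (v n) < e" by (simp add: dist_norm)
    qed
  qed
  then obtain p where p: "v \<longlonglongrightarrow> p" using Cauchy_convergent convergent_def by blast
  have pV: "p \<in> V" using closed_sequentially[OF V(2) v(1) p] .
  have "(\<lambda>n. d + 1 / (real n + 1)) \<longlonglongrightarrow> d + 0"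
    using LIMSEQ_inverse_real_of_nat by (intro tendsto_intros) (simp add: inverse_eq_divide add.commute)
  moreover have "(\<lambda>n. (norm (x - v n))\<^sup>2) \<longlonglongrightarrow> (norm (x - p))\<^sup>2" by (intro tendsto_intros p)
  ultimately have "(norm (x - p))\<^sup>2 \<le> d + 0" using v(2) by (intro LIMSEQ_le) (auto intro: less_imp_le)
  then have pd: "(norm (x - p))\<^sup>2 \<le> d" by simp
  have xp: "(norm (x - p))\<^sup>2 \<le> (norm (x - w))\<^sup>2" if "w \<in> V" for w by (rule order_trans[OF pd d[OF that]])
  have "inner w (x - p) = 0" if w: "w \<in> V" for w
  proof (cases "w = 0")
    case False
    define t where "t = inner w (x - p) / inner w w"
    have "p + t *\<^sub>R w \<in> V" using pV w V(1) by (intro subspace_add subspace_scale)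
    from xp[OF this] have "inner (x - p) (x - p) \<le> inner ((x - p) - t *\<^sub>R w) ((x - p) - t *\<^sub>R w)"
      by (simp add: power2_norm_eq_inner diff_diff_eq)
    also have "\<dots> = inner (x - p) (x - p) - 2 * t * inner w (x - p) + t\<^sup>2 * inner w w"
      by (simp add: inner_diff_left inner_diff_right inner_commute power2_eq_square algebra_simps)
    also have "t\<^sup>2 * inner w w = t * inner w (x - p)" using False by (simp add: t_def power2_eq_square)
    finally have "t * inner w (x - p) \<le> 0" by simp
    moreover have "t * inner w (x - p) = (inner w (x - p))\<^sup>2 / inner w w" by (simp add: t_def power2_eq_square)
    moreover have "inner w w > 0" using False by simp
    ultimately have "(inner w (x - p))\<^sup>2 \<le> 0" by (simp add: divide_le_0_iff)
    then show ?thesis by simp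
  qed simp
  moreover have "x - p \<noteq> 0" using x pV by auto
  ultimately show ?thesis by blast
qed

text \<open>For a complex subspace, real orthogonality to both \<open>v\<close> and \<open>\<i> v\<close> is complex
  orthogonality to \<open>v\<close>.\<close>

lemma exists_orthogonal_vector_complex:
  fixes V :: "'a::complex_hilbert set"
  assumes add: "\<And>x y. x \<in> V \<Longrightarrow> y \<in> V \<Longrightarrow> x + y \<in> V" and scale: "\<And>c x. x \<in> V \<Longrightarrow> c *\<^sub>C x \<in> V" and 0: "0 \<in> V"
    and V: "closed V" "V \<noteq> UNIV"
  shows "\<exists>y. y \<noteq> 0 \<and> (\<forall>v\<in>V. cinner v y = 0)"
proof -
  have "subspace V" unfolding subspace_def using add 0 scale by (metis scaleC_of_real)
  then obtain y where y: "y \<noteq> 0" "\<And>v. v \<in> V \<Longrightarrow> inner v y = 0" using exists_orthogonal_vector[OF _ V] by blast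
  have "cinner v y = 0" if v: "v \<in> V" for v
  proof (rule complex_eqI)
    show "Re (cinner v y) = Re 0" using y(2)[OF v] by (simp add: Re_cinner)
    have "Re (cinner ((-\<i>) *\<^sub>C v) y) = 0" using y(2)[OF scale[OF v]] by (simp only: Re_cinner)
    then show "Im (cinner v y) = Im 0" by (simp add: cinner_scaleC_left)
  qed
  then show ?thesis using y(1) by blast
qed

text \<open>The lower bound makes $T - z$ injective with closed range and a bounded inverse, and the last hypothesis
  makes the range dense.\<close>

lemma resolvent_setI:
  fixes T :: "('a::complex_hilbert \<times> 'a) set"
  assumes 0: "(0, 0) \<in> T" and add: "\<And>f f' g g'. (f, f') \<in> T \<Longrightarrow> (g, g') \<in> T \<Longrightarrow> (f + g, f' + g') \<in> T"
    and scale: "\<And>c f f'. (f, f') \<in> T \<Longrightarrow> (c *\<^sub>C f, c *\<^sub>C f') \<in> T" and cl: "closed T"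
    and c: "c > 0" and low: "\<And>f f'. (f, f') \<in> T \<Longrightarrow> c * norm f \<le> norm (f' - z *\<^sub>C f)"
    and dense: "\<And>y. (\<And>f f'. (f, f') \<in> T \<Longrightarrow> cinner (f' - z *\<^sub>C f) y = 0) \<Longrightarrow> y = 0"
  shows "z \<in> resolvent_set_of T"
proof -
  define Rg where "Rg = {f' - z *\<^sub>C f | f f'. (f, f') \<in> T}"
  have sub: "(f - g, f' - g') \<in> T" if "(f, f') \<in> T" "(g, g') \<in> T" for f f' g g'
    using add[OF that(1) scale[OF that(2), of "-1"]] by (simp add: scaleC_minus1)
  have clR: "closed Rg"
    unfolding closed_sequential_limits
  proof (intro allI impI, elim conjE)
    fix h l assume h: "\<forall>n. h n \<in> Rg" and l: "h \<longlonglongrightarrow> l"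
    obtain f f' where ff: "\<And>n. (f n, f' n) \<in> T" "\<And>n. h n = f' n - z *\<^sub>C f n"
      using h unfolding Rg_def mem_Collect_eq by metis
    have le: "c * norm (f m - f n) \<le> norm (h m - h n)" for m n
      using low[OF sub[OF ff(1) ff(1)], of m n] by (simp add: ff(2) scaleC_diff_right algebra_simps)
    have "Cauchy f"
    proof (rule metric_CauchyI)
      fix e :: real assume e: "e > 0"
      have "Cauchy h" using l by (rule LIMSEQ_imp_Cauchy)
      from metric_CauchyD[OF this, of "c * e"] obtain M where M: "\<And>m n. m \<ge> M \<Longrightarrow> n \<ge> M \<Longrightarrow> dist (h m) (h n) < c * e"
        using e c by auto
      show "\<exists>M. \<forall>m\<ge>M. \<forall>n\<ge>M. dist (f m) (f n) < e"
      proof (intro exI[of _ M] allI impI)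
        fix m n assume "m \<ge> M" "n \<ge> M"
        from M[OF this] have "c * norm (f m - f n) < c * e" using le[of m n] by (simp add: dist_norm)
        then show "dist (f m) (f n) < e" using c by (simp add: dist_norm)
      qed
    qed
    then obtain p where p: "f \<longlonglongrightarrow> p" using Cauchy_convergent convergent_def by blast
    have "(\<lambda>n. h n + z *\<^sub>C f n) \<longlonglongrightarrow> l + z *\<^sub>C p"
      by (intro tendsto_add l bounded_linear.tendsto[OF bounded_linear_scaleC] p)
    then have "f' \<longlonglongrightarrow> l + z *\<^sub>C p" by (simp add: ff(2))
    then have "(\<lambda>n. (f n, f' n)) \<longlonglongrightarrow> (p, l + z *\<^sub>C p)" using p by (rule tendsto_Pair[rotated])
    then have "(p, l + z *\<^sub>C p) \<in> T" using closed_sequentially[OF cl, of "\<lambda>n. (f n, f' n)"] ff(1) by blast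
    then show "l \<in> Rg" unfolding Rg_def by (force intro: exI[of _ p] exI[of _ "l + z *\<^sub>C p"])
  qed
  have "Rg = UNIV"
  proof (rule ccontr)
    assume ne: "Rg \<noteq> UNIV"
    have Radd: "x + y \<in> Rg" if xy: "x \<in> Rg" "y \<in> Rg" for x y
    proof -
      obtain f f' g g' where "(f, f') \<in> T" "x = f' - z *\<^sub>C f" "(g, g') \<in> T" "y = g' - z *\<^sub>C g"
        using xy unfolding Rg_def by blast
      then show ?thesis unfolding Rg_def mem_Collect_eq
        by (intro exI[of _ "f + g"] exI[of _ "f' + g'"]) (simp add: add scaleC_add_right)
    qed
    have Rscale: "a *\<^sub>C x \<in> Rg" if x: "x \<in> Rg" for a x
    proof -
      obtain f f' where "(f, f') \<in> T" "x = f' - z *\<^sub>C f" using x unfolding Rg_def by blast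
      then show ?thesis unfolding Rg_def mem_Collect_eq
        by (intro exI[of _ "a *\<^sub>C f"] exI[of _ "a *\<^sub>C f'"]) (simp add: scale scaleC_diff_right scaleC_scaleC mult.commute)
    qed
    have R0: "0 \<in> Rg" unfolding Rg_def mem_Collect_eq using 0 by (intro exI[of _ 0]) simp
    obtain y where "y \<noteq> 0" "\<forall>v\<in>Rg. cinner v y = 0"
      using exists_orthogonal_vector_complex[OF Radd Rscale R0 clR ne] by blast
    then show False using dense[of y] unfolding Rg_def by blast
  qed
  then have ex: "\<exists>f. (f, h + z *\<^sub>C f) \<in> T" for h
  proof -
    have "h \<in> Rg" using \<open>Rg = UNIV\<close> by simp
    then obtain f f' where "(f, f') \<in> T" "h = f' - z *\<^sub>C f" unfolding Rg_def by blast
    then show ?thesis by (intro exI[of _ f]) simp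
  qed
  have uniq: "f = g" if "(f, h + z *\<^sub>C f) \<in> T" "(g, h + z *\<^sub>C g) \<in> T" for f g h
  proof -
    have "c * norm (f - g) \<le> 0" using low[OF sub[OF that]] by (simp add: scaleC_diff_right)
    then show ?thesis using c by (simp add: mult_le_0_iff)
  qed
  define R where "R h = (THE f. (f, h + z *\<^sub>C f) \<in> T)" for h
  have R: "(R h, h + z *\<^sub>C R h) \<in> T" for h unfolding R_def by (rule theI') (use ex uniq in blast)
  have R': "R h = f \<longleftrightarrow> (f, h + z *\<^sub>C f) \<in> T" for h f using R uniq by blast
  have "bounded_linear R"
  proof (rule bounded_linear_intro[where K = "1 / c"])
    show "R (x + y) = R x + R y" for x y
      unfolding R' using add[OF R[of x] R[of y]] by (simp only: scaleC_add_right add_ac)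
    show "R (r *\<^sub>R x) = r *\<^sub>R R x" for r x
      unfolding R' using scale[OF R[of x], of "of_real r"]
      by (simp only: scaleC_of_real scaleR_add_right scaleC_scaleR)
    show "norm (R x) \<le> norm x * (1 / c)" for x using low[OF R[of x]] c by (simp add: field_simps)
  qed
  then show ?thesis unfolding resolvent_set_of_def using R' by blast
qed


section \<open>The adjoint of the minimal operator\<close>

lemma L2_equiv_refl: "square_integrable f \<Longrightarrow> L2_equiv f f"
  by (simp add: L2_equiv_def)

lemma L2_cases: obtains f where "square_integrable f" "abs_L2_half_line f = U"
proof (rule that)
  show "square_integrable (rep_L2_half_line U)"
    using Quotient3_rep_reflp[OF Quotient3_L2_half_line, of U] by (auto simp: L2_equiv_def)
  show "abs_L2_half_line (rep_L2_half_line U) = U" by (rule Quotient3_abs_rep[OF Quotient3_L2_half_line])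
qed

lemma abs_L2_eq_iff:
  assumes "square_integrable f" "square_integrable g"
  shows "abs_L2_half_line f = abs_L2_half_line g \<longleftrightarrow> (AE x in half_line. f x = g x)"
  using Quotient3_rel[OF Quotient3_L2_half_line, of f g] assms by (auto simp: L2_equiv_def)

lemma cinner_abs_L2:
  "square_integrable f \<Longrightarrow> square_integrable g \<Longrightarrow>
   cinner (abs_L2_half_line f) (abs_L2_half_line g) = (LINT x|half_line. f x * cnj (g x))"
  by (simp add: cinner_L2_half_line.abs_eq L2_equiv_refl)

lemma abs_L2_add:
  "square_integrable f \<Longrightarrow> square_integrable g \<Longrightarrow>
   abs_L2_half_line f + abs_L2_half_line g = abs_L2_half_line (\<lambda>x. f x + g x)"
  by (simp add: plus_L2_half_line.abs_eq L2_equiv_refl)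

lemma abs_L2_scale: "square_integrable f \<Longrightarrow> c *\<^sub>C abs_L2_half_line f = abs_L2_half_line (\<lambda>x. c * f x)"
  by (simp add: scaleC_L2_half_line.abs_eq L2_equiv_refl)

lemma continuous_AE_eq_imp_eq:
  fixes f g :: "real \<Rightarrow> complex"
  assumes f: "continuous_on {0<..} f" and g: "continuous_on {0<..} g" and ae: "AE x in half_line. f x = g x" and x: "x > 0"
  shows "f x = g x"
proof (rule ccontr)
  assume ne: "f x \<noteq> g x"
  let ?S = "{y \<in> {0<..}. f y - g y \<noteq> 0}"
  have "?S = {0<..} \<inter> (\<lambda>y. f y - g y) -` (- {0})" by auto
  moreover have "open ({0<..} \<inter> (\<lambda>y. f y - g y) -` (- {0}))"
    by (intro continuous_open_preimage continuous_intros f g)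
  ultimately have "open ?S" by (simp only:)
  moreover have "x \<in> ?S" using x ne by simp
  ultimately have "\<not> negligible ?S" using open_not_negligible by blast
  moreover have "?S \<in> null_sets lebesgue"
  proof -
    have "AE y in lebesgue. y \<in> {0<..} \<longrightarrow> f y = g y" using ae by (simp add: AE_restrict_space_iff)
    then have "AE y in lebesgue. y \<notin> ?S" by eventually_elim auto
    moreover have "?S \<in> sets lebesgue" using \<open>open ?S\<close> by (simp add: borel_open)
    ultimately show ?thesis by (simp add: AE_iff_null_sets)
  qed
  ultimately show False using negligible_iff_null_sets by blast
qed

lemma square_integrable_cong_AE:
  assumes f: "square_integrable f" and g: "continuous_on {0<..} g" and ae: "AE x in half_line. f x = g x"
  shows "square_integrable g"
  unfolding square_integrable_def
proof
  show gm: "g \<in> borel_measurable half_line" by (rule measurable_half_line_continuous[OF g])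
  have fm: "f \<in> borel_measurable half_line" using f by (simp add: square_integrable_def)
  have "integrable half_line (\<lambda>x. (cmod (f x))\<^sup>2) = integrable half_line (\<lambda>x. (cmod (g x))\<^sup>2)"
    using ae fm gm by (intro integrable_cong_AE) (auto elim: eventually_mono)
  then show "integrable half_line (\<lambda>x. (cmod (g x))\<^sup>2)" using f by (simp add: square_integrable_def)
qed

text \<open>Two continuous functions that agree almost everywhere agree everywhere, so the choice in the definition
  of the representative is immaterial.\<close>

lemma continuous_representative_eq:
  assumes f: "square_integrable f" and c: "continuous_on {0<..} f" and x: "x > 0"
  shows "continuous_representative (abs_L2_half_line f) x = f x"
proof -
  let ?g = "continuous_representative (abs_L2_half_line f)"
  have g: "square_integrable ?g \<and> abs_L2_half_line ?g = abs_L2_half_line f \<and> continuous_on {0<..} ?g"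
    unfolding continuous_representative_def by (rule someI[of _ f]) (use f c in auto)
  then have "AE x in half_line. ?g x = f x" using abs_L2_eq_iff[of ?g f] f by blast
  then show ?thesis using continuous_AE_eq_imp_eq[of ?g f] g c x by blast
qed

lemma deriv1_eq:
  assumes "\<And>y. y > 0 \<Longrightarrow> g y = f y" "(f has_vector_derivative d) (at x)" "x > 0"
  shows "deriv1 g x = d"
proof -
  have "(g has_vector_derivative d) (at x)"
    by (rule has_vector_derivative_transform_within_open[OF assms(2), of "{0<..}"]) (use assms in auto)
  then show ?thesis by (rule vector_derivative_at)
qed

lemma bracket_at_regular:
  assumes f: "bessel_max \<nu> f f1 h" and x: "x > 0"
  shows "bracket_at (continuous_representative (abs_L2_half_line f)) (bessel_regular \<nu>) x = bracket_reg \<nu> f f1 x"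
    "bracket_at (continuous_representative (abs_L2_half_line f)) (bessel_singular \<nu>) x = bracket_sing \<nu> f f1 x"
proof -
  have sol: "bessel_sol \<nu> f f1 h" and sq: "square_integrable f" using f by (auto simp: bessel_max_def)
  note r = continuous_representative_eq[OF sq bessel_solD(3)[OF sol]]
  have d: "deriv1 (continuous_representative (abs_L2_half_line f)) x = f1 x"
    by (rule deriv1_eq[OF r bessel_solD(1)[OF sol x] x])
  have u: "deriv1 (bessel_regular \<nu>) x = regular_deriv \<nu> x" "deriv1 (bessel_singular \<nu>) x = singular_deriv \<nu> x"
    using bessel_solD(1)[OF bessel_sol_regular x] bessel_solD(1)[OF bessel_sol_singular x] by (auto intro: vector_derivative_at)
  show "bracket_at (continuous_representative (abs_L2_half_line f)) (bessel_regular \<nu>) x = bracket_reg \<nu> f f1 x"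
    unfolding bracket_at_def bracket_reg_def d u r[OF x] by (simp add: bessel_regular_def regular_deriv_def)
  show "bracket_at (continuous_representative (abs_L2_half_line f)) (bessel_singular \<nu>) x = bracket_sing \<nu> f f1 x"
    unfolding bracket_at_def bracket_sing_def d u r[OF x] by (simp add: bessel_singular_def singular_deriv_def regular_deriv_def)
qed

lemma bracket_0_regular:
  assumes f: "bessel_max \<nu> f f1 h"
  shows "(bracket_reg \<nu> f f1 \<longlongrightarrow> l) (at_right 0) \<Longrightarrow> bracket_0 (abs_L2_half_line f) (bessel_regular \<nu>) = l"
    "(bracket_reg \<nu> f f1 \<longlongrightarrow> l) (at_right 0) \<Longrightarrow> bracket_0_exists (abs_L2_half_line f) (bessel_regular \<nu>)"
    "(bracket_sing \<nu> f f1 \<longlongrightarrow> l) (at_right 0) \<Longrightarrow> bracket_0 (abs_L2_half_line f) (bessel_singular \<nu>) = l"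
    "(bracket_sing \<nu> f f1 \<longlongrightarrow> l) (at_right 0) \<Longrightarrow> bracket_0_exists (abs_L2_half_line f) (bessel_singular \<nu>)"
proof -
  have 1: "(bracket_at (continuous_representative (abs_L2_half_line f)) (bessel_regular \<nu>) \<longlongrightarrow> l) (at_right 0)"
    if "(bracket_reg \<nu> f f1 \<longlongrightarrow> l) (at_right 0)" for l
    using that by (rule Lim_transform_eventually)
      (auto simp: bracket_at_regular[OF f] intro!: eventually_mono[OF eventually_at_right_less])
  have 2: "(bracket_at (continuous_representative (abs_L2_half_line f)) (bessel_singular \<nu>) \<longlongrightarrow> l) (at_right 0)"
    if "(bracket_sing \<nu> f f1 \<longlongrightarrow> l) (at_right 0)" for l
    using that by (rule Lim_transform_eventually)
      (auto simp: bracket_at_regular[OF f] intro!: eventually_mono[OF eventually_at_right_less])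
  show "(bracket_reg \<nu> f f1 \<longlongrightarrow> l) (at_right 0) \<Longrightarrow> bracket_0 (abs_L2_half_line f) (bessel_regular \<nu>) = l"
    unfolding bracket_0_def by (intro tendsto_Lim 1) auto
  show "(bracket_sing \<nu> f f1 \<longlongrightarrow> l) (at_right 0) \<Longrightarrow> bracket_0 (abs_L2_half_line f) (bessel_singular \<nu>) = l"
    unfolding bracket_0_def by (intro tendsto_Lim 2) auto
  show "(bracket_reg \<nu> f f1 \<longlongrightarrow> l) (at_right 0) \<Longrightarrow> bracket_0_exists (abs_L2_half_line f) (bessel_regular \<nu>)"
    unfolding bracket_0_exists_def using 1 by blast
  show "(bracket_sing \<nu> f f1 \<longlongrightarrow> l) (at_right 0) \<Longrightarrow> bracket_0_exists (abs_L2_half_line f) (bessel_singular \<nu>)"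
    unfolding bracket_0_exists_def using 2 by blast
qed

lemma C1_locally_absolutely_continuous:
  assumes d: "\<And>x. x > 0 \<Longrightarrow> (f has_vector_derivative f' x) (at x)" and c: "continuous_on {0<..} f'"
  shows "locally_absolutely_continuous f"
  unfolding locally_absolutely_continuous_def absolutely_continuous_on_Icc_def
proof (intro allI impI, elim conjE)
  fix a b e :: real assume ab: "0 < a" "a < b" and e: "e > 0"
  have "bounded (f' ` {a..b})"
    using ab by (intro compact_imp_bounded compact_continuous_image continuous_on_subset[OF c]) auto
  then obtain C where C: "\<And>x. x \<in> {a..b} \<Longrightarrow> cmod (f' x) \<le> C" unfolding bounded_iff ball_simps by blast
  have C0: "C \<ge> 0" using order_trans[OF norm_ge_zero C[of a]] ab by simp
  have lip: "cmod (f v - f u) \<le> (C + 1) * (v - u)" if uv: "a \<le> u" "u \<le> v" "v \<le> b" for u v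
  proof -
    have "norm (f v - f u) \<le> C * norm (v - u)"
    proof (rule differentiable_bound[of "{a..b}" f "\<lambda>x h. h *\<^sub>R f' x"])
      show "(f has_derivative (\<lambda>h. h *\<^sub>R f' z)) (at z within {a..b})" if "z \<in> {a..b}" for z
        using d[of z] that ab has_derivative_at_withinI unfolding has_vector_derivative_def by fastforce
      show "onorm (\<lambda>h. h *\<^sub>R f' z) \<le> C" if "z \<in> {a..b}" for z
        using C[OF that] by (intro onorm_le) (simp add: mult.commute[of _ "cmod (f' z)"] mult_right_mono)
    qed (use uv in auto)
    also have "\<dots> \<le> (C + 1) * (v - u)" using uv by (simp add: mult_right_mono)
    finally show ?thesis .
  qed
  show "\<exists>\<delta>>0. \<forall>I. finite I \<and> (\<forall>(u, v)\<in>I. a \<le> u \<and> u \<le> v \<and> v \<le> b) \<and>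
      disjoint_family_on (\<lambda>(u, v). {u<..<v}) I \<and> (\<Sum>(u, v)\<in>I. v - u) < \<delta> \<longrightarrow> (\<Sum>(u, v)\<in>I. cmod (f v - f u)) < e"
  proof (intro exI[of _ "e / (C + 1)"] conjI allI impI; (elim conjE)?)
    show "0 < e / (C + 1)" using e C0 by simp
    fix I assume I: "finite I" "\<forall>(u, v)\<in>I. a \<le> u \<and> u \<le> v \<and> v \<le> b" "(\<Sum>(u, v)\<in>I. v - u) < e / (C + 1)"
    have "(\<Sum>(u, v)\<in>I. cmod (f v - f u)) \<le> (\<Sum>(u, v)\<in>I. (C + 1) * (v - u))"
      using I(2) lip by (intro sum_mono) auto
    also have "\<dots> = (C + 1) * (\<Sum>(u, v)\<in>I. v - u)" by (simp add: sum_distrib_left case_prod_unfold)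
    also have "\<dots> < (C + 1) * (e / (C + 1))" using I(3) C0 by (intro mult_strict_left_mono) auto
    also have "\<dots> = e" using C0 by simp
    finally show "(\<Sum>(u, v)\<in>I. cmod (f v - f u)) < e" .
  qed
qed

lemma square_integrable_compact_cont:
  assumes "compact_cont f" shows "square_integrable f"
proof -
  obtain a b where ab: "0 < a" "a < b" "\<And>x. x > 0 \<Longrightarrow> x \<notin> {a..b} \<Longrightarrow> f x = 0" and c: "continuous_on {0<..} f"
    using assms unfolding compact_cont_def by blast
  have "integrable half_line (\<lambda>x. f x * cnj (f x))"
  proof (rule compact_cont_integrable[OF assms])
    show "(\<lambda>x. cnj (f x)) absolutely_integrable_on {a..b}" if "0 < a" for a b
      by (rule absolutely_integrable_continuous_real, rule continuous_on_subset[of "{0<..}"])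
        (use that in \<open>auto intro!: continuous_intros c\<close>)
  qed
  from integrable_norm[OF this] have "integrable half_line (\<lambda>x. (cmod (f x))\<^sup>2)"
    by (simp add: norm_mult power2_eq_square)
  then show ?thesis using measurable_half_line_continuous[OF c] by (simp add: square_integrable_def)
qed

text \<open>If \<open>\<phi>\<close> and \<open>\<psi>\<close> are continuous, then \<open>\<phi>1\<close> is itself
  continuously differentiable, so that both local absolute continuity conditions hold.\<close>

lemma bessel_preminimal_compact_cont:
  assumes sol: "bessel_sol \<nu> \<phi> \<phi>1 \<psi>" and \<phi>: "compact_cont \<phi>" and \<psi>: "compact_cont \<psi>"
  shows "(abs_L2_half_line \<phi>, abs_L2_half_line \<psi>) \<in> bessel_preminimal \<nu>"
proof -
  have c: "continuous_on {0<..} \<phi>" "continuous_on {0<..} \<psi>" using \<phi> \<psi> by (auto simp: compact_cont_def)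
  have c2: "continuous_on {0<..} (\<lambda>x. bessel_q \<nu> x * \<phi> x - \<psi> x)" by (intro continuous_intros c continuous_on_bessel_q)
  have d2: "(\<phi>1 has_vector_derivative bessel_q \<nu> x * \<phi> x - \<psi> x) (at x)" if "x > 0" for x
    by (rule primitive_continuous_has_vector_derivative[OF bessel_solD(2)[OF sol] c2 that])
  have d1: "deriv1 \<phi> x = \<phi>1 x" if "x > 0" for x by (rule vector_derivative_at[OF bessel_solD(1)[OF sol that]])
  have d3: "(deriv1 \<phi> has_vector_derivative bessel_q \<nu> x * \<phi> x - \<psi> x) (at x)" if "x > 0" for x
    by (rule has_vector_derivative_transform_within_open[OF d2[OF that], of "{0<..}"]) (use that d1 in auto)
  have "bessel_maximal_fun \<nu> \<phi> \<psi>"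
    unfolding bessel_maximal_fun_def
  proof (intro conjI square_integrable_compact_cont \<phi> \<psi>)
    show "\<phi> differentiable_on {0<..}"
      unfolding differentiable_on_def
      by (rule ballI, rule differentiable_at_withinI, rule differentiableI_vector, rule bessel_solD(1)[OF sol], simp)
    show "locally_absolutely_continuous \<phi>"
      by (rule C1_locally_absolutely_continuous[OF bessel_solD(1)[OF sol] bessel_solD(4)[OF sol]])
    show "locally_absolutely_continuous (deriv1 \<phi>)"
      by (rule C1_locally_absolutely_continuous[OF d3 c2])
    show "AE x in half_line. (deriv1 \<phi> has_vector_derivative of_real ((\<nu>\<^sup>2 - 1/4) / x\<^sup>2) * \<phi> x - \<psi> x) (at x)"
      by (rule AE_I2) (use d3 in \<open>auto simp: bessel_q_def\<close>)
  qed
  moreover have "\<exists>a b. 0 < a \<and> a < b \<and> (\<forall>x>0. x \<notin> {a..b} \<longrightarrow> \<phi> x = 0)" using \<phi> by (auto simp: compact_cont_def)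
  ultimately show ?thesis unfolding bessel_preminimal_def by blast
qed

lemma bessel_maximal_fun_imp_max:
  assumes f: "bessel_maximal_fun \<nu> f h"
  shows "bessel_max \<nu> f (deriv1 f) h"
proof -
  have ac: "absolutely_continuous_on_Icc a b (deriv1 f)" if "0 < a" "a < b" for a b
    using f that by (auto simp: bessel_maximal_fun_def locally_absolutely_continuous_def)
  have "AE x in lebesgue. x \<in> {0<..} \<longrightarrow> (deriv1 f has_vector_derivative bessel_q \<nu> x * f x - h x) (at x)"
    using f by (simp add: bessel_maximal_fun_def AE_restrict_space_iff bessel_q_def)
  from AE_E3[OF this] obtain N where N: "\<And>x. x \<in> space lebesgue - N \<Longrightarrow> x \<in> {0<..} \<longrightarrow> (deriv1 f has_vector_derivative bessel_q \<nu> x * f x - h x) (at x)"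
    "N \<in> null_sets lebesgue" by metis
  have "((\<lambda>x. bessel_q \<nu> x * f x - h x) has_integral deriv1 f b - deriv1 f a) {a..b}" if ab: "0 < a" "a \<le> b" for a b
  proof (cases "a = b")
    case False
    then have "a < b" using ab by simp
    show ?thesis
      by (rule has_integral_absolutely_continuous[OF ab(2) ac[OF ab(1) \<open>a < b\<close>], of N])
        (use N ab negligible_iff_null_sets in auto)
  qed auto
  then have "primitive (deriv1 f) (\<lambda>x. bessel_q \<nu> x * f x - h x)" by (auto simp: primitive_def)
  moreover have "(f has_vector_derivative deriv1 f x) (at x)" if "x > 0" for x
  proof -
    have "f differentiable at x"
      using f that by (auto simp: bessel_maximal_fun_def differentiable_on_eq_differentiable_at)
    then show ?thesis by (simp add: vector_derivative_works)
  qed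
  ultimately show ?thesis using f by (auto simp: bessel_max_def bessel_sol_def bessel_maximal_fun_def)
qed

text \<open>The graph of the maximal operator, written with the integrated form of the equation.\<close>

definition bessel_graph :: "real \<Rightarrow> (L2_half_line \<times> L2_half_line) set" where
  "bessel_graph \<nu> = {(abs_L2_half_line f, abs_L2_half_line h) | f f1 h. bessel_max \<nu> f f1 h}"

lemma vanishing_brackets:
  assumes f: "bessel_max \<nu> f f1 h" and z: "0 < a" "\<And>x. 0 < x \<Longrightarrow> x < a \<Longrightarrow> f x = 0"
  shows "eventually (\<lambda>x. f x = 0 \<and> f1 x = 0) (at_right 0)"
proof -
  have "f1 x = 0" if x: "0 < x" "x < a" for x
  proof -
    have "(f has_vector_derivative f1 x) (at x)" using f x by (auto simp: bessel_max_def bessel_sol_def)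
    moreover have "(f has_vector_derivative 0) (at x)"
      by (rule has_vector_derivative_transform_within_open[of "\<lambda>_. 0" _ _ "{0<..<a}"]) (use x z in auto)
    ultimately show ?thesis by (rule vector_derivative_unique_at)
  qed
  then show ?thesis using z by (auto simp: eventually_at_right[OF zero_less_one] intro!: exI[of _ a])
qed

lemma bessel_preminimal_subset:
  assumes "(F, H) \<in> bessel_preminimal \<nu>"
  obtains f f1 h where "F = abs_L2_half_line f" "H = abs_L2_half_line h" "bessel_max \<nu> f f1 h"
    "eventually (\<lambda>x. f x = 0 \<and> f1 x = 0) (at_right 0)"
proof -
  obtain f h a b where *: "F = abs_L2_half_line f" "H = abs_L2_half_line h" "bessel_maximal_fun \<nu> f h"
    "0 < a" "\<forall>x>0. x \<notin> {a..b} \<longrightarrow> f x = 0" using assms unfolding bessel_preminimal_def by blast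
  note m = bessel_maximal_fun_imp_max[OF *(3)]
  show ?thesis by (rule that[OF *(1,2) m vanishing_brackets[OF m *(4)]]) (use * in auto)
qed

text \<open>Functions in the preminimal domain vanish near \<open>0\<close>, so Green's identity has no boundary
  term.\<close>

lemma bessel_graph_subset_adjoint:
  assumes \<nu>: "0 \<le> \<nu>" "\<nu> < 1"
  shows "bessel_graph \<nu> \<subseteq> adjoint_operator (bessel_preminimal \<nu>)"
proof
  fix p assume "p \<in> bessel_graph \<nu>"
  then obtain g g1 k where p: "p = (abs_L2_half_line g, abs_L2_half_line k)" and g: "bessel_max \<nu> g g1 k"
    by (auto simp: bessel_graph_def)
  have "cinner H (abs_L2_half_line g) = cinner F (abs_L2_half_line k)" if FH: "(F, H) \<in> bessel_preminimal \<nu>" for F H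
  proof -
    obtain f f1 h where *: "F = abs_L2_half_line f" "H = abs_L2_half_line h" "bessel_max \<nu> f f1 h"
      "eventually (\<lambda>x. f x = 0 \<and> f1 x = 0) (at_right 0)" using FH by (rule bessel_preminimal_subset)
    have "((\<lambda>x. f x * cnj (g1 x) - f1 x * cnj (g x)) \<longlongrightarrow> 0) (at_right 0)"
      by (rule tendsto_eventually) (use *(4) in \<open>auto elim: eventually_mono\<close>)
    from green_identity[OF \<nu> *(3) bessel_max_cnj[OF g] this]
    show ?thesis using *(3) g by (simp add: * cinner_abs_L2 bessel_max_def)
  qed
  then show "p \<in> adjoint_operator (bessel_preminimal \<nu>)" unfolding p adjoint_operator_def by auto
qed

text \<open>Orthogonality to both homogeneous solutions is what makes the solution by variation of parameters,
  started to the left of the support, vanish again to its right.\<close>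

lemma ex_test_function:
  assumes \<psi>: "compact_cont \<psi>"
    and 0: "(LINT x|half_line. \<psi> x * bessel_regular \<nu> x) = 0" "(LINT x|half_line. \<psi> x * bessel_singular \<nu> x) = 0"
  shows "\<exists>\<phi> \<phi>1. bessel_sol \<nu> \<phi> \<phi>1 \<psi> \<and> compact_cont \<phi>"
proof -
  obtain a b where ab: "0 < a" "a < b" "\<And>x. x > 0 \<Longrightarrow> x \<notin> {a..b} \<Longrightarrow> \<psi> x = 0" and c: "continuous_on {0<..} \<psi>"
    using \<psi> unfolding compact_cont_def by blast
  have ex: "\<exists>U. primitive U (\<lambda>x. g x * \<psi> x) \<and> (\<forall>x>0. x \<notin> {a..b} \<longrightarrow> U x = 0)"
    if g: "continuous_on {0<..} g" and z: "(LINT x|half_line. \<psi> x * g x) = 0" for g :: "real \<Rightarrow> complex"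
  proof -
    have gc: "continuous_on {0<..} (\<lambda>x. g x * \<psi> x)" by (intro continuous_intros g c)
    have "(\<lambda>x. g x * \<psi> x) integrable_on {r..s}" if "0 < r" for r s
      by (rule integrable_continuous_interval, rule continuous_on_subset[OF gc]) (use that in auto)
    then obtain U where U: "primitive U (\<lambda>x. g x * \<psi> x)" "U a = 0" using primitive_exists_at[of "\<lambda>x. g x * \<psi> x" a] by blast
    have i: "integrable half_line (\<lambda>x. \<psi> x * g x)"
    proof (rule compact_cont_integrable[OF \<psi>])
      show "g absolutely_integrable_on {r..s}" if "0 < r" for r s
        by (rule absolutely_integrable_continuous_real, rule continuous_on_subset[OF g]) (use that in auto)
    qed
    have eq: "(LINT x|half_line. indicator {a..b} x *\<^sub>R (g x * \<psi> x)) = (LINT x|half_line. \<psi> x * g x)"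
      by (rule Bochner_Integration.integral_cong) (use ab in \<open>auto simp: indicator_def\<close>)
    have "integrable half_line (\<lambda>x. indicator {a..b} x *\<^sub>R (g x * \<psi> x))"
      by (rule Bochner_Integration.integrable_cong[THEN iffD1, OF refl _ i]) (use ab in \<open>auto simp: indicator_def\<close>)
    from half_line_integral_Icc[OF ab(1) this primitiveD[OF U(1) ab(1)]] ab
    have Ub: "U b = 0" unfolding eq z by (simp add: U(2))
    have "U x = 0" if x: "x > 0" "x \<notin> {a..b}" for x
    proof (cases "x < a")
      case True
      have A: "((\<lambda>t. g t * \<psi> t) has_integral 0) {x..a}"
        by (rule has_integral_spike[of "{a}" _ _ "\<lambda>_. 0"]) (use x ab in auto)
      have B: "((\<lambda>t. g t * \<psi> t) has_integral U a - U x) {x..a}" using True x by (intro primitiveD[OF U(1)]) auto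
      show ?thesis using has_integral_unique[OF B A] U(2) by simp
    next
      case False
      then have xb: "x > b" using x by auto
      have A: "((\<lambda>t. g t * \<psi> t) has_integral 0) {b..x}"
        by (rule has_integral_spike[of "{b}" _ _ "\<lambda>_. 0"]) (use x ab in auto)
      have B: "((\<lambda>t. g t * \<psi> t) has_integral U x - U b) {b..x}" using xb ab by (intro primitiveD[OF U(1)]) auto
      show ?thesis using has_integral_unique[OF B A] Ub by simp
    qed
    then show ?thesis using U by blast
  qed
  obtain U where U: "primitive U (\<lambda>x. bessel_regular \<nu> x * \<psi> x)" "\<And>x. x > 0 \<Longrightarrow> x \<notin> {a..b} \<Longrightarrow> U x = 0"
    using ex[OF continuous_singular_regular(1) 0(1)] by blast
  obtain V where V: "primitive V (\<lambda>x. bessel_singular \<nu> x * \<psi> x)" "\<And>x. x > 0 \<Longrightarrow> x \<notin> {a..b} \<Longrightarrow> V x = 0"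
    using ex[OF continuous_singular_regular(3) 0(2)] by blast
  note sol = variation_of_parameters[OF U(1) V(1)]
  moreover have "compact_cont (\<lambda>x. (bessel_singular \<nu> x * U x - bessel_regular \<nu> x * V x) / of_real (kappa \<nu>))"
    unfolding compact_cont_def using bessel_solD(3)[OF sol] U(2) V(2) ab
    by (intro conjI exI[of _ a] exI[of _ b]) auto
  ultimately show ?thesis by blast
qed

text \<open>For a pair in the adjoint, subtract from the first component a particular solution \<open>G\<close> for
  the second one. The difference annihilates every \<open>\<psi>\<close> that is $\tau_\nu$ of a
  compactly supported function, hence is a homogeneous solution almost everywhere.\<close>

lemma adjoint_subset_bessel_graph:
  assumes \<nu>: "0 \<le> \<nu>" "\<nu> < 1"
  shows "adjoint_operator (bessel_preminimal \<nu>) \<subseteq> bessel_graph \<nu>"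
proof clarify
  fix G' K' assume adj: "(G', K') \<in> adjoint_operator (bessel_preminimal \<nu>)"
  obtain g where g: "square_integrable g" "abs_L2_half_line g = G'" by (rule L2_cases)
  obtain k where k: "square_integrable k" "abs_L2_half_line k = K'" by (rule L2_cases)
  have ki: "k absolutely_integrable_on {a..b}" if "0 < a" for a b by (rule square_integrable_Icc[OF k(1) that])
  have ex: "\<exists>U. primitive U (\<lambda>x. w x * k x)" if w: "continuous_on {0<..} w" for w :: "real \<Rightarrow> complex"
  proof (rule primitive_exists)
    fix a b :: real assume a: "0 < a"
    have wc: "continuous_on {a..b} w" by (rule continuous_on_subset[OF w]) (use a in auto)
    have "(\<lambda>x. w x * k x) absolutely_integrable_on {a..b}"
    proof (rule absolutely_integrable_bounded_measurable_product[OF bilinear_times _ _ _ ki[OF a]])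
      show "w \<in> borel_measurable (lebesgue_on {a..b})" by (rule continuous_imp_measurable_on_sets_lebesgue[OF wc]) auto
      show "bounded (w ` {a..b})" by (intro compact_imp_bounded compact_continuous_image wc) auto
    qed auto
    then show "(\<lambda>x. w x * k x) integrable_on {a..b}" using set_lebesgue_integral_eq_integral(1) by blast
  qed
  obtain U where U: "primitive U (\<lambda>x. bessel_regular \<nu> x * k x)" using ex[OF continuous_singular_regular(1)] by blast
  obtain V where V: "primitive V (\<lambda>x. bessel_singular \<nu> x * k x)" using ex[OF continuous_singular_regular(3)] by blast
  \<comment> \<open>Near \<open>0\<close> and infinity \<open>G\<close> may fail to be square integrable, so it is compared with \<open>g\<close> on test functions only.\<close>
  obtain G G1 where G: "bessel_sol \<nu> G G1 k" using variation_of_parameters[OF U V] by blast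
  define w where "w x = cnj (g x) - cnj (G x)" for x
  have Gi: "(\<lambda>x. cnj (G x)) absolutely_integrable_on {a..b}" if "0 < a" for a b
    by (rule absolutely_integrable_continuous_real, rule continuous_on_subset[of "{0<..}"])
       (use that in \<open>auto intro!: continuous_intros bessel_solD(3)[OF G]\<close>)
  have gi: "(\<lambda>x. cnj (g x)) absolutely_integrable_on {a..b}" if "0 < a" for a b
    by (rule square_integrable_Icc[OF square_integrable_cnj[OF g(1)] that])
  have wi: "w absolutely_integrable_on {a..b}" if "0 < a" for a b
    unfolding w_def by (intro set_integral_diff(1) gi Gi that)
  have "\<exists>c d. AE x in half_line. w x = c * bessel_regular \<nu> x + d * bessel_singular \<nu> x"
  proof (rule dubois_reymond[OF wi])
    fix \<psi> assume \<psi>: "compact_cont \<psi>" "(LINT x|half_line. \<psi> x * bessel_regular \<nu> x) = 0" "(LINT x|half_line. \<psi> x * bessel_singular \<nu> x) = 0"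
    obtain \<phi> \<phi>1 where \<phi>: "bessel_sol \<nu> \<phi> \<phi>1 \<psi>" "compact_cont \<phi>" using ex_test_function[OF \<psi>] by blast
    have sq: "square_integrable \<phi>" "square_integrable \<psi>" using \<phi> \<psi> by (auto intro: square_integrable_compact_cont)
    have "cinner (abs_L2_half_line \<psi>) G' = cinner (abs_L2_half_line \<phi>) K'"
      using adj bessel_preminimal_compact_cont[OF \<phi>(1,2) \<psi>(1)] by (auto simp: adjoint_operator_def)
    then have 1: "(LINT x|half_line. \<psi> x * cnj (g x)) = (LINT x|half_line. \<phi> x * cnj (k x))"
      using sq g k by (auto simp: cinner_abs_L2)
    obtain a b where ab: "0 < a" "a < b" "\<And>x. x > 0 \<Longrightarrow> x \<notin> {a..b} \<Longrightarrow> \<psi> x = 0 \<and> \<phi> x = 0"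
      using compact_cont_common[OF \<psi>(1) \<phi>(2)] by blast
    have i1: "integrable half_line (\<lambda>x. \<psi> x * cnj (G x))" by (rule compact_cont_integrable[OF \<psi>(1) Gi])
    have i2: "integrable half_line (\<lambda>x. \<phi> x * cnj (k x))" using sq k(1) by (intro square_integrable_mult_cnj)
    let ?P = "\<lambda>x. \<phi> x * cnj (G1 x) - \<phi>1 x * cnj (G x)"
    have P: "primitive ?P (\<lambda>x. \<psi> x * cnj (G x) - \<phi> x * cnj (k x))"
      by (rule lagrange_identity[OF \<phi>(1) bessel_sol_cnj[OF G]])
    have \<phi>1z: "\<phi>1 x = 0" if "x > 0" "x \<notin> {a..b}" for x
    proof -
      have "(\<phi> has_vector_derivative 0) (at x)"
        by (rule has_vector_derivative_transform_within_open[of "\<lambda>_. 0" _ _ "{0<..} - {a..b}"])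
           (use that ab in \<open>auto intro: open_Diff\<close>)
      then show ?thesis using vector_derivative_unique_at[OF bessel_solD(1)[OF \<phi>(1) that(1)]] by blast
    qed
    have "((\<lambda>x. \<psi> x * cnj (G x) - \<phi> x * cnj (k x)) has_integral ?P (b + 1) - ?P (a / 2)) {a/2..b+1}"
      by (rule primitiveD[OF P]) (use ab in auto)
    moreover have "?P (b + 1) = 0" "?P (a / 2) = 0" using ab \<phi>1z[of "b + 1"] \<phi>1z[of "a/2"] ab(3)[of "b+1"] ab(3)[of "a/2"] by auto
    ultimately have hi: "((\<lambda>x. \<psi> x * cnj (G x) - \<phi> x * cnj (k x)) has_integral 0) {a/2..b+1}" by simp
    have "(LINT x|half_line. \<psi> x * cnj (G x) - \<phi> x * cnj (k x)) =
        (LINT x|half_line. indicator {a/2..b+1} x *\<^sub>R (\<psi> x * cnj (G x) - \<phi> x * cnj (k x)))"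
      by (rule Bochner_Integration.integral_cong) (use ab in \<open>force simp: indicator_def\<close>)+
    also have "\<dots> = 0"
      by (rule half_line_integral_Icc[OF _ integrable_mult_indicator hi]) (use ab i1 i2 in auto)
    finally have 2: "(LINT x|half_line. \<psi> x * cnj (G x)) = (LINT x|half_line. \<phi> x * cnj (k x))" using i1 i2 by simp
    have "(LINT x|half_line. \<psi> x * w x) = (LINT x|half_line. \<psi> x * cnj (g x) - \<psi> x * cnj (G x))"
      by (simp add: w_def right_diff_distrib)
    also have "\<dots> = (LINT x|half_line. \<psi> x * cnj (g x)) - (LINT x|half_line. \<psi> x * cnj (G x))"
      by (rule Bochner_Integration.integral_diff[OF square_integrable_mult_cnj[OF sq(2) g(1)] i1])
    finally show "(LINT x|half_line. \<psi> x * w x) = 0" using 1 2 by simp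
  qed
  then obtain c d where cd: "AE x in half_line. w x = c * bessel_regular \<nu> x + d * bessel_singular \<nu> x" by blast
  define f where "f x = G x + cnj c * bessel_regular \<nu> x + cnj d * bessel_singular \<nu> x" for x
  define f1 where "f1 x = G1 x + cnj c * regular_deriv \<nu> x + cnj d * singular_deriv \<nu> x" for x
  have sol: "bessel_sol \<nu> f f1 k"
    using bessel_sol_add[OF bessel_sol_add[OF G bessel_sol_cmult[OF bessel_sol_regular, of _ "cnj c"]] bessel_sol_cmult[OF bessel_sol_singular, of _ "cnj d"]]
    by (simp add: f_def[abs_def] f1_def[abs_def])
  have real: "cnj (bessel_regular \<nu> x) = bessel_regular \<nu> x" "cnj (bessel_singular \<nu> x) = bessel_singular \<nu> x" for x
    by (auto simp: bessel_regular_def bessel_singular_def)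
  have ae: "AE x in half_line. g x = f x"
    using cd
  proof eventually_elim
    case (elim x)
    have "g x - G x = cnj (w x)" by (simp add: w_def)
    also have "\<dots> = cnj c * bessel_regular \<nu> x + cnj d * bessel_singular \<nu> x" by (simp add: elim real)
    finally show ?case by (simp add: f_def algebra_simps)
  qed
  have fsq: "square_integrable f" by (rule square_integrable_cong_AE[OF g(1) bessel_solD(3)[OF sol] ae])
  have "G' = abs_L2_half_line f" using abs_L2_eq_iff[OF g(1) fsq] ae g(2) by simp
  moreover have "bessel_max \<nu> f f1 k" using sol fsq k(1) by (simp add: bessel_max_def)
  ultimately show "(G', K') \<in> bessel_graph \<nu>" using k(2) unfolding bessel_graph_def by blast
qed

lemma adjoint_bessel_minimal:
  assumes "0 \<le> \<nu>" "\<nu> < 1"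
  shows "adjoint_operator (bessel_minimal \<nu>) = bessel_graph \<nu>"
  using bessel_graph_subset_adjoint[OF assms] adjoint_subset_bessel_graph[OF assms]
  unfolding bessel_minimal_def adjoint_closure by blast


section \<open>Differentiation under the integral sign\<close>

lemma has_vector_derivative_quotientI:
  fixes F :: "real \<Rightarrow> complex"
  assumes "((\<lambda>y. (F y - F x) / of_real (y - x)) \<longlongrightarrow> D) (at x)"
  shows "(F has_vector_derivative D) (at x)"
  unfolding has_vector_derivative_def has_derivative_within
proof (intro conjI bounded_linear_scaleR_left)
  have "((\<lambda>y. norm ((F y - F x) / of_real (y - x) - D)) \<longlongrightarrow> norm (D - D)) (at x)"
    by (intro tendsto_intros assms)
  then have "((\<lambda>y. norm ((F y - F x) / of_real (y - x) - D)) \<longlongrightarrow> 0) (at x)" by simp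
  moreover have "eventually (\<lambda>y. norm ((F y - F x) / of_real (y - x) - D) = norm ((1 / norm (y - x)) *\<^sub>R (F y - (F x + (y - x) *\<^sub>R D)))) (at x)"
  proof -
    have "norm ((F y - F x) / of_real (y - x) - D) = norm ((1 / norm (y - x)) *\<^sub>R (F y - (F x + (y - x) *\<^sub>R D)))" if "y \<noteq> x" for y
    proof -
      have "(F y - F x) / of_real (y - x) - D = (F y - (F x + (y - x) *\<^sub>R D)) / of_real (y - x)"
        using that by (simp add: field_simps scaleR_conv_of_real)
      then show ?thesis by (simp add: norm_divide del: of_real_diff)
    qed
    then show ?thesis by (auto simp: eventually_at_filter)
  qed
  ultimately have "((\<lambda>y. norm ((1 / norm (y - x)) *\<^sub>R (F y - (F x + (y - x) *\<^sub>R D)))) \<longlongrightarrow> 0) (at x)"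
    by (rule Lim_transform_eventually)
  then show "((\<lambda>y. (1 / norm (y - x)) *\<^sub>R (F y - (F x + (y - x) *\<^sub>R D))) \<longlongrightarrow> 0) (at x)"
    by (rule tendsto_norm_zero_cancel)
qed

lemma vector_derivative_norm_bound:
  fixes f f' :: "real \<Rightarrow> complex"
  assumes d: "\<And>x. x \<in> {a<..<b} \<Longrightarrow> (f has_vector_derivative f' x) (at x)"
    and B: "\<And>x. x \<in> {a<..<b} \<Longrightarrow> cmod (f' x) \<le> B" and xy: "x \<in> {a<..<b}" "y \<in> {a<..<b}"
  shows "cmod (f y - f x) \<le> B * \<bar>y - x\<bar>"
proof -
  have "norm (f y - f x) \<le> B * norm (y - x)"
  proof (rule differentiable_bound[of "{a<..<b}" f "\<lambda>x h. h *\<^sub>R f' x"])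
    show "(f has_derivative (\<lambda>h. h *\<^sub>R f' z)) (at z within {a<..<b})" if "z \<in> {a<..<b}" for z
      using has_derivative_at_withinI[OF d[OF that, unfolded has_vector_derivative_def]] .
    show "onorm (\<lambda>h. h *\<^sub>R f' z) \<le> B" if "z \<in> {a<..<b}" for z
      using B[OF that] by (intro onorm_le) (simp add: mult.commute[of _ "cmod (f' z)"] mult_right_mono)
  qed (use xy in auto)
  then show ?thesis by simp
qed

text \<open>The difference quotients are dominated by \<open>g\<close> according to the mean value inequality, so
  dominated convergence applies.\<close>

lemma leibniz_rule_dominated:
  fixes f f' :: "real \<Rightarrow> 'a \<Rightarrow> complex"
  assumes x0: "x0 \<in> {a<..<b}"
    and i: "\<And>x. x \<in> {a<..<b} \<Longrightarrow> integrable M (f x)"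
    and d: "\<And>x s. x \<in> {a<..<b} \<Longrightarrow> s \<in> space M \<Longrightarrow> ((\<lambda>x. f x s) has_vector_derivative f' x s) (at x)"
    and B: "\<And>x s. x \<in> {a<..<b} \<Longrightarrow> s \<in> space M \<Longrightarrow> cmod (f' x s) \<le> g s"
    and g: "integrable M g" and m: "f' x0 \<in> borel_measurable M"
  shows "((\<lambda>x. LINT s|M. f x s) has_vector_derivative (LINT s|M. f' x0 s)) (at x0)"
    and "integrable M (f' x0)"
proof -
  show "integrable M (f' x0)"
    using B[OF x0] by (intro Bochner_Integration.integrable_bound[OF g m]) (auto intro!: AE_I2 order_trans[OF _ abs_ge_self])
  have op: "at x0 within {a<..<b} = at x0" using x0 by (intro at_within_open) auto
  show "((\<lambda>x. LINT s|M. f x s) has_vector_derivative (LINT s|M. f' x0 s)) (at x0)"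
  proof (rule has_vector_derivative_quotientI, subst op[symmetric], unfold tendsto_at_iff_sequentially, intro allI impI)
    fix X :: "nat \<Rightarrow> real" assume X: "\<forall>i. X i \<in> {a<..<b} - {x0}" "X \<longlonglongrightarrow> x0"
    have Xi: "X n \<in> {a<..<b}" "X n \<noteq> x0" for n using X(1) by auto
    have "(\<lambda>n. LINT s|M. (f (X n) s - f x0 s) / of_real (X n - x0)) \<longlonglongrightarrow> (LINT s|M. f' x0 s)"
    proof (rule integral_dominated_convergence[where w = g])
      show "(\<lambda>s. (f (X n) s - f x0 s) / of_real (X n - x0)) \<in> borel_measurable M" for n
        using i[OF Xi(1)[of n]] i[OF x0] by (intro borel_measurable_divide borel_measurable_diff borel_measurable_integrable) auto
      show "AE s in M. (\<lambda>n. (f (X n) s - f x0 s) / of_real (X n - x0)) \<longlonglongrightarrow> f' x0 s"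
      proof (rule AE_I2)
        fix s assume s: "s \<in> space M"
        have "((\<lambda>x. f x s) has_derivative (\<lambda>h. h *\<^sub>R f' x0 s)) (at x0)" using d[OF x0 s] by (simp add: has_vector_derivative_def)
        then have "((\<lambda>y. norm (f y s - f x0 s - (y - x0) *\<^sub>R f' x0 s) / norm (y - x0)) \<longlongrightarrow> 0) (at x0)"
          by (simp add: has_derivative_iff_norm)
        then have "((\<lambda>y. norm (f y s - f x0 s - (y - x0) *\<^sub>R f' x0 s) / norm (y - x0)) \<circ> X) \<longlonglongrightarrow> 0"
          unfolding tendsto_at_iff_sequentially using X by auto
        then have "(\<lambda>n. norm ((f (X n) s - f x0 s) / of_real (X n - x0) - f' x0 s)) \<longlonglongrightarrow> 0"
        proof (rule Lim_transform_eventually, intro always_eventually allI)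
          fix n
          have "(f (X n) s - f x0 s) / of_real (X n - x0) - f' x0 s = (f (X n) s - f x0 s - (X n - x0) *\<^sub>R f' x0 s) / of_real (X n - x0)"
            using Xi(2)[of n] by (simp add: field_simps scaleR_conv_of_real)
          then show "((\<lambda>y. norm (f y s - f x0 s - (y - x0) *\<^sub>R f' x0 s) / norm (y - x0)) \<circ> X) n = norm ((f (X n) s - f x0 s) / of_real (X n - x0) - f' x0 s)"
            by (simp add: norm_divide del: of_real_diff)
        qed
        then show "(\<lambda>n. (f (X n) s - f x0 s) / of_real (X n - x0)) \<longlonglongrightarrow> f' x0 s"
          by (simp add: tendsto_norm_zero_iff LIM_zero_iff)
      qed
      show "AE s in M. norm ((f (X n) s - f x0 s) / of_real (X n - x0)) \<le> g s" for n
      proof (rule AE_I2)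
        fix s assume s: "s \<in> space M"
        have "cmod (f (X n) s - f x0 s) \<le> g s * \<bar>X n - x0\<bar>"
          by (rule vector_derivative_norm_bound[of a b "\<lambda>x. f x s" "\<lambda>x. f' x s", OF d[OF _ s] B[OF _ s] x0 Xi(1)])
        then show "norm ((f (X n) s - f x0 s) / of_real (X n - x0)) \<le> g s"
          using Xi(2)[of n] by (simp add: norm_divide divide_le_eq del: of_real_diff)
      qed
    qed (use g m in auto)
    moreover have "(LINT s|M. (f (X n) s - f x0 s) / of_real (X n - x0)) = ((LINT s|M. f (X n) s) - (LINT s|M. f x0 s)) / of_real (X n - x0)" for n
      using i[OF Xi(1)[of n]] i[OF x0] by (simp del: of_real_diff)
    ultimately show "((\<lambda>y. ((LINT s|M. f y s) - (LINT s|M. f x0 s)) / of_real (y - x0)) \<circ> X) \<longlonglongrightarrow> (LINT s|M. f' x0 s)"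
      unfolding o_def by (simp only:)
  qed
qed

text \<open>With $n \ge p$ one has $w^n \le n^n e^w$, from $1 + w/n \le e^{w/n}$.\<close>

lemma exp_minus_le_powr:
  fixes p :: real
  assumes "p \<ge> 0" shows "\<exists>C\<ge>0. \<forall>w>0. exp (- w) \<le> C * w powr (- p)"
proof -
  obtain n :: nat where "max p 1 \<le> real n" using real_arch_simple by blast
  then have n: "p \<le> real n" "n > 0" by auto
  have "exp (- w) \<le> real n ^ n * w powr (- p)" if w: "w > 0" for w :: real
  proof -
    have n1: "real n ^ n \<ge> 1" using n by (intro one_le_power) auto
    have "w powr p \<le> real n ^ n * exp w"
    proof (cases "w \<le> 1")
      case True
      have "w powr p \<le> 1" using True w assms powr_mono'[of 0 p w] by simp
      also have "\<dots> \<le> real n ^ n * exp w" using w n1 mult_mono[of 1 "real n ^ n" 1 "exp w"] by simp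
      finally show ?thesis .
    next
      case False
      then have "w powr p \<le> w powr real n" using n by (intro powr_mono) auto
      also have "\<dots> = real n ^ n * (w / real n) ^ n" using w n by (simp add: powr_realpow power_divide)
      also have "\<dots> \<le> real n ^ n * (1 + w / real n) ^ n" using w n by (intro mult_left_mono power_mono) auto
      also have "\<dots> \<le> real n ^ n * exp w"
        using exp_ge_one_plus_x_over_n_power_n[of n w] w n by (intro mult_left_mono) auto
      finally show ?thesis .
    qed
    then show ?thesis using w by (simp add: powr_minus exp_minus field_simps)
  qed
  then show ?thesis by (intro exI[of _ "real n ^ n"]) auto
qed


section \<open>The Bessel integrals\<close>

text \<open>The absolute value of \<open>bessel_kernel a k x\<close> for \<open>c = Re k\<close>; at \<open>x = 0\<close> it is the integrand of the Gamma integral.\<close>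

definition bessel_weight :: "real \<Rightarrow> real \<Rightarrow> real \<Rightarrow> real \<Rightarrow> real" where
  "bessel_weight a c x s = s powr (a - 1) * exp (- (c * (s + x\<^sup>2 / (4 * s))))"

lemma bessel_weight_nonneg [simp]: "bessel_weight a c x s \<ge> 0"
  by (simp add: bessel_weight_def)

lemma measurable_bessel_weight: "bessel_weight a c x \<in> borel_measurable half_line"
  unfolding bessel_weight_def[abs_def] by (rule measurable_half_line_continuous) (auto intro!: continuous_intros)

lemma gamma_weight_bounds:
  assumes "c > 0" "a > 0"
  obtains C where "C \<ge> 0" "\<And>s. s > 0 \<Longrightarrow> bessel_weight a c 0 s \<le> C * s powr (a - 1)"
    "\<And>s. s > 0 \<Longrightarrow> bessel_weight a c 0 s \<le> C * s powr (-2)"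
proof -
  obtain C where C: "C \<ge> 0" "\<And>w. w > 0 \<Longrightarrow> exp (- w) \<le> C * w powr (- (a + 1))"
    using exp_minus_le_powr[of "a + 1"] assms by auto
  define D where "D = max 1 (C * c powr (- (a + 1)))"
  show ?thesis
  proof (rule that[of D])
    show "D \<ge> 0" by (simp add: D_def)
    fix s :: real assume s: "s > 0"
    have "bessel_weight a c 0 s \<le> s powr (a - 1) * 1" unfolding bessel_weight_def using s assms by (intro mult_left_mono) auto
    also have "\<dots> \<le> D * s powr (a - 1)" by (simp add: D_def mult_le_cancel_right1)
    finally show "bessel_weight a c 0 s \<le> D * s powr (a - 1)" .
    have "bessel_weight a c 0 s \<le> s powr (a - 1) * (C * (c * s) powr (- (a + 1)))"
      unfolding bessel_weight_def using C(2)[of "c * s"] s assms by (intro mult_left_mono) auto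
    also have "\<dots> = (C * c powr (- (a + 1))) * (s powr (a - 1) * s powr (- (a + 1)))"
      using s assms by (simp add: powr_mult)
    also have "s powr (a - 1) * s powr (- (a + 1)) = s powr (-2)" by (simp flip: powr_add)
    also have "(C * c powr (- (a + 1))) * s powr (-2) \<le> D * s powr (-2)" by (intro mult_right_mono) (auto simp: D_def)
    finally show "bessel_weight a c 0 s \<le> D * s powr (-2)" .
  qed
qed

lemma integrable_gamma_weight:
  assumes "c > 0" "a > 0" shows "integrable half_line (bessel_weight a c 0)"
proof -
  obtain C where C: "\<And>s. s > 0 \<Longrightarrow> bessel_weight a c 0 s \<le> C * s powr (a - 1)"
    "\<And>s. s > 0 \<Longrightarrow> bessel_weight a c 0 s \<le> C * s powr (-2)" using gamma_weight_bounds[OF assms] by metis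
  show ?thesis
    by (rule integrable_half_line_powr_bound[of _ "a - 1" "-2" C, OF measurable_bessel_weight]) (use C assms in auto)
qed

text \<open>The factor $e^{-c x^2/(4s)}$ is at most a constant times $(x^2/s)^{-p}$, which trades a power of
  \<open>x\<close> for a power of \<open>s\<close>. A large \<open>p\<close> gives decay at infinity, a
  small one the right order at \<open>0\<close>.\<close>

lemma bessel_weight_le_gamma:
  assumes "c > 0" "p \<ge> 0"
  obtains C where "C \<ge> 0" "\<And>x s. x > 0 \<Longrightarrow> s > 0 \<Longrightarrow> bessel_weight a c x s \<le> C * x powr (- (2 * p)) * bessel_weight (a + p) c 0 s"
proof -
  obtain C where C: "C \<ge> 0" "\<And>w. w > 0 \<Longrightarrow> exp (- w) \<le> C * w powr (- p)"
    using exp_minus_le_powr[OF assms(2)] by auto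
  show ?thesis
  proof (rule that[of "C * (c / 4) powr (- p)"])
    show "C * (c / 4) powr (- p) \<ge> 0" using C by simp
    fix x s :: real assume x: "x > 0" and s: "s > 0"
    have "exp (- (c * (s + x\<^sup>2 / (4 * s)))) = exp (- (c * s)) * exp (- (c * x\<^sup>2 / (4 * s)))"
      by (simp add: exp_add[symmetric] algebra_simps)
    then have "bessel_weight a c x s = s powr (a - 1) * exp (- (c * s)) * exp (- (c * x\<^sup>2 / (4 * s)))"
      by (simp add: bessel_weight_def)
    also have "\<dots> \<le> s powr (a - 1) * exp (- (c * s)) * (C * (c * x\<^sup>2 / (4 * s)) powr (- p))"
      using C(2)[of "c * x\<^sup>2 / (4 * s)"] x s assms by (intro mult_left_mono) auto
    also have "(c * x\<^sup>2 / (4 * s)) powr (- p) = (c / 4) powr (- p) * x powr (- (2 * p)) * s powr p"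
    proof -
      have e: "c * x\<^sup>2 / (4 * s) = (c / 4) * x powr 2 * s powr (-1)" using x s by (simp add: powr_minus field_simps)
      show ?thesis unfolding e by (simp only: powr_mult powr_powr) simp
    qed
    also have "s powr (a - 1) * exp (- (c * s)) * (C * ((c / 4) powr (- p) * x powr (- (2 * p)) * s powr p))
       = C * (c / 4) powr (- p) * x powr (- (2 * p)) * ((s powr (a - 1) * s powr p) * exp (- (c * s)))" by (simp add: mult_ac)
    also have "s powr (a - 1) * s powr p = s powr (a + p - 1)" by (simp flip: powr_add add: algebra_simps)
    finally show "bessel_weight a c x s \<le> C * (c / 4) powr (- p) * x powr (- (2 * p)) * bessel_weight (a + p) c 0 s"
      by (simp add: bessel_weight_def)
  qed
qed

lemma integrable_bessel_weight:
  assumes "c > 0" "x > 0" shows "integrable half_line (bessel_weight a c x)"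
proof -
  define p where "p = max 0 (1 - a)"
  obtain C where C: "\<And>x s. x > 0 \<Longrightarrow> s > 0 \<Longrightarrow> bessel_weight a c x s \<le> C * x powr (- (2 * p)) * bessel_weight (a + p) c 0 s"
    using bessel_weight_le_gamma[OF assms(1), of p] by (metis max.cobounded1 p_def)
  show ?thesis
  proof (rule Bochner_Integration.integrable_bound)
    show "integrable half_line (\<lambda>s. C * x powr (- (2 * p)) * bessel_weight (a + p) c 0 s)"
      using assms by (intro integrable_mult_right integrable_gamma_weight) (auto simp: p_def)
    show "AE s in half_line. norm (bessel_weight a c x s) \<le> norm (C * x powr (- (2 * p)) * bessel_weight (a + p) c 0 s)"
      by (rule AE_I2) (use C[OF assms(2)] in \<open>auto intro!: order_trans[OF _ abs_ge_self]\<close>)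
  qed (rule measurable_bessel_weight)
qed

definition bessel_kernel :: "real \<Rightarrow> complex \<Rightarrow> real \<Rightarrow> real \<Rightarrow> complex" where
  "bessel_kernel a k x s = of_real (s powr (a - 1)) * exp (- (k * of_real (s + x\<^sup>2 / (4 * s))))"

text \<open>Up to elementary factors this is the Macdonald function: $\int_0^\infty s^{a-1} e^{-k(s + x^2/(4s))} ds
  = 2 (x/2)^a K_a(kx)$.\<close>

definition bessel_integral :: "real \<Rightarrow> complex \<Rightarrow> real \<Rightarrow> complex" where
  "bessel_integral a k x = (LINT s|half_line. bessel_kernel a k x s)"

lemma norm_bessel_kernel: "cmod (bessel_kernel a k x s) = bessel_weight a (Re k) x s"
  by (simp add: bessel_kernel_def bessel_weight_def norm_mult)

lemma continuous_bessel_kernel: "continuous_on {0<..} (bessel_kernel a k x)"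
  unfolding bessel_kernel_def by (intro continuous_intros) auto

lemma measurable_bessel_kernel: "bessel_kernel a k x \<in> borel_measurable half_line"
  by (rule measurable_half_line_continuous[OF continuous_bessel_kernel])

lemma integrable_bessel_kernel:
  assumes k: "Re k > 0" and "x > 0 \<or> (x = 0 \<and> a > 0)" shows "integrable half_line (bessel_kernel a k x)"
proof (rule integrable_norm_cancel[OF _ measurable_bessel_kernel])
  show "integrable half_line (\<lambda>s. norm (bessel_kernel a k x s))"
    unfolding norm_bessel_kernel using assms integrable_bessel_weight[OF k] integrable_gamma_weight[OF k] by auto
qed

lemma bessel_weight_le_0:
  assumes "c > 0" "s > 0" shows "bessel_weight a c x s \<le> bessel_weight a c 0 s"
proof -
  have "c * s \<le> c * (s + x\<^sup>2 / (4 * s))" using assms by (intro mult_left_mono) auto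
  then show ?thesis unfolding bessel_weight_def by (intro mult_left_mono) auto
qed

lemma bessel_weight_tendsto_0:
  assumes c: "c > 0" and x: "x > 0 \<or> (x = 0 \<and> a > 1)"
  shows "(bessel_weight a c x \<longlongrightarrow> 0) (at_right 0)"
proof -
  have *: "\<exists>C b. b > 0 \<and> (\<forall>s>0. bessel_weight a c x s \<le> C * s powr b)"
  proof (cases "x > 0")
    case True
    define p where "p = max 0 (2 - a)"
    obtain C where C: "C \<ge> 0" "\<And>s. s > 0 \<Longrightarrow> bessel_weight a c x s \<le> C * x powr (- (2 * p)) * bessel_weight (a + p) c 0 s"
      using bessel_weight_le_gamma[OF c, of p] True by (metis max.cobounded1 p_def)
    have ap: "a + p > 1" by (simp add: p_def)
    obtain D where D: "\<And>s. s > 0 \<Longrightarrow> bessel_weight (a + p) c 0 s \<le> D * s powr (a + p - 1)"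
      using gamma_weight_bounds[OF c, of "a + p"] ap by (metis less_trans zero_less_one)
    have "bessel_weight a c x s \<le> C * x powr (- (2 * p)) * D * s powr (a + p - 1)" if "s > 0" for s
    proof -
      have "C * x powr (- (2 * p)) * bessel_weight (a + p) c 0 s \<le> C * x powr (- (2 * p)) * (D * s powr (a + p - 1))"
        using C(1) D[OF that] by (intro mult_left_mono) auto
      then show ?thesis using C(2)[OF that] by (simp add: mult.assoc)
    qed
    then show ?thesis using ap by (intro exI[of _ "C * x powr (- (2 * p)) * D"] exI[of _ "a + p - 1"]) auto
  next
    case False
    then have x: "x = 0" "a > 1" using x by auto
    obtain D where D: "\<And>s. s > 0 \<Longrightarrow> bessel_weight a c 0 s \<le> D * s powr (a - 1)"
      using gamma_weight_bounds[OF c, of a] x by (metis less_trans zero_less_one)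
    then show ?thesis using x by (intro exI[of _ D] exI[of _ "a - 1"]) auto
  qed
  then obtain C b where b: "b > 0" "\<And>s. s > 0 \<Longrightarrow> bessel_weight a c x s \<le> C * s powr b" by blast
  have pos: "eventually (\<lambda>s::real. 0 < s) (at_right 0)" by (simp add: eventually_at_right_less)
  show ?thesis
  proof (rule tendsto_sandwich)
    show "eventually (\<lambda>s. 0 \<le> bessel_weight a c x s) (at_right 0)" by simp
    show "eventually (\<lambda>s. bessel_weight a c x s \<le> C * s powr b) (at_right 0)" using pos by eventually_elim (rule b)
    have "((\<lambda>s. s powr b) \<longlongrightarrow> 0) (at_right 0)"
    proof (rule tendsto_zero_powrI[OF tendsto_ident_at tendsto_const _ b(1)])
      show "eventually (\<lambda>s::real. 0 \<le> s) (at_right 0)" using pos by eventually_elim auto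
    qed
    then show "((\<lambda>s. C * s powr b) \<longlongrightarrow> 0) (at_right 0)" by (rule tendsto_mult_right_zero)
  qed auto
qed

lemma bessel_weight_tendsto_inf:
  assumes c: "c > 0" shows "(bessel_weight a c x \<longlongrightarrow> 0) at_top"
proof -
  obtain C where C: "\<And>s. s > 0 \<Longrightarrow> bessel_weight (max a 1) c 0 s \<le> C * s powr (-2)"
    using gamma_weight_bounds[OF c, of "max a 1"] by (metis less_max_iff_disj zero_less_one)
  show ?thesis
  proof (rule tendsto_sandwich)
    show "eventually (\<lambda>s. 0 \<le> bessel_weight a c x s) at_top" by simp
    show "eventually (\<lambda>s. bessel_weight a c x s \<le> C * s powr (-2)) at_top"
      using eventually_ge_at_top[of 1]
    proof eventually_elim
      case (elim s)
      have "bessel_weight a c x s \<le> bessel_weight a c 0 s" using elim c by (intro bessel_weight_le_0) auto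
      also have "\<dots> \<le> bessel_weight (max a 1) c 0 s" unfolding bessel_weight_def using elim by (intro mult_right_mono powr_mono) auto
      also have "\<dots> \<le> C * s powr (-2)" using C[of s] elim by simp
      finally show ?case .
    qed
    have "((\<lambda>s::real. s powr (-2)) \<longlongrightarrow> 0) at_top" by (rule tendsto_neg_powr) (auto intro: filterlim_ident)
    then show "((\<lambda>s. C * s powr (-2)) \<longlongrightarrow> 0) at_top" by (rule tendsto_mult_right_zero)
  qed auto
qed

lemma half_line_FTC:
  fixes F f :: "real \<Rightarrow> complex"
  assumes d: "\<And>s. s > 0 \<Longrightarrow> (F has_vector_derivative f s) (at s)" and f: "integrable half_line f"
    and A: "(F \<longlongrightarrow> A) (at_right 0)" and B: "(F \<longlongrightarrow> B) at_top"
  shows "(LINT s|half_line. f s) = B - A"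
proof -
  define X :: "nat \<Rightarrow> real" where "X n = 1 / (real n + 1)" for n
  have X: "\<And>n. X n > 0" "X \<longlonglongrightarrow> 0" using inverse_sequence unfolding X_def[abs_def] by auto
  have "(\<lambda>n. F (real n) - F (X n)) \<longlonglongrightarrow> (LINT s|half_line. f s)"
    by (rule primitive_tendsto_integral[OF primitive_has_vector_derivative[OF d] f X filterlim_real_sequentially])
  moreover have "(\<lambda>n. F (real n) - F (X n)) \<longlonglongrightarrow> B - A"
    by (intro tendsto_diff tendsto_at_right_0_sequence[OF A X] filterlim_compose[OF B filterlim_real_sequentially])
  ultimately show ?thesis by (rule LIMSEQ_unique)
qed

text \<open>Substitution $s \mapsto c/s$. With $c = x^2/4$ it leaves the exponent of the Bessel kernel unchanged.\<close>

lemma half_line_reflection: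
  fixes f :: "real \<Rightarrow> complex"
  assumes f: "integrable half_line f" and c: "c > 0"
  shows "(LINT s|half_line. f s) = (LINT s|half_line. of_real (c / s\<^sup>2) * f (c / s))"
    and "integrable half_line (\<lambda>s. of_real (c / s\<^sup>2) * f (c / s))"
proof -
  have im: "(\<lambda>s. c / s) ` {0<..} = {0<..}"
  proof (intro equalityI subsetI)
    fix y :: real assume "y \<in> {0<..}"
    then have "y = c / (c / y)" "c / y \<in> {0<..}" using c by auto
    then show "y \<in> (\<lambda>s. c / s) ` {0<..}" by blast
  qed (use c in auto)
  have inj: "inj_on (\<lambda>s. c / s) {0<..}" using c by (auto simp: inj_on_def)
  have der: "((\<lambda>s. c / s) has_field_derivative - (c / s\<^sup>2)) (at s within {0<..})" if "s \<in> {0<..}" for s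
    using that by (auto intro!: derivative_eq_intros simp: power2_eq_square)
  have abs: "\<bar>- (c / s\<^sup>2)\<bar> = c / s\<^sup>2" for s using c by simp
  have "(\<lambda>s. \<bar>- (c / s\<^sup>2)\<bar> *\<^sub>R f (c / s)) absolutely_integrable_on {0<..} \<and> integral {0<..} (\<lambda>s. \<bar>- (c / s\<^sup>2)\<bar> *\<^sub>R f (c / s)) = integral {0<..} f
     \<longleftrightarrow> f absolutely_integrable_on ((\<lambda>s. c / s) ` {0<..}) \<and> integral ((\<lambda>s. c / s) ` {0<..}) f = integral {0<..} f"
    by (rule has_absolute_integral_change_of_variables_real[OF _ der inj]) auto
  then have *: "(\<lambda>s. of_real (c / s\<^sup>2) * f (c / s)) absolutely_integrable_on {0<..}"
     "integral {0<..} (\<lambda>s. of_real (c / s\<^sup>2) * f (c / s)) = integral {0<..} f"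
    unfolding im abs using f by (simp_all add: integrable_half_line_iff scaleR_conv_of_real)
  show i: "integrable half_line (\<lambda>s. of_real (c / s\<^sup>2) * f (c / s))" using *(1) by (simp only: integrable_half_line_iff)
  show "(LINT s|half_line. f s) = (LINT s|half_line. of_real (c / s\<^sup>2) * f (c / s))"
    unfolding half_line_integral_eq[OF i] half_line_integral_eq[OF f] using *(2) by simp
qed

lemma exp_kernel_derivative:
  fixes k :: complex and g :: "real \<Rightarrow> real"
  assumes "(g has_real_derivative g') (at s)"
  shows "((\<lambda>s. exp (- (k * of_real (g s)))) has_vector_derivative - (k * of_real g') * exp (- (k * of_real (g s)))) (at s)"
proof -
  have 1: "((\<lambda>s. - (k * complex_of_real (g s))) has_vector_derivative - (k * of_real g')) (at s)"
    by (intro has_vector_derivative_minus has_vector_derivative_mult_right has_vector_derivative_of_real assms)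
  have 2: "(exp has_field_derivative exp (- (k * of_real (g s)))) (at (- (k * of_real (g s))))" by (rule DERIV_exp)
  from field_vector_diff_chain_at[OF 1 2] show ?thesis by (simp add: o_def)
qed

lemma bessel_kernel_derivative:
  assumes s: "s > 0"
  shows "(bessel_kernel (a + 1) k x has_vector_derivative
     of_real a * bessel_kernel a k x s - k * bessel_kernel (a + 1) k x s + k * of_real (x\<^sup>2 / 4) * bessel_kernel (a - 1) k x s) (at s)"
proof -
  have 1: "((\<lambda>s. s powr a) has_real_derivative a * s powr (a - 1)) (at s)" using s by (auto intro!: derivative_eq_intros)
  have 2: "((\<lambda>s. s + x\<^sup>2 / (4 * s)) has_real_derivative 1 - x\<^sup>2 / (4 * s\<^sup>2)) (at s)"
    using s by (auto intro!: derivative_eq_intros simp: power2_eq_square field_simps)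
  let ?e = "exp (- (k * complex_of_real (s + x\<^sup>2 / (4 * s))))"
  have D: "((\<lambda>s. complex_of_real (s powr a) * exp (- (k * of_real (s + x\<^sup>2 / (4 * s))))) has_vector_derivative
     of_real (s powr a) * (- (k * of_real (1 - x\<^sup>2 / (4 * s\<^sup>2))) * ?e) + of_real (a * s powr (a - 1)) * ?e) (at s)"
    by (rule has_vector_derivative_mult[OF has_vector_derivative_of_real[OF 1] exp_kernel_derivative[OF 2]])
  have eq: "of_real (s powr a) * (- (k * of_real (1 - x\<^sup>2 / (4 * s\<^sup>2))) * ?e) + of_real (a * s powr (a - 1)) * ?e
     = of_real a * bessel_kernel a k x s - k * bessel_kernel (a + 1) k x s + k * of_real (x\<^sup>2 / 4) * bessel_kernel (a - 1) k x s"
  proof -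
    have e: "a - 1 - 1 = a - 2" "a + 1 - 1 = a" by simp_all
    have "complex_of_real (s powr (a - 2)) = of_real (s powr a) / (of_real s)\<^sup>2" using powr_shift[OF s, of a] by simp
    then show ?thesis unfolding bessel_kernel_def e using s by (simp add: field_simps)
  qed
  have K: "bessel_kernel (a + 1) k x = (\<lambda>s. complex_of_real (s powr a) * exp (- (k * of_real (s + x\<^sup>2 / (4 * s)))))"
    by (simp add: bessel_kernel_def fun_eq_iff)
  show ?thesis using D unfolding eq K[symmetric] .
qed

text \<open>The left-hand side is the integral of the derivative of \<open>bessel_kernel (a + 1) k x\<close>, which
  vanishes at both ends.\<close>

lemma bessel_integral_recurrence:
  assumes k: "Re k > 0" and x: "x > 0 \<or> (x = 0 \<and> a > 0)"
  shows "of_real a * bessel_integral a k x - k * bessel_integral (a + 1) k x + k * of_real (x\<^sup>2 / 4) * bessel_integral (a - 1) k x = 0"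
proof -
  have i: "integrable half_line (bessel_kernel a k x)" "integrable half_line (bessel_kernel (a + 1) k x)"
    using x by (auto intro!: integrable_bessel_kernel k)
  have i3: "integrable half_line (\<lambda>s. k * of_real (x\<^sup>2 / 4) * bessel_kernel (a - 1) k x s)"
  proof (cases "x = 0")
    case False
    then have "integrable half_line (bessel_kernel (a - 1) k x)" using x by (intro integrable_bessel_kernel k) auto
    then show ?thesis by (rule integrable_mult_right)
  qed simp
  have n: "((\<lambda>s. norm (bessel_kernel (a + 1) k x s)) \<longlongrightarrow> 0) (at_right 0)" "((\<lambda>s. norm (bessel_kernel (a + 1) k x s)) \<longlongrightarrow> 0) at_top"
    unfolding norm_bessel_kernel using bessel_weight_tendsto_0[OF k, of x "a + 1"] bessel_weight_tendsto_inf[OF k, of "a + 1" x] x by auto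
  have "(LINT s|half_line. of_real a * bessel_kernel a k x s - k * bessel_kernel (a + 1) k x s + k * of_real (x\<^sup>2 / 4) * bessel_kernel (a - 1) k x s) = 0 - 0"
    by (rule half_line_FTC[OF bessel_kernel_derivative _ tendsto_norm_zero_cancel[OF n(1)] tendsto_norm_zero_cancel[OF n(2)]])
       (use i i3 in auto)
  then show ?thesis using i i3 unfolding bessel_integral_def by simp
qed

lemma bessel_integral_reflection:
  assumes k: "Re k > 0" and x: "x > 0"
  shows "bessel_integral (- a) k x = of_real ((x\<^sup>2 / 4) powr (- a)) * bessel_integral a k x"
proof -
  have i: "integrable half_line (bessel_kernel (- a) k x)" using x by (intro integrable_bessel_kernel k) auto
  let ?c = "x\<^sup>2 / 4"
  have c: "?c > 0" using x by simp
  have "bessel_integral (- a) k x = (LINT s|half_line. of_real (?c / s\<^sup>2) * bessel_kernel (- a) k x (?c / s))"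
    unfolding bessel_integral_def by (rule half_line_reflection(1)[OF i c])
  also have "\<dots> = (LINT s|half_line. of_real (?c powr (- a)) * bessel_kernel a k x s)"
  proof (rule Bochner_Integration.integral_cong[OF refl])
    fix s :: real assume "s \<in> space half_line"
    then have s: "s > 0" by simp
    have 1: "?c / s + x\<^sup>2 / (4 * (?c / s)) = s + x\<^sup>2 / (4 * s)" using x s by (simp add: field_simps)
    have "(?c / s) powr (- a - 1) = ?c powr (- a - 1) / s powr (- a - 1)" by (rule powr_divide)
    also have "\<dots> = ?c powr (- a) / ?c * (s powr a * s)"
    proof -
      have "?c powr (- a - 1) = ?c powr (- a) / ?c" using c by (rule powr_shift1)
      moreover have "s powr (- a - 1) = 1 / (s powr a * s)" using s by (simp add: powr_diff powr_minus_divide)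
      ultimately show ?thesis by simp
    qed
    finally have "?c / s\<^sup>2 * (?c / s) powr (- a - 1) = ?c powr (- a) * (s powr a / s)"
      using c s by (simp add: power2_eq_square)
    also have "s powr a / s = s powr (a - 1)" using powr_shift1[OF s] by simp
    finally have 2: "complex_of_real (?c / s\<^sup>2) * of_real ((?c / s) powr (- a - 1)) = of_real (?c powr (- a)) * of_real (s powr (a - 1))"
      by (simp only: of_real_mult[symmetric])
    show "of_real (?c / s\<^sup>2) * bessel_kernel (- a) k x (?c / s) = of_real (?c powr (- a)) * bessel_kernel a k x s"
      unfolding bessel_kernel_def 1 mult.assoc[symmetric] 2 ..
  qed
  also have "\<dots> = of_real (?c powr (- a)) * bessel_integral a k x" by (simp add: bessel_integral_def)
  finally show ?thesis .
qed

lemma bessel_kernel_x_derivative: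
  assumes s: "s > 0"
  shows "((\<lambda>x. bessel_kernel a k x s) has_vector_derivative - (k * of_real (x / 2)) * bessel_kernel (a - 1) k x s) (at x)"
proof -
  have 1: "((\<lambda>x. s + x\<^sup>2 / (4 * s)) has_real_derivative x / (2 * s)) (at x)"
    using s by (auto intro!: derivative_eq_intros simp: field_simps)
  have D: "((\<lambda>x. bessel_kernel a k x s) has_vector_derivative
     of_real (s powr (a - 1)) * (- (k * of_real (x / (2 * s))) * exp (- (k * of_real (s + x\<^sup>2 / (4 * s)))))) (at x)"
    unfolding bessel_kernel_def by (rule has_vector_derivative_mult_right[OF exp_kernel_derivative[OF 1]])
  have e: "complex_of_real (s powr (a - 1 - 1)) = of_real (s powr (a - 1)) / of_real s" using powr_shift1[OF s, of "a - 1"] by simp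
  have "of_real (s powr (a - 1)) * (- (k * of_real (x / (2 * s))) * exp (- (k * of_real (s + x\<^sup>2 / (4 * s)))))
     = - (k * of_real (x / 2)) * bessel_kernel (a - 1) k x s"
    unfolding bessel_kernel_def e using s by (simp add: field_simps)
  then show ?thesis using D by (simp only:)
qed

text \<open>On a neighbourhood of \<open>x\<close> bounded away from \<open>0\<close> the kernels have a common
  integrable bound.\<close>

lemma bessel_integral_derivative:
  assumes k: "Re k > 0" and x: "x > 0"
  shows "(bessel_integral a k has_vector_derivative - (k * of_real (x / 2)) * bessel_integral (a - 1) k x) (at x)"
proof -
  have "((\<lambda>x. LINT s|half_line. bessel_kernel a k x s) has_vector_derivative
     (LINT s|half_line. - (k * of_real (x / 2)) * bessel_kernel (a - 1) k x s)) (at x)"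
  proof (rule leibniz_rule_dominated[where a = "x / 2" and b = "2 * x" and g = "\<lambda>s. cmod k * x * bessel_weight (a - 1) (Re k) (x / 2) s"])
    show "x \<in> {x / 2<..<2 * x}" using x by auto
    show "integrable half_line (bessel_kernel a k y)" if "y \<in> {x / 2<..<2 * x}" for y
      using that x by (intro integrable_bessel_kernel k) auto
    show "((\<lambda>x. bessel_kernel a k x s) has_vector_derivative - (k * of_real (y / 2)) * bessel_kernel (a - 1) k y s) (at y)"
      if "s \<in> space half_line" for y s using that by (intro bessel_kernel_x_derivative) simp
    show "integrable half_line (\<lambda>s. cmod k * x * bessel_weight (a - 1) (Re k) (x / 2) s)"
      using x k by (intro integrable_mult_right integrable_bessel_weight) auto
    show "(\<lambda>s. - (k * of_real (x / 2)) * bessel_kernel (a - 1) k x s) \<in> borel_measurable half_line"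
      by (intro borel_measurable_times measurable_bessel_kernel) auto
    fix y s assume y: "y \<in> {x / 2<..<2 * x}" and s: "s \<in> space half_line"
    have "(x / 2)\<^sup>2 \<le> y\<^sup>2" using y x by (intro power_mono) auto
    then have "Re k * (s + (x / 2)\<^sup>2 / (4 * s)) \<le> Re k * (s + y\<^sup>2 / (4 * s))"
      using s k by (intro mult_left_mono add_left_mono divide_right_mono) auto
    then have A: "bessel_weight (a - 1) (Re k) y s \<le> bessel_weight (a - 1) (Re k) (x / 2) s"
      unfolding bessel_weight_def by (intro mult_left_mono) auto
    have B: "cmod k * (\<bar>y\<bar> / 2) \<le> cmod k * x" using y x by (intro mult_left_mono) auto
    have "cmod k * (\<bar>y\<bar> / 2) * bessel_weight (a - 1) (Re k) y s \<le> cmod k * x * bessel_weight (a - 1) (Re k) (x / 2) s"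
      by (rule mult_mono[OF B A]) (use x in auto)
    then show "cmod (- (k * of_real (y / 2)) * bessel_kernel (a - 1) k y s) \<le> cmod k * x * bessel_weight (a - 1) (Re k) (x / 2) s"
      by (simp add: norm_mult norm_bessel_kernel)
  qed
  then show ?thesis by (simp add: bessel_integral_def[abs_def])
qed

lemma integral_at_right_0_limit:
  fixes f :: "real \<Rightarrow> real \<Rightarrow> complex"
  assumes m: "\<And>x. f x \<in> borel_measurable half_line" and g: "integrable half_line g"
    and le: "\<And>x s. s > 0 \<Longrightarrow> x > 0 \<Longrightarrow> cmod (f x s) \<le> g s" and lim: "\<And>s. s > 0 \<Longrightarrow> ((\<lambda>x. f x s) \<longlongrightarrow> f 0 s) (at_right 0)"
  shows "((\<lambda>x. LINT s|half_line. f x s) \<longlongrightarrow> (LINT s|half_line. f 0 s)) (at_right 0)"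
  unfolding tendsto_at_iff_sequentially
proof (intro allI impI)
  fix X :: "nat \<Rightarrow> real" assume "\<forall>i. X i \<in> {0<..} - {0}" "X \<longlonglongrightarrow> 0"
  then have X: "\<And>n. X n > 0" "X \<longlonglongrightarrow> 0" by auto
  have "(\<lambda>n. LINT s|half_line. f (X n) s) \<longlonglongrightarrow> (LINT s|half_line. f 0 s)"
    by (rule integral_dominated_convergence[OF m m g])
       (use X le tendsto_at_right_0_sequence[OF lim X] in \<open>auto intro!: AE_I2\<close>)
  then show "((\<lambda>x. LINT s|half_line. f x s) \<circ> X) \<longlonglongrightarrow> (LINT s|half_line. f 0 s)" by (simp add: o_def)
qed

lemma bessel_kernel_tendsto_0:
  assumes "s > 0" shows "((\<lambda>x. bessel_kernel a k x s) \<longlongrightarrow> bessel_kernel a k 0 s) (at_right 0)"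
proof -
  have "isCont (\<lambda>x. bessel_kernel a k x s) 0" by (rule has_vector_derivative_continuous[OF bessel_kernel_x_derivative[OF assms]])
  then show ?thesis by (simp add: continuous_at filterlim_at_split)
qed

lemma bessel_integral_tendsto_0:
  assumes k: "Re k > 0" and a: "a > 0"
  shows "(bessel_integral a k \<longlongrightarrow> bessel_integral a k 0) (at_right 0)"
  unfolding bessel_integral_def[abs_def]
  by (rule integral_at_right_0_limit[OF measurable_bessel_kernel integrable_gamma_weight[OF k a]])
     (auto simp: norm_bessel_kernel intro!: bessel_weight_le_0 k bessel_kernel_tendsto_0)

text \<open>Bounding the logarithm by powers allows the estimates for \<open>bessel_weight\<close> to be used for
  logarithmic integrals.\<close>

lemma abs_ln_le:
  assumes "s > (0::real)" shows "\<bar>ln s\<bar> \<le> 4 * (s powr (1/4) + s powr (-1/4))"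
proof (cases "s \<ge> 1")
  case True
  have "ln s \<le> s powr (1/4) / (1/4)" using True by (intro ln_powr_bound) auto
  then have "ln s \<le> 4 * s powr (1/4)" by simp
  moreover have "\<bar>ln s\<bar> = ln s" using True by simp
  ultimately show ?thesis using powr_ge_zero[of s "-1/4"] by argo
next
  case False
  have "ln (1 / s) \<le> (1 / s) powr (1/4) / (1/4)" using False assms by (intro ln_powr_bound) auto
  then have "- ln s \<le> 4 * s powr (-1/4)" using assms by (simp add: ln_div powr_divide powr_minus_divide)
  moreover have "\<bar>ln s\<bar> = - ln s" using False assms by simp
  ultimately show ?thesis using powr_ge_zero[of s "1/4"] by argo
qed

definition log_weight :: "real \<Rightarrow> real \<Rightarrow> real \<Rightarrow> real" where
  "log_weight a c s = 4 * (bessel_weight (a + 1/4) c 0 s + bessel_weight (a - 1/4) c 0 s)"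

lemma integrable_log_weight: "c > 0 \<Longrightarrow> a > 1/4 \<Longrightarrow> integrable half_line (log_weight a c)"
  unfolding log_weight_def[abs_def] by (intro integrable_mult_right Bochner_Integration.integrable_add integrable_gamma_weight) auto

lemma log_kernel_le:
  assumes "Re k > 0" "s > 0"
  shows "cmod (of_real (ln s) * bessel_kernel a k x s) \<le> log_weight a (Re k) s"
proof -
  have e: "s powr (1/4) * s powr (a - 1) = s powr (a + 1/4 - 1)" "s powr (-1/4) * s powr (a - 1) = s powr (a - 1/4 - 1)"
    by (simp_all flip: powr_add add: algebra_simps)
  have "cmod (of_real (ln s) * bessel_kernel a k x s) = \<bar>ln s\<bar> * bessel_weight a (Re k) x s"
    by (simp add: norm_mult norm_bessel_kernel)
  also have "\<dots> \<le> (4 * (s powr (1/4) + s powr (-1/4))) * bessel_weight a (Re k) 0 s"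
    using assms by (intro mult_mono abs_ln_le bessel_weight_le_0) auto
  also have "\<dots> = log_weight a (Re k) s"
    unfolding log_weight_def bessel_weight_def e[symmetric] by (simp add: algebra_simps)
  finally show ?thesis .
qed

lemma measurable_log_kernel: "(\<lambda>s. of_real (ln s) * bessel_kernel a k x s) \<in> borel_measurable half_line"
  by (rule measurable_half_line_continuous) (intro continuous_intros continuous_bessel_kernel, auto)

definition log_integral :: "complex \<Rightarrow> real \<Rightarrow> complex" where
  "log_integral k x = (LINT s|half_line. of_real (ln s) * bessel_kernel 1 k x s)"

lemma integrable_log_kernel:
  assumes "Re k > 0" "a > 1/4" shows "integrable half_line (\<lambda>s. of_real (ln s) * bessel_kernel a k x s)"
proof (rule Bochner_Integration.integrable_bound[OF integrable_log_weight[OF assms] measurable_log_kernel])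
  show "AE s in half_line. cmod (of_real (ln s) * bessel_kernel a k x s) \<le> norm (log_weight a (Re k) s)"
    by (rule AE_I2) (use log_kernel_le[OF assms(1)] in \<open>auto intro!: order_trans[OF _ abs_ge_self]\<close>)
qed

lemma log_integral_tendsto_0:
  assumes k: "Re k > 0" shows "(log_integral k \<longlongrightarrow> log_integral k 0) (at_right 0)"
  unfolding log_integral_def[abs_def]
  by (rule integral_at_right_0_limit[OF measurable_log_kernel integrable_log_weight[OF k, of 1]])
     (auto intro!: log_kernel_le k tendsto_mult bessel_kernel_tendsto_0)

text \<open>For index \<open>0\<close> the integral diverges logarithmically as $x \to 0$. Integrating $1/s = (\ln
  s)'$ by parts leaves integrals of $\ln s$ against \<open>bessel_kernel 1\<close> and against
  \<open>bessel_kernel (- 1)\<close>; the reflection $s \mapsto x^2/(4s)$ turns the second into the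
  first and produces the explicit logarithm.\<close>

lemma bessel_integral_0_log:
  assumes k: "Re k > 0" and x: "x > 0"
  shows "bessel_integral 0 k x = 2 * k * log_integral k x - of_real (ln (x\<^sup>2 / 4)) * k * bessel_integral 1 k x"
proof -
  let ?c = "x\<^sup>2 / 4"
  have c: "?c > 0" using x by simp
  let ?L = "\<lambda>s. of_real (ln s) * bessel_kernel 1 k x s"
  have iL: "integrable half_line ?L" by (rule integrable_log_kernel[OF k]) simp
  have i0: "integrable half_line (bessel_kernel 0 k x)" and i1: "integrable half_line (bessel_kernel 1 k x)"
    using x by (auto intro!: integrable_bessel_kernel k)
  let ?R = "\<lambda>s. of_real (?c / s\<^sup>2) * (of_real (ln (?c / s)) * bessel_kernel 1 k x (?c / s))"
  have R: "?R s = of_real (?c / s\<^sup>2) * of_real (ln ?c - ln s) * bessel_kernel 1 k x s" if s: "s > 0" for s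
  proof -
    have 1: "?c / s + x\<^sup>2 / (4 * (?c / s)) = s + x\<^sup>2 / (4 * s)" using x s by (simp add: field_simps)
    have 2: "ln (?c / s) = ln ?c - ln s" by (subst ln_div) (use c s in auto)
    show ?thesis unfolding bessel_kernel_def 1 2 using s x by simp
  qed
  have iR: "integrable half_line ?R" and LR: "log_integral k x = (LINT s|half_line. ?R s)"
    using half_line_reflection[OF iL c] by (auto simp: log_integral_def)
  let ?Q = "\<lambda>s. of_real (?c / s\<^sup>2) * bessel_kernel 1 k x (?c / s)"
  have Q: "?Q s = of_real (?c / s\<^sup>2) * bessel_kernel 1 k x s" if s: "s > 0" for s
  proof -
    have 1: "?c / s + x\<^sup>2 / (4 * (?c / s)) = s + x\<^sup>2 / (4 * s)" using x s by (simp add: field_simps)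
    show ?thesis unfolding bessel_kernel_def 1 using s x by simp
  qed
  have iQ: "integrable half_line ?Q" and EQ: "bessel_integral 1 k x = (LINT s|half_line. ?Q s)"
    using half_line_reflection[OF i1 c] by (auto simp: bessel_integral_def)
  let ?F = "\<lambda>s. of_real (ln s) * bessel_kernel 1 k x s"
  let ?f = "\<lambda>s. bessel_kernel 0 k x s - k * ?L s + k * (of_real (ln ?c) * ?Q s - ?R s)"
  have "(LINT s|half_line. ?f s) = 0 - 0"
  proof (rule half_line_FTC)
    show "(?F has_vector_derivative ?f s) (at s)" if s: "s > 0" for s
    proof -
      have 1: "(ln has_real_derivative 1 / s) (at s)" using s by (auto intro!: derivative_eq_intros)
      have D: "(?F has_vector_derivative of_real (ln s) * (of_real 0 * bessel_kernel 0 k x s - k * bessel_kernel 1 k x s + k * of_real ?c * bessel_kernel (-1) k x s)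
          + of_real (1 / s) * bessel_kernel 1 k x s) (at s)"
        using has_vector_derivative_mult[OF has_vector_derivative_of_real[OF 1] bessel_kernel_derivative[OF s, of 0 k x]] by simp
      have b0: "bessel_kernel 0 k x s = of_real (1 / s) * bessel_kernel 1 k x s"
        using s by (simp add: bessel_kernel_def powr_minus_divide)
      have "s powr (-1 - 1) = 1 / s\<^sup>2" using powr_shift[OF s, of 0] s by simp
      then have b1: "bessel_kernel (-1) k x s = of_real (1 / s\<^sup>2) * bessel_kernel 1 k x s"
        using s by (simp add: bessel_kernel_def)
      have "of_real (ln s) * (of_real 0 * bessel_kernel 0 k x s - k * bessel_kernel 1 k x s + k * of_real ?c * bessel_kernel (-1) k x s)
          + of_real (1 / s) * bessel_kernel 1 k x s = ?f s"
        unfolding R[OF s] Q[OF s] b0 b1 using s by (simp add: field_simps)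
      then show ?thesis using D by (simp only:)
    qed
    show "integrable half_line ?f"
      by (intro Bochner_Integration.integrable_add Bochner_Integration.integrable_diff integrable_mult_right i0 iL iQ iR)
    have le: "cmod (?F s) \<le> 4 * (bessel_weight (5/4) (Re k) x s + bessel_weight (3/4) (Re k) x s)" if s: "s > 0" for s
    proof -
      have "cmod (?F s) = \<bar>ln s\<bar> * bessel_weight 1 (Re k) x s" by (simp add: norm_mult norm_bessel_kernel)
      also have "\<dots> \<le> (4 * (s powr (1/4) + s powr (-1/4))) * bessel_weight 1 (Re k) x s"
        using s by (intro mult_right_mono abs_ln_le) auto
      also have "\<dots> = 4 * (bessel_weight (5/4) (Re k) x s + bessel_weight (3/4) (Re k) x s)"
        using s unfolding bessel_weight_def by (simp add: algebra_simps)
      finally show ?thesis .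
    qed
    have "((\<lambda>s. 4 * (bessel_weight (5/4) (Re k) x s + bessel_weight (3/4) (Re k) x s)) \<longlongrightarrow> 4 * (0 + 0)) (at_right 0)"
      using x k by (intro tendsto_mult tendsto_add tendsto_const bessel_weight_tendsto_0) auto
    then have l0: "((\<lambda>s. 4 * (bessel_weight (5/4) (Re k) x s + bessel_weight (3/4) (Re k) x s)) \<longlongrightarrow> 0) (at_right 0)" by simp
    show "(?F \<longlongrightarrow> 0) (at_right 0)"
      by (rule Lim_null_comparison[OF eventually_mono[OF eventually_at_right_less le] l0])
    have "((\<lambda>s. 4 * (bessel_weight (5/4) (Re k) x s + bessel_weight (3/4) (Re k) x s)) \<longlongrightarrow> 4 * (0 + 0)) at_top"
      using x k by (intro tendsto_mult tendsto_add tendsto_const bessel_weight_tendsto_inf) auto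
    then have l1: "((\<lambda>s. 4 * (bessel_weight (5/4) (Re k) x s + bessel_weight (3/4) (Re k) x s)) \<longlongrightarrow> 0) at_top" by simp
    show "(?F \<longlongrightarrow> 0) at_top"
      by (rule Lim_null_comparison[OF eventually_mono[OF eventually_gt_at_top le] l1])
  qed
  moreover have "(LINT s|half_line. ?f s) = bessel_integral 0 k x - k * log_integral k x + k * (of_real (ln ?c) * bessel_integral 1 k x - log_integral k x)"
  proof -
    have gen: "(LINT s|half_line. f0 s - k * f1 s + k * (c * f2 s - f3 s)) = (LINT s|half_line. f0 s) - k * (LINT s|half_line. f1 s) + k * (c * (LINT s|half_line. f2 s) - (LINT s|half_line. f3 s))"
      if "integrable half_line f0" "integrable half_line f1" "integrable half_line f2" "integrable half_line f3"
      for f0 f1 f2 f3 and c :: complex using that by simp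
    have b: "bessel_integral 0 k x = (LINT s|half_line. bessel_kernel 0 k x s)" "log_integral k x = (LINT s|half_line. ?L s)"
      by (auto simp: bessel_integral_def log_integral_def)
    show ?thesis unfolding gen[OF i0 iL iQ iR] b(1) b(2)[symmetric] LR[symmetric] EQ[symmetric] ..
  qed
  ultimately show ?thesis by (simp add: algebra_simps)
qed


section \<open>Gamma integrals with a complex exponent\<close>

lemma Gamma_half_line:
  assumes a: "a > 0" shows "bessel_integral a 1 0 = of_real (Gamma a)"
proof -
  have i: "integrable half_line (bessel_kernel a 1 0)" using a by (intro integrable_bessel_kernel) auto
  have "((\<lambda>t. of_real t powr (complex_of_real a - 1) / of_real (exp t)) has_integral Gamma (complex_of_real a)) {0<..}"
    using Gamma_integral_complex'[of "of_real a"] a by simp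
  then have "(bessel_kernel a 1 0 has_integral Gamma (complex_of_real a)) {0<..}"
  proof (rule has_integral_eq[rotated])
    fix t :: real assume "t \<in> {0<..}"
    then have t: "t > 0" by simp
    have "of_real t powr (complex_of_real a - 1) = complex_of_real (t powr (a - 1))"
      using t powr_of_real[of t "a - 1"] by simp
    then show "of_real t powr (complex_of_real a - 1) / of_real (exp t) = bessel_kernel a 1 0 t"
      unfolding bessel_kernel_def by (simp add: exp_minus field_simps exp_of_real[symmetric])
  qed
  then have "integral {0<..} (bessel_kernel a 1 0) = Gamma (complex_of_real a)" by (rule integral_unique)
  then show ?thesis unfolding bessel_integral_def half_line_integral_eq[OF i] by (simp add: Gamma_complex_of_real)
qed

lemma kernel_path_derivative:
  fixes k :: complex
  assumes s: "s > 0"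
  shows "((\<lambda>t. bessel_kernel a (1 + of_real t * (k - 1)) 0 s) has_vector_derivative
     - (k - 1) * bessel_kernel (a + 1) (1 + of_real t * (k - 1)) 0 s) (at t)"
proof -
  have 1: "((\<lambda>t. - ((1 + of_real t * (k - 1)) * of_real s)) has_vector_derivative - ((k - 1) * of_real s)) (at t)"
    by (auto intro!: derivative_eq_intros)
  have 2: "(exp has_field_derivative exp (- ((1 + of_real t * (k - 1)) * of_real s))) (at (- ((1 + of_real t * (k - 1)) * of_real s)))"
    by (rule DERIV_exp)
  have 3: "((\<lambda>t. complex_of_real (s powr (a - 1)) * exp (- ((1 + of_real t * (k - 1)) * of_real s))) has_vector_derivative
     of_real (s powr (a - 1)) * (- ((k - 1) * of_real s) * exp (- ((1 + of_real t * (k - 1)) * of_real s)))) (at t)"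
    using has_vector_derivative_mult_right[OF field_vector_diff_chain_at[OF 1 2], of "of_real (s powr (a - 1))"] by (simp add: o_def)
  have e: "complex_of_real (s powr (a + 1 - 1)) = of_real (s powr (a - 1)) * of_real s"
    using powr_shift1[OF s, of a] s by simp
  have K: "bessel_kernel b c 0 s = of_real (s powr (b - 1)) * exp (- (c * of_real s))" for b c by (simp add: bessel_kernel_def)
  have e4: "c * (- ((k - 1) * r) * X) = - (k - 1) * (c * r * X)" for c r X :: complex by (simp add: algebra_simps)
  show ?thesis using 3 unfolding K e e4 .
qed

text \<open>The case \<open>k = 1\<close> is the Gamma integral. Along the segment from \<open>1\<close> to
  \<open>k\<close> the product of the integral with $k^a$ is constant, because the derivative of the
  integral is the integral of index \<open>a + 1\<close> and the recurrence at \<open>x = 0\<close>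
  relates the two.\<close>

lemma bessel_integral_at_0:
  assumes k: "Re k > 0" and a: "a > 0"
  shows "bessel_integral a k 0 = of_real (Gamma a) * k powr (- of_real a)"
proof -
  define \<kappa> where "\<kappa> t = 1 + complex_of_real t * (k - 1)" for t
  define m where "m = min 1 (Re k)"
  \<comment> \<open>On the slightly longer segment for parameters in \<open>(-\<delta>, 1 + \<delta>)\<close> the real part stays above \<open>m / 2\<close>, so derivatives at the ends are two-sided.\<close>
  define \<delta> where "\<delta> = m / (2 * (1 + \<bar>Re k - 1\<bar>))"
  have m: "m > 0" using k by (simp add: m_def)
  have \<delta>: "\<delta> > 0" 
  proof -
    have "0 < 1 + \<bar>Re k - 1\<bar>" by (rule add_pos_nonneg) auto
    then show ?thesis unfolding \<delta>_def by (intro divide_pos_pos[OF m] mult_pos_pos) auto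
  qed
  have \<delta>2: "\<delta> * \<bar>Re k - 1\<bar> \<le> m / 2"
  proof -
    have "\<delta> * \<bar>Re k - 1\<bar> \<le> \<delta> * (1 + \<bar>Re k - 1\<bar>)" using \<delta> by (intro mult_left_mono) auto
    also have "\<dots> = m / 2"
    proof -
      have gen: "m / (2 * D) * D = m / 2" if "D \<noteq> 0" for D :: real using that by simp
      show ?thesis unfolding \<delta>_def by (rule gen) (use abs_ge_zero[of "Re k - 1"] in linarith)
    qed
    finally show ?thesis .
  qed
  have Re_\<kappa>: "Re (\<kappa> t) \<ge> m / 2" if t: "t \<in> {-\<delta><..<1 + \<delta>}" for t
  proof -
    define t' where "t' = max 0 (min 1 t)"
    have t': "0 \<le> t'" "t' \<le> 1" "\<bar>t - t'\<bar> \<le> \<delta>" using t \<delta> by (auto simp: t'_def)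
    have "m * 1 \<le> 1 * (1 - t') + Re k * t'"
    proof -
      have "m * (1 - t') + m * t' \<le> 1 * (1 - t') + Re k * t'"
        using t' by (intro add_mono mult_right_mono) (auto simp: m_def)
      then show ?thesis by (simp add: algebra_simps)
    qed
    moreover have "\<bar>(t - t') * (Re k - 1)\<bar> \<le> m / 2"
      using mult_right_mono[OF t'(3), of "\<bar>Re k - 1\<bar>"] \<delta>2 by (simp add: abs_mult)
    moreover have "Re (\<kappa> t) = (1 * (1 - t') + Re k * t') + (t - t') * (Re k - 1)" by (simp add: \<kappa>_def algebra_simps)
    ultimately show ?thesis by (smt (verit) field_sum_of_halves)
  qed
  then have Rpos: "Re (\<kappa> t) > 0" if "t \<in> {-\<delta><..<1 + \<delta>}" for t using that m by fastforce
  define F where "F t = bessel_integral a (\<kappa> t) 0" for t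
  have dF: "(F has_vector_derivative - (k - 1) * bessel_integral (a + 1) (\<kappa> t) 0) (at t)" if t: "t \<in> {-\<delta><..<1 + \<delta>}" for t
  proof -
    have "((\<lambda>t. LINT s|half_line. bessel_kernel a (\<kappa> t) 0 s) has_vector_derivative
      (LINT s|half_line. - (k - 1) * bessel_kernel (a + 1) (\<kappa> t) 0 s)) (at t)"
    proof (rule leibniz_rule_dominated[OF t, where g = "\<lambda>s. cmod (k - 1) * bessel_weight (a + 1) (m / 2) 0 s"])
      show "integrable half_line (bessel_kernel a (\<kappa> y) 0)" if "y \<in> {-\<delta><..<1 + \<delta>}" for y
        by (rule integrable_bessel_kernel[OF Rpos[OF that]]) (use a in auto)
      show "((\<lambda>x. bessel_kernel a (\<kappa> x) 0 s) has_vector_derivative - (k - 1) * bessel_kernel (a + 1) (\<kappa> y) 0 s) (at y)"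
        if "s \<in> space half_line" for y s
        unfolding \<kappa>_def by (rule kernel_path_derivative) (use that in simp)
      show "integrable half_line (\<lambda>s. cmod (k - 1) * bessel_weight (a + 1) (m / 2) 0 s)"
        by (intro integrable_mult_right integrable_gamma_weight) (use a m in auto)
      show "(\<lambda>s. - (k - 1) * bessel_kernel (a + 1) (\<kappa> t) 0 s) \<in> borel_measurable half_line"
        by (intro borel_measurable_times measurable_bessel_kernel) auto
      fix y s assume y: "y \<in> {-\<delta><..<1 + \<delta>}" and "s \<in> space half_line"
      then have s: "s > 0" by simp
      have "m / 2 * s \<le> Re (\<kappa> y) * s" using Re_\<kappa>[OF y] s by (intro mult_right_mono) auto
      then have "bessel_weight (a + 1) (Re (\<kappa> y)) 0 s \<le> bessel_weight (a + 1) (m / 2) 0 s"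
        unfolding bessel_weight_def by (intro mult_left_mono) auto
      then show "cmod (- (k - 1) * bessel_kernel (a + 1) (\<kappa> y) 0 s) \<le> cmod (k - 1) * bessel_weight (a + 1) (m / 2) 0 s"
        unfolding norm_mult norm_minus_cancel norm_bessel_kernel by (rule mult_left_mono) simp
    qed
    then show ?thesis by (simp add: F_def[abs_def] bessel_integral_def)
  qed
  have dP: "((\<lambda>t. \<kappa> t powr of_real a) has_vector_derivative (k - 1) * (of_real a * \<kappa> t powr (of_real a - 1))) (at t)"
    if t: "t \<in> {-\<delta><..<1 + \<delta>}" for t
  proof -
    have 1: "(\<kappa> has_vector_derivative (k - 1)) (at t)" unfolding \<kappa>_def[abs_def] by (auto intro!: derivative_eq_intros)
    have "\<kappa> t \<notin> \<real>\<^sub>\<le>\<^sub>0" using Rpos[OF t] by (auto simp: complex_nonpos_Reals_iff)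
    from field_vector_diff_chain_at[OF 1 has_field_derivative_powr[OF this]] show ?thesis by (simp add: o_def)
  qed
  have dJ: "((\<lambda>t. \<kappa> t powr of_real a * F t) has_vector_derivative 0) (at t)" if t: "t \<in> {-\<delta><..<1 + \<delta>}" for t
  proof -
    have nz: "\<kappa> t \<noteq> 0" using Rpos[OF t] by auto
    have rec: "of_real a * bessel_integral a (\<kappa> t) 0 = \<kappa> t * bessel_integral (a + 1) (\<kappa> t) 0"
      using bessel_integral_recurrence[OF Rpos[OF t], of 0 a] a by simp
    have "\<kappa> t powr of_real a = \<kappa> t powr (of_real a - 1) * \<kappa> t" using nz by (simp add: powr_diff)
    then have "\<kappa> t powr of_real a * (- (k - 1) * bessel_integral (a + 1) (\<kappa> t) 0) + (k - 1) * (of_real a * \<kappa> t powr (of_real a - 1)) * F t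
       = (k - 1) * \<kappa> t powr (of_real a - 1) * (of_real a * bessel_integral a (\<kappa> t) 0 - \<kappa> t * bessel_integral (a + 1) (\<kappa> t) 0)"
      by (simp add: F_def algebra_simps)
    also have "\<dots> = 0" using rec by simp
    finally show ?thesis using has_vector_derivative_mult[OF dP[OF t] dF[OF t]] by simp
  qed
  have "cmod (\<kappa> 1 powr of_real a * F 1 - \<kappa> 0 powr of_real a * F 0) \<le> 0 * \<bar>1 - 0\<bar>"
    by (rule vector_derivative_norm_bound[OF dJ]) (use \<delta> in auto)
  then have "\<kappa> 1 powr of_real a * F 1 = \<kappa> 0 powr of_real a * F 0" by simp
  then have "k powr of_real a * bessel_integral a k 0 = of_real (Gamma a)"
    by (simp add: \<kappa>_def F_def Gamma_half_line[OF a])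
  moreover have "k powr of_real a \<noteq> 0" using k by auto
  ultimately show ?thesis by (simp add: powr_minus nonzero_eq_divide_eq mult.commute flip: divide_inverse)
qed

text \<open>Differentiation of \<open>bessel_integral_at_0\<close> with respect to \<open>a\<close> at \<open>a =
  1\<close>, where the derivative of the Gamma function is minus the constant of Euler.\<close>

lemma log_integral_at_0:
  assumes k: "Re k > 0"
  shows "log_integral k 0 = (- euler_mascheroni - Ln k) / k"
proof -
  have nz: "k \<noteq> 0" using k by auto
  have 1: "((\<lambda>a. LINT s|half_line. bessel_kernel a k 0 s) has_vector_derivative (LINT s|half_line. of_real (ln s) * bessel_kernel 1 k 0 s)) (at 1)"
  proof (rule leibniz_rule_dominated[where a = "1/2" and b = "3/2" and g = "\<lambda>s. log_weight (1/2) (Re k) s + log_weight (3/2) (Re k) s"])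
    show "integrable half_line (bessel_kernel a k 0)" if "a \<in> {1/2<..<3/2}" for a
      by (rule integrable_bessel_kernel[OF k]) (use that in auto)
    show "((\<lambda>a. bessel_kernel a k 0 s) has_vector_derivative of_real (ln s) * bessel_kernel a k 0 s) (at a)" if "s \<in> space half_line" for a s
    proof -
      have s: "s > 0" using that by simp
      have "((\<lambda>a. s powr (a - 1)) has_real_derivative ln s * s powr (a - 1)) (at a)"
        using s by (auto intro!: derivative_eq_intros)
      from has_vector_derivative_mult_left[OF has_vector_derivative_of_real[OF this], of "exp (- (k * of_real (s + 0\<^sup>2 / (4 * s))))"]
      show ?thesis by (simp add: bessel_kernel_def mult.assoc)
    qed
    show "integrable half_line (\<lambda>s. log_weight (1/2) (Re k) s + log_weight (3/2) (Re k) s)"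
      by (intro Bochner_Integration.integrable_add integrable_log_weight k) auto
    fix a s assume a: "a \<in> {1/2<..<3/2::real}" and "s \<in> space half_line"
    then have s: "s > 0" by simp
    have "cmod (of_real (ln s) * bessel_kernel a k 0 s) = \<bar>ln s\<bar> * bessel_weight a (Re k) 0 s" by (simp add: norm_mult norm_bessel_kernel)
    also have "\<dots> \<le> \<bar>ln s\<bar> * (bessel_weight (1/2) (Re k) 0 s + bessel_weight (3/2) (Re k) 0 s)"
    proof (rule mult_left_mono)
      have "s powr (a - 1) \<le> s powr (1/2 - 1) + s powr (3/2 - 1)"
      proof (cases "s \<le> 1")
        case True
        then have "s powr (a - 1) \<le> s powr (1/2 - 1)" using a s by (intro powr_mono') auto
        then show ?thesis using powr_ge_zero[of s "3/2 - 1"] by linarith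
      next
        case False
        then have "s powr (a - 1) \<le> s powr (3/2 - 1)" using a s by (intro powr_mono) auto
        then show ?thesis using powr_ge_zero[of s "1/2 - 1"] by linarith
      qed
      then have "s powr (a - 1) * exp (- (Re k * (s + 0\<^sup>2 / (4 * s)))) \<le> (s powr (1/2 - 1) + s powr (3/2 - 1)) * exp (- (Re k * (s + 0\<^sup>2 / (4 * s))))"
        by (rule mult_right_mono) simp
      then show "bessel_weight a (Re k) 0 s \<le> bessel_weight (1/2) (Re k) 0 s + bessel_weight (3/2) (Re k) 0 s"
        unfolding bessel_weight_def distrib_right .
    qed simp
    also have "\<dots> = cmod (of_real (ln s) * bessel_kernel (1/2) k 0 s) + cmod (of_real (ln s) * bessel_kernel (3/2) k 0 s)"
      by (simp add: norm_mult norm_bessel_kernel distrib_left)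
    also have "\<dots> \<le> log_weight (1/2) (Re k) s + log_weight (3/2) (Re k) s"
      by (intro add_mono log_kernel_le k s)
    finally show "cmod (of_real (ln s) * bessel_kernel a k 0 s) \<le> log_weight (1/2) (Re k) s + log_weight (3/2) (Re k) s" .
  qed (auto intro: measurable_log_kernel)
  have G: "(Gamma has_real_derivative - euler_mascheroni) (at (1::real))"
    using has_field_derivative_Gamma[of "1::real" UNIV] by simp
  have P: "((\<lambda>a. k powr (- complex_of_real a)) has_vector_derivative - (Ln k * k powr (- 1))) (at 1)"
  proof -
    have d1: "((\<lambda>a. - complex_of_real a) has_vector_derivative - 1) (at 1)" by (auto intro!: derivative_eq_intros)
    have d2: "((\<lambda>w. k powr w) has_field_derivative Ln k * k powr (- complex_of_real 1)) (at (- complex_of_real 1))"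
      using nz by (auto intro!: derivative_eq_intros simp: mult.commute has_field_derivative_powr_right)
    from field_vector_diff_chain_at[OF d1 d2] show ?thesis by (simp add: o_def)
  qed
  have 2: "((\<lambda>a. of_real (Gamma a) * k powr (- complex_of_real a)) has_vector_derivative
     of_real (Gamma 1) * - (Ln k * k powr (- 1)) + of_real (- euler_mascheroni) * k powr (- complex_of_real 1)) (at (1::real))"
    by (rule has_vector_derivative_mult[OF has_vector_derivative_of_real[OF G] P])
  have 3: "((\<lambda>a. LINT s|half_line. bessel_kernel a k 0 s) has_vector_derivative
     of_real (Gamma 1) * - (Ln k * k powr (- 1)) + of_real (- euler_mascheroni) * k powr (- complex_of_real 1)) (at (1::real))"
    by (rule has_vector_derivative_transform_within_open[OF 2, of "{0<..}"])
       (auto simp: bessel_integral_at_0[OF k, symmetric] bessel_integral_def)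
  have "log_integral k 0 = of_real (Gamma 1) * - (Ln k * k powr (- 1)) + of_real (- euler_mascheroni) * k powr (- complex_of_real 1)"
    unfolding log_integral_def by (rule vector_derivative_unique_at[OF 1 3])
  also have "\<dots> = (- euler_mascheroni - Ln k) / k"
    using nz powr_minus[of k 1] by (simp add: powr_minus field_simps)
  finally show ?thesis .
qed


section \<open>The decaying solution\<close>

text \<open>Up to a factor depending on \<open>\<nu>\<close> and \<open>k\<close> this is $\sqrt x K_\nu(kx)$.\<close>

definition weyl_sol :: "real \<Rightarrow> complex \<Rightarrow> real \<Rightarrow> complex" where
  "weyl_sol \<nu> k x = bessel_regular \<nu> x * bessel_integral (- \<nu>) k x"

definition weyl_sol_deriv :: "real \<Rightarrow> complex \<Rightarrow> real \<Rightarrow> complex" where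
  "weyl_sol_deriv \<nu> k x = regular_deriv \<nu> x * bessel_integral (- \<nu>) k x
     - bessel_regular \<nu> x * (k * of_real (x / 2) * bessel_integral (- \<nu> - 1) k x)"

lemma regular_deriv_x: "x > 0 \<Longrightarrow> regular_deriv \<nu> x * of_real x = of_real (1/2 + \<nu>) * bessel_regular \<nu> x"
proof -
  assume x: "x > 0"
  have e: "\<nu> - 1/2 = (1/2 + \<nu>) - 1" by simp
  show ?thesis unfolding regular_deriv_def bessel_regular_def e powr_shift1[OF x] using x by simp
qed

text \<open>Two derivatives of \<open>bessel_integral (- \<nu>) k\<close> lead to the indices \<open>- \<nu> -
  1\<close> and \<open>- \<nu> - 2\<close>; the recurrence eliminates the latter and the terms with the
  former cancel.\<close>

lemma bessel_sol_weyl: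
  assumes k: "Re k > 0"
  shows "bessel_sol \<nu> (weyl_sol \<nu> k) (weyl_sol_deriv \<nu> k) (\<lambda>x. - (k\<^sup>2) * weyl_sol \<nu> k x)"
  unfolding bessel_sol_def
proof (intro conjI allI impI primitive_has_vector_derivative)
  fix x :: real assume x: "x > 0"
  let ?u = "bessel_regular \<nu>" and ?u1 = "regular_deriv \<nu>"
  let ?E = "bessel_integral (- \<nu>) k" and ?E1 = "bessel_integral (- \<nu> - 1) k" and ?E2 = "bessel_integral (- \<nu> - 2) k"
  have du: "(?u has_vector_derivative ?u1 x) (at x)" by (rule has_vector_derivative_regular[OF x])
  have du1: "(?u1 has_vector_derivative bessel_q \<nu> x * ?u x) (at x)"
    using primitive_continuous_has_vector_derivative[OF bessel_solD(2)[OF bessel_sol_regular[of \<nu>]] _ x]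
      continuous_on_mult[OF continuous_on_bessel_q continuous_singular_regular(1)[of \<nu>]] by simp
  have dE: "(?E has_vector_derivative - (k * of_real (x / 2)) * ?E1 x) (at x)" by (rule bessel_integral_derivative[OF k x])
  have dE1: "(?E1 has_vector_derivative - (k * of_real (x / 2)) * ?E2 x) (at x)"
  proof -
    have e: "- \<nu> - 2 = - \<nu> - 1 - 1" by simp
    show ?thesis unfolding e by (rule bessel_integral_derivative[OF k x])
  qed
  have "((\<lambda>x. ?u x * ?E x) has_vector_derivative ?u x * (- (k * of_real (x / 2)) * ?E1 x) + ?u1 x * ?E x) (at x)"
    by (rule has_vector_derivative_mult[OF du dE])
  then show "(weyl_sol \<nu> k has_vector_derivative weyl_sol_deriv \<nu> k x) (at x)"
    by (simp add: weyl_sol_def[abs_def] weyl_sol_deriv_def algebra_simps)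
  have dx: "((\<lambda>x. k * complex_of_real (x / 2)) has_vector_derivative k * of_real (1 / 2)) (at x)"
    by (intro has_vector_derivative_mult_right has_vector_derivative_of_real) (auto intro!: derivative_eq_intros)
  have 1: "((\<lambda>x. ?u1 x * ?E x - ?u x * (k * of_real (x / 2) * ?E1 x)) has_vector_derivative
     (?u1 x * (- (k * of_real (x / 2)) * ?E1 x) + bessel_q \<nu> x * ?u x * ?E x) -
     (?u x * (k * of_real (x / 2) * (- (k * of_real (x / 2)) * ?E2 x) + k * of_real (1 / 2) * ?E1 x) + ?u1 x * (k * of_real (x / 2) * ?E1 x))) (at x)"
    by (rule has_vector_derivative_diff[OF has_vector_derivative_mult[OF du1 dE] has_vector_derivative_mult[OF du has_vector_derivative_mult[OF dx dE1]]])
  have rec: "of_real (- \<nu> - 1) * ?E1 x - k * ?E x + k * of_real (x\<^sup>2 / 4) * ?E2 x = 0"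
  proof -
    have e: "- \<nu> - 1 + 1 = - \<nu>" "- \<nu> - 1 - 1 = - \<nu> - 2" by simp_all
    show ?thesis using bessel_integral_recurrence[OF k, of x "- \<nu> - 1"] x unfolding e by blast
  qed
  have "(?u1 x * (- (k * of_real (x / 2)) * ?E1 x) + bessel_q \<nu> x * ?u x * ?E x) -
     (?u x * (k * of_real (x / 2) * (- (k * of_real (x / 2)) * ?E2 x) + k * of_real (1 / 2) * ?E1 x) + ?u1 x * (k * of_real (x / 2) * ?E1 x))
     = bessel_q \<nu> x * ?u x * ?E x - k * (?u1 x * of_real x) * ?E1 x - ?u x * k / 2 * ?E1 x + ?u x * k * (k * of_real (x\<^sup>2 / 4) * ?E2 x)"
    by (simp add: field_simps power2_eq_square)
  also have "k * of_real (x\<^sup>2 / 4) * ?E2 x = k * ?E x + of_real (\<nu> + 1) * ?E1 x" using rec by (simp add: algebra_simps)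
  also have "?u1 x * of_real x = of_real (1/2 + \<nu>) * ?u x" by (rule regular_deriv_x[OF x])
  also have "bessel_q \<nu> x * ?u x * ?E x - k * (of_real (1/2 + \<nu>) * ?u x) * ?E1 x - ?u x * k / 2 * ?E1 x + ?u x * k * (k * ?E x + of_real (\<nu> + 1) * ?E1 x)
     = bessel_q \<nu> x * weyl_sol \<nu> k x - - (k\<^sup>2) * weyl_sol \<nu> k x"
    by (simp add: weyl_sol_def field_simps power2_eq_square)
  finally show "(weyl_sol_deriv \<nu> k has_vector_derivative bessel_q \<nu> x * weyl_sol \<nu> k x - - (k\<^sup>2) * weyl_sol \<nu> k x) (at x)"
    using 1 by (simp only: weyl_sol_deriv_def[abs_def])
qed

lemma square_integrable_weyl_sol:
  assumes k: "Re k > 0" and \<nu>: "0 \<le> \<nu>" "\<nu> < 1"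
  shows "square_integrable (weyl_sol \<nu> k)"
proof -
  have bound: "\<exists>C. \<forall>x>0. cmod (weyl_sol \<nu> k x) \<le> C * x powr (1/2 + \<nu> - 2 * p)" if p: "p > \<nu>" for p
  proof -
    have p0: "p \<ge> 0" using p \<nu> by simp
    obtain C where C: "C \<ge> 0" "\<And>x s. x > 0 \<Longrightarrow> s > 0 \<Longrightarrow> bessel_weight (- \<nu>) (Re k) x s \<le> C * x powr (- (2 * p)) * bessel_weight (- \<nu> + p) (Re k) 0 s"
      using bessel_weight_le_gamma[OF k p0] by metis
    define G where "G = (LINT s|half_line. bessel_weight (- \<nu> + p) (Re k) 0 s)"
    have iG: "integrable half_line (bessel_weight (- \<nu> + p) (Re k) 0)" using p by (intro integrable_gamma_weight k) auto
    have "cmod (weyl_sol \<nu> k x) \<le> C * G * x powr (1/2 + \<nu> - 2 * p)" if x: "x > 0" for x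
    proof -
      have "cmod (bessel_integral (- \<nu>) k x) \<le> (LINT s|half_line. bessel_weight (- \<nu>) (Re k) x s)"
        unfolding bessel_integral_def using Bochner_Integration.integral_norm_bound[of half_line "bessel_kernel (- \<nu>) k x"]
        by (simp add: norm_bessel_kernel)
      also have "\<dots> \<le> (LINT s|half_line. C * x powr (- (2 * p)) * bessel_weight (- \<nu> + p) (Re k) 0 s)"
        using C(2)[OF x] by (intro integral_mono integrable_mult_right iG integrable_bessel_weight k x) auto
      also have "\<dots> = C * x powr (- (2 * p)) * G" by (simp add: G_def)
      finally have "cmod (weyl_sol \<nu> k x) \<le> x powr (1/2 + \<nu>) * (C * x powr (- (2 * p)) * G)"
        unfolding weyl_sol_def norm_mult by (intro mult_mono) (auto simp: bessel_regular_def)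
      also have "\<dots> = C * G * (x powr (1/2 + \<nu>) * x powr (- (2 * p)))" by simp
      also have "x powr (1/2 + \<nu>) * x powr (- (2 * p)) = x powr (1/2 + \<nu> - 2 * p)" by (simp flip: powr_add)
      finally show ?thesis .
    qed
    then show ?thesis by blast
  qed
  \<comment> \<open>The first exponent \<open>p = (1 + 3 \<nu>) / 4\<close> exceeds \<open>\<nu>\<close> and gives the power \<open>x powr (- \<nu> / 2)\<close> near \<open>0\<close>; the second one serves at infinity.\<close>
  obtain C where C: "\<And>x. x > 0 \<Longrightarrow> cmod (weyl_sol \<nu> k x) \<le> C * x powr (1/2 + \<nu> - 2 * ((1 + 3 * \<nu>) / 4))"
    using bound[of "(1 + 3 * \<nu>) / 4"] \<nu> by auto
  obtain D where D: "\<And>x. x > 0 \<Longrightarrow> cmod (weyl_sol \<nu> k x) \<le> D * x powr (1/2 + \<nu> - 2 * 2)"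
    using bound[of 2] \<nu> by auto
  show ?thesis
  proof (rule square_integrable_powr_bound[of _ "1/2 + \<nu> - 2 * ((1 + 3 * \<nu>) / 4)" "1/2 + \<nu> - 2 * 2" "max C D"])
    show "weyl_sol \<nu> k \<in> borel_measurable half_line"
      by (rule measurable_half_line_continuous[OF bessel_solD(3)[OF bessel_sol_weyl[OF k]]])
    show "cmod (weyl_sol \<nu> k x) \<le> max C D * x powr (1/2 + \<nu> - 2 * ((1 + 3 * \<nu>) / 4))" if "0 < x" for x
      by (rule order_trans[OF C[OF that] mult_right_mono]) auto
    show "cmod (weyl_sol \<nu> k x) \<le> max C D * x powr (1/2 + \<nu> - 2 * 2)" if "1 < x" for x
      by (rule order_trans[OF D mult_right_mono]) (use that in auto)
  qed (use \<nu> in \<open>auto simp: field_simps\<close>)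
qed

lemma powr_quotient_aux:
  assumes "x > (0::real)" shows "x powr (2 * b) * (x\<^sup>2 / 4) powr (- b) = 4 powr b"
proof -
  have e: "x\<^sup>2 / 4 = x powr 2 * (1/4)" using assms by simp
  have "(x\<^sup>2 / 4) powr (- b) = x powr (- (2 * b)) * (1/4) powr (- b)" unfolding e powr_mult powr_powr by simp
  moreover have "(1/4::real) powr (- b) = 4 powr b" by (simp add: powr_minus powr_divide)
  moreover have "x powr (2 * b) * x powr (- (2 * b)) = 1" using assms by (simp flip: powr_add)
  ultimately show ?thesis by (metis mult.assoc mult_1)
qed

text \<open>In the bracket with \<open>bessel_regular\<close> only the derivative of the integral survives. It has
  the index \<open>- \<nu> - 1\<close>; reflection turns it into the index \<open>\<nu> + 1\<close>,
  whose integral converges at \<open>x = 0\<close>.\<close>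

lemma weyl_sol_bracket_reg:
  assumes k: "Re k > 0" and \<nu>: "0 \<le> \<nu>"
  shows "(bracket_reg \<nu> (weyl_sol \<nu> k) (weyl_sol_deriv \<nu> k) \<longlongrightarrow>
     k / 2 * of_real (4 powr (\<nu> + 1)) * (of_real (Gamma (\<nu> + 1)) * k powr (- of_real (\<nu> + 1)))) (at_right 0)"
proof -
  have eq: "bracket_reg \<nu> (weyl_sol \<nu> k) (weyl_sol_deriv \<nu> k) x = k / 2 * of_real (4 powr (\<nu> + 1)) * bessel_integral (\<nu> + 1) k x" if x: "x > 0" for x
  proof -
    have r: "bessel_integral (- \<nu> - 1) k x = of_real ((x\<^sup>2 / 4) powr (- (\<nu> + 1))) * bessel_integral (\<nu> + 1) k x"
      using bessel_integral_reflection[OF k x, of "\<nu> + 1"] by simp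
    have "x powr (1/2 + \<nu>) * x powr (1/2 + \<nu>) * x = x powr (2 * (\<nu> + 1))"
    proof -
      have "x powr (2 * (\<nu> + 1)) = x powr (1/2 + \<nu>) * x powr (1/2 + \<nu>) * x powr 1"
        unfolding powr_add[symmetric] by (simp add: algebra_simps)
      then show ?thesis using x by simp
    qed
    then have p: "x powr (1/2 + \<nu>) * x powr (1/2 + \<nu>) * x * (x\<^sup>2 / 4) powr (- (\<nu> + 1)) = 4 powr (\<nu> + 1)"
      using powr_quotient_aux[OF x, of "\<nu> + 1"] by simp
    have "bracket_reg \<nu> (weyl_sol \<nu> k) (weyl_sol_deriv \<nu> k) x
      = k / 2 * (bessel_regular \<nu> x * bessel_regular \<nu> x * of_real x) * bessel_integral (- \<nu> - 1) k x"
      unfolding bracket_reg_def weyl_sol_def weyl_sol_deriv_def by (simp add: algebra_simps)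
    also have "\<dots> = k / 2 * of_real (x powr (1/2 + \<nu>) * x powr (1/2 + \<nu>) * x * (x\<^sup>2 / 4) powr (- (\<nu> + 1))) * bessel_integral (\<nu> + 1) k x"
      unfolding r bessel_regular_def by simp
    finally show ?thesis unfolding p .
  qed
  have "((\<lambda>x. k / 2 * of_real (4 powr (\<nu> + 1)) * bessel_integral (\<nu> + 1) k x) \<longlongrightarrow>
     k / 2 * of_real (4 powr (\<nu> + 1)) * bessel_integral (\<nu> + 1) k 0) (at_right 0)"
    using \<nu> by (intro tendsto_mult_left bessel_integral_tendsto_0 k) auto
  then have "((\<lambda>x. k / 2 * of_real (4 powr (\<nu> + 1)) * bessel_integral (\<nu> + 1) k x) \<longlongrightarrow>
     k / 2 * of_real (4 powr (\<nu> + 1)) * (of_real (Gamma (\<nu> + 1)) * k powr (- of_real (\<nu> + 1)))) (at_right 0)"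
    using \<nu> by (simp only: bessel_integral_at_0[OF k, of "\<nu> + 1"])
  then show ?thesis
    by (rule Lim_transform_eventually) (auto intro!: eventually_mono[OF eventually_at_right_less] simp: eq)
qed

text \<open>By reflection the solution is also a multiple of \<open>bessel_singular\<close> times
  \<open>bessel_integral \<nu> k\<close>, so the same cancellation occurs and the index \<open>1 - \<nu>
  > 0\<close> remains.\<close>

lemma weyl_sol_bracket_sing:
  assumes k: "Re k > 0" and \<nu>: "0 < \<nu>" "\<nu> < 1"
  shows "(bracket_sing \<nu> (weyl_sol \<nu> k) (weyl_sol_deriv \<nu> k) \<longlongrightarrow>
     2 * k * (of_real (Gamma (1 - \<nu>)) * k powr (- of_real (1 - \<nu>)))) (at_right 0)"
proof -
  let ?v = "bessel_singular \<nu>" and ?v1 = "singular_deriv \<nu>"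
  let ?c = "complex_of_real (4 powr \<nu>)"
  have \<psi>: "weyl_sol \<nu> k x = ?c * (?v x * bessel_integral \<nu> k x)" if x: "x > 0" for x
  proof -
    have "x powr (1/2 + \<nu>) * (x\<^sup>2 / 4) powr (- \<nu>) = x powr (1/2 - \<nu>) * (x powr (2 * \<nu>) * (x\<^sup>2 / 4) powr (- \<nu>))"
      by (simp add: add.commute flip: powr_add mult.assoc)
    also have "\<dots> = x powr (1/2 - \<nu>) * 4 powr \<nu>" by (simp only: powr_quotient_aux[OF x])
    finally have "complex_of_real (x powr (1/2 + \<nu>)) * of_real ((x\<^sup>2 / 4) powr (- \<nu>)) = of_real (x powr (1/2 - \<nu>)) * of_real (4 powr \<nu>)"
      by (simp only: of_real_mult[symmetric])
    then show ?thesis using \<nu> unfolding weyl_sol_def bessel_integral_reflection[OF k x] bessel_regular_def bessel_singular_def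
      by (simp add: mult_ac)
  qed
  have \<psi>1: "weyl_sol_deriv \<nu> k x = ?c * (?v x * (- (k * of_real (x / 2)) * bessel_integral (\<nu> - 1) k x) + ?v1 x * bessel_integral \<nu> k x)" if x: "x > 0" for x
  proof -
    have "((\<lambda>x. ?c * (?v x * bessel_integral \<nu> k x)) has_vector_derivative ?c * (?v x * (- (k * of_real (x / 2)) * bessel_integral (\<nu> - 1) k x) + ?v1 x * bessel_integral \<nu> k x)) (at x)"
      by (intro has_vector_derivative_mult_right has_vector_derivative_mult bessel_solD(1)[OF bessel_sol_singular x] bessel_integral_derivative k x)
    then have "(weyl_sol \<nu> k has_vector_derivative ?c * (?v x * (- (k * of_real (x / 2)) * bessel_integral (\<nu> - 1) k x) + ?v1 x * bessel_integral \<nu> k x)) (at x)"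
      by (rule has_vector_derivative_transform_within_open[of _ _ _ "{0<..}"]) (use x \<psi> in auto)
    from vector_derivative_unique_at[OF bessel_solD(1)[OF bessel_sol_weyl[OF k] x] this] show ?thesis .
  qed
  have eq: "bracket_sing \<nu> (weyl_sol \<nu> k) (weyl_sol_deriv \<nu> k) x = 2 * k * bessel_integral (1 - \<nu>) k x" if x: "x > 0" for x
  proof -
    have r: "bessel_integral (\<nu> - 1) k x = of_real ((x\<^sup>2 / 4) powr (- (1 - \<nu>))) * bessel_integral (1 - \<nu>) k x"
      using bessel_integral_reflection[OF k x, of "1 - \<nu>"] by simp
    have "x powr (1/2 - \<nu>) * x powr (1/2 - \<nu>) * x = x powr (2 * (1 - \<nu>))"
    proof -
      have "x powr (2 * (1 - \<nu>)) = x powr (1/2 - \<nu>) * x powr (1/2 - \<nu>) * x powr 1"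
        unfolding powr_add[symmetric] by (simp add: algebra_simps)
      then show ?thesis using x by simp
    qed
    then have "x powr (1/2 - \<nu>) * x powr (1/2 - \<nu>) * x * (x\<^sup>2 / 4) powr (- (1 - \<nu>)) = 4 powr (1 - \<nu>)"
      using powr_quotient_aux[OF x, of "1 - \<nu>"] by simp
    moreover have "(4::real) powr \<nu> * 4 powr (1 - \<nu>) = 4" by (simp flip: powr_add)
    ultimately have p: "4 powr \<nu> * (x powr (1/2 - \<nu>) * x powr (1/2 - \<nu>) * x * (x\<^sup>2 / 4) powr (- (1 - \<nu>))) = 4" by simp
    have "bracket_sing \<nu> (weyl_sol \<nu> k) (weyl_sol_deriv \<nu> k) x = k / 2 * (?c * (?v x * ?v x * of_real x)) * bessel_integral (\<nu> - 1) k x"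
      unfolding bracket_sing_def \<psi>[OF x] \<psi>1[OF x] by (simp add: algebra_simps)
    also have "\<dots> = k / 2 * of_real (4 powr \<nu> * (x powr (1/2 - \<nu>) * x powr (1/2 - \<nu>) * x * (x\<^sup>2 / 4) powr (- (1 - \<nu>)))) * bessel_integral (1 - \<nu>) k x"
      unfolding r bessel_singular_def using \<nu> by simp
    finally show ?thesis unfolding p by simp
  qed
  have "((\<lambda>x. 2 * k * bessel_integral (1 - \<nu>) k x) \<longlongrightarrow> 2 * k * bessel_integral (1 - \<nu>) k 0) (at_right 0)"
    using \<nu> by (intro tendsto_mult_left bessel_integral_tendsto_0 k) auto
  then have "((\<lambda>x. 2 * k * bessel_integral (1 - \<nu>) k x) \<longlongrightarrow> 2 * k * (of_real (Gamma (1 - \<nu>)) * k powr (- of_real (1 - \<nu>)))) (at_right 0)"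
    using \<nu> by (simp only: bessel_integral_at_0[OF k, of "1 - \<nu>"] diff_gt_0_iff_gt)
  then show ?thesis
    by (rule Lim_transform_eventually) (auto intro!: eventually_mono[OF eventually_at_right_less] simp: eq)
qed

text \<open>The logarithm in \<open>bessel_integral_0_log\<close> cancels against the one in
  \<open>bessel_singular\<close>.\<close>

lemma weyl_sol_bracket_sing_0:
  assumes k: "Re k > 0"
  shows "(bracket_sing 0 (weyl_sol 0 k) (weyl_sol_deriv 0 k) \<longlongrightarrow>
     2 * (- euler_mascheroni - Ln k + of_real (ln 2))) (at_right 0)"
proof -
  have nz: "k \<noteq> 0" using k by auto
  have eq: "bracket_sing 0 (weyl_sol 0 k) (weyl_sol_deriv 0 k) x = 2 * k * log_integral k x + of_real (2 * ln 2) * k * bessel_integral 1 k x" if x: "x > 0" for x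
  proof -
    have r: "bessel_integral (- 1) k x = of_real (4 / x\<^sup>2) * bessel_integral 1 k x"
      using bessel_integral_reflection[OF k x, of 1] x by (simp add: powr_minus_divide)
    have l: "ln (x\<^sup>2 / 4) = 2 * ln x - 2 * ln 2"
    proof -
      have "ln (x\<^sup>2 / 4) = ln (x\<^sup>2) - ln 4" using x by (subst ln_div) auto
      moreover have "ln (4::real) = 2 * ln 2" using ln_realpow[of 2 2] by simp
      ultimately show ?thesis using x by (simp add: ln_realpow)
    qed
    define u u1 where "u = x powr (1/2)" and "u1 = 1/2 * x powr (-1/2)"
    have uu: "u * u = x" using x by (simp add: u_def flip: powr_add)
    have ux: "x powr (-1/2) * u = 1" using x by (simp add: u_def flip: powr_add)
    have "bracket_sing 0 (weyl_sol 0 k) (weyl_sol_deriv 0 k) x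
        = of_real (u * x powr (-1/2)) * bessel_integral 0 k x + of_real (u * u * ln x) * (k * of_real (x / 2) * bessel_integral (-1) k x)"
      unfolding bracket_sing_def weyl_sol_def weyl_sol_deriv_def bessel_regular_def regular_deriv_def singular_deriv_def bessel_singular_def u_def
      by (simp add: algebra_simps)
    also have "\<dots> = bessel_integral 0 k x + of_real (x * ln x) * (k * of_real (x / 2) * bessel_integral (-1) k x)"
      unfolding uu using ux by (simp add: mult.commute)
    also have "\<dots> = bessel_integral 0 k x + 2 * of_real (ln x) * k * bessel_integral 1 k x"
      unfolding r using x by (simp add: power2_eq_square)
    also have "\<dots> = 2 * k * log_integral k x + of_real (2 * ln 2) * k * bessel_integral 1 k x"
      unfolding bessel_integral_0_log[OF k x] l by (simp add: algebra_simps)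
    finally show ?thesis .
  qed
  have "((\<lambda>x. 2 * k * log_integral k x + of_real (2 * ln 2) * k * bessel_integral 1 k x) \<longlongrightarrow>
     2 * k * log_integral k 0 + of_real (2 * ln 2) * k * bessel_integral 1 k 0) (at_right 0)"
    by (intro tendsto_add tendsto_mult_left bessel_integral_tendsto_0 log_integral_tendsto_0 k) auto
  moreover have "2 * k * log_integral k 0 + of_real (2 * ln 2) * k * bessel_integral 1 k 0 = 2 * (- euler_mascheroni - Ln k + of_real (ln 2))"
    using nz unfolding log_integral_at_0[OF k] bessel_integral_at_0[OF k zero_less_one] by (simp add: powr_minus field_simps)
  ultimately have "((\<lambda>x. 2 * k * log_integral k x + of_real (2 * ln 2) * k * bessel_integral 1 k x) \<longlongrightarrow> 2 * (- euler_mascheroni - Ln k + of_real (ln 2))) (at_right 0)"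
    by simp
  then show ?thesis
    by (rule Lim_transform_eventually) (auto intro!: eventually_mono[OF eventually_at_right_less] simp: eq)
qed


section \<open>The boundary maps on the maximal domain\<close>

text \<open>This makes \<open>csqrt (- z)\<close> an admissible parameter of the decaying solution for every
  \<open>z\<close> off the positive half-line.\<close>

lemma Re_csqrt_pos:
  assumes "w \<notin> \<real>\<^sub>\<le>\<^sub>0" shows "Re (csqrt w) > 0"
proof -
  have "Re (csqrt w) \<noteq> 0"
  proof
    assume 0: "Re (csqrt w) = 0"
    have "w = (csqrt w)\<^sup>2" by simp
    also have "csqrt w = \<i> * of_real (Im (csqrt w))" using 0 by (simp add: complex_eq_iff)
    also have "\<dots>\<^sup>2 = of_real (- (Im (csqrt w))\<^sup>2)" by (simp add: power_mult_distrib)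
    finally have "w \<in> \<real>\<^sub>\<le>\<^sub>0" by (metis nonpos_Reals_of_real_iff neg_le_0_iff_le zero_le_power2)
    then show False using assms by simp
  qed
  then show ?thesis using csqrt_principal[of w] by linarith
qed

lemma minus_notin_nonpos: "z \<notin> \<real>\<^sub>\<ge>\<^sub>0 \<Longrightarrow> - z \<notin> \<real>\<^sub>\<le>\<^sub>0" for z :: complex
  by (auto simp: complex_nonpos_Reals_iff complex_nonneg_Reals_iff)

lemma bessel_max_weyl:
  assumes z: "z \<notin> \<real>\<^sub>\<ge>\<^sub>0" and \<nu>: "0 \<le> \<nu>" "\<nu> < 1"
  shows "bessel_max \<nu> (weyl_sol \<nu> (csqrt (- z))) (weyl_sol_deriv \<nu> (csqrt (- z))) (\<lambda>x. z * weyl_sol \<nu> (csqrt (- z)) x)"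
proof -
  have k: "Re (csqrt (- z)) > 0" by (rule Re_csqrt_pos[OF minus_notin_nonpos[OF z]])
  have "- ((csqrt (- z))\<^sup>2) = z" by simp
  then show ?thesis using bessel_sol_weyl[OF k, of \<nu>] square_integrable_weyl_sol[OF k \<nu>]
    by (simp add: bessel_max_def square_integrable_scale)
qed

text \<open>The choice of representatives and limits hidden in the boundary maps is resolved here once and for all.\<close>

lemma bessel_graph_cases:
  assumes \<nu>: "0 \<le> \<nu>" "\<nu> < 1" and FH: "(F, H) \<in> bessel_graph \<nu>"
  obtains f f1 h where "F = abs_L2_half_line f" "H = abs_L2_half_line h" "bessel_max \<nu> f f1 h"
    "(bracket_reg \<nu> f f1 \<longlongrightarrow> bessel_Gamma0 \<nu> F) (at_right 0)"
    "(bracket_sing \<nu> f f1 \<longlongrightarrow> - of_real (kappa \<nu>) * bessel_Gamma1 \<nu> F) (at_right 0)"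
    "bracket_0_exists F (bessel_regular \<nu>)" "bracket_0_exists F (bessel_singular \<nu>)"
proof -
  obtain f f1 h where f: "F = abs_L2_half_line f" "H = abs_L2_half_line h" "bessel_max \<nu> f f1 h"
    using FH unfolding bessel_graph_def by blast
  obtain l0 where l0: "(bracket_reg \<nu> f f1 \<longlongrightarrow> l0) (at_right 0)" using bracket_reg_converges[OF \<nu> f(3)] by blast
  obtain l1 where l1: "(bracket_sing \<nu> f f1 \<longlongrightarrow> l1) (at_right 0)" using bracket_reg_converges[OF \<nu> f(3)] by blast
  have g0: "bessel_Gamma0 \<nu> F = l0" unfolding bessel_Gamma0_def f(1) by (rule bracket_0_regular(1)[OF f(3) l0])
  have "bracket_0 F (bessel_singular \<nu>) = l1" unfolding f(1) by (rule bracket_0_regular(3)[OF f(3) l1])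
  then have g1: "- of_real (kappa \<nu>) * bessel_Gamma1 \<nu> F = l1"
    unfolding bessel_Gamma1_def kappa_def by (auto simp: field_simps)
  show ?thesis
    by (rule that[OF f]) (use l0 l1 g0 g1 bracket_0_regular(2)[OF f(3) l0] bracket_0_regular(4)[OF f(3) l1] f(1) in auto)
qed

lemma bessel_GammaI:
  assumes f: "bessel_max \<nu> f f1 h" and l0: "(bracket_reg \<nu> f f1 \<longlongrightarrow> l0) (at_right 0)" and l1: "(bracket_sing \<nu> f f1 \<longlongrightarrow> l1) (at_right 0)"
  shows "bessel_Gamma0 \<nu> (abs_L2_half_line f) = l0" "bessel_Gamma1 \<nu> (abs_L2_half_line f) = - l1 / of_real (kappa \<nu>)"
proof -
  show "bessel_Gamma0 \<nu> (abs_L2_half_line f) = l0" unfolding bessel_Gamma0_def by (rule bracket_0_regular(1)[OF f l0])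
  have "bracket_0 (abs_L2_half_line f) (bessel_singular \<nu>) = l1" by (rule bracket_0_regular(3)[OF f l1])
  then show "bessel_Gamma1 \<nu> (abs_L2_half_line f) = - l1 / of_real (kappa \<nu>)"
    unfolding bessel_Gamma1_def kappa_def by auto
qed

lemma bessel_graph_add:
  assumes \<nu>: "0 \<le> \<nu>" "\<nu> < 1" and FH: "(F, H) \<in> bessel_graph \<nu>" and GK: "(G, K) \<in> bessel_graph \<nu>"
  shows "(F + G, H + K) \<in> bessel_graph \<nu>" "bessel_Gamma0 \<nu> (F + G) = bessel_Gamma0 \<nu> F + bessel_Gamma0 \<nu> G"
    "bessel_Gamma1 \<nu> (F + G) = bessel_Gamma1 \<nu> F + bessel_Gamma1 \<nu> G"
proof -
  obtain f f1 h where f: "F = abs_L2_half_line f" "H = abs_L2_half_line h" "bessel_max \<nu> f f1 h"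
    "(bracket_reg \<nu> f f1 \<longlongrightarrow> bessel_Gamma0 \<nu> F) (at_right 0)"
    "(bracket_sing \<nu> f f1 \<longlongrightarrow> - of_real (kappa \<nu>) * bessel_Gamma1 \<nu> F) (at_right 0)"
    by (rule bessel_graph_cases[OF \<nu> FH])
  obtain g g1 k where g: "G = abs_L2_half_line g" "K = abs_L2_half_line k" "bessel_max \<nu> g g1 k"
    "(bracket_reg \<nu> g g1 \<longlongrightarrow> bessel_Gamma0 \<nu> G) (at_right 0)"
    "(bracket_sing \<nu> g g1 \<longlongrightarrow> - of_real (kappa \<nu>) * bessel_Gamma1 \<nu> G) (at_right 0)"
    by (rule bessel_graph_cases[OF \<nu> GK])
  have m: "bessel_max \<nu> (\<lambda>x. f x + g x) (\<lambda>x. f1 x + g1 x) (\<lambda>x. h x + k x)" by (rule bessel_max_add[OF f(3) g(3)])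
  have s: "F + G = abs_L2_half_line (\<lambda>x. f x + g x)" "H + K = abs_L2_half_line (\<lambda>x. h x + k x)"
    using f(1-3) g(1-3) by (auto simp: abs_L2_add bessel_max_def)
  show "(F + G, H + K) \<in> bessel_graph \<nu>" using m unfolding s bessel_graph_def by blast
  have b0: "bracket_reg \<nu> (\<lambda>x. f x + g x) (\<lambda>x. f1 x + g1 x) = (\<lambda>x. bracket_reg \<nu> f f1 x + bracket_reg \<nu> g g1 x)"
    and b1: "bracket_sing \<nu> (\<lambda>x. f x + g x) (\<lambda>x. f1 x + g1 x) = (\<lambda>x. bracket_sing \<nu> f f1 x + bracket_sing \<nu> g g1 x)"
    by (auto simp: bracket_reg_def bracket_sing_def algebra_simps)
  have l0: "(bracket_reg \<nu> (\<lambda>x. f x + g x) (\<lambda>x. f1 x + g1 x) \<longlongrightarrow> bessel_Gamma0 \<nu> F + bessel_Gamma0 \<nu> G) (at_right 0)"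
    unfolding b0 by (rule tendsto_add[OF f(4) g(4)])
  have l1: "(bracket_sing \<nu> (\<lambda>x. f x + g x) (\<lambda>x. f1 x + g1 x) \<longlongrightarrow> - of_real (kappa \<nu>) * bessel_Gamma1 \<nu> F + - of_real (kappa \<nu>) * bessel_Gamma1 \<nu> G) (at_right 0)"
    unfolding b1 by (rule tendsto_add[OF f(5) g(5)])
  show "bessel_Gamma0 \<nu> (F + G) = bessel_Gamma0 \<nu> F + bessel_Gamma0 \<nu> G" unfolding s by (rule bessel_GammaI(1)[OF m l0 l1])
  show "bessel_Gamma1 \<nu> (F + G) = bessel_Gamma1 \<nu> F + bessel_Gamma1 \<nu> G"
    unfolding s(1) bessel_GammaI(2)[OF m l0 l1] by (simp add: field_simps)
qed

lemma bessel_graph_scale: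
  assumes \<nu>: "0 \<le> \<nu>" "\<nu> < 1" and FH: "(F, H) \<in> bessel_graph \<nu>"
  shows "(c *\<^sub>C F, c *\<^sub>C H) \<in> bessel_graph \<nu>" "bessel_Gamma0 \<nu> (c *\<^sub>C F) = c * bessel_Gamma0 \<nu> F"
    "bessel_Gamma1 \<nu> (c *\<^sub>C F) = c * bessel_Gamma1 \<nu> F"
proof -
  obtain f f1 h where f: "F = abs_L2_half_line f" "H = abs_L2_half_line h" "bessel_max \<nu> f f1 h"
    "(bracket_reg \<nu> f f1 \<longlongrightarrow> bessel_Gamma0 \<nu> F) (at_right 0)"
    "(bracket_sing \<nu> f f1 \<longlongrightarrow> - of_real (kappa \<nu>) * bessel_Gamma1 \<nu> F) (at_right 0)"
    by (rule bessel_graph_cases[OF \<nu> FH])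
  have m: "bessel_max \<nu> (\<lambda>x. c * f x) (\<lambda>x. c * f1 x) (\<lambda>x. c * h x)" by (rule bessel_max_cmult[OF f(3)])
  have s: "c *\<^sub>C F = abs_L2_half_line (\<lambda>x. c * f x)" "c *\<^sub>C H = abs_L2_half_line (\<lambda>x. c * h x)"
    using f(1-3) by (auto simp: abs_L2_scale bessel_max_def)
  show "(c *\<^sub>C F, c *\<^sub>C H) \<in> bessel_graph \<nu>" using m unfolding s bessel_graph_def by blast
  have b0: "bracket_reg \<nu> (\<lambda>x. c * f x) (\<lambda>x. c * f1 x) = (\<lambda>x. c * bracket_reg \<nu> f f1 x)"
    and b1: "bracket_sing \<nu> (\<lambda>x. c * f x) (\<lambda>x. c * f1 x) = (\<lambda>x. c * bracket_sing \<nu> f f1 x)"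
    by (auto simp: bracket_reg_def bracket_sing_def algebra_simps)
  have l0: "(bracket_reg \<nu> (\<lambda>x. c * f x) (\<lambda>x. c * f1 x) \<longlongrightarrow> c * bessel_Gamma0 \<nu> F) (at_right 0)"
    unfolding b0 by (rule tendsto_mult_left[OF f(4)])
  have l1: "(bracket_sing \<nu> (\<lambda>x. c * f x) (\<lambda>x. c * f1 x) \<longlongrightarrow> c * (- of_real (kappa \<nu>) * bessel_Gamma1 \<nu> F)) (at_right 0)"
    unfolding b1 by (rule tendsto_mult_left[OF f(5)])
  show "bessel_Gamma0 \<nu> (c *\<^sub>C F) = c * bessel_Gamma0 \<nu> F" unfolding s by (rule bessel_GammaI(1)[OF m l0 l1])
  show "bessel_Gamma1 \<nu> (c *\<^sub>C F) = c * bessel_Gamma1 \<nu> F"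
    unfolding s(1) bessel_GammaI(2)[OF m l0 l1] by (simp add: field_simps)
qed

text \<open>Green's identity is bilinear; conjugating the second function gives the sesquilinear form, and the limit
  at \<open>0\<close> comes from the Pluecker relation.\<close>

lemma bessel_graph_green:
  assumes \<nu>: "0 \<le> \<nu>" "\<nu> < 1" and FH: "(F, H) \<in> bessel_graph \<nu>" and GK: "(G, K) \<in> bessel_graph \<nu>"
  shows "cinner H G - cinner F K = bessel_Gamma1 \<nu> F * cnj (bessel_Gamma0 \<nu> G) - bessel_Gamma0 \<nu> F * cnj (bessel_Gamma1 \<nu> G)"
proof -
  obtain f f1 h where f: "F = abs_L2_half_line f" "H = abs_L2_half_line h" "bessel_max \<nu> f f1 h"
    "(bracket_reg \<nu> f f1 \<longlongrightarrow> bessel_Gamma0 \<nu> F) (at_right 0)"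
    "(bracket_sing \<nu> f f1 \<longlongrightarrow> - of_real (kappa \<nu>) * bessel_Gamma1 \<nu> F) (at_right 0)"
    by (rule bessel_graph_cases[OF \<nu> FH])
  obtain g g1 k where g: "G = abs_L2_half_line g" "K = abs_L2_half_line k" "bessel_max \<nu> g g1 k"
    "(bracket_reg \<nu> g g1 \<longlongrightarrow> bessel_Gamma0 \<nu> G) (at_right 0)"
    "(bracket_sing \<nu> g g1 \<longlongrightarrow> - of_real (kappa \<nu>) * bessel_Gamma1 \<nu> G) (at_right 0)"
    by (rule bessel_graph_cases[OF \<nu> GK])
  have c0: "bracket_reg \<nu> (\<lambda>x. cnj (g x)) (\<lambda>x. cnj (g1 x)) = (\<lambda>x. cnj (bracket_reg \<nu> g g1 x))"
    and c1: "bracket_sing \<nu> (\<lambda>x. cnj (g x)) (\<lambda>x. cnj (g1 x)) = (\<lambda>x. cnj (bracket_sing \<nu> g g1 x))"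
    by (auto simp: bracket_reg_def bracket_sing_def bessel_regular_def bessel_singular_def regular_deriv_def singular_deriv_def)
  let ?k = "complex_of_real (kappa \<nu>)"
  have "((\<lambda>x. (bracket_sing \<nu> f f1 x * cnj (bracket_reg \<nu> g g1 x) - bracket_reg \<nu> f f1 x * cnj (bracket_sing \<nu> g g1 x)) / ?k) \<longlongrightarrow>
      ((- ?k * bessel_Gamma1 \<nu> F) * cnj (bessel_Gamma0 \<nu> G) - bessel_Gamma0 \<nu> F * cnj (- ?k * bessel_Gamma1 \<nu> G)) / ?k) (at_right 0)"
    by (intro tendsto_divide tendsto_diff tendsto_mult tendsto_cnj f g tendsto_const) simp
  moreover have "((- ?k * bessel_Gamma1 \<nu> F) * cnj (bessel_Gamma0 \<nu> G) - bessel_Gamma0 \<nu> F * cnj (- ?k * bessel_Gamma1 \<nu> G)) / ?k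
    = bessel_Gamma0 \<nu> F * cnj (bessel_Gamma1 \<nu> G) - bessel_Gamma1 \<nu> F * cnj (bessel_Gamma0 \<nu> G)"
    by (simp add: field_simps)
  ultimately have "((\<lambda>x. (bracket_sing \<nu> f f1 x * cnj (bracket_reg \<nu> g g1 x) - bracket_reg \<nu> f f1 x * cnj (bracket_sing \<nu> g g1 x)) / ?k) \<longlongrightarrow>
      bessel_Gamma0 \<nu> F * cnj (bessel_Gamma1 \<nu> G) - bessel_Gamma1 \<nu> F * cnj (bessel_Gamma0 \<nu> G)) (at_right 0)" by simp
  then have "((\<lambda>x. f x * cnj (g1 x) - f1 x * cnj (g x)) \<longlongrightarrow>
      bessel_Gamma0 \<nu> F * cnj (bessel_Gamma1 \<nu> G) - bessel_Gamma1 \<nu> F * cnj (bessel_Gamma0 \<nu> G)) (at_right 0)"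
    by (rule Lim_transform_eventually)
       (intro eventually_mono[OF eventually_at_right_less], simp only: plucker_identity[of _ f "\<lambda>x. cnj (g1 x)" f1 "\<lambda>x. cnj (g x)" \<nu>] c0 c1)
  from green_identity[OF \<nu> f(3) bessel_max_cnj[OF g(3)] this]
  show ?thesis using f(3) g(3) by (simp add: f(1,2) g(1,2) cinner_abs_L2 bessel_max_def)
qed

text \<open>Equal functions have equal derivatives, so the difference of the right-hand sides has the primitive
  \<open>0\<close>.\<close>

lemma bessel_graph_single_valued:
  assumes "(F, H) \<in> bessel_graph \<nu>" "(F, K) \<in> bessel_graph \<nu>"
  shows "H = K"
proof -
  obtain f f1 h where f: "F = abs_L2_half_line f" "H = abs_L2_half_line h" "bessel_max \<nu> f f1 h" using assms(1) by (auto simp: bessel_graph_def)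
  obtain g g1 k where g: "F = abs_L2_half_line g" "K = abs_L2_half_line k" "bessel_max \<nu> g g1 k" using assms(2) by (auto simp: bessel_graph_def)
  have fs: "bessel_sol \<nu> f f1 h" "square_integrable f" "square_integrable h" using f(3) by (auto simp: bessel_max_def)
  have gs: "bessel_sol \<nu> g g1 k" "square_integrable g" "square_integrable k" using g(3) by (auto simp: bessel_max_def)
  have "AE x in half_line. f x = g x" using abs_L2_eq_iff[OF fs(2) gs(2)] f(1) g(1) by simp
  then have eq: "f x = g x" if "x > 0" for x
    by (rule continuous_AE_eq_imp_eq[OF bessel_solD(3)[OF fs(1)] bessel_solD(3)[OF gs(1)] _ that])
  have eq1: "f1 x = g1 x" if x: "x > 0" for x
  proof -
    have "(f has_vector_derivative g1 x) (at x)"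
      by (rule has_vector_derivative_transform_within_open[OF bessel_solD(1)[OF gs(1) x], of "{0<..}"]) (use x eq in auto)
    then show ?thesis using vector_derivative_unique_at[OF bessel_solD(1)[OF fs(1) x]] by blast
  qed
  have P: "primitive (\<lambda>x. f1 x - g1 x) (\<lambda>x. (bessel_q \<nu> x * f x - h x) - (bessel_q \<nu> x * g x - k x))"
    by (rule primitive_diff[OF bessel_solD(2)[OF fs(1)] bessel_solD(2)[OF gs(1)]])
  have P': "primitive (\<lambda>x. 0) (\<lambda>x. k x - h x)"
    by (rule primitive_cong[OF P]) (use eq eq1 in auto)
  have "AE x in half_line. k x - h x = 0"
  proof (rule integrals_zero_imp_AE_zero)
    show "(\<lambda>x. k x - h x) absolutely_integrable_on {a..b}" if "0 < a" for a b
      by (intro set_integral_diff(1) square_integrable_Icc fs gs that)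
    show "integral {a..b} (\<lambda>x. k x - h x) = 0" if "0 < a" "a \<le> b" for a b
      using primitiveD[OF P' that] by (simp add: integral_unique)
  qed
  then have "AE x in half_line. h x = k x" by eventually_elim simp
  then show ?thesis using abs_L2_eq_iff[OF fs(3) gs(3)] f(2) g(2) by simp
qed

lemma bessel_graph_zero: "(0, 0) \<in> bessel_graph \<nu>"
proof -
  have "bessel_max \<nu> (\<lambda>x. 0) (\<lambda>x. 0) (\<lambda>x. 0)"
    by (auto simp: bessel_max_def bessel_sol_def primitive_def)
  then show ?thesis unfolding bessel_graph_def zero_L2_half_line_def by blast
qed

lemma absolutely_continuous_on_Icc_add:
  assumes "absolutely_continuous_on_Icc a b f" "absolutely_continuous_on_Icc a b g"
  shows "absolutely_continuous_on_Icc a b (\<lambda>x. f x + g x)"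
  unfolding absolutely_continuous_on_Icc_def
proof (intro allI impI)
  fix e :: real assume e: "e > 0"
  obtain d where d: "d > 0" "\<And>I. finite I \<Longrightarrow> (\<forall>(u, v)\<in>I. a \<le> u \<and> u \<le> v \<and> v \<le> b) \<Longrightarrow>
        disjoint_family_on (\<lambda>(u, v). {u<..<v}) I \<Longrightarrow> (\<Sum>(u, v)\<in>I. v - u) < d \<Longrightarrow> (\<Sum>(u, v)\<in>I. cmod (f v - f u)) < e / 2"
    using assms(1)[unfolded absolutely_continuous_on_Icc_def, rule_format, of "e/2"] e by auto
  obtain d' where d': "d' > 0" "\<And>I. finite I \<Longrightarrow> (\<forall>(u, v)\<in>I. a \<le> u \<and> u \<le> v \<and> v \<le> b) \<Longrightarrow>
        disjoint_family_on (\<lambda>(u, v). {u<..<v}) I \<Longrightarrow> (\<Sum>(u, v)\<in>I. v - u) < d' \<Longrightarrow> (\<Sum>(u, v)\<in>I. cmod (g v - g u)) < e / 2"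
    using assms(2)[unfolded absolutely_continuous_on_Icc_def, rule_format, of "e/2"] e by auto
  show "\<exists>\<delta>>0. \<forall>I. finite I \<and> (\<forall>(u, v)\<in>I. a \<le> u \<and> u \<le> v \<and> v \<le> b) \<and>
        disjoint_family_on (\<lambda>(u, v). {u<..<v}) I \<and> (\<Sum>(u, v)\<in>I. v - u) < \<delta> \<longrightarrow>
        (\<Sum>(u, v)\<in>I. cmod (f v + g v - (f u + g u))) < e"
  proof (intro exI[of _ "min d d'"] conjI allI impI; (elim conjE)?)
    show "0 < min d d'" using d d' by simp
    fix I assume I: "finite I" "\<forall>(u, v)\<in>I. a \<le> u \<and> u \<le> v \<and> v \<le> b" "disjoint_family_on (\<lambda>(u, v). {u<..<v}) I" "(\<Sum>(u, v)\<in>I. v - u) < min d d'"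
    have le: "cmod (f v + g v - (f u + g u)) \<le> cmod (f v - f u) + cmod (g v - g u)" for u v
      using norm_triangle_ineq[of "f v - f u" "g v - g u"] by (simp add: algebra_simps)
    have "(\<Sum>(u, v)\<in>I. cmod (f v + g v - (f u + g u))) \<le> (\<Sum>(u, v)\<in>I. cmod (f v - f u) + cmod (g v - g u))"
      by (intro sum_mono) (auto simp: le)
    also have "\<dots> = (\<Sum>(u, v)\<in>I. cmod (f v - f u)) + (\<Sum>(u, v)\<in>I. cmod (g v - g u))" by (simp add: case_prod_unfold sum.distrib)
    also have "\<dots> < e / 2 + e / 2" using I by (intro add_strict_mono d(2) d'(2)) auto
    finally show "(\<Sum>(u, v)\<in>I. cmod (f v + g v - (f u + g u))) < e" by simp
  qed
qed

lemma absolutely_continuous_on_Icc_cmult: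
  assumes "absolutely_continuous_on_Icc a b f" shows "absolutely_continuous_on_Icc a b (\<lambda>x. c * f x)"
  unfolding absolutely_continuous_on_Icc_def
proof (intro allI impI)
  fix e :: real assume e: "e > 0"
  define C where "C = cmod c + 1"
  have C: "C > 0" by (simp add: C_def add_nonneg_pos)
  obtain d where d: "d > 0" "\<And>I. finite I \<Longrightarrow> (\<forall>(u, v)\<in>I. a \<le> u \<and> u \<le> v \<and> v \<le> b) \<Longrightarrow>
        disjoint_family_on (\<lambda>(u, v). {u<..<v}) I \<Longrightarrow> (\<Sum>(u, v)\<in>I. v - u) < d \<Longrightarrow> (\<Sum>(u, v)\<in>I. cmod (f v - f u)) < e / C"
    using assms(1)[unfolded absolutely_continuous_on_Icc_def, rule_format, of "e/C"] e C by auto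
  show "\<exists>\<delta>>0. \<forall>I. finite I \<and> (\<forall>(u, v)\<in>I. a \<le> u \<and> u \<le> v \<and> v \<le> b) \<and>
        disjoint_family_on (\<lambda>(u, v). {u<..<v}) I \<and> (\<Sum>(u, v)\<in>I. v - u) < \<delta> \<longrightarrow>
        (\<Sum>(u, v)\<in>I. cmod (c * f v - c * f u)) < e"
  proof (intro exI[of _ d] conjI allI impI d(1); elim conjE)
    fix I assume I: "finite I" "\<forall>(u, v)\<in>I. a \<le> u \<and> u \<le> v \<and> v \<le> b" "disjoint_family_on (\<lambda>(u, v). {u<..<v}) I" "(\<Sum>(u, v)\<in>I. v - u) < d"
    have "(\<Sum>(u, v)\<in>I. cmod (c * f v - c * f u)) = cmod c * (\<Sum>(u, v)\<in>I. cmod (f v - f u))"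
      by (simp add: case_prod_unfold sum_distrib_left norm_mult flip: right_diff_distrib)
    also have "\<dots> \<le> C * (\<Sum>(u, v)\<in>I. cmod (f v - f u))" by (intro mult_right_mono sum_nonneg) (auto simp: C_def)
    also have "\<dots> < C * (e / C)" using C by (intro mult_strict_left_mono d(2) I)
    also have "\<dots> = e" using C by simp
    finally show "(\<Sum>(u, v)\<in>I. cmod (c * f v - c * f u)) < e" .
  qed
qed

lemma locally_absolutely_continuous_cong:
  assumes "locally_absolutely_continuous f" "\<And>x. x > 0 \<Longrightarrow> f x = g x" shows "locally_absolutely_continuous g"
  unfolding locally_absolutely_continuous_def
proof (intro allI impI)
  fix a b :: real assume ab: "0 < a \<and> a < b"
  then have "absolutely_continuous_on_Icc a b f" using assms(1) by (auto simp: locally_absolutely_continuous_def)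
  moreover have "(\<Sum>(u, v)\<in>I. cmod (f v - f u)) = (\<Sum>(u, v)\<in>I. cmod (g v - g u))" if "\<forall>(u, v)\<in>I. a \<le> u \<and> u \<le> v \<and> v \<le> b" for I
    using that ab assms(2) by (intro sum.cong) (auto simp: split_beta)
  ultimately show "absolutely_continuous_on_Icc a b g" unfolding absolutely_continuous_on_Icc_def by (metis (no_types, lifting))
qed

lemma bessel_maximal_fun_add:
  assumes f: "bessel_maximal_fun \<nu> f h" and g: "bessel_maximal_fun \<nu> g k"
  shows "bessel_maximal_fun \<nu> (\<lambda>x. f x + g x) (\<lambda>x. h x + k x)"
proof -
  have fd: "(f has_vector_derivative deriv1 f x) (at x)" and gd: "(g has_vector_derivative deriv1 g x) (at x)" if "x > 0" for x
    using bessel_maximal_fun_imp_max[OF f] bessel_maximal_fun_imp_max[OF g] that by (auto simp: bessel_max_def bessel_sol_def)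
  have d: "deriv1 (\<lambda>x. f x + g x) x = deriv1 f x + deriv1 g x" if "x > 0" for x
    by (rule vector_derivative_at[OF has_vector_derivative_add[OF fd[OF that] gd[OF that]]])
  have ac: "locally_absolutely_continuous (\<lambda>x. f x + g x)" "locally_absolutely_continuous (\<lambda>x. deriv1 f x + deriv1 g x)"
    using f g by (auto simp: bessel_maximal_fun_def locally_absolutely_continuous_def intro: absolutely_continuous_on_Icc_add)
  have "AE x in half_line. (deriv1 f has_vector_derivative of_real ((\<nu>\<^sup>2 - 1 / 4) / x\<^sup>2) * f x - h x) (at x)"
    "AE x in half_line. (deriv1 g has_vector_derivative of_real ((\<nu>\<^sup>2 - 1 / 4) / x\<^sup>2) * g x - k x) (at x)"
    "AE x in half_line. x > 0"
    using f g by (auto simp: bessel_maximal_fun_def intro!: AE_I2)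
  then have ae: "AE x in half_line. (deriv1 (\<lambda>x. f x + g x) has_vector_derivative of_real ((\<nu>\<^sup>2 - 1 / 4) / x\<^sup>2) * (f x + g x) - (h x + k x)) (at x)"
  proof eventually_elim
    case (elim x)
    have "((\<lambda>x. deriv1 f x + deriv1 g x) has_vector_derivative (of_real ((\<nu>\<^sup>2 - 1 / 4) / x\<^sup>2) * f x - h x) + (of_real ((\<nu>\<^sup>2 - 1 / 4) / x\<^sup>2) * g x - k x)) (at x)"
      by (rule has_vector_derivative_add[OF elim(1,2)])
    then have "(deriv1 (\<lambda>x. f x + g x) has_vector_derivative (of_real ((\<nu>\<^sup>2 - 1 / 4) / x\<^sup>2) * f x - h x) + (of_real ((\<nu>\<^sup>2 - 1 / 4) / x\<^sup>2) * g x - k x)) (at x)"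
      by (rule has_vector_derivative_transform_within_open[of _ _ _ "{0<..}"]) (use elim d in auto)
    moreover have "(of_real ((\<nu>\<^sup>2 - 1 / 4) / x\<^sup>2) * f x - h x) + (of_real ((\<nu>\<^sup>2 - 1 / 4) / x\<^sup>2) * g x - k x) = of_real ((\<nu>\<^sup>2 - 1 / 4) / x\<^sup>2) * (f x + g x) - (h x + k x)"
      by (simp only: distrib_left) simp
    ultimately show ?case by (simp only:)
  qed
  show ?thesis unfolding bessel_maximal_fun_def
  proof (intro conjI ae ac(1))
    show "locally_absolutely_continuous (deriv1 (\<lambda>x. f x + g x))" by (rule locally_absolutely_continuous_cong[OF ac(2)]) (simp add: d)
  qed (use f g in \<open>auto simp: bessel_maximal_fun_def intro: square_integrable_add differentiable_on_add\<close>)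
qed

lemma bessel_maximal_fun_cmult:
  assumes f: "bessel_maximal_fun \<nu> f h"
  shows "bessel_maximal_fun \<nu> (\<lambda>x. c * f x) (\<lambda>x. c * h x)"
proof -
  have fd: "(f has_vector_derivative deriv1 f x) (at x)" if "x > 0" for x
    using bessel_maximal_fun_imp_max[OF f] that by (auto simp: bessel_max_def bessel_sol_def)
  have d: "deriv1 (\<lambda>x. c * f x) x = c * deriv1 f x" if "x > 0" for x
    by (rule vector_derivative_at[OF has_vector_derivative_mult_right[OF fd[OF that]]])
  have ac: "locally_absolutely_continuous (\<lambda>x. c * f x)" "locally_absolutely_continuous (\<lambda>x. c * deriv1 f x)"
    using f by (auto simp: bessel_maximal_fun_def locally_absolutely_continuous_def intro: absolutely_continuous_on_Icc_cmult)
  have "AE x in half_line. (deriv1 f has_vector_derivative of_real ((\<nu>\<^sup>2 - 1 / 4) / x\<^sup>2) * f x - h x) (at x)" "AE x in half_line. x > 0"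
    using f by (auto simp: bessel_maximal_fun_def intro!: AE_I2)
  then have ae: "AE x in half_line. (deriv1 (\<lambda>x. c * f x) has_vector_derivative of_real ((\<nu>\<^sup>2 - 1 / 4) / x\<^sup>2) * (c * f x) - c * h x) (at x)"
  proof eventually_elim
    case (elim x)
    have "(deriv1 (\<lambda>x. c * f x) has_vector_derivative c * (of_real ((\<nu>\<^sup>2 - 1 / 4) / x\<^sup>2) * f x - h x)) (at x)"
      by (rule has_vector_derivative_transform_within_open[OF has_vector_derivative_mult_right[OF elim(1)], of "{0<..}"]) (use elim d in auto)
    moreover have "c * (of_real ((\<nu>\<^sup>2 - 1 / 4) / x\<^sup>2) * f x - h x) = of_real ((\<nu>\<^sup>2 - 1 / 4) / x\<^sup>2) * (c * f x) - c * h x"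
      by (simp only: right_diff_distrib mult.left_commute)
    ultimately show ?case by (simp only:)
  qed
  show ?thesis unfolding bessel_maximal_fun_def
  proof (intro conjI ae ac(1))
    show "locally_absolutely_continuous (deriv1 (\<lambda>x. c * f x))" by (rule locally_absolutely_continuous_cong[OF ac(2)]) (simp add: d)
  qed (use f in \<open>auto simp: bessel_maximal_fun_def intro: square_integrable_scale differentiable_on_mult\<close>)
qed

lemma bessel_preminimal_add:
  assumes "(F, H) \<in> bessel_preminimal \<nu>" "(G, K) \<in> bessel_preminimal \<nu>"
  shows "(F + G, H + K) \<in> bessel_preminimal \<nu>"
proof -
  obtain f h a b where f: "F = abs_L2_half_line f" "H = abs_L2_half_line h" "bessel_maximal_fun \<nu> f h" "0 < a" "a < b" "\<forall>x>0. x \<notin> {a..b} \<longrightarrow> f x = 0"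
    using assms(1) unfolding bessel_preminimal_def by blast
  obtain g k c d where g: "G = abs_L2_half_line g" "K = abs_L2_half_line k" "bessel_maximal_fun \<nu> g k" "0 < c" "c < d" "\<forall>x>0. x \<notin> {c..d} \<longrightarrow> g x = 0"
    using assms(2) unfolding bessel_preminimal_def by blast
  have "F + G = abs_L2_half_line (\<lambda>x. f x + g x)" "H + K = abs_L2_half_line (\<lambda>x. h x + k x)"
    using f(1-3) g(1-3) by (auto simp: abs_L2_add bessel_maximal_fun_def)
  moreover have "0 < min a c \<and> min a c < max b d \<and> (\<forall>x>0. x \<notin> {min a c..max b d} \<longrightarrow> f x + g x = 0)"
    using f g by (auto simp: min_le_iff_disj le_max_iff_disj)
  ultimately show ?thesis using bessel_maximal_fun_add[OF f(3) g(3)] unfolding bessel_preminimal_def by blast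
qed

lemma bessel_preminimal_scale:
  assumes "(F, H) \<in> bessel_preminimal \<nu>" shows "(c *\<^sub>C F, c *\<^sub>C H) \<in> bessel_preminimal \<nu>"
proof -
  obtain f h a b where f: "F = abs_L2_half_line f" "H = abs_L2_half_line h" "bessel_maximal_fun \<nu> f h" "0 < a" "a < b" "\<forall>x>0. x \<notin> {a..b} \<longrightarrow> f x = 0"
    using assms(1) unfolding bessel_preminimal_def by blast
  have "c *\<^sub>C F = abs_L2_half_line (\<lambda>x. c * f x)" "c *\<^sub>C H = abs_L2_half_line (\<lambda>x. c * h x)"
    using f(1-3) by (auto simp: abs_L2_scale bessel_maximal_fun_def)
  moreover have "0 < a \<and> a < b \<and> (\<forall>x>0. x \<notin> {a..b} \<longrightarrow> c * f x = 0)" using f by auto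
  ultimately show ?thesis using bessel_maximal_fun_cmult[OF f(3)] unfolding bessel_preminimal_def by blast
qed

lemma bessel_preminimal_zero: "(0, 0) \<in> bessel_preminimal \<nu>"
proof -
  have "compact_cont (\<lambda>x. 0)" unfolding compact_cont_def by (intro conjI continuous_on_const exI[of _ 1] exI[of _ 2]) auto
  moreover have "bessel_sol \<nu> (\<lambda>x. 0) (\<lambda>x. 0) (\<lambda>x. 0)" by (auto simp: bessel_sol_def primitive_def)
  ultimately show ?thesis using bessel_preminimal_compact_cont unfolding zero_L2_half_line_def by blast
qed


section \<open>The boundary triplet and the selfadjoint extension\<close>

lemma closure_pair_add:
  fixes T :: "('a::real_normed_vector \<times> 'a) set"
  assumes T: "\<And>p q. p \<in> T \<Longrightarrow> q \<in> T \<Longrightarrow> p + q \<in> T" and p: "p \<in> closure T" "q \<in> closure T"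
  shows "p + q \<in> closure T"
proof -
  obtain a b where "\<And>n. a n \<in> T" "a \<longlonglongrightarrow> p" "\<And>n. b n \<in> T" "b \<longlonglongrightarrow> q" using p unfolding closure_sequential by metis
  then show ?thesis unfolding closure_sequential by (intro exI[of _ "\<lambda>n. a n + b n"]) (auto intro: T tendsto_add)
qed

lemma bessel_minimal_add:
  assumes "(F, H) \<in> bessel_minimal \<nu>" "(G, K) \<in> bessel_minimal \<nu>" shows "(F + G, H + K) \<in> bessel_minimal \<nu>"
  using closure_pair_add[of "bessel_preminimal \<nu>" "(F, H)" "(G, K)"] assms bessel_preminimal_add
  unfolding bessel_minimal_def by fastforce

lemma bessel_minimal_scale:
  assumes "(F, H) \<in> bessel_minimal \<nu>" shows "(c *\<^sub>C F, c *\<^sub>C H) \<in> bessel_minimal \<nu>"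
proof -
  obtain a where a: "\<And>n. a n \<in> bessel_preminimal \<nu>" "a \<longlonglongrightarrow> (F, H)"
    using assms unfolding bessel_minimal_def closure_sequential by metis
  have "(\<lambda>n. (c *\<^sub>C fst (a n), c *\<^sub>C snd (a n))) \<longlonglongrightarrow> (c *\<^sub>C fst (F, H), c *\<^sub>C snd (F, H))"
    by (intro tendsto_Pair bounded_linear.tendsto[OF bounded_linear_scaleC] tendsto_fst tendsto_snd a(2))
  moreover have "(c *\<^sub>C fst (a n), c *\<^sub>C snd (a n)) \<in> bessel_preminimal \<nu>" for n
    using bessel_preminimal_scale[of "fst (a n)" "snd (a n)"] a(1)[of n] by simp
  ultimately show ?thesis unfolding bessel_minimal_def closure_sequential
    by (intro exI[of _ "\<lambda>n. (c *\<^sub>C fst (a n), c *\<^sub>C snd (a n))"]) auto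
qed

context
  fixes \<nu> :: real
  assumes \<nu>: "0 \<le> \<nu>" "\<nu> < 1"
begin

lemma preminimal_subset_graph: "bessel_preminimal \<nu> \<subseteq> bessel_graph \<nu>"
  by (auto simp: bessel_graph_def elim!: bessel_preminimal_subset)

text \<open>The graph is an adjoint.\<close>

lemma closed_bessel_graph: "closed (bessel_graph \<nu>)"
  using adjoint_closed[of "bessel_minimal \<nu>"] by (simp add: adjoint_bessel_minimal \<nu>)

lemma minimal_subset_graph: "bessel_minimal \<nu> \<subseteq> bessel_graph \<nu>"
  unfolding bessel_minimal_def by (rule closure_minimal[OF preminimal_subset_graph closed_bessel_graph])

lemma linear_operator_minimal: "linear_operator (bessel_minimal \<nu>)"
  unfolding linear_operator_def
proof (intro conjI)
  show "(0, 0) \<in> bessel_minimal \<nu>" using bessel_preminimal_zero closure_subset unfolding bessel_minimal_def by blast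
  show "single_valued (bessel_minimal \<nu>)"
    unfolding single_valued_def using minimal_subset_graph bessel_graph_single_valued by blast
qed (auto intro: bessel_minimal_add bessel_minimal_scale)

text \<open>A vector \<open>y\<close> orthogonal to the domain would put \<open>(0, y)\<close> into the adjoint,
  which is single valued.\<close>

lemma densely_defined_minimal: "densely_defined (bessel_minimal \<nu>)"
  unfolding densely_defined_def
proof (rule ccontr)
  let ?D = "Domain (bessel_minimal \<nu>)"
  assume ne: "closure ?D \<noteq> UNIV"
  have add: "x + y \<in> closure ?D" if xy: "x \<in> closure ?D" "y \<in> closure ?D" for x y
  proof -
    obtain a b where ab: "\<And>n. a n \<in> ?D" "a \<longlonglongrightarrow> x" "\<And>n. b n \<in> ?D" "b \<longlonglongrightarrow> y" using xy unfolding closure_sequential by metis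
    have "a n + b n \<in> ?D" for n 
    proof -
      obtain s t where "(a n, s) \<in> bessel_minimal \<nu>" "(b n, t) \<in> bessel_minimal \<nu>" using ab(1,3)[of n] by blast
      then show ?thesis by (rule DomainI[OF bessel_minimal_add])
    qed
    then show ?thesis unfolding closure_sequential using tendsto_add[OF ab(2,4)]
      by (intro exI[of _ "\<lambda>n. a n + b n"]) auto
  qed
  have scale: "c *\<^sub>C x \<in> closure ?D" if x: "x \<in> closure ?D" for c x
  proof -
    obtain a where ab: "\<And>n. a n \<in> ?D" "a \<longlonglongrightarrow> x" using x unfolding closure_sequential by metis
    have "c *\<^sub>C a n \<in> ?D" for n 
    proof -
      obtain s where "(a n, s) \<in> bessel_minimal \<nu>" using ab(1)[of n] by blast
      then show ?thesis by (rule DomainI[OF bessel_minimal_scale])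
    qed
    then show ?thesis unfolding closure_sequential using bounded_linear.tendsto[OF bounded_linear_scaleC ab(2)]
      by (intro exI[of _ "\<lambda>n. c *\<^sub>C a n"]) auto
  qed
  have "(0, 0) \<in> bessel_minimal \<nu>" using linear_operator_minimal by (simp add: linear_operator_def)
  then have "0 \<in> ?D" by (rule DomainI)
  then have 0: "0 \<in> closure ?D" by (rule subsetD[OF closure_subset])
  have "\<exists>y. y \<noteq> 0 \<and> (\<forall>v\<in>closure ?D. cinner v y = 0)"
    by (rule exists_orthogonal_vector_complex) (fact add scale 0 closed_closure ne)+
  then obtain y where y: "y \<noteq> 0" "\<forall>v\<in>closure ?D. cinner v y = 0" by (elim exE conjE)
  have "cinner H 0 = cinner F y" if "(F, H) \<in> bessel_minimal \<nu>" for F H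
  proof -
    have "F \<in> closure ?D" using DomainI[OF that] by (rule subsetD[OF closure_subset])
    then have "cinner F y = 0" using y(2) by (rule bspec[rotated])
    then show ?thesis using cinner_commute[of H 0] by simp
  qed
  then have "(0, y) \<in> adjoint_operator (bessel_minimal \<nu>)" by (auto simp: adjoint_operator_def)
  then have "(0, y) \<in> bessel_graph \<nu>" by (simp add: adjoint_bessel_minimal \<nu>)
  then show False using bessel_graph_single_valued[OF bessel_graph_zero] y(1) by blast
qed

lemma symmetric_minimal: "symmetric_operator (bessel_minimal \<nu>)"
proof -
  have "bessel_minimal \<nu> \<subseteq> adjoint_operator (bessel_minimal \<nu>)" using minimal_subset_graph by (simp add: adjoint_bessel_minimal \<nu>)
  then show ?thesis unfolding symmetric_operator_def adjoint_operator_def by blast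
qed

abbreviation "\<Gamma>0 \<equiv> bessel_Gamma0 \<nu>"
abbreviation "\<Gamma>1 \<equiv> bessel_Gamma1 \<nu>"

definition weyl_vec :: "complex \<Rightarrow> L2_half_line" where
  "weyl_vec z = abs_L2_half_line (weyl_sol \<nu> (csqrt (- z)))"

lemma weyl_vec_graph:
  assumes z: "z \<notin> \<real>\<^sub>\<ge>\<^sub>0" shows "(weyl_vec z, z *\<^sub>C weyl_vec z) \<in> bessel_graph \<nu>"
proof -
  note m = bessel_max_weyl[OF z \<nu>]
  have "z *\<^sub>C weyl_vec z = abs_L2_half_line (\<lambda>x. z * weyl_sol \<nu> (csqrt (- z)) x)"
    using m by (simp add: weyl_vec_def abs_L2_scale bessel_max_def)
  then show ?thesis using m unfolding bessel_graph_def weyl_vec_def by auto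
qed

lemma weyl_vec_Gamma0:
  assumes z: "z \<notin> \<real>\<^sub>\<ge>\<^sub>0"
  defines "k \<equiv> csqrt (- z)"
  shows "\<Gamma>0 (weyl_vec z) = k / 2 * of_real (4 powr (\<nu> + 1)) * (of_real (Gamma (\<nu> + 1)) * k powr (- of_real (\<nu> + 1)))"
    "\<Gamma>0 (weyl_vec z) \<noteq> 0"
proof -
  have k: "Re k > 0" unfolding k_def by (rule Re_csqrt_pos[OF minus_notin_nonpos[OF z]])
  have m: "bessel_max \<nu> (weyl_sol \<nu> k) (weyl_sol_deriv \<nu> k) (\<lambda>x. z * weyl_sol \<nu> k x)"
    unfolding k_def by (rule bessel_max_weyl[OF z \<nu>])
  show eq: "\<Gamma>0 (weyl_vec z) = k / 2 * of_real (4 powr (\<nu> + 1)) * (of_real (Gamma (\<nu> + 1)) * k powr (- of_real (\<nu> + 1)))"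
    unfolding bessel_Gamma0_def weyl_vec_def k_def[symmetric]
    by (rule bracket_0_regular(1)[OF m weyl_sol_bracket_reg[OF k \<nu>(1)]])
  have "Gamma (\<nu> + 1) > 0" using \<nu> by (intro Gamma_real_pos) auto
  then show "\<Gamma>0 (weyl_vec z) \<noteq> 0" unfolding eq using k by auto
qed

lemma weyl_vec_Gamma1:
  assumes z: "z \<notin> \<real>\<^sub>\<ge>\<^sub>0"
  defines "k \<equiv> csqrt (- z)"
  shows "\<Gamma>1 (weyl_vec z) = (if \<nu> = 0 then 2 * (- euler_mascheroni - Ln k + of_real (ln 2))
      else - (2 * k * (of_real (Gamma (1 - \<nu>)) * k powr (- of_real (1 - \<nu>)))) / of_real (2 * \<nu>))"
proof -
  have k: "Re k > 0" unfolding k_def by (rule Re_csqrt_pos[OF minus_notin_nonpos[OF z]])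
  have m: "bessel_max \<nu> (weyl_sol \<nu> k) (weyl_sol_deriv \<nu> k) (\<lambda>x. z * weyl_sol \<nu> k x)"
    unfolding k_def by (rule bessel_max_weyl[OF z \<nu>])
  note r = weyl_sol_bracket_reg[OF k \<nu>(1)]
  show ?thesis
  proof (cases "\<nu> = 0")
    case True
    have l: "(bracket_sing \<nu> (weyl_sol \<nu> k) (weyl_sol_deriv \<nu> k) \<longlongrightarrow> 2 * (- euler_mascheroni - Ln k + of_real (ln 2))) (at_right 0)"
      using weyl_sol_bracket_sing_0[OF k] True by simp
    show ?thesis using bessel_GammaI(2)[OF m r l] unfolding weyl_vec_def k_def[symmetric] by (simp add: True kappa_def)
  next
    case False
    then have "0 < \<nu>" using \<nu> by simp
    from bessel_GammaI(2)[OF m r weyl_sol_bracket_sing[OF k this \<nu>(2)]] False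
    show ?thesis unfolding weyl_vec_def k_def[symmetric] by (simp add: kappa_def)
  qed
qed

lemma i_notin_nonneg: "\<i> \<notin> \<real>\<^sub>\<ge>\<^sub>0" "- \<i> \<notin> \<real>\<^sub>\<ge>\<^sub>0"
  by (auto simp: complex_nonneg_Reals_iff)

text \<open>Green's identity for the eigenvector with itself. It shows that the imaginary part of the quotient of
  the boundary values has the sign of \<open>Im z\<close>.\<close>

lemma weyl_vec_imaginary:
  assumes z: "z \<notin> \<real>\<^sub>\<ge>\<^sub>0"
  shows "Im (\<Gamma>1 (weyl_vec z) / \<Gamma>0 (weyl_vec z)) * (cmod (\<Gamma>0 (weyl_vec z)))\<^sup>2 = Im z * (norm (weyl_vec z))\<^sup>2"
proof -
  let ?F = "weyl_vec z"
  have "cinner (z *\<^sub>C ?F) ?F - cinner ?F (z *\<^sub>C ?F) = \<Gamma>1 ?F * cnj (\<Gamma>0 ?F) - \<Gamma>0 ?F * cnj (\<Gamma>1 ?F)"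
    by (rule bessel_graph_green[OF \<nu> weyl_vec_graph[OF z] weyl_vec_graph[OF z]])
  then have e: "(z - cnj z) * of_real ((norm ?F)\<^sup>2) = \<Gamma>1 ?F * cnj (\<Gamma>0 ?F) - \<Gamma>0 ?F * cnj (\<Gamma>1 ?F)"
    by (simp add: cinner_scaleC_left cinner_scaleC_right cinner_self algebra_simps del: of_real_power)
  have Im_gen: "Im (w * complex_of_real r) = Im w * r" for w r by simp
  have "\<Gamma>1 ?F * cnj (\<Gamma>0 ?F) = \<Gamma>1 ?F / \<Gamma>0 ?F * of_real ((cmod (\<Gamma>0 ?F))\<^sup>2)"
    using weyl_vec_Gamma0(2)[OF z] by (simp add: complex_norm_square field_simps del: of_real_power)
  then have a: "Im (\<Gamma>1 ?F * cnj (\<Gamma>0 ?F)) = Im (\<Gamma>1 ?F / \<Gamma>0 ?F) * (cmod (\<Gamma>0 ?F))\<^sup>2"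
    by (simp only: Im_gen)
  have b: "Im ((z - cnj z) * of_real ((norm ?F)\<^sup>2)) = 2 * Im z * (norm ?F)\<^sup>2" by (simp del: of_real_power)
  have c: "Im (\<Gamma>1 ?F * cnj (\<Gamma>0 ?F) - \<Gamma>0 ?F * cnj (\<Gamma>1 ?F)) = 2 * Im (\<Gamma>1 ?F * cnj (\<Gamma>0 ?F))" by simp
  have "2 * Im z * (norm ?F)\<^sup>2 = 2 * (Im (\<Gamma>1 ?F / \<Gamma>0 ?F) * (cmod (\<Gamma>0 ?F))\<^sup>2)"
    using arg_cong[OF e, of Im] unfolding b c a .
  then show ?thesis by simp
qed

lemma bessel_Gamma_zero: "\<Gamma>0 0 = 0" "\<Gamma>1 0 = 0"
  using bessel_graph_scale(2,3)[OF \<nu> bessel_graph_zero, of 0] by simp_all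

lemma weyl_vec_nonzero: "z \<notin> \<real>\<^sub>\<ge>\<^sub>0 \<Longrightarrow> weyl_vec z \<noteq> 0"
  using weyl_vec_Gamma0(2) bessel_Gamma_zero by metis

text \<open>The boundary data of the eigenvectors at \<open>\<i>\<close> and \<open>- \<i>\<close> are linearly
  independent, since the quotients of their components lie in different half-planes.\<close>

lemma Gamma_surjective: "\<exists>F H. (F, H) \<in> bessel_graph \<nu> \<and> \<Gamma>0 F = a \<and> \<Gamma>1 F = b"
proof -
  define m where "m z = \<Gamma>1 (weyl_vec z) / \<Gamma>0 (weyl_vec z)" for z
  define P where "P z = (1 / \<Gamma>0 (weyl_vec z)) *\<^sub>C weyl_vec z" for z
  have P: "(P z, z *\<^sub>C P z) \<in> bessel_graph \<nu>" "\<Gamma>0 (P z) = 1" "\<Gamma>1 (P z) = m z" if z: "z \<notin> \<real>\<^sub>\<ge>\<^sub>0" for z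
    using bessel_graph_scale[OF \<nu> weyl_vec_graph[OF z], of "1 / \<Gamma>0 (weyl_vec z)"] weyl_vec_Gamma0(2)[OF z]
    by (simp_all add: P_def m_def scaleC_scaleC mult.commute)
  have "Im (m \<i>) * (cmod (\<Gamma>0 (weyl_vec \<i>)))\<^sup>2 = (norm (weyl_vec \<i>))\<^sup>2"
    using weyl_vec_imaginary[OF i_notin_nonneg(1)] by (simp add: m_def)
  moreover have "(norm (weyl_vec \<i>))\<^sup>2 > 0" using weyl_vec_nonzero[OF i_notin_nonneg(1)] by simp
  ultimately have i1: "Im (m \<i>) > 0" by (metis zero_less_mult_pos2 zero_less_power2 norm_eq_zero weyl_vec_Gamma0(2)[OF i_notin_nonneg(1)])
  have "Im (m (- \<i>)) * (cmod (\<Gamma>0 (weyl_vec (- \<i>))))\<^sup>2 = - (norm (weyl_vec (- \<i>)))\<^sup>2"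
    using weyl_vec_imaginary[OF i_notin_nonneg(2)] by (simp add: m_def)
  then have i2: "Im (m (- \<i>)) \<le> 0"
    by (metis neg_le_0_iff_le zero_le_power2 zero_less_power2 norm_eq_zero weyl_vec_Gamma0(2)[OF i_notin_nonneg(2)] mult_le_0_iff not_le)
  have ne: "m \<i> - m (- \<i>) \<noteq> 0" using i1 i2 by (metis eq_iff_diff_eq_0 not_le)
  define \<alpha> where "\<alpha> = (b - a * m (- \<i>)) / (m \<i> - m (- \<i>))"
  define \<beta> where "\<beta> = a - \<alpha>"
  note s1 = bessel_graph_scale[OF \<nu> P(1)[OF i_notin_nonneg(1)], of \<alpha>] and s2 = bessel_graph_scale[OF \<nu> P(1)[OF i_notin_nonneg(2)], of \<beta>]
  note s = bessel_graph_add[OF \<nu> s1(1) s2(1)]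
  have "\<alpha> * (m \<i> - m (- \<i>)) = b - a * m (- \<i>)" using ne by (simp add: \<alpha>_def)
  then have "\<alpha> * m \<i> + \<beta> * m (- \<i>) = b" by (simp add: \<beta>_def algebra_simps)
  moreover have "\<alpha> + \<beta> = a" by (simp add: \<beta>_def)
  ultimately show ?thesis using s P(2,3)[OF i_notin_nonneg(1)] P(2,3)[OF i_notin_nonneg(2)] s1(2,3) s2(2,3) by fastforce
qed

definition A0 :: "(L2_half_line \<times> L2_half_line) set" where
  "A0 = {(F, H) \<in> bessel_graph \<nu>. \<Gamma>0 F = 0}"

lemma extension_0_eq: "extension_0 (bessel_minimal \<nu>) \<Gamma>0 = A0"
  by (simp add: extension_0_def A0_def adjoint_bessel_minimal \<nu>)

lemma preminimal_subset_A0: "bessel_preminimal \<nu> \<subseteq> A0"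
proof clarify
  fix F H assume FH: "(F, H) \<in> bessel_preminimal \<nu>"
  then obtain f f1 h where f: "F = abs_L2_half_line f" "H = abs_L2_half_line h" "bessel_max \<nu> f f1 h"
    "eventually (\<lambda>x. f x = 0 \<and> f1 x = 0) (at_right 0)" by (rule bessel_preminimal_subset)
  have "(bracket_reg \<nu> f f1 \<longlongrightarrow> 0) (at_right 0)"
    by (rule tendsto_eventually) (use f(4) in \<open>auto elim: eventually_mono simp: bracket_reg_def\<close>)
  then have "\<Gamma>0 F = 0" unfolding f(1) bessel_Gamma0_def by (rule bracket_0_regular(1)[OF f(3)])
  then show "(F, H) \<in> A0" using FH preminimal_subset_graph by (auto simp: A0_def)
qed

text \<open>Green's identity against an element with $\Gamma_0 = 0$ and $\Gamma_1 = 1$ forces $\Gamma_0$ to vanish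
  on the domain of the adjoint.\<close>

lemma adjoint_A0: "adjoint_operator A0 = A0"
proof
  show "A0 \<subseteq> adjoint_operator A0"
  proof (clarsimp simp: adjoint_operator_def)
    fix G K F H assume "(G, K) \<in> A0" "(F, H) \<in> A0"
    then show "cinner H G = cinner F K" using bessel_graph_green[OF \<nu>, of F H G K] by (simp add: A0_def)
  qed
  show "adjoint_operator A0 \<subseteq> A0"
  proof clarify
    fix G K assume GK: "(G, K) \<in> adjoint_operator A0"
    then have "(G, K) \<in> adjoint_operator (bessel_preminimal \<nu>)" using preminimal_subset_A0 unfolding adjoint_operator_def by blast
    then have g: "(G, K) \<in> bessel_graph \<nu>" using adjoint_subset_bessel_graph[OF \<nu>] by blast
    obtain F H where F: "(F, H) \<in> bessel_graph \<nu>" "\<Gamma>0 F = 0" "\<Gamma>1 F = 1" using Gamma_surjective by blast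
    then have "cinner H G = cinner F K" using GK unfolding adjoint_operator_def A0_def by blast
    then have "\<Gamma>0 G = 0" using bessel_graph_green[OF \<nu> F(1) g] F(2,3) by simp
    then show "(G, K) \<in> A0" using g by (simp add: A0_def)
  qed
qed

lemma A0_nonneg:
  assumes FH: "(F, H) \<in> A0" obtains r where "r \<ge> 0" "cinner H F = of_real r"
proof -
  have "(F, H) \<in> adjoint_operator A0" using FH adjoint_A0 by simp
  then have "cinner H F = cinner F H" using FH by (auto simp: adjoint_operator_def)
  then have "cinner H F = cnj (cinner H F)" using cinner_commute[of F H] by simp
  then have "Im (cinner H F) = 0" by (metis Reals_cnj_iff complex_is_Real_iff)
  then have e: "cinner H F = of_real (Re (cinner H F))" by (simp add: complex_eq_iff)
  have g: "(F, H) \<in> bessel_graph \<nu>" "\<Gamma>0 F = 0" using FH by (auto simp: A0_def)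
  obtain f f1 h where f: "F = abs_L2_half_line f" "H = abs_L2_half_line h" "bessel_max \<nu> f f1 h"
    "(bracket_reg \<nu> f f1 \<longlongrightarrow> \<Gamma>0 F) (at_right 0)"
    by (rule bessel_graph_cases[OF \<nu> g(1)])
  have "0 \<le> Re (LINT x|half_line. h x * cnj (f x))"
    by (rule form_nonneg[OF \<nu> f(3)]) (use f(4) g(2) in simp)
  then have "0 \<le> Re (cinner H F)" using f(3) by (simp add: f(1,2) cinner_abs_L2 bessel_max_def)
  then show ?thesis using that e by blast
qed

text \<open>Half of a lower bound for the distance from \<open>z\<close> to the half-line; the factor compensates
  the constant in \<open>cinner_norm_le\<close>. For real \<open>z\<close> the distance is \<open>- Re
  z\<close>, for nonreal \<open>z\<close> at least \<open>\<bar>Im z\<bar>\<close>.\<close>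

definition gap :: "complex \<Rightarrow> real" where "gap z = (if Im z = 0 then - Re z else \<bar>Im z\<bar>) / 2"

lemma gap_pos: "z \<notin> \<real>\<^sub>\<ge>\<^sub>0 \<Longrightarrow> gap z > 0"
  by (auto simp: gap_def complex_nonneg_Reals_iff)

text \<open>The quadratic form of $A_0 - z$ on a unit vector lies in $[0,\infty) - z$, hence is at least the
  distance of \<open>z\<close> from the half-line in absolute value.\<close>

lemma A0_lower_bound:
  assumes FH: "(F, H) \<in> A0" and z: "z \<notin> \<real>\<^sub>\<ge>\<^sub>0"
  shows "gap z * norm F \<le> norm (H - z *\<^sub>C F)"
proof (cases "F = 0")
  case False
  obtain r where r: "r \<ge> 0" "cinner H F = of_real r" using A0_nonneg[OF FH] .
  let ?n = "norm F"
  have n: "?n > 0" using False by simp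
  have e: "cinner (H - z *\<^sub>C F) F = of_real r - z * of_real (?n\<^sup>2)"
    by (simp add: cinner_diff_left cinner_scaleC_left r cinner_self del: of_real_power)
  have "2 * gap z * ?n\<^sup>2 \<le> cmod (of_real r - z * of_real (?n\<^sup>2))"
  proof (cases "Im z = 0")
    case True
    have "- Re z * ?n\<^sup>2 \<le> r - Re z * ?n\<^sup>2" using r by simp
    also have "\<dots> = Re (of_real r - z * of_real (?n\<^sup>2))" by (simp del: of_real_power)
    also have "\<dots> \<le> cmod (of_real r - z * of_real (?n\<^sup>2))" by (rule complex_Re_le_cmod)
    finally show ?thesis using True by (simp add: gap_def)
  next
    case False
    have "\<bar>Im z\<bar> * ?n\<^sup>2 = \<bar>Im (of_real r - z * of_real (?n\<^sup>2))\<bar>" by (simp add: abs_mult del: of_real_power)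
    also have "\<dots> \<le> cmod (of_real r - z * of_real (?n\<^sup>2))" by (rule abs_Im_le_cmod)
    finally show ?thesis using False by (simp add: gap_def)
  qed
  also have "\<dots> \<le> 2 * (norm (H - z *\<^sub>C F) * ?n)" unfolding e[symmetric] by (rule cinner_norm_le)
  finally have "(gap z * ?n) * ?n \<le> norm (H - z *\<^sub>C F) * ?n" by (simp add: power2_eq_square)
  then show ?thesis using n by (rule mult_right_le_imp_le)
qed simp

lemma resolvent_set_A0:
  assumes z: "z \<notin> \<real>\<^sub>\<ge>\<^sub>0" shows "z \<in> resolvent_set_of A0"
proof (rule resolvent_setI[of A0 "gap z"])
  show "(0, 0) \<in> A0" by (simp add: A0_def bessel_graph_zero bessel_Gamma_zero)
  show "(f + g, f' + g') \<in> A0" if "(f, f') \<in> A0" "(g, g') \<in> A0" for f f' g g'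
    using that bessel_graph_add[OF \<nu>, of f f' g g'] by (auto simp: A0_def)
  show "(c *\<^sub>C f, c *\<^sub>C f') \<in> A0" if "(f, f') \<in> A0" for c f f'
    using that bessel_graph_scale[OF \<nu>, of f f' c] by (auto simp: A0_def)
  show "closed A0" using adjoint_closed[of A0] by (simp add: adjoint_A0)
  show "gap z > 0" by (rule gap_pos[OF z])
  show "gap z * norm f \<le> norm (f' - z *\<^sub>C f)" if "(f, f') \<in> A0" for f f' by (rule A0_lower_bound[OF that z])
  fix y assume y: "\<And>f f'. (f, f') \<in> A0 \<Longrightarrow> cinner (f' - z *\<^sub>C f) y = 0"
  have "cinner f' y = cinner f (cnj z *\<^sub>C y)" if "(f, f') \<in> A0" for f f'
    using y[OF that] by (simp add: cinner_diff_left cinner_scaleC_left cinner_scaleC_right)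
  then have "(y, cnj z *\<^sub>C y) \<in> A0" using adjoint_A0 by (auto simp: adjoint_operator_def)
  moreover have "cnj z \<notin> \<real>\<^sub>\<ge>\<^sub>0" using z by (auto simp: complex_nonneg_Reals_iff)
  ultimately have "gap (cnj z) * norm y \<le> 0" "gap (cnj z) > 0" using A0_lower_bound[of y "cnj z *\<^sub>C y" "cnj z"] gap_pos by auto
  then show "y = 0" by (simp add: mult_le_0_iff)
qed

text \<open>Subtracting from an eigenvector the multiple of \<open>weyl_vec z\<close> with the same value of
  $\Gamma_0$ leaves an eigenvector of $A_0$, which is zero by the lower bound.\<close>

lemma eigenspace_minimal:
  assumes z: "z \<notin> \<real>\<^sub>\<ge>\<^sub>0"
  shows "F \<in> eigenspace_of (adjoint_operator (bessel_minimal \<nu>)) z \<longleftrightarrow> (\<exists>c. F = c *\<^sub>C weyl_vec z)"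
proof
  assume "F \<in> eigenspace_of (adjoint_operator (bessel_minimal \<nu>)) z"
  then have F: "(F, z *\<^sub>C F) \<in> bessel_graph \<nu>" by (simp add: eigenspace_of_def adjoint_bessel_minimal \<nu>)
  define c where "c = \<Gamma>0 F / \<Gamma>0 (weyl_vec z)"
  note s = bessel_graph_scale[OF \<nu> weyl_vec_graph[OF z], of "- c"]
  note a = bessel_graph_add[OF \<nu> F s(1)]
  have g0: "\<Gamma>0 (F + (- c) *\<^sub>C weyl_vec z) = 0" unfolding a(2) s(2) using weyl_vec_Gamma0(2)[OF z] by (simp add: c_def)
  have e: "z *\<^sub>C F + (- c) *\<^sub>C z *\<^sub>C weyl_vec z = z *\<^sub>C (F + (- c) *\<^sub>C weyl_vec z)"
    by (simp add: scaleC_add_right scaleC_scaleC mult.commute)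
  have "(F + (- c) *\<^sub>C weyl_vec z, z *\<^sub>C (F + (- c) *\<^sub>C weyl_vec z)) \<in> A0" using a(1) g0 unfolding e A0_def by simp
  from A0_lower_bound[OF this z] have "gap z * norm (F + (- c) *\<^sub>C weyl_vec z) \<le> 0" by simp
  then have "F + (- c) *\<^sub>C weyl_vec z = 0" using gap_pos[OF z] by (simp add: mult_le_0_iff)
  moreover have "(- c) *\<^sub>C weyl_vec z = - (c *\<^sub>C weyl_vec z)" using scaleC_scaleC[of "-1" c "weyl_vec z"] by (simp add: scaleC_minus1)
  ultimately have "F = c *\<^sub>C weyl_vec z" by simp
  then show "\<exists>c. F = c *\<^sub>C weyl_vec z" by blast
next
  assume "\<exists>c. F = c *\<^sub>C weyl_vec z"
  then obtain c where "F = c *\<^sub>C weyl_vec z" by blast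
  then show "F \<in> eigenspace_of (adjoint_operator (bessel_minimal \<nu>)) z"
    using bessel_graph_scale(1)[OF \<nu> weyl_vec_graph[OF z], of c]
    by (simp add: eigenspace_of_def adjoint_bessel_minimal \<nu> scaleC_scaleC mult.commute)
qed

lemma orthonormal_basis_eigenspace:
  assumes z: "z \<notin> \<real>\<^sub>\<ge>\<^sub>0"
  shows "orthonormal_basis_of (eigenspace_of (adjoint_operator (bessel_minimal \<nu>)) z) {of_real (1 / norm (weyl_vec z)) *\<^sub>C weyl_vec z}"
proof -
  let ?n = "norm (weyl_vec z)"
  have n: "?n > 0" using weyl_vec_nonzero[OF z] by simp
  have 1: "cinner (of_real (1 / ?n) *\<^sub>C weyl_vec z) (of_real (1 / ?n) *\<^sub>C weyl_vec z) = 1"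
    unfolding cinner_scaleC_left cinner_scaleC_right unfolding cinner_self using n by (simp add: power2_eq_square)
  have 2: "c *\<^sub>C weyl_vec z = 0" if "cinner (c *\<^sub>C weyl_vec z) (of_real (1 / ?n) *\<^sub>C weyl_vec z) = 0" for c
    using that n unfolding cinner_scaleC_left cinner_scaleC_right unfolding cinner_self by auto
  show ?thesis unfolding orthonormal_basis_of_def using 1 2 by (auto simp: eigenspace_minimal[OF z])
qed

lemma bessel_boundary_triplet: "boundary_triplet (bessel_minimal \<nu>) \<Gamma>0 \<Gamma>1"
  unfolding boundary_triplet_def adjoint_bessel_minimal[OF \<nu>]
proof (intro conjI linear_operator_minimal densely_defined_minimal symmetric_minimal)
  show "closed (bessel_minimal \<nu>)" by (simp add: bessel_minimal_def)
  show "equal_deficiency_indices (bessel_minimal \<nu>)"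
    unfolding equal_deficiency_indices_def
    by (intro exI conjI, rule orthonormal_basis_eigenspace[OF i_notin_nonneg(1)], rule orthonormal_basis_eigenspace[OF i_notin_nonneg(2)])
       (auto simp: eqpoll_singleton_iff)
  show "\<forall>\<Gamma>\<in>{\<Gamma>0, \<Gamma>1}. \<forall>f\<in>Domain (bessel_graph \<nu>). \<forall>g\<in>Domain (bessel_graph \<nu>). \<forall>c. \<Gamma> (f + g) = \<Gamma> f + \<Gamma> g \<and> \<Gamma> (c *\<^sub>C f) = c *\<^sub>C \<Gamma> f"
  proof (intro ballI allI)
    fix \<Gamma> f g c assume "\<Gamma> \<in> {\<Gamma>0, \<Gamma>1}" and fg: "f \<in> Domain (bessel_graph \<nu>)" "g \<in> Domain (bessel_graph \<nu>)"
    obtain f' g' where "(f, f') \<in> bessel_graph \<nu>" "(g, g') \<in> bessel_graph \<nu>" using fg by blast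
    then show "\<Gamma> (f + g) = \<Gamma> f + \<Gamma> g \<and> \<Gamma> (c *\<^sub>C f) = c *\<^sub>C \<Gamma> f"
      using \<open>\<Gamma> \<in> {\<Gamma>0, \<Gamma>1}\<close> bessel_graph_add[OF \<nu>, of f f' g g'] bessel_graph_scale[OF \<nu>, of f f' c]
      by (auto simp: scaleC_complex_def)
  qed
  show "\<forall>(f, f')\<in>bessel_graph \<nu>. \<forall>(g, g')\<in>bessel_graph \<nu>. cinner f' g - cinner f g' = cinner (\<Gamma>1 f) (\<Gamma>0 g) - cinner (\<Gamma>0 f) (\<Gamma>1 g)"
    using bessel_graph_green[OF \<nu>] by (auto simp: cinner_complex_def)
  show "(\<lambda>f. (\<Gamma>0 f, \<Gamma>1 f)) ` Domain (bessel_graph \<nu>) = UNIV"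
  proof (intro equalityI subsetI UNIV_I)
    fix p :: "complex \<times> complex"
    obtain a b where p: "p = (a, b)" by (cases p)
    obtain F H where "(F, H) \<in> bessel_graph \<nu>" "\<Gamma>0 F = a" "\<Gamma>1 F = b" using Gamma_surjective[of a b] by (elim exE conjE)
    then show "p \<in> (\<lambda>f. (\<Gamma>0 f, \<Gamma>1 f)) ` Domain (bessel_graph \<nu>)" unfolding p by (intro image_eqI[of _ _ F]) auto
  qed
qed

text \<open>On the one-dimensional eigenspace the Weyl function is the quotient of the boundary values of a spanning
  vector.\<close>

lemma bessel_weyl_function:
  assumes z: "z \<notin> \<real>\<^sub>\<ge>\<^sub>0"
  shows "weyl_function (bessel_minimal \<nu>) \<Gamma>0 \<Gamma>1 z h = \<Gamma>1 (weyl_vec z) / \<Gamma>0 (weyl_vec z) * h"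
proof -
  let ?V = "eigenspace_of (adjoint_operator (bessel_minimal \<nu>)) z"
  let ?c = "h / \<Gamma>0 (weyl_vec z)"
  note s = bessel_graph_scale[OF \<nu> weyl_vec_graph[OF z]]
  have inj: "inj_on \<Gamma>0 ?V"
    using weyl_vec_Gamma0(2)[OF z] by (auto simp: inj_on_def eigenspace_minimal[OF z] s(2))
  have "the_inv_into ?V \<Gamma>0 h = ?c *\<^sub>C weyl_vec z"
    by (rule the_inv_into_f_eq[OF inj]) (use weyl_vec_Gamma0(2)[OF z] in \<open>auto simp: eigenspace_minimal[OF z] s(2)\<close>)
  then show ?thesis unfolding weyl_function_def by (simp add: s(3))
qed

end


section \<open>Uniqueness of the Nevanlinna measure\<close>

text \<open>The integral over \<open>x\<close> from \<open>a\<close> to \<open>b\<close> of the Poisson kernel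
  $y/((t-x)^2 + y^2)$.\<close>

definition arctan_diff :: "real \<Rightarrow> real \<Rightarrow> real \<Rightarrow> real \<Rightarrow> real" where
  "arctan_diff y a b t = arctan ((b - t) / y) - arctan ((a - t) / y)"

lemma arctan_diff_deriv:
  assumes "y > 0"
  shows "((\<lambda>b. arctan_diff y a b t) has_real_derivative y / ((t - b)\<^sup>2 + y\<^sup>2)) (at b)"
proof -
  have "((\<lambda>b. arctan_diff y a b t) has_real_derivative inverse (1 + ((b - t) / y)\<^sup>2) * (1 / y)) (at b)"
    unfolding arctan_diff_def using assms by (auto intro!: derivative_eq_intros)
  moreover have "inverse (1 + ((b - t) / y)\<^sup>2) * (1 / y) = y / ((t - b)\<^sup>2 + y\<^sup>2)"
  proof -
    have "1 + ((b - t) / y)\<^sup>2 = ((t - b)\<^sup>2 + y\<^sup>2) / y\<^sup>2" using assms by (simp add: field_simps power2_commute)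
    then show ?thesis using assms by (simp add: power2_eq_square)
  qed
  ultimately show ?thesis by simp
qed

text \<open>Domination by the weight $1/(1+t^2)$ for fixed \<open>y\<close>; from $t^2 \le 2(t-x)^2 + 2x^2$.\<close>

lemma poisson_bound:
  fixes x y R t :: real
  assumes "y > 0" "\<bar>x\<bar> \<le> R"
  shows "y / ((t - x)\<^sup>2 + y\<^sup>2) \<le> y * (2 + (2 * R\<^sup>2 + 1) / y\<^sup>2) * (1 / (1 + t\<^sup>2))"
proof -
  have pos: "(t - x)\<^sup>2 + y\<^sup>2 > 0" by (rule add_nonneg_pos[OF zero_le_power2 zero_less_power[OF assms(1)]])
  have "x\<^sup>2 \<le> R\<^sup>2" using assms by (metis abs_ge_zero power2_abs power_mono)
  moreover have "t\<^sup>2 \<le> 2 * (t - x)\<^sup>2 + 2 * x\<^sup>2" using zero_le_power2[of "t - 2 * x"] by (simp add: power2_eq_square algebra_simps)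
  ultimately have "1 + t\<^sup>2 \<le> 2 * (t - x)\<^sup>2 + (2 * R\<^sup>2 + 1)" by simp
  also have "\<dots> \<le> (2 * (t - x)\<^sup>2 + (2 * R\<^sup>2 + 1)) + (2 * y\<^sup>2 + (2 * R\<^sup>2 + 1) / y\<^sup>2 * (t - x)\<^sup>2)" by simp
  also have "\<dots> = (2 + (2 * R\<^sup>2 + 1) / y\<^sup>2) * ((t - x)\<^sup>2 + y\<^sup>2)" using assms by (simp add: field_simps)
  finally have "1 / ((t - x)\<^sup>2 + y\<^sup>2) \<le> (2 + (2 * R\<^sup>2 + 1) / y\<^sup>2) * (1 / (1 + t\<^sup>2))"
    using pos by (simp add: divide_simps add_pos_nonneg mult.commute)
  then have "y * (1 / ((t - x)\<^sup>2 + y\<^sup>2)) \<le> y * ((2 + (2 * R\<^sup>2 + 1) / y\<^sup>2) * (1 / (1 + t\<^sup>2)))"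
    using assms by (intro mult_left_mono) auto
  then show ?thesis by (simp add: mult.assoc)
qed

text \<open>Here the bound has to be uniform in \<open>y\<close>, so that the limit \<open>y \<longlongrightarrow>
  0\<close> may be taken under the integral. For bounded \<open>t\<close> it is trivial, and for large
  \<open>t\<close> the distance of \<open>t\<close> from \<open>[- R, R]\<close> is at least
  \<open>1\<close>, where the Poisson kernel is at most $1/(t-x)^2$.\<close>

lemma arctan_diff_bound:
  assumes y: "0 < y" "y \<le> 1" and ab: "\<bar>a\<bar> \<le> R" "\<bar>b\<bar> \<le> R"
  shows "\<bar>arctan_diff y a b t\<bar> \<le> ((pi * (1 + (R + 1)\<^sup>2)) + 2 * R * (2 * R\<^sup>2 + 3)) * (1 / (1 + t\<^sup>2))"
proof -
  have R: "R \<ge> 0" using ab by simp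
  have t0: "1 + t\<^sup>2 > 0" by (simp add: add_pos_nonneg)
  show ?thesis
  proof (cases "\<bar>t\<bar> \<le> R + 1")
    case True
    have "\<bar>arctan_diff y a b t\<bar> \<le> pi"
      unfolding arctan_diff_def using arctan_bounded[of "(b - t) / y"] arctan_bounded[of "(a - t) / y"] by (auto simp: abs_le_iff)
    also have "pi \<le> (pi * (1 + (R + 1)\<^sup>2)) * (1 / (1 + t\<^sup>2))"
    proof -
      have "t\<^sup>2 \<le> (R + 1)\<^sup>2" using True R by (metis abs_ge_zero power2_abs power_mono)
      then have "pi * (1 + t\<^sup>2) \<le> pi * (1 + (R + 1)\<^sup>2)" by (intro mult_left_mono) auto
      then show ?thesis using t0 by (simp add: pos_le_divide_eq)
    qed
    also have "\<dots> \<le> ((pi * (1 + (R + 1)\<^sup>2)) + 2 * R * (2 * R\<^sup>2 + 3)) * (1 / (1 + t\<^sup>2))"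
      using R t0 by (intro mult_right_mono) auto
    finally show ?thesis .
  next
    case False
    define C where "C = (2 * R\<^sup>2 + 3) * (1 / (1 + t\<^sup>2))"
    have "norm (arctan_diff y a b t - arctan_diff y a a t) \<le> C * norm (b - a)"
    proof (rule field_differentiable_bound[of "{-R..R}" "\<lambda>b. arctan_diff y a b t" "\<lambda>b. y / ((t - b)\<^sup>2 + y\<^sup>2)"])
      fix x assume x: "x \<in> {-R..R}"
      show "((\<lambda>b. arctan_diff y a b t) has_real_derivative y / ((t - x)\<^sup>2 + y\<^sup>2)) (at x within {-R..R})"
        by (rule has_field_derivative_at_within[OF arctan_diff_deriv[OF y(1)]])
      have tx: "\<bar>t - x\<bar> \<ge> 1" using x False by auto
      then have tx2: "(t - x)\<^sup>2 \<ge> 1" by (metis abs_square_le_1 linorder_linear one_power2 power2_abs abs_1 power_mono zero_le_one)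
      have "x\<^sup>2 \<le> R\<^sup>2" using x by (metis abs_le_iff atLeastAtMost_iff abs_ge_zero minus_le_iff power2_abs power_mono)
      moreover have "t\<^sup>2 \<le> 2 * (t - x)\<^sup>2 + 2 * x\<^sup>2" using zero_le_power2[of "t - 2 * x"] by (simp add: power2_eq_square algebra_simps)
      moreover have "2 * R\<^sup>2 + 1 \<le> (2 * R\<^sup>2 + 1) * (t - x)\<^sup>2" using mult_left_mono[OF tx2, of "2 * R\<^sup>2 + 1"] by simp
      ultimately have "1 + t\<^sup>2 \<le> 2 * (t - x)\<^sup>2 + (2 * R\<^sup>2 + 1) * (t - x)\<^sup>2" by linarith
      also have "\<dots> = (2 * R\<^sup>2 + 3) * (t - x)\<^sup>2" by (simp add: algebra_simps)
      finally have le: "1 / (t - x)\<^sup>2 \<le> C" unfolding C_def using tx2 t0 by (simp add: divide_simps mult.commute)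
      have "y / ((t - x)\<^sup>2 + y\<^sup>2) \<le> 1 / (t - x)\<^sup>2" using y tx2 by (intro frac_le) auto
      then show "norm (y / ((t - x)\<^sup>2 + y\<^sup>2)) \<le> C" using le y by simp
    qed (use ab in auto)
    also have "\<dots> \<le> C * (2 * R)"
    proof (rule mult_left_mono)
      show "norm (b - a) \<le> 2 * R" using ab by simp
      show "0 \<le> C" unfolding C_def using t0 by simp
    qed
    also have "C * (2 * R) = (2 * R * (2 * R\<^sup>2 + 3)) * (1 / (1 + t\<^sup>2))" by (simp add: C_def)
    also have "\<dots> \<le> ((pi * (1 + (R + 1)\<^sup>2)) + 2 * R * (2 * R\<^sup>2 + 3)) * (1 / (1 + t\<^sup>2))"
      using R t0 by (intro mult_right_mono) auto
    finally show ?thesis by (simp add: arctan_diff_def)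
  qed
qed

lemma nevanlinna_measure_integrable:
  assumes "nevanlinna_measure m \<mu>" shows "integrable \<mu> (\<lambda>t. 1 / (1 + t\<^sup>2))"
proof (rule integrableI_bounded)
  have [measurable_cong]: "sets \<mu> = sets borel" using assms by (simp add: nevanlinna_measure_def)
  show "(\<lambda>t. 1 / (1 + t\<^sup>2)) \<in> borel_measurable \<mu>" by measurable
  have "(\<integral>\<^sup>+t. ennreal (norm (1 / (1 + t\<^sup>2))) \<partial>\<mu>) = (\<integral>\<^sup>+t. ennreal (1 / (1 + t\<^sup>2)) \<partial>\<mu>)"
    by (intro nn_integral_cong) (simp add: add_nonneg_nonneg)
  then show "(\<integral>\<^sup>+t. ennreal (norm (1 / (1 + t\<^sup>2))) \<partial>\<mu>) < \<infinity>" using assms by (simp add: nevanlinna_measure_def)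
qed

lemma integrable_weight_bound:
  fixes f :: "real \<Rightarrow> 'b::{banach, second_countable_topology}"
  assumes \<mu>: "nevanlinna_measure m \<mu>" and f: "f \<in> borel_measurable borel" and le: "\<And>t. norm (f t) \<le> C * (1 / (1 + t\<^sup>2))"
  shows "integrable \<mu> f"
proof (rule Bochner_Integration.integrable_bound)
  show "integrable \<mu> (\<lambda>t. C * (1 / (1 + t\<^sup>2)))" by (rule integrable_mult_right[OF nevanlinna_measure_integrable[OF \<mu>]])
  have "sets \<mu> = sets borel" using \<mu> by (simp add: nevanlinna_measure_def)
  then show "f \<in> borel_measurable \<mu>" using f by (simp cong: measurable_cong_sets)
  show "AE t in \<mu>. norm (f t) \<le> norm (C * (1 / (1 + t\<^sup>2)))"
    by (rule AE_I2) (use order_trans[OF le abs_ge_self] in simp)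
qed

text \<open>The difference equals $(1 + t z)/((t - z)(1 + t^2))$, and $(1 + t z)/(t - z)$ is bounded in
  \<open>t\<close>.\<close>

lemma nevanlinna_kernel_bound:
  assumes z: "Im z \<noteq> 0"
  shows "\<exists>C. \<forall>t::real. cmod (1 / (of_real t - z) - of_real (t / (1 + t\<^sup>2))) \<le> C * (1 / (1 + t\<^sup>2))"
proof -
  define y where "y = \<bar>Im z\<bar>"
  define K where "K = 2 + (2 * (Re z)\<^sup>2 + 1) / y\<^sup>2"
  have y: "y > 0" using z by (simp add: y_def)
  have "cmod (1 / (of_real t - z) - of_real (t / (1 + t\<^sup>2))) \<le> (1 + cmod z) * (1 + (K + 1)) * (1 / (1 + t\<^sup>2))" for t :: real
  proof -
    have t0: "1 + t\<^sup>2 > 0" by (simp add: add_pos_nonneg)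
    have ct0: "complex_of_real (1 + t\<^sup>2) \<noteq> 0" using t0 by (simp only: of_real_eq_0_iff)
    have nz: "of_real t - z \<noteq> 0" using z by (auto simp: complex_eq_iff)
    have "1 / (of_real t - z) - of_real (t / (1 + t\<^sup>2)) = (1 + of_real t * z) / ((of_real t - z) * of_real (1 + t\<^sup>2))"
      using nz ct0 by (simp add: field_simps power2_eq_square)
    then have e: "cmod (1 / (of_real t - z) - of_real (t / (1 + t\<^sup>2))) = cmod (1 + of_real t * z) / cmod (of_real t - z) * (1 / (1 + t\<^sup>2))"
      using t0 by (simp add: norm_divide norm_mult del: of_real_add of_real_power)
    have sq: "(cmod (of_real t - z))\<^sup>2 = (t - Re z)\<^sup>2 + y\<^sup>2" by (simp add: cmod_power2 y_def)
    have "y * (1 / (cmod (of_real t - z))\<^sup>2) \<le> y * (K * (1 / (1 + t\<^sup>2)))"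
      using poisson_bound[OF y order_refl, of t "Re z"] unfolding sq K_def by (simp add: mult.assoc)
    then have "1 / (cmod (of_real t - z))\<^sup>2 \<le> K * (1 / (1 + t\<^sup>2))" using y by (simp only: mult_le_cancel_left_pos)
    then have "1 / (cmod (of_real t - z))\<^sup>2 \<le> K / (1 + t\<^sup>2)" by simp
    then have le: "(1 + t\<^sup>2) \<le> K * (cmod (of_real t - z))\<^sup>2" using nz t0 by (simp add: field_simps)
    have K0: "K \<ge> 0" by (simp add: K_def)
    have "(1 + \<bar>t\<bar>)\<^sup>2 \<le> 2 * (1 + t\<^sup>2)" using zero_le_power2[of "1 - \<bar>t\<bar>"] by (simp add: power2_eq_square algebra_simps)
    also have "\<dots> \<le> 2 * (K * (cmod (of_real t - z))\<^sup>2)" using le by simp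
    also have "\<dots> \<le> ((1 + (K + 1)) * cmod (of_real t - z))\<^sup>2"
    proof -
      have "2 * K \<le> (1 + (K + 1))\<^sup>2" using K0 by (simp add: power2_eq_square algebra_simps)
      then show ?thesis unfolding power_mult_distrib by (simp add: mult_right_mono flip: mult.assoc)
    qed
    finally have "1 + \<bar>t\<bar> \<le> (1 + (K + 1)) * cmod (of_real t - z)"
      by (rule power2_le_imp_le) (use K0 in simp)
    moreover have "cmod (1 + of_real t * z) \<le> (1 + cmod z) * (1 + \<bar>t\<bar>)"
    proof -
      have "cmod (1 + of_real t * z) \<le> 1 + \<bar>t\<bar> * cmod z" using norm_triangle_ineq[of 1 "of_real t * z"] by (simp add: norm_mult)
      also have "\<dots> \<le> (1 + \<bar>t\<bar> * cmod z) + (cmod z + \<bar>t\<bar>)" by simp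
      finally show ?thesis by (simp add: algebra_simps)
    qed
    ultimately have "cmod (1 + of_real t * z) \<le> (1 + cmod z) * ((1 + (K + 1)) * cmod (of_real t - z))"
      by (meson add_nonneg_nonneg mult_left_mono norm_ge_zero order_trans zero_le_one)
    then have "cmod (1 + of_real t * z) / cmod (of_real t - z) \<le> (1 + cmod z) * (1 + (K + 1))"
      using nz by (simp add: divide_le_eq mult.assoc)
    then show ?thesis unfolding e using t0 by (intro mult_right_mono) auto
  qed
  then show ?thesis by blast
qed

lemma nevanlinna_Im:
  assumes \<mu>: "nevanlinna_measure m \<mu>" and y: "y > 0"
  shows "Im (m (Complex x y)) = (LINT t|\<mu>. y / ((t - x)\<^sup>2 + y\<^sup>2))"
proof -
  let ?z = "Complex x y"
  let ?f = "\<lambda>t. 1 / (complex_of_real t - ?z) - of_real (t / (1 + t\<^sup>2))"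
  obtain C0 :: real where C0: "m ?z = of_real C0 + (LINT t|\<mu>. ?f t)" using \<mu> y unfolding nevanlinna_measure_def by force
  obtain C where C: "\<And>t. cmod (?f t) \<le> C * (1 / (1 + t\<^sup>2))" using nevanlinna_kernel_bound[of ?z] y by auto
  have i: "integrable \<mu> ?f" by (rule integrable_weight_bound[OF \<mu> _ C]) measurable
  have "Im (m ?z) = Im (LINT t|\<mu>. ?f t)" unfolding C0 by (simp only: plus_complex.simps Im_complex_of_real add_0)
  also have "\<dots> = (LINT t|\<mu>. Im (?f t))" by (rule integral_bounded_linear[OF bounded_linear_Im i, symmetric])
  also have "\<dots> = (LINT t|\<mu>. y / ((t - x)\<^sup>2 + y\<^sup>2))"
    by (intro Bochner_Integration.integral_cong refl) (simp add: Im_divide power2_eq_square)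
  finally show ?thesis .
qed

text \<open>As functions of \<open>b\<close> both sides have the derivative \<open>Im (m (Complex b y))\<close>, and
  they vanish at \<open>b = a\<close>. Differentiating in this way makes the interchange of two
  integrals unnecessary.\<close>

lemma nevanlinna_arctan_eq:
  assumes \<mu>: "nevanlinna_measure m \<mu>" and \<mu>': "nevanlinna_measure m \<mu>'" and y: "0 < y" "y \<le> 1" and ab: "a < b"
  shows "(LINT t|\<mu>. arctan_diff y a b t) = (LINT t|\<mu>'. arctan_diff y a b t)"
proof -
  define R where "R = \<bar>a\<bar> + \<bar>b\<bar> + 1"
  have R: "\<bar>x\<bar> \<le> R" if "x \<in> {a - 1<..<b + 1}" for x using that ab by (auto simp: R_def)
  have aR: "\<bar>a\<bar> \<le> R" by (simp add: R_def)
  have m1: "(\<lambda>t. complex_of_real (arctan_diff y a x t)) \<in> borel_measurable borel" for x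
    unfolding arctan_diff_def by measurable
  have m2: "(\<lambda>t. complex_of_real (y / ((t - x)\<^sup>2 + y\<^sup>2))) \<in> borel_measurable borel" for x by measurable
  have int: "integrable \<nu> (\<lambda>t. complex_of_real (arctan_diff y a x t))" if \<nu>: "nevanlinna_measure m \<nu>" and x: "x \<in> {a - 1<..<b + 1}" for \<nu> x
    by (rule integrable_weight_bound[OF \<nu> m1, where C = "(pi * (1 + (R + 1)\<^sup>2)) + 2 * R * (2 * R\<^sup>2 + 3)"])
       (use arctan_diff_bound[OF y aR R[OF x]] in \<open>simp only: norm_of_real\<close>)
  have der: "((\<lambda>x. LINT t|\<nu>. complex_of_real (arctan_diff y a x t)) has_vector_derivative of_real (Im (m (Complex x0 y)))) (at x0)"
    if \<nu>: "nevanlinna_measure m \<nu>" and x0: "x0 \<in> {a - 1<..<b + 1}" for \<nu> x0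
  proof -
    have sets: "sets \<nu> = sets borel" using \<nu> by (simp add: nevanlinna_measure_def)
    have "((\<lambda>x. LINT t|\<nu>. complex_of_real (arctan_diff y a x t)) has_vector_derivative (LINT t|\<nu>. complex_of_real (y / ((t - x0)\<^sup>2 + y\<^sup>2)))) (at x0)"
    proof (rule leibniz_rule_dominated[OF x0 int[OF \<nu>], where g = "\<lambda>t. y * (2 + (2 * R\<^sup>2 + 1) / y\<^sup>2) * (1 / (1 + t\<^sup>2))"])
      show "((\<lambda>x. complex_of_real (arctan_diff y a x s)) has_vector_derivative complex_of_real (y / ((s - x)\<^sup>2 + y\<^sup>2))) (at x)" for x s
        by (rule has_vector_derivative_of_real[OF arctan_diff_deriv[OF y(1)]])
      show "cmod (complex_of_real (y / ((s - x)\<^sup>2 + y\<^sup>2))) \<le> y * (2 + (2 * R\<^sup>2 + 1) / y\<^sup>2) * (1 / (1 + s\<^sup>2))" if "x \<in> {a - 1<..<b + 1}" for x s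
      proof -
        have "cmod (complex_of_real (y / ((s - x)\<^sup>2 + y\<^sup>2))) = y / ((s - x)\<^sup>2 + y\<^sup>2)"
          unfolding norm_of_real using y by (intro abs_of_nonneg divide_nonneg_nonneg add_nonneg_nonneg) auto
        then show ?thesis using poisson_bound[OF y(1) R[OF that], of s] by (simp only:)
      qed
      show "integrable \<nu> (\<lambda>t. y * (2 + (2 * R\<^sup>2 + 1) / y\<^sup>2) * (1 / (1 + t\<^sup>2)))"
        by (rule integrable_mult_right[OF nevanlinna_measure_integrable[OF \<nu>]])
      show "(\<lambda>s. complex_of_real (y / ((s - x0)\<^sup>2 + y\<^sup>2))) \<in> borel_measurable \<nu>"
        using m2[of x0] sets by (simp cong: measurable_cong_sets)
    qed
    moreover have "(LINT t|\<nu>. complex_of_real (y / ((t - x0)\<^sup>2 + y\<^sup>2))) = of_real (Im (m (Complex x0 y)))"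
      unfolding nevanlinna_Im[OF \<nu> y(1)] by (rule integral_complex_of_real)
    ultimately show ?thesis by (simp only:)
  qed
  let ?D = "\<lambda>x. (LINT t|\<mu>. complex_of_real (arctan_diff y a x t)) - (LINT t|\<mu>'. complex_of_real (arctan_diff y a x t))"
  have "cmod (?D b - ?D a) \<le> 0 * \<bar>b - a\<bar>"
  proof (rule vector_derivative_norm_bound[where a = "a - 1" and b = "b + 1" and f = ?D and f' = "\<lambda>_. 0"])
    show "(?D has_vector_derivative 0) (at x)" if "x \<in> {a - 1<..<b + 1}" for x
      using has_vector_derivative_diff[OF der[OF \<mu> that] der[OF \<mu>' that]] by simp
  qed (use ab in auto)
  moreover have "?D a = 0" by (simp add: arctan_diff_def)
  ultimately have "(LINT t|\<mu>. complex_of_real (arctan_diff y a b t)) = (LINT t|\<mu>'. complex_of_real (arctan_diff y a b t))" by simp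
  then show ?thesis unfolding integral_complex_of_real by (simp only: of_real_eq_iff)
qed

text \<open>The shift of \<open>c\<close> by \<open>1 / (n + 1)\<close> together with the smaller height \<open>1 /
  (n + 1)\<^sup>2\<close> gives the limit at \<open>t = c\<close> the same value as to the left of
  \<open>c\<close>; without the shift it would be \<open>0\<close> there and atoms would be counted by
  half.\<close>

lemma arctan_step_limit:
  "(\<lambda>n. arctan ((c + 1 / (real n + 1) - t) / (1 / (real n + 1)\<^sup>2))) \<longlonglongrightarrow> (if t \<le> c then pi / 2 else - (pi / 2))"
proof -
  have e: "(c + 1 / (real n + 1) - t) / (1 / (real n + 1)\<^sup>2) = (real n + 1) * ((c - t) * (real n + 1) + 1)" for n
    by (simp add: power2_eq_square field_simps)
  have N: "filterlim (\<lambda>n. real n + 1) at_top sequentially"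
    by (rule filterlim_at_top_mono[OF filterlim_real_sequentially]) (simp add: always_eventually)
  show ?thesis
  proof (cases "t \<le> c")
    case True
    have "real n + 1 \<le> (real n + 1) * ((c - t) * (real n + 1) + 1)" for n
      using mult_left_mono[of 1 "(c - t) * (real n + 1) + 1" "real n + 1"] True by simp
    then have "filterlim (\<lambda>n. (real n + 1) * ((c - t) * (real n + 1) + 1)) at_top sequentially"
      by (intro filterlim_at_top_mono[OF N] always_eventually allI)
    then show ?thesis unfolding e using True filterlim_compose[OF tendsto_arctan_at_top] by simp
  next
    case False
    have "filterlim (\<lambda>n. (real n + 1) * ((c - t) * (real n + 1) + 1)) at_bot sequentially"
      unfolding filterlim_uminus_at_bot
    proof (rule filterlim_at_top_mono[OF N])
      have "\<forall>\<^sub>F n in sequentially. real n + 1 \<ge> 2 / (t - c)" using N by (rule filterlim_at_top[THEN iffD1, THEN spec])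
      then show "\<forall>\<^sub>F n in sequentially. real n + 1 \<le> - ((real n + 1) * ((c - t) * (real n + 1) + 1))"
      proof (rule eventually_mono)
        fix n assume "2 / (t - c) \<le> real n + 1"
        then have "1 \<le> (t - c) * (real n + 1) - 1" using False by (simp add: field_simps)
        then have "(real n + 1) * 1 \<le> (real n + 1) * ((t - c) * (real n + 1) - 1)" by (intro mult_left_mono) auto
        also have "\<dots> = - ((real n + 1) * ((c - t) * (real n + 1) + 1))" by (simp add: algebra_simps)
        finally show "real n + 1 \<le> - ((real n + 1) * ((c - t) * (real n + 1) + 1))" by simp
      qed
    qed
    then show ?thesis unfolding e using False filterlim_compose[OF tendsto_arctan_at_bot] by simp
  qed
qed

lemma nevanlinna_measure_finite:
  assumes \<mu>: "nevanlinna_measure m \<mu>" shows "emeasure \<mu> {a<..b} \<noteq> \<infinity>"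
proof -
  define R where "R = \<bar>a\<bar> + \<bar>b\<bar>"
  have s: "sets \<mu> = sets borel" using \<mu> by (simp add: nevanlinna_measure_def)
  have "integrable \<mu> (indicator {a<..b} :: real \<Rightarrow> real)"
  proof (rule integrable_weight_bound[OF \<mu>])
    show "norm (indicator {a<..b} t :: real) \<le> (1 + R\<^sup>2) * (1 / (1 + t\<^sup>2))" for t :: real
    proof (cases "t \<in> {a<..b}")
      case True
      then have "\<bar>t\<bar> \<le> R" by (auto simp: R_def)
      then have "t\<^sup>2 \<le> R\<^sup>2" by (metis abs_ge_zero power2_abs power_mono)
      then show ?thesis using True by (simp add: pos_le_divide_eq add_pos_nonneg)
    qed (simp add: add_nonneg_nonneg)
  qed measurable
  then show ?thesis using s by (simp add: integrable_indicator_iff less_top[symmetric])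
qed

lemma nevanlinna_measure_limit:
  assumes \<mu>: "nevanlinna_measure m \<mu>" and ab: "a < b"
  shows "(\<lambda>n. LINT t|\<mu>. arctan_diff (1 / (real n + 1)\<^sup>2) (a + 1 / (real n + 1)) (b + 1 / (real n + 1)) t)
    \<longlonglongrightarrow> pi * measure \<mu> {a<..b}"
proof -
  define R where "R = \<bar>a\<bar> + \<bar>b\<bar> + 1"
  define C where "C = (pi * (1 + (R + 1)\<^sup>2)) + 2 * R * (2 * R\<^sup>2 + 3)"
  have s: "sets \<mu> = sets borel" using \<mu> by (simp add: nevanlinna_measure_def)
  let ?f = "\<lambda>n. arctan_diff (1 / (real n + 1)\<^sup>2) (a + 1 / (real n + 1)) (b + 1 / (real n + 1))"
  have "(\<lambda>n. LINT t|\<mu>. ?f n t) \<longlonglongrightarrow> (LINT t|\<mu>. pi * indicator {a<..b} t)"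
  proof (rule integral_dominated_convergence[where w = "\<lambda>t. C * (1 / (1 + t\<^sup>2))"])
    show "(\<lambda>t. pi * indicator {a<..b} t :: real) \<in> borel_measurable \<mu>" unfolding measurable_cong_sets[OF s refl] by measurable
    show "?f n \<in> borel_measurable \<mu>" for n unfolding measurable_cong_sets[OF s refl] arctan_diff_def by measurable
    show "integrable \<mu> (\<lambda>t. C * (1 / (1 + t\<^sup>2)))" by (rule integrable_mult_right[OF nevanlinna_measure_integrable[OF \<mu>]])
    show "AE t in \<mu>. norm (?f n t) \<le> C * (1 / (1 + t\<^sup>2))" for n
    proof (rule AE_I2)
      fix t
      have n1: "0 < 1 / (real n + 1)" "1 / (real n + 1) \<le> 1" by simp_all
      have y: "0 < 1 / (real n + 1)\<^sup>2" "1 / (real n + 1)\<^sup>2 \<le> 1" by simp_all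
      have r: "\<bar>a + 1 / (real n + 1)\<bar> \<le> R" "\<bar>b + 1 / (real n + 1)\<bar> \<le> R" using n1 unfolding R_def by argo+
      show "norm (?f n t) \<le> C * (1 / (1 + t\<^sup>2))"
        unfolding real_norm_def C_def by (rule arctan_diff_bound[OF y r])
    qed
    show "AE t in \<mu>. (\<lambda>n. ?f n t) \<longlonglongrightarrow> pi * indicator {a<..b} t"
    proof (rule AE_I2)
      fix t
      have "(\<lambda>n. ?f n t) \<longlonglongrightarrow> (if t \<le> b then pi / 2 else - (pi / 2)) - (if t \<le> a then pi / 2 else - (pi / 2))"
        unfolding arctan_diff_def by (rule tendsto_diff[OF arctan_step_limit arctan_step_limit])
      then show "(\<lambda>n. ?f n t) \<longlonglongrightarrow> pi * indicator {a<..b} t" using ab by (auto simp: indicator_def split: if_splits)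
    qed
  qed
  then show ?thesis using s by simp
qed

text \<open>The integrals of \<open>arctan_diff\<close> agree for both measures, hence so do their limits, the
  measures of half-open intervals.\<close>

lemma nevanlinna_measure_unique:
  assumes \<mu>: "nevanlinna_measure m \<mu>" and \<mu>': "nevanlinna_measure m \<mu>'"
  shows "\<mu> = \<mu>'"
proof (rule measure_eqI_generator_eq[where E = "range (\<lambda>(a, b). {a<..b::real})" and \<Omega> = UNIV and A = "\<lambda>n. {- real n<..real n}"])
  have eq: "measure \<mu> {a<..b} = measure \<mu>' {a<..b}" if ab: "a < b" for a b
  proof -
    have "(LINT t|\<mu>. arctan_diff (1 / (real n + 1)\<^sup>2) (a + 1 / (real n + 1)) (b + 1 / (real n + 1)) t)
        = (LINT t|\<mu>'. arctan_diff (1 / (real n + 1)\<^sup>2) (a + 1 / (real n + 1)) (b + 1 / (real n + 1)) t)" for n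
      by (rule nevanlinna_arctan_eq[OF \<mu> \<mu>']) (use ab in simp_all)
    then have "pi * measure \<mu> {a<..b} = pi * measure \<mu>' {a<..b}"
      using LIMSEQ_unique[OF nevanlinna_measure_limit[OF \<mu> ab]] nevanlinna_measure_limit[OF \<mu>' ab] by simp
    then show ?thesis by simp
  qed
  show "emeasure \<mu> X = emeasure \<mu>' X" if "X \<in> range (\<lambda>(a, b). {a<..b::real})" for X
  proof -
    obtain a b where X: "X = {a<..b}" using \<open>X \<in> range (\<lambda>(a, b). {a<..b::real})\<close> by auto
    show ?thesis
    proof (cases "a < b")
      case True
      then show ?thesis unfolding X using nevanlinna_measure_finite[OF \<mu>, of a b] nevanlinna_measure_finite[OF \<mu>', of a b] eq[OF True]
        by (simp add: emeasure_eq_ennreal_measure)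
    qed (simp add: X)
  qed
  show "Int_stable (range (\<lambda>(a, b). {a<..b::real}))"
  proof (rule Int_stableI, elim rangeE)
    fix A B :: "real set" and x y assume "A = (case x of (a, b) \<Rightarrow> {a<..b})" "B = (case y of (a, b) \<Rightarrow> {a<..b})"
    then have "A \<inter> B = (case (max (fst x) (fst y), min (snd x) (snd y)) of (a, b) \<Rightarrow> {a<..b})" by (auto simp: case_prod_beta)
    then show "A \<inter> B \<in> range (\<lambda>(a, b). {a<..b})" by (rule range_eqI)
  qed
  show "sets \<mu> = sigma_sets UNIV (range (\<lambda>(a, b). {a<..b::real}))" "sets \<mu>' = sigma_sets UNIV (range (\<lambda>(a, b). {a<..b::real}))"
    using \<mu> \<mu>' unfolding nevanlinna_measure_def borel_sigma_sets_Ioc by simp_all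
  show "(\<Union>i. {- real i<..real i}) = UNIV"
  proof -
    have "x \<in> (\<Union>i. {- real i<..real i})" for x
    proof -
      obtain n where "\<bar>x\<bar> < real n" using reals_Archimedean2 by blast
      then show ?thesis by (intro UN_I[of n]) auto
    qed
    then show ?thesis by blast
  qed
  show "range (\<lambda>n. {- real n<..real n}) \<subseteq> range (\<lambda>(a, b). {a<..b})" by auto
  show "emeasure \<mu> {- real i<..real i} \<noteq> \<infinity>" for i by (rule nevanlinna_measure_finite[OF \<mu>])
qed auto


section \<open>The Stieltjes transform of a power\<close>

definition stieltjes_integral :: "real \<Rightarrow> complex \<Rightarrow> complex" where
  "stieltjes_integral \<nu> w = (LINT t|half_line. of_real (t powr \<nu>) * (1 / (of_real t - w) - of_real (t / (1 + t\<^sup>2))))"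

definition stieltjes_power :: "nat \<Rightarrow> real \<Rightarrow> complex \<Rightarrow> complex" where
  "stieltjes_power n \<nu> w = (LINT t|half_line. of_real (t powr \<nu>) / (of_real t - w) ^ n)"

lemma inverse_square_derivative:
  fixes x w :: complex
  assumes "x - w \<noteq> 0"
  shows "((\<lambda>z. 1 / (z - w)\<^sup>2) has_field_derivative - 2 / (x - w) ^ 3) (at x)"
proof -
  have d: "((\<lambda>z. (z - w)\<^sup>2) has_field_derivative 2 * (x - w)) (at x)" by (auto intro!: derivative_eq_intros)
  have eq: "(0 * y\<^sup>2 - 1 * (2 * y)) / (y\<^sup>2 * y\<^sup>2) = - 2 / y ^ 3" if "y \<noteq> 0" for y :: complex
    using that by (simp add: power2_eq_square power3_eq_cube)
  show ?thesis
    by (rule DERIV_cong[OF DERIV_divide[OF DERIV_const d] eq[OF assms]]) (use assms in simp)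
qed

lemma zero_vector_derivative_constant:
  fixes f :: "real \<Rightarrow> complex"
  assumes "\<And>r. (f has_vector_derivative 0) (at r)" shows "f r = f s"
proof -
  define R where "R = \<bar>r\<bar> + \<bar>s\<bar> + 1"
  have "cmod (f r - f s) \<le> 0 * \<bar>r - s\<bar>"
    by (rule vector_derivative_norm_bound[where a = "- R" and b = R and f' = "\<lambda>_. 0"]) (use assms in \<open>auto simp: R_def\<close>)
  then show ?thesis by simp
qed

context
  fixes \<nu> :: real and v :: complex
  assumes \<nu>: "0 \<le> \<nu>" "\<nu> < 1" and v: "Im v \<noteq> 0"
begin

text \<open>The line through \<open>- 1\<close> in the direction \<open>v\<close>. As \<open>v\<close> is not real, it avoids the positive half-line, and for \<open>v = z + 1\<close> it reaches \<open>z\<close> at \<open>r = 1\<close>.\<close>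

abbreviation ray :: "real \<Rightarrow> complex" where "ray r \<equiv> of_real r * v - 1"

abbreviation slope :: real where "slope \<equiv> \<bar>Im v\<bar> / cmod v"

lemma slope_pos: "slope > 0"
proof -
  have "v \<noteq> 0" using v by auto
  then show ?thesis using v by simp
qed

text \<open>As $t - (rv - 1) = (1 + t) - rv$, this is the distance of the real point $1 + t$ from the line $\mathbb
  R v$. The estimate is uniform in \<open>r\<close> and provides the dominating functions for all
  derivatives along the line.\<close>

lemma ray_distance: assumes "t > 0" shows "slope * (1 + t) \<le> cmod (of_real t - ray r)"
proof -
  have vp: "cmod v > 0" using v by auto
  have "(1 + t) * Im v = Im (v * cnj (of_real (1 + t) - of_real r * v))"
    by (simp add: algebra_simps)
  then have "\<bar>(1 + t) * Im v\<bar> \<le> cmod (v * cnj (of_real (1 + t) - of_real r * v))"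
    using abs_Im_le_cmod[of "v * cnj (of_real (1 + t) - of_real r * v)"] by simp
  then have "\<bar>Im v\<bar> * (1 + t) \<le> cmod v * cmod (of_real (1 + t) - of_real r * v)"
    using assms by (simp only: norm_mult complex_mod_cnj abs_mult) (simp add: mult.commute)
  moreover have "of_real (1 + t) - of_real r * v = of_real t - ray r" by simp
  ultimately have "\<bar>Im v\<bar> * (1 + t) \<le> cmod v * cmod (of_real t - ray r)" by (simp only:)
  then show ?thesis using vp by (simp only: times_divide_eq_left pos_divide_le_eq mult.commute[of "cmod v"])
qed

lemma ray_nonzero: "t > 0 \<Longrightarrow> of_real t - ray r \<noteq> 0"
  using ray_distance[of t r] mult_pos_pos[OF slope_pos, of "1 + t"] by auto

lemma ray_notin_nonneg: "ray r \<notin> \<real>\<^sub>\<ge>\<^sub>0" "- ray r \<notin> \<real>\<^sub>\<le>\<^sub>0" "ray r \<noteq> 0"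
proof -
  show 1: "ray r \<notin> \<real>\<^sub>\<ge>\<^sub>0" using v by (auto simp: complex_nonneg_Reals_iff)
  then show "ray r \<noteq> 0" by (metis nonneg_Reals_zero_I)
  show "- ray r \<notin> \<real>\<^sub>\<le>\<^sub>0" using 1 by (simp only: nonneg_Reals_def nonpos_Reals_def) (auto simp: complex_nonneg_Reals_iff complex_nonpos_Reals_iff complex_eq_iff)
qed

lemma powr_quotient_measurable [measurable]:
  "(\<lambda>t. of_real (t powr \<nu>) / (of_real t - w) ^ n :: complex) \<in> borel_measurable half_line"
  by (intro measurable_restrict_space1 measurable_completion) measurable

lemma powr_quotient_bound:
  assumes t: "t > 0" and n: "n \<ge> 2"
  shows "cmod (of_real (t powr \<nu>) / (of_real t - ray r) ^ n) \<le> (1 / slope ^ n) * (t powr \<nu> / (1 + t)\<^sup>2)"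
proof -
  have s: "slope ^ n > 0" using slope_pos by simp
  have "slope ^ n * (1 + t)\<^sup>2 \<le> slope ^ n * (1 + t) ^ n" using s t n by (intro mult_left_mono power_increasing) auto
  also have "\<dots> \<le> cmod (of_real t - ray r) ^ n"
    unfolding power_mult_distrib[symmetric] using ray_distance[OF t] slope_pos t by (intro power_mono) auto
  finally have "t powr \<nu> / cmod (of_real t - ray r) ^ n \<le> t powr \<nu> / (slope ^ n * (1 + t)\<^sup>2)"
    using s t zero_less_power[OF zero_less_norm_iff[THEN iffD2, OF ray_nonzero[OF t]]] by (intro divide_left_mono mult_pos_pos) auto
  then show ?thesis by (simp add: norm_divide norm_power)
qed

lemma integrable_powr_weight: "integrable half_line (\<lambda>t. t powr \<nu> / (1 + t)\<^sup>2)"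
proof (rule integrable_half_line_powr_bound[where a = \<nu> and b = "\<nu> - 2" and C = 1])
  show "(\<lambda>t. t powr \<nu> / (1 + t)\<^sup>2) \<in> borel_measurable half_line"
    by (intro measurable_restrict_space1 measurable_completion) measurable
  show "norm (t powr \<nu> / (1 + t)\<^sup>2) \<le> 1 * t powr \<nu>" if "0 < t" for t :: real
  proof -
    have "t powr \<nu> / (1 + t)\<^sup>2 \<le> t powr \<nu> / 1" using that by (intro frac_le) (auto intro: one_le_power)
    then show ?thesis by simp
  qed
  show "norm (t powr \<nu> / (1 + t)\<^sup>2) \<le> 1 * t powr (\<nu> - 2)" if "1 < t" for t :: real
  proof -
    have "t powr \<nu> / (1 + t)\<^sup>2 \<le> t powr \<nu> / t\<^sup>2" using that by (intro divide_left_mono power_mono) auto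
    then show ?thesis using that by (simp add: powr_shift)
  qed
qed (use \<nu> in auto)

lemma integrable_powr_quotient:
  assumes n: "n \<ge> 2" shows "integrable half_line (\<lambda>t. of_real (t powr \<nu>) / (of_real t - ray r) ^ n)"
proof (rule Bochner_Integration.integrable_bound)
  show "integrable half_line (\<lambda>t. (1 / slope ^ n) * (t powr \<nu> / (1 + t)\<^sup>2))" by (rule integrable_mult_right[OF integrable_powr_weight])
  show "AE t in half_line. norm (of_real (t powr \<nu>) / (of_real t - ray r) ^ n) \<le> norm ((1 / slope ^ n) * (t powr \<nu> / (1 + t)\<^sup>2))"
    by (rule AE_I2) (use order_trans[OF powr_quotient_bound[OF _ n] abs_ge_self] in simp)
qed measurable

lemma integrable_stieltjes:
  "integrable half_line (\<lambda>t. of_real (t powr \<nu>) * (1 / (of_real t - ray r) - of_real (t / (1 + t\<^sup>2))))"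
proof (rule Bochner_Integration.integrable_bound)
  let ?C = "2 * ((1 + cmod (ray r)) / slope)"
  show "integrable half_line (\<lambda>t. ?C * (t powr \<nu> / (1 + t)\<^sup>2))" by (rule integrable_mult_right[OF integrable_powr_weight])
  show "(\<lambda>t. of_real (t powr \<nu>) * (1 / (of_real t - ray r) - of_real (t / (1 + t\<^sup>2)))) \<in> borel_measurable half_line"
    by (intro measurable_restrict_space1 measurable_completion) measurable
  show "AE t in half_line. norm (of_real (t powr \<nu>) * (1 / (of_real t - ray r) - of_real (t / (1 + t\<^sup>2)))) \<le> norm (?C * (t powr \<nu> / (1 + t)\<^sup>2))"
  proof (rule AE_I2)
    fix t assume "t \<in> space half_line"
    then have t: "t > 0" by simp
    have t2: "1 + t\<^sup>2 > 0" by (simp add: add_pos_nonneg)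
    have ct: "complex_of_real (1 + t\<^sup>2) \<noteq> 0" using t2 by (simp only: of_real_eq_0_iff)
    note nz = ray_nonzero[OF t, of r]
    have "1 / (of_real t - ray r) - of_real (t / (1 + t\<^sup>2)) = (1 + of_real t * ray r) / ((of_real t - ray r) * of_real (1 + t\<^sup>2))"
    proof -
      have "1 / x - T / A = (1 + T * (T - x)) / (x * A)" if "x \<noteq> 0" "A \<noteq> 0" "A = 1 + T * T" for x T A :: complex
      proof -
        have "1 / x - T / A = (A - T * x) / (x * A)" using that(1,2) by (simp add: diff_frac_eq mult.commute)
        then show ?thesis using that(3) by (simp add: algebra_simps)
      qed
      from this[OF nz ct, of "of_real t"] show ?thesis by (simp add: power2_eq_square)
    qed
    then have e: "norm (1 / (of_real t - ray r) - of_real (t / (1 + t\<^sup>2))) = cmod (1 + of_real t * ray r) / (cmod (of_real t - ray r) * (1 + t\<^sup>2))"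
      using t2 by (simp only: norm_divide norm_mult norm_of_real)
    have 1: "cmod (1 + of_real t * ray r) \<le> (1 + cmod (ray r)) * (1 + t)"
    proof -
      have "cmod (1 + of_real t * ray r) \<le> 1 + t * cmod (ray r)"
        using norm_triangle_ineq[of 1 "of_real t * ray r"] t by (simp only: norm_mult norm_of_real norm_one)
      also have "\<dots> \<le> (1 + t * cmod (ray r)) + (cmod (ray r) + t)" using t by simp
      finally show ?thesis by (simp only: algebra_simps)
    qed
    have 2: "(1 + t)\<^sup>2 \<le> 2 * (1 + t\<^sup>2)" using zero_le_power2[of "1 - t"] by (simp add: power2_eq_square algebra_simps)
    have pos: "0 < (slope * (1 + t)) * ((1 + t)\<^sup>2 / 2)"
      using t by (intro mult_pos_pos[OF mult_pos_pos[OF slope_pos]]) auto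
    have "cmod (1 + of_real t * ray r) / (cmod (of_real t - ray r) * (1 + t\<^sup>2)) \<le> ((1 + cmod (ray r)) * (1 + t)) / ((slope * (1 + t)) * ((1 + t)\<^sup>2 / 2))"
      using ray_distance[OF t] slope_pos t 2 1 by (intro frac_le mult_mono pos) auto
    also have "\<dots> = ?C * (1 / (1 + t)\<^sup>2)" 
    proof -
      have "(c * x) / ((d * x) * (q / 2)) = 2 * (c / d) * (1 / q)" if "x \<noteq> 0" for c x d q :: real using that by simp
      from this[of "1 + t"] show ?thesis using t by (simp only:)
    qed
    finally have "t powr \<nu> * norm (1 / (of_real t - ray r) - of_real (t / (1 + t\<^sup>2))) \<le> t powr \<nu> * (?C * (1 / (1 + t)\<^sup>2))"
      unfolding e by (rule mult_left_mono) simp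
    also have "\<dots> = ?C * (t powr \<nu> / (1 + t)\<^sup>2)" by simp
    finally have "norm (of_real (t powr \<nu>) * (1 / (of_real t - ray r) - of_real (t / (1 + t\<^sup>2)))) \<le> ?C * (t powr \<nu> / (1 + t)\<^sup>2)"
      by (simp only: norm_mult norm_of_real abs_of_nonneg[OF powr_ge_zero])
    also have "\<dots> \<le> norm (?C * (t powr \<nu> / (1 + t)\<^sup>2))" by simp
    finally show "norm (of_real (t powr \<nu>) * (1 / (of_real t - ray r) - of_real (t / (1 + t\<^sup>2)))) \<le> norm (?C * (t powr \<nu> / (1 + t)\<^sup>2))" .
  qed
qed

lemma ray_derivative: "(ray has_vector_derivative v) (at r)"
  by (auto intro!: derivative_eq_intros simp: has_vector_derivative_def scaleR_conv_of_real)

lemma stieltjes_integral_derivative: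
  "((\<lambda>r. stieltjes_integral \<nu> (ray r)) has_vector_derivative v * stieltjes_power 2 \<nu> (ray r0)) (at r0)"
proof -
  have "((\<lambda>r. stieltjes_integral \<nu> (ray r)) has_vector_derivative (LINT t|half_line. v * (of_real (t powr \<nu>) / (of_real t - ray r0) ^ 2))) (at r0)"
    unfolding stieltjes_integral_def
  proof (rule leibniz_rule_dominated[where a = "r0 - 1" and b = "r0 + 1" and g = "\<lambda>t. cmod v * ((1 / slope ^ 2) * (t powr \<nu> / (1 + t)\<^sup>2))"])
    show "integrable half_line (\<lambda>t. cmod v * ((1 / slope ^ 2) * (t powr \<nu> / (1 + t)\<^sup>2)))"
      by (intro integrable_mult_right integrable_powr_weight)
    show "cmod (v * (of_real (t powr \<nu>) / (of_real t - ray r) ^ 2)) \<le> cmod v * ((1 / slope ^ 2) * (t powr \<nu> / (1 + t)\<^sup>2))"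
      if "t \<in> space half_line" for t r
      unfolding norm_mult[of v] using that by (intro mult_left_mono powr_quotient_bound) auto
    show "((\<lambda>r. of_real (t powr \<nu>) * (1 / (of_real t - ray r) - of_real (t / (1 + t\<^sup>2)))) has_vector_derivative v * (of_real (t powr \<nu>) / (of_real t - ray r) ^ 2)) (at r)"
      if "t \<in> space half_line" for t r
    proof -
      have t: "t > 0" using that by simp
      have "((\<lambda>w. of_real (t powr \<nu>) * (1 / (of_real t - w) - of_real (t / (1 + t\<^sup>2)))) has_field_derivative of_real (t powr \<nu>) / (of_real t - ray r) ^ 2) (at (ray r))"
        using ray_nonzero[OF t, of r] by (auto intro!: derivative_eq_intros simp: power2_eq_square simp del: of_real_power)
      from field_vector_diff_chain_at[OF ray_derivative this] show ?thesis by (simp only: o_def)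
    qed
    show "(\<lambda>t. v * (of_real (t powr \<nu>) / (of_real t - ray r0) ^ 2)) \<in> borel_measurable half_line"
      by (rule borel_measurable_times[OF borel_measurable_const powr_quotient_measurable])
  qed (use integrable_stieltjes in \<open>simp_all only: greaterThanLessThan_iff, simp\<close>)
  then show ?thesis unfolding stieltjes_power_def by (simp only: integral_mult_right_zero)
qed

lemma stieltjes_power_derivative:
  "((\<lambda>r. stieltjes_power 2 \<nu> (ray r)) has_vector_derivative v * (2 * stieltjes_power 3 \<nu> (ray r0))) (at r0)"
proof -
  have "((\<lambda>r. stieltjes_power 2 \<nu> (ray r)) has_vector_derivative (LINT t|half_line. (v * 2) * (of_real (t powr \<nu>) / (of_real t - ray r0) ^ 3))) (at r0)"
    unfolding stieltjes_power_def
  proof (rule leibniz_rule_dominated[where a = "r0 - 1" and b = "r0 + 1" and g = "\<lambda>t. cmod (v * 2) * ((1 / slope ^ 3) * (t powr \<nu> / (1 + t)\<^sup>2))"])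
    show "integrable half_line (\<lambda>t. cmod (v * 2) * ((1 / slope ^ 3) * (t powr \<nu> / (1 + t)\<^sup>2)))"
      by (intro integrable_mult_right integrable_powr_weight)
    show "cmod ((v * 2) * (of_real (t powr \<nu>) / (of_real t - ray r) ^ 3)) \<le> cmod (v * 2) * ((1 / slope ^ 3) * (t powr \<nu> / (1 + t)\<^sup>2))"
      if "t \<in> space half_line" for t r
      unfolding norm_mult[of "v * 2"] using that by (intro mult_left_mono powr_quotient_bound) auto
    show "((\<lambda>r. of_real (t powr \<nu>) / (of_real t - ray r) ^ 2) has_vector_derivative (v * 2) * (of_real (t powr \<nu>) / (of_real t - ray r) ^ 3)) (at r)"
      if "t \<in> space half_line" for t r
    proof -
      have t: "t > 0" using that by simp
      have "((\<lambda>w. of_real (t powr \<nu>) / (of_real t - w) ^ 2) has_field_derivative 2 * (of_real (t powr \<nu>) / (of_real t - ray r) ^ 3)) (at (ray r))"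
      proof -
        have "((\<lambda>w. c / (b - w) ^ 2) has_field_derivative 2 * (c / (b - x) ^ 3)) (at x)" if "b - x \<noteq> 0" for b c x :: complex
        proof -
          have "((\<lambda>w. c * (1 / (w - b)\<^sup>2)) has_field_derivative c * (- 2 / (x - b) ^ 3)) (at x)"
            by (intro DERIV_cmult inverse_square_derivative) (use that in auto)
          moreover have "(w - b)\<^sup>2 = (b - w)\<^sup>2" for w by (rule power2_commute)
          moreover have "c * (- 2 / (x - b) ^ 3) = 2 * (c / (b - x) ^ 3)"
          proof -
            have "(x - b) ^ 3 = - ((b - x) ^ 3)" using power_minus_odd[of 3 "b - x"] by simp
            then show ?thesis by simp
          qed
          ultimately show ?thesis by simp
        qed
        from this[OF ray_nonzero[OF t]] show ?thesis .
      qed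
      from field_vector_diff_chain_at[OF ray_derivative this] show ?thesis by (simp only: o_def mult.assoc)
    qed
    show "(\<lambda>t. (v * 2) * (of_real (t powr \<nu>) / (of_real t - ray r0) ^ 3)) \<in> borel_measurable half_line"
      by (rule borel_measurable_times[OF borel_measurable_const powr_quotient_measurable])
  qed (use integrable_powr_quotient[of 2] in auto)
  then show ?thesis unfolding stieltjes_power_def by (simp only: integral_mult_right_zero mult.assoc)
qed

text \<open>The function $t^{\nu+1}/(t-w)^2$ vanishes at both ends, and its derivative is $((\nu-1)(t-w) - 2w)\,
  t^\nu/(t-w)^3$.\<close>

lemma stieltjes_power_recurrence:
  "of_real (\<nu> - 1) * stieltjes_power 2 \<nu> (ray r) = 2 * ray r * stieltjes_power 3 \<nu> (ray r)"
proof -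
  let ?w = "ray r"
  let ?F = "\<lambda>t. of_real (t powr (\<nu> + 1)) / (of_real t - ?w) ^ 2 :: complex"
  let ?f = "\<lambda>t. of_real (\<nu> - 1) * (of_real (t powr \<nu>) / (of_real t - ?w) ^ 2) - 2 * ?w * (of_real (t powr \<nu>) / (of_real t - ?w) ^ 3)"
  have i: "integrable half_line (\<lambda>t. of_real (\<nu> - 1) * (of_real (t powr \<nu>) / (of_real t - ?w) ^ 2))"
    "integrable half_line (\<lambda>t. 2 * ?w * (of_real (t powr \<nu>) / (of_real t - ?w) ^ 3))"
    by (intro integrable_mult_right integrable_powr_quotient; simp)+
  have d: "(?F has_vector_derivative ?f t) (at t)" if t: "t > 0" for t
  proof -
    have pw: "t powr (\<nu> + 1) = t powr \<nu> * t" using t by (simp add: powr_add)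
    have "((\<lambda>t. t powr (\<nu> + 1)) has_real_derivative (\<nu> + 1) * t powr \<nu>) (at t)"
      using has_real_derivative_powr[OF t, of "\<nu> + 1"] by simp
    then have d1: "((\<lambda>t. complex_of_real (t powr (\<nu> + 1))) has_vector_derivative of_real ((\<nu> + 1) * t powr \<nu>)) (at t)"
      by (rule has_vector_derivative_of_real)
    have d2: "((\<lambda>t. 1 / (of_real t - ?w) ^ 2) has_vector_derivative 1 * (- 2 / (of_real t - ?w) ^ 3)) (at t)"
      using field_vector_diff_chain_at[OF has_vector_derivative_of_real[OF DERIV_ident] inverse_square_derivative[OF ray_nonzero[OF t, of r]]]
      by (simp add: o_def)
    have "((\<lambda>t. complex_of_real (t powr (\<nu> + 1)) * (1 / (of_real t - ?w) ^ 2)) has_vector_derivative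
        of_real (t powr (\<nu> + 1)) * (1 * (- 2 / (of_real t - ?w) ^ 3)) + of_real ((\<nu> + 1) * t powr \<nu>) * (1 / (of_real t - ?w) ^ 2)) (at t)"
      by (rule has_vector_derivative_mult[OF d1 d2])
    moreover have "of_real (t powr (\<nu> + 1)) * (1 * (- 2 / (of_real t - ?w) ^ 3)) + of_real ((\<nu> + 1) * t powr \<nu>) * (1 / (of_real t - ?w) ^ 2) = ?f t"
    proof -
      have "P * T * (1 * (- 2 / x ^ 3)) + (N + 1) * P * (1 / x ^ 2) = (N - 1) * (P / x ^ 2) - 2 * (T - x) * (P / x ^ 3)" if "x \<noteq> 0" for P T N x :: complex
        using that by (simp add: field_simps power2_eq_square power3_eq_cube)
      from this[OF ray_nonzero[OF t, of r], of "of_real (t powr \<nu>)" "of_real t" "of_real \<nu>"] show ?thesis by (simp add: pw)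
    qed
    ultimately show ?thesis by (simp only: times_divide_eq_right mult_1_right)
  qed
  have b: "cmod (?F t) \<le> (1 / slope ^ 2) * (t powr (\<nu> + 1) / (1 + t)\<^sup>2)" if t: "t > 0" for t
  proof -
    have "cmod (?F t) = t * cmod (of_real (t powr \<nu>) / (of_real t - ?w) ^ 2)" using t by (simp add: powr_add norm_mult norm_divide)
    also have "\<dots> \<le> t * ((1 / slope ^ 2) * (t powr \<nu> / (1 + t)\<^sup>2))" using t by (intro mult_left_mono powr_quotient_bound) auto
    finally show ?thesis using t by (simp add: powr_add mult_ac)
  qed
  have "(?F \<longlongrightarrow> 0) (at_right 0)"
  proof (rule Lim_null_comparison[where g = "\<lambda>t. (1 / slope ^ 2) * t powr (\<nu> + 1)"])
    show "\<forall>\<^sub>F t in at_right 0. norm (?F t) \<le> (1 / slope ^ 2) * t powr (\<nu> + 1)"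
      unfolding eventually_at_right_field
    proof (intro exI[of _ 1] conjI allI impI)
      fix t :: real assume t: "0 < t"
      have "t powr (\<nu> + 1) / (1 + t)\<^sup>2 \<le> t powr (\<nu> + 1) / 1" using t by (intro frac_le) (auto intro: one_le_power)
      then have "(1 / slope ^ 2) * (t powr (\<nu> + 1) / (1 + t)\<^sup>2) \<le> (1 / slope ^ 2) * t powr (\<nu> + 1)" by (intro mult_left_mono) auto
      with b[OF t] show "norm (?F t) \<le> (1 / slope ^ 2) * t powr (\<nu> + 1)" by (rule order_trans)
    qed simp
    have "((\<lambda>t. (1 / slope ^ 2) * t powr (\<nu> + 1)) \<longlongrightarrow> (1 / slope ^ 2) * 0 powr (\<nu> + 1)) (at_right 0)"
      by (intro tendsto_intros tendsto_powr' ) (use \<nu> in \<open>auto simp: eventually_at_filter\<close>)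
    then show "((\<lambda>t. (1 / slope ^ 2) * t powr (\<nu> + 1)) \<longlongrightarrow> 0) (at_right 0)" by simp
  qed
  moreover have "(?F \<longlongrightarrow> 0) at_top"
  proof (rule Lim_null_comparison[where g = "\<lambda>t. (1 / slope ^ 2) * t powr (\<nu> - 1)"])
    show "\<forall>\<^sub>F t in at_top. norm (?F t) \<le> (1 / slope ^ 2) * t powr (\<nu> - 1)"
      using eventually_gt_at_top[of 0]
    proof (rule eventually_mono)
      fix t :: real assume t: "0 < t"
      have "t powr (\<nu> + 1) / (1 + t)\<^sup>2 \<le> t powr (\<nu> + 1) / t\<^sup>2" using t by (intro divide_left_mono power_mono) auto
      also have "\<dots> = t powr (\<nu> - 1)" using powr_shift[of t "\<nu> + 1"] t by simp
      finally have "(1 / slope ^ 2) * (t powr (\<nu> + 1) / (1 + t)\<^sup>2) \<le> (1 / slope ^ 2) * t powr (\<nu> - 1)" by (intro mult_left_mono) auto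
      with b[OF t] show "norm (?F t) \<le> (1 / slope ^ 2) * t powr (\<nu> - 1)" by (rule order_trans)
    qed
    show "((\<lambda>t. (1 / slope ^ 2) * t powr (\<nu> - 1)) \<longlongrightarrow> 0) at_top"
      by (rule tendsto_mult_right_zero[OF tendsto_neg_powr[OF _ filterlim_ident]]) (use \<nu> in simp)
  qed
  ultimately have "(LINT t|half_line. ?f t) = 0 - 0"
    by (intro half_line_FTC[OF d]) (use i in auto)
  then show ?thesis unfolding stieltjes_power_def Bochner_Integration.integral_diff[OF i] integral_mult_right_zero by simp
qed

lemma Ln_ray_derivative: "((\<lambda>r. Ln (- ray r)) has_vector_derivative v / ray r) (at r)"
proof -
  have "((\<lambda>w. Ln (- w)) has_field_derivative 1 / ray r) (at (ray r))"
    using ray_notin_nonneg(2,3)[of r] by (auto intro!: derivative_eq_intros simp: field_simps)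
  from field_vector_diff_chain_at[OF ray_derivative this] show ?thesis by (simp add: o_def)
qed

lemma exp_Ln_ray_derivative:
  "((\<lambda>r. exp (a * Ln (- ray r))) has_vector_derivative a * (v / ray r) * exp (a * Ln (- ray r))) (at r)"
proof -
  have "((\<lambda>w. exp (a * w)) has_field_derivative a * exp (a * Ln (- ray r))) (at (Ln (- ray r)))"
    by (auto intro!: derivative_eq_intros)
  from field_vector_diff_chain_at[OF Ln_ray_derivative this] show ?thesis by (simp add: o_def mult_ac)
qed

text \<open>By the recurrence the derivative of $(-w)^{1-\nu} \int t^\nu (t-w)^{-2} dt$ along the line is zero.\<close>

lemma stieltjes_power_ray:
  "stieltjes_power 2 \<nu> (ray r) = stieltjes_power 2 \<nu> (- 1) * exp (of_real (\<nu> - 1) * Ln (- ray r))"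
proof -
  let ?E = "\<lambda>a r. exp (a * Ln (- ray r))"
  have "((\<lambda>r. ?E (of_real (1 - \<nu>)) r * stieltjes_power 2 \<nu> (ray r)) has_vector_derivative 0) (at r)" for r
  proof -
    have "((\<lambda>r. ?E (of_real (1 - \<nu>)) r * stieltjes_power 2 \<nu> (ray r)) has_vector_derivative
      ?E (of_real (1 - \<nu>)) r * (v * (2 * stieltjes_power 3 \<nu> (ray r))) + of_real (1 - \<nu>) * (v / ray r) * ?E (of_real (1 - \<nu>)) r * stieltjes_power 2 \<nu> (ray r)) (at r)"
      by (rule has_vector_derivative_mult[OF exp_Ln_ray_derivative stieltjes_power_derivative])
    moreover have "?E (of_real (1 - \<nu>)) r * (v * (2 * stieltjes_power 3 \<nu> (ray r))) + of_real (1 - \<nu>) * (v / ray r) * ?E (of_real (1 - \<nu>)) r * stieltjes_power 2 \<nu> (ray r) = 0"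
    proof -
      have "e * (v * (2 * j)) + (1 - n) * (v / w) * e * h = 0" if rec: "(n - 1) * h = 2 * w * j" and w: "w \<noteq> 0" for e j n w h :: complex
      proof -
        obtain q where q: "v = q * w" using w by (metis nonzero_eq_divide_eq)
        have "e * (v * (2 * j)) + (1 - n) * (v / w) * e * h = e * q * (2 * w * j - (n - 1) * h)" using w by (simp add: q algebra_simps)
        then show ?thesis using rec by simp
      qed
      from this[of "of_real \<nu>"] show ?thesis using stieltjes_power_recurrence[of r] ray_notin_nonneg(3)[of r] by (simp only: of_real_diff of_real_1)
    qed
    ultimately show ?thesis by (simp only:)
  qed
  from zero_vector_derivative_constant[OF this, of r 0]
  have "?E (of_real (1 - \<nu>)) r * stieltjes_power 2 \<nu> (ray r) = stieltjes_power 2 \<nu> (- 1)" by simp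
  then have "?E (of_real (\<nu> - 1)) r * (?E (of_real (1 - \<nu>)) r * stieltjes_power 2 \<nu> (ray r)) = ?E (of_real (\<nu> - 1)) r * stieltjes_power 2 \<nu> (- 1)" by (simp only:)
  moreover have "?E (of_real (\<nu> - 1)) r * ?E (of_real (1 - \<nu>)) r = 1" by (simp add: exp_add[symmetric] algebra_simps)
  ultimately show ?thesis by (simp only: mult.assoc[symmetric] mult_1_left) (simp only: mult.commute)
qed

text \<open>The substitution \<open>t = s / (1 - s)\<close> turns the integral into the Beta integral with
  parameters \<open>1 + \<nu>\<close> and \<open>1 - \<nu>\<close>.\<close>

lemma stieltjes_power_minus_1: "stieltjes_power 2 \<nu> (- 1) = of_real (Gamma (1 + \<nu>) * Gamma (1 - \<nu>))"
proof -
  let ?f = "\<lambda>t::real. t powr \<nu> / (1 + t)\<^sup>2"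
  let ?g = "\<lambda>s::real. s / (1 - s)"
  have im: "?g ` {0<..<1} = {0<..}"
  proof (intro equalityI subsetI)
    fix t :: real assume "t \<in> {0<..}"
    then show "t \<in> ?g ` {0<..<1}" by (intro image_eqI[of _ _ "t / (1 + t)"]) (auto simp: field_simps)
  qed auto
  have "(\<lambda>s. \<bar>1 / (1 - s)\<^sup>2\<bar> *\<^sub>R ?f (?g s)) absolutely_integrable_on {0<..<1} \<and> integral {0<..<1} (\<lambda>s. \<bar>1 / (1 - s)\<^sup>2\<bar> *\<^sub>R ?f (?g s)) = integral {0<..} ?f
      \<longleftrightarrow> ?f absolutely_integrable_on ?g ` {0<..<1} \<and> integral (?g ` {0<..<1}) ?f = integral {0<..} ?f"
  proof (rule has_absolute_integral_change_of_variables_real)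
    show "(?g has_field_derivative 1 / (1 - s)\<^sup>2) (at s within {0<..<1})" if "s \<in> {0<..<1}" for s
      using that by (auto intro!: derivative_eq_intros simp: field_simps power2_eq_square)
    show "inj_on ?g {0<..<1}" by (auto simp: inj_on_def field_simps)
  qed simp
  moreover have "?f absolutely_integrable_on {0<..}" using integrable_powr_weight by (simp add: integrable_half_line_iff)
  ultimately have "integral {0<..} ?f = integral {0<..<1} (\<lambda>s. \<bar>1 / (1 - s)\<^sup>2\<bar> *\<^sub>R ?f (?g s))" unfolding im by simp
  also have "\<dots> = integral {0<..<1} (\<lambda>s. s powr (1 + \<nu> - 1) * (1 - s) powr (1 - \<nu> - 1))"
  proof (rule Henstock_Kurzweil_Integration.integral_cong)
    fix s :: real assume s: "s \<in> {0<..<1}"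
    have "1 + ?g s = 1 / (1 - s)" using s by (simp add: field_simps)
    then show "\<bar>1 / (1 - s)\<^sup>2\<bar> *\<^sub>R ?f (?g s) = s powr (1 + \<nu> - 1) * (1 - s) powr (1 - \<nu> - 1)"
      using s by (simp add: powr_divide powr_minus power_divide field_simps)
  qed
  also have "\<dots> = Beta (1 + \<nu>) (1 - \<nu>)"
    using has_integral_Beta_real[of "1 + \<nu>" "1 - \<nu>"] \<nu> by (intro integral_unique) (simp add: has_integral_Icc_iff_Ioo)
  also have "\<dots> = Gamma (1 + \<nu>) * Gamma (1 - \<nu>)" using Gamma_fact[of 1, where 'a = real] by (simp add: Beta_def)
  finally have "integral {0<..} ?f = Gamma (1 + \<nu>) * Gamma (1 - \<nu>)" .
  then have "(LINT t|half_line. ?f t) = Gamma (1 + \<nu>) * Gamma (1 - \<nu>)" using half_line_integral_eq[OF integrable_powr_weight] by simp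
  moreover have "stieltjes_power 2 \<nu> (- 1) = of_real (LINT t|half_line. ?f t)"
    unfolding stieltjes_power_def integral_complex_of_real[symmetric] by (simp add: add.commute)
  ultimately show ?thesis by simp
qed

end


section \<open>The Weyl function and its spectral function\<close>

text \<open>The Weyl function in terms of the principal logarithm of \<open>- z\<close>, which is holomorphic off
  the positive half-line.\<close>

definition weyl_m :: "real \<Rightarrow> complex \<Rightarrow> complex" where
  "weyl_m \<nu> z = (if \<nu> = 0 then of_real (ln 2) - euler_mascheroni - Ln (- z) / 2
     else - of_real (Gamma (1 - \<nu>) / (2 * \<nu> * 4 powr \<nu> * Gamma (1 + \<nu>))) * exp (of_real \<nu> * Ln (- z)))"

lemma notin_nonneg_nonzero: "z \<notin> \<real>\<^sub>\<ge>\<^sub>0 \<Longrightarrow> - z \<noteq> 0" for z :: complex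
  by auto

lemma weyl_function_eq:
  assumes \<nu>: "0 \<le> \<nu>" "\<nu> < 1" and z: "z \<notin> \<real>\<^sub>\<ge>\<^sub>0"
  shows "weyl_function (bessel_minimal \<nu>) (bessel_Gamma0 \<nu>) (bessel_Gamma1 \<nu>) z h = weyl_m \<nu> z * h"
proof -
  define k where "k = csqrt (- z)"
  define l where "l = Ln k"
  have z0: "- z \<noteq> 0" by (rule notin_nonneg_nonzero[OF z])
  have k: "k = exp (Ln (- z) / 2)" unfolding k_def by (rule csqrt_exp_Ln[OF z0])
  have l: "l = Ln (- z) / 2" unfolding l_def
    by (rule Ln_unique[OF k[symmetric]]) (use mpi_less_Im_Ln[OF z0] Im_Ln_le_pi[OF z0] pi_gt_zero in \<open>simp; linarith\<close>)+
  have kl: "k = exp l" by (simp add: k l)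
  have k0: "k \<noteq> 0" by (simp add: kl)
  have pw: "k powr a = exp (a * l)" for a using k0 by (simp add: powr_def l_def)
  have g: "Gamma (1 + \<nu>) > 0" using \<nu> by (intro Gamma_real_pos) auto
  have p4: "(4::real) powr (\<nu> + 1) = 4 * 4 powr \<nu>" by (simp add: powr_add)
  have G0: "bessel_Gamma0 \<nu> (weyl_vec \<nu> z) = of_real (2 * 4 powr \<nu> * Gamma (1 + \<nu>)) * exp (- (of_real \<nu> * l))"
  proof -
    have "k * k powr (- of_real (\<nu> + 1)) = exp (- (of_real \<nu> * l))"
      unfolding pw unfolding kl exp_add[symmetric] by (simp add: algebra_simps)
    moreover have "bessel_Gamma0 \<nu> (weyl_vec \<nu> z) = of_real (2 * 4 powr \<nu> * Gamma (1 + \<nu>)) * (k * k powr (- of_real (\<nu> + 1)))"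
      unfolding weyl_vec_Gamma0(1)[OF \<nu> z] k_def[symmetric] p4 by (simp add: add.commute)
    ultimately show ?thesis by (simp only:)
  qed
  have "bessel_Gamma1 \<nu> (weyl_vec \<nu> z) / bessel_Gamma0 \<nu> (weyl_vec \<nu> z) = weyl_m \<nu> z"
  proof (cases "\<nu> = 0")
    case True
    then show ?thesis unfolding G0 weyl_vec_Gamma1[OF \<nu> z] k_def[symmetric] weyl_m_def l_def[symmetric] by (simp add: l)
  next
    case False
    have "k * k powr (- of_real (1 - \<nu>)) = exp (of_real \<nu> * l)"
      unfolding pw unfolding kl exp_add[symmetric] by (simp add: algebra_simps)
    then have G1: "bessel_Gamma1 \<nu> (weyl_vec \<nu> z) = - (of_real (Gamma (1 - \<nu>) / \<nu>) * exp (of_real \<nu> * l))"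
      unfolding weyl_vec_Gamma1[OF \<nu> z] k_def[symmetric] using False by (simp add: mult.left_commute[of k])
    have "exp (of_real \<nu> * Ln (- z)) = exp (of_real \<nu> * l) * exp (of_real \<nu> * l)" unfolding l exp_add[symmetric] by simp
    moreover have "exp (of_real \<nu> * l) * exp (- (of_real \<nu> * l)) = 1" unfolding exp_add[symmetric] by simp
    moreover have "- (G / n * e) / (2 * P * H * e') = - (G / (2 * n * P * H)) * (e * e)"
      if "e * e' = 1" "n \<noteq> 0" "P \<noteq> 0" "H \<noteq> 0" for G n e P H e' :: complex
    proof -
      have "e' \<noteq> 0" "e = inverse e'" using that(1) by (auto simp: inverse_unique mult.commute)
      then show ?thesis using that by (simp add: field_simps)
    qed
    ultimately show ?thesis unfolding G0 G1 weyl_m_def using False g by simp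
  qed
  then show ?thesis using bessel_weyl_function[OF \<nu> z, of h] by simp
qed

text \<open>The argument in $[0, 2\pi)$ of \<open>z\<close> is the principal argument of \<open>- z\<close>
  increased by \<open>pi\<close>.\<close>

lemma powr_2pi_exp:
  assumes z: "z \<notin> \<real>\<^sub>\<ge>\<^sub>0" shows "powr_2pi z a = exp (of_real a * (Ln (- z) + \<i> * of_real pi))"
proof -
  have z0: "- z \<noteq> 0" by (rule notin_nonneg_nonzero[OF z])
  have "Arg2pi z \<noteq> 0" using z by (auto simp: Arg2pi_eq_0 complex_is_Real_iff complex_nonneg_Reals_iff)
  then have A: "Arg2pi z = Im (Ln (- z)) + pi" using Arg2pi_Ln[of z] Arg2pi_ge_0[of z] by linarith
  have "cmod z powr a = exp (a * Re (Ln (- z)))" using z0 by (simp add: powr_def)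
  then have "powr_2pi z a = exp (of_real (a * Re (Ln (- z))) + \<i> * of_real (a * (Im (Ln (- z)) + pi)))"
    unfolding powr_2pi_def A exp_add by (simp only: exp_of_real)
  also have "of_real (a * Re (Ln (- z))) + \<i> * of_real (a * (Im (Ln (- z)) + pi)) = of_real a * (Ln (- z) + \<i> * of_real pi)"
    by (simp add: complex_eq_iff algebra_simps)
  finally show ?thesis .
qed

lemma weyl_m_powr:
  assumes z: "z \<notin> \<real>\<^sub>\<ge>\<^sub>0"
  shows "weyl_m \<nu> z = (if \<nu> = 0 then - Ln (powr_2pi z (1 / 2) / 2) + \<i> * of_real pi / 2 - euler_mascheroni
     else exp (\<i> * of_real ((1 - \<nu>) * pi)) * of_real (Gamma (1 - \<nu>) / (2 * \<nu> * 4 powr \<nu> * Gamma (1 + \<nu>))) * powr_2pi z \<nu>)"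
proof (cases "\<nu> = 0")
  case True
  have z0: "- z \<noteq> 0" by (rule notin_nonneg_nonzero[OF z])
  let ?l = "Ln (- z) / 2 + \<i> * of_real pi / 2 - of_real (ln 2)"
  have "exp (of_real (ln 2)) = (2 :: complex)" unfolding exp_of_real by simp
  then have "exp ?l = powr_2pi z (1 / 2) / 2"
    unfolding powr_2pi_exp[OF z] exp_diff by (simp add: algebra_simps add_divide_distrib)
  moreover have "Im ?l = (Im (Ln (- z)) + pi) / 2" by simp
  ultimately have "Ln (powr_2pi z (1 / 2) / 2) = ?l"
    using mpi_less_Im_Ln[OF z0] Im_Ln_le_pi[OF z0] by (intro Ln_unique) auto
  then show ?thesis using True by (simp add: weyl_m_def)
next
  case False
  have "exp (\<i> * of_real ((1 - \<nu>) * pi)) * powr_2pi z \<nu> = exp (\<i> * of_real pi + of_real \<nu> * Ln (- z))"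
    unfolding powr_2pi_exp[OF z] exp_add[symmetric] by (simp add: algebra_simps)
  also have "\<dots> = - exp (of_real \<nu> * Ln (- z))" unfolding exp_add by simp
  finally have eq: "exp (\<i> * of_real ((1 - \<nu>) * pi)) * powr_2pi z \<nu> = - exp (of_real \<nu> * Ln (- z))" .
  have "- K * E = A * K * P" if "A * P = - E" for A K P E :: complex
    using that by (metis mult.assoc mult.commute mult_minus_left mult_minus_right)
  from this[OF eq] show ?thesis unfolding weyl_m_def using False by (simp only: if_False)
qed

definition spectral_constant :: "real \<Rightarrow> real" where
  "spectral_constant \<nu> = 1 / (2 powr (2 * \<nu> + 1) * (Gamma (1 + \<nu>))\<^sup>2)"

lemma spectral_constant_nonneg: "spectral_constant \<nu> \<ge> 0" by (simp add: spectral_constant_def)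

text \<open>Both sides are multiples of $(-w)^{\nu-1}$; the constants agree because the value at \<open>- 1\<close>
  is $\Gamma(1+\nu)\,\Gamma(1-\nu)$.\<close>

lemma weyl_m_ray_derivative:
  assumes \<nu>: "0 \<le> \<nu>" "\<nu> < 1" and v: "Im v \<noteq> 0"
  shows "((\<lambda>r. weyl_m \<nu> (of_real r * v - 1)) has_vector_derivative
    v * of_real (spectral_constant \<nu>) * stieltjes_power 2 \<nu> (of_real r * v - 1)) (at r)"
proof -
  let ?w = "of_real r * v - 1"
  have w0: "?w \<noteq> 0" by (rule ray_notin_nonneg(3)[OF \<nu> v])
  have g: "Gamma (1 + \<nu>) > 0" using \<nu> by (intro Gamma_real_pos) auto
  have p2: "(2::real) powr (2 * \<nu> + 1) = 2 * 4 powr \<nu>"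
    using powr_powr[of 2 2 \<nu>] by (simp add: powr_add)
  have E: "exp (Ln (- ?w)) = - ?w" using w0 by simp
  have S: "of_real (spectral_constant \<nu>) * stieltjes_power 2 \<nu> ?w
      = of_real (Gamma (1 - \<nu>) / (2 * 4 powr \<nu> * Gamma (1 + \<nu>))) * exp (of_real (\<nu> - 1) * Ln (- ?w))"
    unfolding stieltjes_power_ray[OF \<nu> v, of r] stieltjes_power_minus_1[OF \<nu> v] spectral_constant_def p2
    using g by (simp add: power2_eq_square)
  show ?thesis
  proof (cases "\<nu> = 0")
    case True
    have "((\<lambda>r. of_real (ln 2) - euler_mascheroni - Ln (- (of_real r * v - 1)) / 2) has_vector_derivative 0 - v / ?w / 2) (at r)"
      by (intro has_vector_derivative_diff has_vector_derivative_const has_vector_derivative_divide Ln_ray_derivative[OF \<nu> v])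
    moreover have "0 - v / ?w / 2 = v * of_real (spectral_constant \<nu>) * stieltjes_power 2 \<nu> ?w"
    proof -
      have "exp (of_real (\<nu> - 1) * Ln (- ?w)) = inverse (exp (Ln (- ?w)))" by (simp add: True exp_minus)
      also have "\<dots> = - (1 / ?w)" unfolding E by (simp only: minus_divide_right inverse_eq_divide)
      finally have "exp (of_real (\<nu> - 1) * Ln (- ?w)) = - (1 / ?w)" .
      then show ?thesis unfolding mult.assoc S by (simp add: True)
    qed
    ultimately show ?thesis using True by (simp add: weyl_m_def)
  next
    case False
    let ?K = "complex_of_real (Gamma (1 - \<nu>) / (2 * \<nu> * 4 powr \<nu> * Gamma (1 + \<nu>)))"
    have "((\<lambda>r. - ?K * exp (of_real \<nu> * Ln (- (of_real r * v - 1)))) has_vector_derivative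
       - ?K * (of_real \<nu> * (v / ?w) * exp (of_real \<nu> * Ln (- ?w)))) (at r)"
      by (rule has_vector_derivative_mult_right[OF exp_Ln_ray_derivative[OF \<nu> v]])
    moreover have "- ?K * (of_real \<nu> * (v / ?w) * exp (of_real \<nu> * Ln (- ?w))) = v * of_real (spectral_constant \<nu>) * stieltjes_power 2 \<nu> ?w"
    proof -
      have "exp (of_real \<nu> * Ln (- ?w)) = exp (of_real (\<nu> - 1) * Ln (- ?w)) * exp (Ln (- ?w))"
        unfolding exp_add[symmetric] by (simp add: algebra_simps)
      then have e: "exp (of_real \<nu> * Ln (- ?w)) = - (exp (of_real (\<nu> - 1) * Ln (- ?w)) * ?w)" unfolding E by (simp only: mult_minus_right)
      have K: "of_real (Gamma (1 - \<nu>) / (2 * 4 powr \<nu> * Gamma (1 + \<nu>))) = ?K * of_real \<nu>" using False by simp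
      have "- k * (n * (v / w) * - (e * w)) = v * (k * n * e)" if "w \<noteq> 0" for k n w e :: complex using that by simp
      then have "- ?K * (of_real \<nu> * (v / ?w) * exp (of_real \<nu> * Ln (- ?w))) = v * (?K * of_real \<nu> * exp (of_real (\<nu> - 1) * Ln (- ?w)))"
        unfolding e using w0 by blast
      also have "\<dots> = v * (of_real (spectral_constant \<nu>) * stieltjes_power 2 \<nu> ?w)" unfolding S K ..
      finally show ?thesis by (simp only: mult.assoc)
    qed
    ultimately show ?thesis using False by (simp add: weyl_m_def)
  qed
qed

lemma stieltjes_integral_minus_1_real: "Im (stieltjes_integral \<nu> (- 1)) = 0"
proof -
  have "stieltjes_integral \<nu> (- 1) = (LINT t|half_line. complex_of_real (t powr \<nu> * (1 / (t + 1) - t / (1 + t\<^sup>2))))"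
    unfolding stieltjes_integral_def by (intro Bochner_Integration.integral_cong refl) simp
  then show ?thesis by (simp only: integral_complex_of_real Im_complex_of_real)
qed

text \<open>Along the line through \<open>- 1\<close> and \<open>z\<close> the difference of the two functions is
  constant, and at \<open>- 1\<close> it is real.\<close>

lemma weyl_m_stieltjes:
  assumes \<nu>: "0 \<le> \<nu>" "\<nu> < 1" and z: "Im z \<noteq> 0"
  shows "weyl_m \<nu> z = of_real (Re (weyl_m \<nu> (- 1) - of_real (spectral_constant \<nu>) * stieltjes_integral \<nu> (- 1)))
    + of_real (spectral_constant \<nu>) * stieltjes_integral \<nu> z"
proof -
  let ?v = "z + 1"
  let ?D = "\<lambda>z. weyl_m \<nu> z - of_real (spectral_constant \<nu>) * stieltjes_integral \<nu> z"
  have v: "Im ?v \<noteq> 0" using z by simp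
  have "((\<lambda>r. ?D (of_real r * ?v - 1)) has_vector_derivative 0) (at r)" for r
    using has_vector_derivative_diff[OF weyl_m_ray_derivative[OF \<nu> v, of r]
      has_vector_derivative_mult_right[OF stieltjes_integral_derivative[OF \<nu> v, of r], of "of_real (spectral_constant \<nu>)"]]
    by (simp add: mult_ac)
  from zero_vector_derivative_constant[OF this, of 1 0] have "?D z = ?D (- 1)" by simp
  moreover have "Im euler_mascheroni = 0" using Im_complex_of_real[of euler_mascheroni] by (simp del: Im_complex_of_real)
  then have "Im (?D (- 1)) = 0" by (simp add: weyl_m_def stieltjes_integral_minus_1_real)
  then have "?D (- 1) = of_real (Re (?D (- 1)))" by (simp only: complex_eq_iff Re_complex_of_real Im_complex_of_real)
  ultimately have "?D z = of_real (Re (?D (- 1)))" by (simp only:)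
  then show ?thesis by (simp only: diff_eq_eq)
qed

definition bessel_spectral_density :: "real \<Rightarrow> real \<Rightarrow> real" where
  "bessel_spectral_density \<nu> t = indicator {0<..} t * (spectral_constant \<nu> * t powr \<nu>)"

definition bessel_spectral_measure :: "real \<Rightarrow> real measure" where
  "bessel_spectral_measure \<nu> = density lborel (bessel_spectral_density \<nu>)"

lemma bessel_spectral_density_measurable [measurable]: "bessel_spectral_density \<nu> \<in> borel_measurable borel"
  unfolding bessel_spectral_density_def by measurable

lemma bessel_spectral_density_nonneg: "bessel_spectral_density \<nu> t \<ge> 0"
  by (simp add: bessel_spectral_density_def spectral_constant_nonneg)

text \<open>The half-line carries Lebesgue measure on its completed \<open>\<sigma>\<close>-algebra, whereas the
  spectral measure lives on the Borel sets.\<close>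

lemma half_line_lborel:
  fixes f :: "real \<Rightarrow> 'a::euclidean_space"
  assumes f: "f \<in> borel_measurable borel"
  shows "(LINT t|half_line. f t) = (LINT t|lborel. indicator {0<..} t *\<^sub>R f t)"
    "integrable half_line f \<longleftrightarrow> integrable lborel (\<lambda>t. indicator {0<..} t *\<^sub>R f t)"
proof -
  have m: "(\<lambda>t. indicator {0<..} t *\<^sub>R f t) \<in> borel_measurable lborel" using f by measurable
  show "(LINT t|half_line. f t) = (LINT t|lborel. indicator {0<..} t *\<^sub>R f t)"
    by (simp add: integral_restrict_space integral_completion[OF m])
  show "integrable half_line f \<longleftrightarrow> integrable lborel (\<lambda>t. indicator {0<..} t *\<^sub>R f t)"
    by (subst integrable_restrict_space) (simp_all add: set_integrable_def integrable_completion[OF m])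
qed

lemma bessel_spectral_measure_integral:
  fixes f :: "real \<Rightarrow> 'a::euclidean_space"
  assumes f: "f \<in> borel_measurable borel"
  shows "(LINT t|bessel_spectral_measure \<nu>. f t) = (LINT t|half_line. (spectral_constant \<nu> * t powr \<nu>) *\<^sub>R f t)"
    "integrable (bessel_spectral_measure \<nu>) f \<longleftrightarrow> integrable half_line (\<lambda>t. (spectral_constant \<nu> * t powr \<nu>) *\<^sub>R f t)"
proof -
  have m: "(\<lambda>t. (spectral_constant \<nu> * t powr \<nu>) *\<^sub>R f t) \<in> borel_measurable borel" using f by measurable
  have d: "f \<in> borel_measurable lborel" "bessel_spectral_density \<nu> \<in> borel_measurable lborel" "AE t in lborel. 0 \<le> bessel_spectral_density \<nu> t"
    using f by (simp_all add: bessel_spectral_density_nonneg)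
  show "(LINT t|bessel_spectral_measure \<nu>. f t) = (LINT t|half_line. (spectral_constant \<nu> * t powr \<nu>) *\<^sub>R f t)"
    unfolding bessel_spectral_measure_def half_line_lborel(1)[OF m] integral_density[OF d]
    by (simp add: bessel_spectral_density_def)
  show "integrable (bessel_spectral_measure \<nu>) f \<longleftrightarrow> integrable half_line (\<lambda>t. (spectral_constant \<nu> * t powr \<nu>) *\<^sub>R f t)"
    unfolding bessel_spectral_measure_def half_line_lborel(2)[OF m] integrable_density[OF d]
    by (simp add: bessel_spectral_density_def)
qed

lemma nevanlinna_measure_bessel:
  assumes \<nu>: "0 \<le> \<nu>" "\<nu> < 1"
  shows "nevanlinna_measure (\<lambda>z. weyl_function (bessel_minimal \<nu>) (bessel_Gamma0 \<nu>) (bessel_Gamma1 \<nu>) z 1) (bessel_spectral_measure \<nu>)"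
  unfolding nevanlinna_measure_def
proof (intro conjI exI allI impI)
  show "sets (bessel_spectral_measure \<nu>) = sets borel" by (simp add: bessel_spectral_measure_def)
  have "integrable half_line (\<lambda>t. (spectral_constant \<nu> * t powr \<nu>) *\<^sub>R (1 / (1 + t\<^sup>2)))"
  proof (rule Bochner_Integration.integrable_bound)
    show "integrable half_line (\<lambda>t. (2 * spectral_constant \<nu>) * (t powr \<nu> / (1 + t)\<^sup>2))"
      by (rule integrable_mult_right[OF integrable_powr_weight[OF \<nu>, of "\<i>"]]) simp
    show "(\<lambda>t. (spectral_constant \<nu> * t powr \<nu>) *\<^sub>R (1 / (1 + t\<^sup>2))) \<in> borel_measurable half_line"
      by (intro measurable_restrict_space1 measurable_completion) measurable
    have "norm ((spectral_constant \<nu> * t powr \<nu>) *\<^sub>R (1 / (1 + t\<^sup>2))) \<le> norm ((2 * spectral_constant \<nu>) * (t powr \<nu> / (1 + t)\<^sup>2))" if "t > 0" for t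
    proof -
      have 0: "1 + t\<^sup>2 > 0" "(1 + t)\<^sup>2 > 0" using that by (simp_all add: add_pos_nonneg)
      have "(1 + t)\<^sup>2 \<le> 2 * (1 + t\<^sup>2)" using zero_le_power2[of "1 - t"] by (simp add: power2_eq_square algebra_simps)
      moreover have "1 / x \<le> 2 / y" if "0 < x" "0 < y" "y \<le> 2 * x" for x y :: real using that by (simp add: field_simps)
      ultimately have "1 / (1 + t\<^sup>2) \<le> 2 / (1 + t)\<^sup>2" using 0 by simp
      then have "(spectral_constant \<nu> * t powr \<nu>) * (1 / (1 + t\<^sup>2)) \<le> (spectral_constant \<nu> * t powr \<nu>) * (2 / (1 + t)\<^sup>2)"
        by (rule mult_left_mono) (simp add: spectral_constant_nonneg)
      then show ?thesis using 0 by (simp add: spectral_constant_nonneg abs_mult mult_ac)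
    qed
    then show "AE t in half_line. norm ((spectral_constant \<nu> * t powr \<nu>) *\<^sub>R (1 / (1 + t\<^sup>2))) \<le> norm ((2 * spectral_constant \<nu>) * (t powr \<nu> / (1 + t)\<^sup>2))"
      by (intro AE_I2) simp
  qed
  then have "integrable (bessel_spectral_measure \<nu>) (\<lambda>t. 1 / (1 + t\<^sup>2))" by (subst bessel_spectral_measure_integral(2)) measurable
  then have "(\<integral>\<^sup>+t. ennreal (norm (1 / (1 + t\<^sup>2))) \<partial>bessel_spectral_measure \<nu>) < \<infinity>" by (simp only: integrable_iff_bounded)
  moreover have "norm (1 / (1 + t\<^sup>2)) = 1 / (1 + t\<^sup>2)" for t :: real by (simp add: add_nonneg_nonneg)
  ultimately show "(\<integral>\<^sup>+t. ennreal (1 / (1 + t\<^sup>2)) \<partial>bessel_spectral_measure \<nu>) < \<infinity>" by (simp only:)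
  fix z :: complex assume z: "Im z \<noteq> 0"
  then have "z \<notin> \<real>\<^sub>\<ge>\<^sub>0" by (auto simp: complex_nonneg_Reals_iff)
  then have "weyl_function (bessel_minimal \<nu>) (bessel_Gamma0 \<nu>) (bessel_Gamma1 \<nu>) z 1 = weyl_m \<nu> z"
    by (simp add: weyl_function_eq[OF \<nu>])
  moreover have "(LINT t|bessel_spectral_measure \<nu>. 1 / (complex_of_real t - z) - complex_of_real (t / (1 + t\<^sup>2)))
      = of_real (spectral_constant \<nu>) * stieltjes_integral \<nu> z"
  proof -
    have "(LINT t|bessel_spectral_measure \<nu>. 1 / (complex_of_real t - z) - complex_of_real (t / (1 + t\<^sup>2)))
      = (LINT t|half_line. (spectral_constant \<nu> * t powr \<nu>) *\<^sub>R (1 / (complex_of_real t - z) - complex_of_real (t / (1 + t\<^sup>2))))"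
      by (rule bessel_spectral_measure_integral(1)) measurable
    also have "\<dots> = (LINT t|half_line. of_real (spectral_constant \<nu>) * (of_real (t powr \<nu>) * (1 / (of_real t - z) - of_real (t / (1 + t\<^sup>2)))))"
      by (simp only: scaleR_conv_of_real of_real_mult mult.assoc)
    finally show ?thesis unfolding stieltjes_integral_def integral_mult_right_zero .
  qed
  ultimately show "weyl_function (bessel_minimal \<nu>) (bessel_Gamma0 \<nu>) (bessel_Gamma1 \<nu>) z 1 =
    of_real (Re (weyl_m \<nu> (- 1) - of_real (spectral_constant \<nu>) * stieltjes_integral \<nu> (- 1))) +
    (LINT t|bessel_spectral_measure \<nu>. 1 / (complex_of_real t - z) - complex_of_real (t / (1 + t\<^sup>2)))"
    by (simp only: weyl_m_stieltjes[OF \<nu> z])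
qed

lemma bessel_spectral_function:
  assumes \<nu>: "0 \<le> \<nu>" "\<nu> < 1"
  shows "spectral_function (bessel_minimal \<nu>) (bessel_Gamma0 \<nu>) (bessel_Gamma1 \<nu>) t =
     t powr (\<nu> + 1) / ((\<nu> + 1) * 2 powr (2 * \<nu> + 1) * (Gamma (1 + \<nu>))\<^sup>2) * indicator {0..} t"
proof -
  let ?\<mu> = "bessel_spectral_measure \<nu>"
  have \<mu>: "spectral_measure (bessel_minimal \<nu>) (bessel_Gamma0 \<nu>) (bessel_Gamma1 \<nu>) = ?\<mu>"
    unfolding spectral_measure_def
    by (rule the_equality, rule nevanlinna_measure_bessel[OF \<nu>], erule nevanlinna_measure_unique, rule nevanlinna_measure_bessel[OF \<nu>])
  have s: "sets ?\<mu> = sets borel" by (simp add: bessel_spectral_measure_def)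
  have ms: "measure ?\<mu> A = (LINT t|half_line. (spectral_constant \<nu> * t powr \<nu>) * indicator A t)" if "A \<in> sets borel" for A
    using bessel_spectral_measure_integral(1)[of "indicator A :: real \<Rightarrow> real" \<nu>] that s by simp
  show ?thesis
  proof (cases "0 \<le> t")
    case True
    have "measure ?\<mu> {0<..t} = (LINT x|half_line. (spectral_constant \<nu> * x powr \<nu>) * indicator {0<..t} x)" by (rule ms) simp
    also have "\<dots> = (LINT x|lborel. indicator {0<..} x *\<^sub>R ((spectral_constant \<nu> * x powr \<nu>) * indicator {0<..t} x))"
      by (rule half_line_lborel(1)) measurable
    also have "\<dots> = (LINT x|lborel. spectral_constant \<nu> * (indicator {0..t} x *\<^sub>R x powr \<nu>))"
      by (rule integral_cong_AE) (use AE_lborel_singleton[of 0] in \<open>auto elim!: eventually_mono simp: indicator_def\<close>)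
    also have "\<dots> = spectral_constant \<nu> * (LINT x|lborel. indicator {0..t} x *\<^sub>R x powr \<nu>)" by (rule integral_mult_right_zero)
    also have "(LINT x|lborel. indicator {0..t} x *\<^sub>R x powr \<nu>) = t powr (\<nu> + 1) / (\<nu> + 1)"
    proof -
      note h = has_integral_powr_from_0[of \<nu> t]
      have "(\<lambda>x. x powr \<nu>) absolutely_integrable_on {0..t}"
        using h \<nu> True by (intro nonnegative_absolutely_integrable_1) (auto simp: integrable_on_def)
      from set_lebesgue_integral_eq_integral(2)[OF this]
      have "(LINT x|lebesgue. indicator {0..t} x *\<^sub>R x powr \<nu>) = t powr (\<nu> + 1) / (\<nu> + 1)"
        using integral_unique[OF h] \<nu> True by (simp add: set_lebesgue_integral_def)
      moreover have "(LINT x|lebesgue. indicator {0..t} x *\<^sub>R x powr \<nu>) = (LINT x|lborel. indicator {0..t} x *\<^sub>R x powr \<nu>)"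
        by (rule integral_completion) measurable
      ultimately show ?thesis by (simp only:)
    qed
    finally show ?thesis using True by (simp add: spectral_function_def \<mu> distribution_function_def spectral_constant_def mult_ac)
  next
    case False
    have "measure ?\<mu> {t<..0} = (LINT x|half_line. (spectral_constant \<nu> * x powr \<nu>) * indicator {t<..0} x)" by (rule ms) simp
    also have "\<dots> = (LINT x|half_line. 0)" by (intro Bochner_Integration.integral_cong refl) simp
    finally show ?thesis using False by (simp add: spectral_function_def \<mu> distribution_function_def)
  qed
qed

theorem proposition5p3:
  fixes \<nu> :: real
  assumes "0 \<le> \<nu>" and "\<nu> < 1"
  shows
    "(boundary_triplet (bessel_minimal \<nu>) (bessel_Gamma0 \<nu>) (bessel_Gamma1 \<nu>) \<and>
      (\<forall>u\<in>Domain (adjoint_operator (bessel_minimal \<nu>)).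
         bracket_0_exists u (bessel_regular \<nu>) \<and> bracket_0_exists u (bessel_singular \<nu>))) \<and>
     (\<forall>z. z \<notin> \<real>\<^sub>\<ge>\<^sub>0 \<longrightarrow>
        z \<in> resolvent_set_of (extension_0 (bessel_minimal \<nu>) (bessel_Gamma0 \<nu>)) \<and>
        (\<forall>h. weyl_function (bessel_minimal \<nu>) (bessel_Gamma0 \<nu>) (bessel_Gamma1 \<nu>) z h =
           (if \<nu> = 0
            then - Ln (powr_2pi z (1 / 2) / 2) + \<i> * of_real pi / 2 - euler_mascheroni
            else exp (\<i> * of_real ((1 - \<nu>) * pi)) *
                 of_real (Gamma (1 - \<nu>) / (2 * \<nu> * 4 powr \<nu> * Gamma (1 + \<nu>))) *
                 powr_2pi z \<nu>) * h)) \<and>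
     (\<forall>t. spectral_function (bessel_minimal \<nu>) (bessel_Gamma0 \<nu>) (bessel_Gamma1 \<nu>) t =
        t powr (\<nu> + 1) / ((\<nu> + 1) * 2 powr (2 * \<nu> + 1) * (Gamma (1 + \<nu>))\<^sup>2) * indicator {0..} t)"
proof (intro conjI allI impI ballI)
  show "boundary_triplet (bessel_minimal \<nu>) (bessel_Gamma0 \<nu>) (bessel_Gamma1 \<nu>)"
    by (rule bessel_boundary_triplet[OF assms])
  fix u assume "u \<in> Domain (adjoint_operator (bessel_minimal \<nu>))"
  then obtain u' where "(u, u') \<in> bessel_graph \<nu>" by (auto simp: adjoint_bessel_minimal[OF assms])
  then show "bracket_0_exists u (bessel_regular \<nu>)" "bracket_0_exists u (bessel_singular \<nu>)"
    by (auto elim: bessel_graph_cases[OF assms])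
next
  fix z :: complex assume z: "z \<notin> \<real>\<^sub>\<ge>\<^sub>0"
  show "z \<in> resolvent_set_of (extension_0 (bessel_minimal \<nu>) (bessel_Gamma0 \<nu>))"
    unfolding extension_0_eq[OF assms] by (rule resolvent_set_A0[OF assms z])
  fix h
  show "weyl_function (bessel_minimal \<nu>) (bessel_Gamma0 \<nu>) (bessel_Gamma1 \<nu>) z h =
           (if \<nu> = 0
            then - Ln (powr_2pi z (1 / 2) / 2) + \<i> * of_real pi / 2 - euler_mascheroni
            else exp (\<i> * of_real ((1 - \<nu>) * pi)) *
                 of_real (Gamma (1 - \<nu>) / (2 * \<nu> * 4 powr \<nu> * Gamma (1 + \<nu>))) *
                 powr_2pi z \<nu>) * h"
    unfolding weyl_function_eq[OF assms z] weyl_m_powr[OF z] ..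
next
  fix t
  show "spectral_function (bessel_minimal \<nu>) (bessel_Gamma0 \<nu>) (bessel_Gamma1 \<nu>) t =
     t powr (\<nu> + 1) / ((\<nu> + 1) * 2 powr (2 * \<nu> + 1) * (Gamma (1 + \<nu>))\<^sup>2) * indicator {0..} t"
    by (rule bessel_spectral_function[OF assms])
qed

end
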